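(* As $h\to0$, the functionals $\widetilde{\mathcal F}_h:L^1(I)\times L^1(I)\to[0,+\infty]$ $\Gamma$-converge, with respect to the (strong) topology of $L^1(I)\times L^1(I)$, to the functional $\widetilde{\mathcal F}:L^1(I)\times L^1(I)\to[0,+\infty]$ defined by $$\widetilde{\mathcal F}(u,d)=\begin{cases}\mathcal F(u) & \text{if } u\in BV(I),\ \|u\|_\infty\le\|g\|_\infty,\ [[u]]>0 \text{ on } J_u,\ D^cu\ge0,\ \text{and } d=0 \text{ a.e. in } I,\\ +\infty&\text{otherwise,}\end{cases}$$ where $$\mathcal F(u)=\int_I W(u')\,dx+\sigma_c|D^cu|(I)+\sum_{x\in J_u}\phi([[u]](x))+\phi\big(g(L)-u(L^-)\big)+\phi\big(u(-L^+)-g(-L)\big),$$ $$W(s)=f(s,0),\qquad \phi(s)=\begin{cases}\dfrac{G_c\sigma_c s}{G_c+\sigma_c s}& \text{if } s\ge0,\\ +\infty&\text{if } s<0.\end{cases}$$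
   Context: Let $L>0$, $I=[-L,L]$, and let $E_0,\sigma_c,G_c>0$ be constants. Let $a(r)=(1-r)^2$ and $$f(s,r)=\min\{\tfrac12E_0(s-\eta)^2+a(r)\sigma_c\eta:\ \eta\ge0\}=\begin{cases}\frac12E_0s^2& s\le a(r)\frac{\sigma_c}{E_0},\\ a(r)\sigma_c s-\frac{\sigma_c^2}{2E_0}a^2(r)& s>a(r)\frac{\sigma_c}{E_0}.\end{cases}$$ Let $g$ be a boundary datum with prescribed values $g(-L),g(L)\in\mathbb R$, and $\|g\|_\infty=\max\{|g(L)|,|g(-L)|\}$. For each mesh size $h>0$, $\mathcal T_h$ is a mesh of $I$ of size $h$, i.e. a subdivision of $I$ into intervals (elements) of size $h$; $\mathbb P_h^0$ and $\mathbb P^1_h$ are the spaces of functions that are constant on each element, respectively continuous on $I$ and affine on each element. The internal lengths $\epsilon_h>0$ satisfy $\epsilon_h\to0$ and $h=o(\epsilon_h)$ as $h\to0$. For $d_h\in\mathbb P^1_h$, $\bar d_h\in\mathbb P_h^0$ is the function equal on each element to the mean value of $d_h$ on that element. For $u_h,d_h\in\mathbb P^1_h$ set $$\mathcal F_h(u_h,d_h)=\min_{\eta_h\in\mathbb P_h^0,\ \eta_h\ge0}\left\{\int_I\tfrac12E_0|u_h'-\eta_h|^2\,dx+\int_I a(\bar d_h)\sigma_c\eta_h\,dx+\tfrac{G_c}{2}\int_I\tfrac1{\epsilon_h}d_h^2+\epsilon_h|d_h'|^2\,dx\right\},$$ equivalently $\mathcal F_h(u_h,d_h)=\int_I f(u_h',\bar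 d_h)\,dx+\frac{G_c}2\int_I\frac1{\epsilon_h}d_h^2+\epsilon_h|d_h'|^2\,dx$. The extended functional is $$\widetilde{\mathcal F}_h(u_h,d_h)=\begin{cases}\mathcal F_h(u_h,d_h)&\text{if } u_h,d_h\in\mathbb P_h^1,\ \|u_h\|_\infty\le\|g\|_\infty,\ d_h\in[0,1],\ u_h=g \text{ and } d_h=0 \text{ on } \partial I=\{\pm L\},\\ +\infty&\text{otherwise in } L^1(I)\times L^1(I).\end{cases}$$ For $u\in BV(I)$: $Du=u'\,dx+D^ju+D^cu$, with $u'$ the density of the absolutely continuous part, $D^cu$ the Cantor part, $J_u$ the (interior) jump set, $[[u]](x)=u(x^+)-u(x^-)$ the jump (right limit minus left limit), and $u(L^-),u(-L^+)$ the one-sided limits (traces) at the endpoints. *)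

theory Defs
  imports "HOL-Analysis.Analysis" "HOL-Library.Landau_Symbols"
begin

section \<open>Gamma-convergence\<close>

text \<open>Gamma-convergence as \<open>h \<rightarrow> 0\<close> of a family indexed by \<open>h \<in> H\<close>, with \<open>H\<close> a set of positive
  reals, on the carrier \<open>X\<close> with (pseudo-)distance \<open>\<delta>\<close>: the liminf inequality and the existence of
  recovery sequences hold along every sequence \<open>h n \<rightarrow> 0\<close> in \<open>H\<close>.\<close>

definition gamma_converges ::
  "'x set \<Rightarrow> ('x \<Rightarrow> 'x \<Rightarrow> real) \<Rightarrow> real set \<Rightarrow> (real \<Rightarrow> 'x \<Rightarrow> ennreal) \<Rightarrow> ('x \<Rightarrow> ennreal) \<Rightarrow> bool" where
  "gamma_converges X \<delta> H F G \<longleftrightarrow>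
     (\<forall>h :: nat \<Rightarrow> real. (\<forall>n. h n \<in> H) \<and> h \<longlonglongrightarrow> 0 \<longrightarrow>
       (\<forall>x\<in>X.
          (\<forall>y. (\<forall>n. y n \<in> X) \<and> (\<lambda>n. \<delta> (y n) x) \<longlonglongrightarrow> 0
               \<longrightarrow> G x \<le> liminf (\<lambda>n. F (h n) (y n))) \<and>
          (\<exists>y. (\<forall>n. y n \<in> X) \<and> (\<lambda>n. \<delta> (y n) x) \<longlonglongrightarrow> 0
               \<and> limsup (\<lambda>n. F (h n) (y n)) \<le> G x)))"


section \<open>The space of integrable functions on the interval\<close>

text \<open>Elements of \<open>L\<^sup>1(I)\<close> are represented by Lebesgue integrable functions. All functionals on
  \<open>L\<^sup>1(I)\<close> below depend only on the class modulo equality almost everywhere on \<open>I\<close>.\<close>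

definition L1 :: "real \<Rightarrow> (real \<Rightarrow> real) set" where
  "L1 L = {u. u absolutely_integrable_on {-L..L}}"

definition L1_dist :: "real \<Rightarrow> (real \<Rightarrow> real) \<Rightarrow> (real \<Rightarrow> real) \<Rightarrow> real" where
  "L1_dist L u v = (LINT x:{-L..L}|lebesgue. \<bar>u x - v x\<bar>)"

definition L1_pair_dist ::
  "real \<Rightarrow> (real \<Rightarrow> real) \<times> (real \<Rightarrow> real) \<Rightarrow> (real \<Rightarrow> real) \<times> (real \<Rightarrow> real) \<Rightarrow> real" where
  "L1_pair_dist L p q = L1_dist L (fst p) (fst q) + L1_dist L (snd p) (snd q)"

definition ae_eq_on :: "real \<Rightarrow> (real \<Rightarrow> real) \<Rightarrow> (real \<Rightarrow> real) \<Rightarrow> bool" where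
  "ae_eq_on L u v \<longleftrightarrow> (AE x in lebesgue. x \<in> {-L..L} \<longrightarrow> u x = v x)"


section \<open>Meshes and finite element spaces\<close>

definition is_mesh :: "real \<Rightarrow> real \<Rightarrow> real set set \<Rightarrow> bool" where
  "is_mesh L h T \<longleftrightarrow> T division_of {-L..L} \<and> (\<forall>K\<in>T. measure lebesgue K = h)"

text \<open>All elements have length \<open>h\<close>, so a mesh exists only if \<open>h\<close> divides the length of \<open>I\<close>.\<close>

definition mesh_sizes :: "real \<Rightarrow> real set" where
  "mesh_sizes L = {h. 0 < h \<and> (\<exists>T. is_mesh L h T)}"

text \<open>Elements are closed intervals sharing endpoints, so piecewise constancy only concerns their
  interiors; the values at the finitely many nodes are irrelevant.\<close>

definition P0 :: "real set set \<Rightarrow> (real \<Rightarrow> real) set" where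
  "P0 T = {\<eta>. \<forall>K\<in>T. \<exists>c. \<forall>x\<in>interior K. \<eta> x = c}"

definition P1 :: "real set set \<Rightarrow> (real \<Rightarrow> real) set" where
  "P1 T = {v. continuous_on (\<Union>T) v \<and> (\<forall>K\<in>T. \<exists>p q. \<forall>x\<in>K. v x = p + q * x)}"

definition elem_mean :: "real set set \<Rightarrow> (real \<Rightarrow> real) \<Rightarrow> real \<Rightarrow> real" where
  "elem_mean T d x =
     (\<Sum>K\<in>T. indicator (interior K) x * ((LINT y:K|lebesgue. d y) / measure lebesgue K))"


section \<open>The discrete energies\<close>

definition degr :: "real \<Rightarrow> real" where
  "degr r = (1 - r)\<^sup>2"

definition f_dens :: "real \<Rightarrow> real \<Rightarrow> real \<Rightarrow> real \<Rightarrow> real" where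
  "f_dens E0 \<sigma>c s r = (INF \<eta>\<in>{0..}. 1/2 * E0 * (s - \<eta>)\<^sup>2 + degr r * \<sigma>c * \<eta>)"

lemma f_dens_eq:
  assumes "0 < E0" "0 < \<sigma>c"
  shows "f_dens E0 \<sigma>c s r =
    (if s \<le> degr r * \<sigma>c / E0 then 1/2 * E0 * s\<^sup>2
     else degr r * \<sigma>c * s - \<sigma>c\<^sup>2 / (2 * E0) * (degr r)\<^sup>2)"
proof -
  define b where "b = degr r * \<sigma>c / E0"
  have b0: "b \<ge> 0"
    using assms by (simp add: b_def degr_def)
  have ab: "degr r * \<sigma>c = E0 * b"
    using assms by (simp add: b_def)
  define \<eta>0 where "\<eta>0 = max 0 (s - b)"
  let ?q = "\<lambda>\<eta>. 1/2 * E0 * (s - \<eta>)\<^sup>2 + degr r * \<sigma>c * \<eta>"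
  have le: "?q \<eta>0 \<le> ?q \<eta>" if "\<eta> \<ge> 0" for \<eta>
  proof -
    have "?q \<eta> - ?q \<eta>0 = E0 * ((\<eta> - \<eta>0)\<^sup>2 / 2 + (\<eta> - \<eta>0) * (b - s + \<eta>0))"
      unfolding ab by (simp add: field_simps power2_eq_square)
    moreover have "(\<eta> - \<eta>0) * (b - s + \<eta>0) \<ge> 0"
    proof (cases "s \<le> b")
      case True
      then show ?thesis using that by (simp add: \<eta>0_def)
    next
      case False
      then show ?thesis by (simp add: \<eta>0_def)
    qed
    then have "E0 * ((\<eta> - \<eta>0)\<^sup>2 / 2 + (\<eta> - \<eta>0) * (b - s + \<eta>0)) \<ge> 0"
      using assms(1) by (metis add_nonneg_nonneg half_gt_zero_iff less_eq_real_def
          mult_nonneg_nonneg zero_le_divide_iff zero_le_numeral zero_le_power2)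
    ultimately have "?q \<eta> - ?q \<eta>0 \<ge> 0"
      by linarith
    then show ?thesis by simp
  qed
  have "f_dens E0 \<sigma>c s r = ?q \<eta>0"
    unfolding f_dens_def
    by (rule cInf_eq_minimum) (use le in \<open>auto simp: \<eta>0_def\<close>)
  also have "\<dots> = (if s \<le> b then 1/2 * E0 * s\<^sup>2 else E0 * b * s - E0 * b\<^sup>2 / 2)"
    unfolding ab \<eta>0_def max_def by (auto simp: field_simps power2_eq_square)
  also have "E0 * b * s = degr r * \<sigma>c * s"
    by (simp add: ab)
  also have "E0 * b\<^sup>2 / 2 = \<sigma>c\<^sup>2 / (2 * E0) * (degr r)\<^sup>2"
    using assms by (simp add: b_def power2_eq_square field_simps)
  finally show ?thesis
    by (simp add: b_def)
qed

definition F_disc ::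
  "real \<Rightarrow> real \<Rightarrow> real \<Rightarrow> real \<Rightarrow> real \<Rightarrow> real set set \<Rightarrow> (real \<Rightarrow> real) \<Rightarrow> (real \<Rightarrow> real) \<Rightarrow> ennreal" where
  "F_disc L E0 \<sigma>c Gc \<epsilon> T u d =
     (INF \<eta>\<in>{\<eta>\<in>P0 T. \<forall>x\<in>{-L..L}. 0 \<le> \<eta> x}.
        (\<integral>\<^sup>+x\<in>{-L..L}. ennreal (1/2 * E0 * \<bar>deriv u x - \<eta> x\<bar>\<^sup>2) \<partial>lebesgue)
      + (\<integral>\<^sup>+x\<in>{-L..L}. ennreal (degr (elem_mean T d x) * \<sigma>c * \<eta> x) \<partial>lebesgue)
      + ennreal (Gc / 2) *
          (\<integral>\<^sup>+x\<in>{-L..L}. ennreal (1 / \<epsilon> * (d x)\<^sup>2 + \<epsilon> * \<bar>deriv d x\<bar>\<^sup>2) \<partial>lebesgue))"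

definition bdry_norm :: "real \<Rightarrow> (real \<Rightarrow> real) \<Rightarrow> real" where
  "bdry_norm L g = max \<bar>g L\<bar> \<bar>g (-L)\<bar>"

definition admissible ::
  "real \<Rightarrow> (real \<Rightarrow> real) \<Rightarrow> real set set \<Rightarrow> (real \<Rightarrow> real) \<Rightarrow> (real \<Rightarrow> real) \<Rightarrow> bool" where
  "admissible L g T u d \<longleftrightarrow>
     u \<in> P1 T \<and> d \<in> P1 T \<and>
     (\<forall>x\<in>{-L..L}. \<bar>u x\<bar> \<le> bdry_norm L g) \<and>
     (\<forall>x\<in>{-L..L}. 0 \<le> d x \<and> d x \<le> 1) \<and>
     u (-L) = g (-L) \<and> u L = g L \<and> d (-L) = 0 \<and> d L = 0"

text \<open>A class in \<open>L\<^sup>1(I)\<close> has at most one continuous representative on \<open>I\<close>, so the infimum below is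
  over at most one value: that of the energy at the admissible representatives of the classes of
  \<open>u\<close> and \<open>d\<close>, if these exist, and \<open>Inf {} = \<infinity>\<close> otherwise.\<close>

definition F_disc_ext ::
  "real \<Rightarrow> real \<Rightarrow> real \<Rightarrow> real \<Rightarrow> (real \<Rightarrow> real) \<Rightarrow> real \<Rightarrow> real set set
     \<Rightarrow> (real \<Rightarrow> real) \<times> (real \<Rightarrow> real) \<Rightarrow> ennreal" where
  "F_disc_ext L E0 \<sigma>c Gc g \<epsilon> T = (\<lambda>(u, d).
     Inf {F_disc L E0 \<sigma>c Gc \<epsilon> T v e | v e.
            admissible L g T v e \<and> ae_eq_on L u v \<and> ae_eq_on L d e})"


section \<open>Functions of bounded variation on the interval\<close>

definition mutually_singular :: "real measure \<Rightarrow> real measure \<Rightarrow> bool" where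
  "mutually_singular M N \<longleftrightarrow> (\<exists>A\<in>sets borel. emeasure M A = 0 \<and> emeasure N (- A) = 0)"

text \<open>A finite signed Borel measure on the open set \<open>U\<close> is given by its Jordan decomposition
  \<open>(P, N)\<close>, where \<open>P\<close> and \<open>N\<close> are Borel measures on the line that vanish outside \<open>U\<close>. It is
  nonnegative iff \<open>N = 0\<close>.\<close>

definition signed_measure_on :: "real set \<Rightarrow> real measure \<times> real measure \<Rightarrow> bool" where
  "signed_measure_on U = (\<lambda>(P, N).
     sets P = sets borel \<and> sets N = sets borel \<and>
     finite_measure P \<and> finite_measure N \<and>
     emeasure P (- U) = 0 \<and> emeasure N (- U) = 0 \<and>
     mutually_singular P N)"

definition sm_val :: "real measure \<times> real measure \<Rightarrow> real set \<Rightarrow> real" where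
  "sm_val \<mu> B = measure (fst \<mu>) B - measure (snd \<mu>) B"

definition sm_integral :: "real measure \<times> real measure \<Rightarrow> (real \<Rightarrow> real) \<Rightarrow> real" where
  "sm_integral \<mu> \<psi> = (LINT x|fst \<mu>. \<psi> x) - (LINT x|snd \<mu>. \<psi> x)"

definition sm_total_variation :: "real measure \<times> real measure \<Rightarrow> real set \<Rightarrow> ennreal" where
  "sm_total_variation \<mu> B = emeasure (fst \<mu>) B + emeasure (snd \<mu>) B"

definition sm_nonneg :: "real measure \<times> real measure \<Rightarrow> bool" where
  "sm_nonneg \<mu> \<longleftrightarrow> (\<forall>B\<in>sets borel. 0 \<le> sm_val \<mu> B)"

definition C1c :: "real set \<Rightarrow> (real \<Rightarrow> real) set" where
  "C1c U = {\<psi>. (\<forall>x. \<psi> differentiable (at x)) \<and> continuous_on UNIV (deriv \<psi>) \<and>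
                (\<exists>K. compact K \<and> K \<subseteq> U \<and> (\<forall>x. x \<notin> K \<longrightarrow> \<psi> x = 0))}"

definition is_distr_deriv :: "real \<Rightarrow> (real \<Rightarrow> real) \<Rightarrow> real measure \<times> real measure \<Rightarrow> bool" where
  "is_distr_deriv L u \<mu> \<longleftrightarrow>
     signed_measure_on {-L<..<L} \<mu> \<and>
     (\<forall>\<psi>\<in>C1c {-L<..<L}.
        (LINT x:{-L..L}|lebesgue. u x * deriv \<psi> x) = - sm_integral \<mu> \<psi>)"

definition BV :: "real \<Rightarrow> (real \<Rightarrow> real) set" where
  "BV L = {u\<in>L1 L. \<exists>\<mu>. is_distr_deriv L u \<mu>}"

definition distr_deriv :: "real \<Rightarrow> (real \<Rightarrow> real) \<Rightarrow> real measure \<times> real measure" where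
  "distr_deriv L u = (SOME \<mu>. is_distr_deriv L u \<mu>)"

text \<open>One-sided limits of an \<open>L\<^sup>1\<close> class are essential limits, i.e. limits up to Lebesgue null
  sets. For \<open>u \<in> BV L\<close> they exist everywhere and are the one-sided limits of the good
  representatives of \<open>u\<close>.\<close>

definition ess_at_left :: "real \<Rightarrow> real filter" where
  "ess_at_left x = inf (at_left x) (ae_filter lebesgue)"

definition ess_at_right :: "real \<Rightarrow> real filter" where
  "ess_at_right x = inf (at_right x) (ae_filter lebesgue)"

definition left_lim :: "(real \<Rightarrow> real) \<Rightarrow> real \<Rightarrow> real" where
  "left_lim u x = Lim (ess_at_left x) u"

definition right_lim :: "(real \<Rightarrow> real) \<Rightarrow> real \<Rightarrow> real" where
  "right_lim u x = Lim (ess_at_right x) u"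

definition jump :: "(real \<Rightarrow> real) \<Rightarrow> real \<Rightarrow> real" where
  "jump u x = right_lim u x - left_lim u x"

definition jump_set :: "real \<Rightarrow> (real \<Rightarrow> real) \<Rightarrow> real set" where
  "jump_set L u = {x\<in>{-L<..<L}. \<exists>l r. (u \<longlongrightarrow> l) (ess_at_left x) \<and> (u \<longlongrightarrow> r) (ess_at_right x) \<and> l \<noteq> r}"

text \<open>The decomposition \<open>Du = u' dx + D\<^sup>j u + D\<^sup>c u\<close>: \<open>w\<close> is the density \<open>u'\<close> of the absolutely
  continuous part, the jump part is the sum of the Dirac masses of weight \<open>jump u x\<close> over the jump
  set, and the Cantor part \<open>c\<close> is singular to Lebesgue measure without atoms. For \<open>u \<in> BV L\<close> such
  a pair \<open>(w, c)\<close> exists, with \<open>c\<close> unique and \<open>w\<close> unique up to null sets.\<close>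

definition is_BV_decomp ::
  "real \<Rightarrow> (real \<Rightarrow> real) \<Rightarrow> (real \<Rightarrow> real) \<times> (real measure \<times> real measure) \<Rightarrow> bool" where
  "is_BV_decomp L u = (\<lambda>(w, c).
     w absolutely_integrable_on {-L..L} \<and>
     signed_measure_on {-L<..<L} c \<and>
     mutually_singular (fst c) lborel \<and> mutually_singular (snd c) lborel \<and>
     (\<forall>x. emeasure (fst c) {x} = 0 \<and> emeasure (snd c) {x} = 0) \<and>
     (\<lambda>x. jump u x) summable_on jump_set L u \<and>
     (\<forall>B\<in>sets borel. B \<subseteq> {-L<..<L} \<longrightarrow>
        sm_val (distr_deriv L u) B =
          (LINT x:B|lebesgue. w x) + (\<Sum>\<^sub>\<infinity>x\<in>jump_set L u \<inter> B. jump u x) + sm_val c B))"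

definition ac_density :: "real \<Rightarrow> (real \<Rightarrow> real) \<Rightarrow> real \<Rightarrow> real" where
  "ac_density L u = fst (SOME p. is_BV_decomp L u p)"

definition cantor_part :: "real \<Rightarrow> (real \<Rightarrow> real) \<Rightarrow> real measure \<times> real measure" where
  "cantor_part L u = snd (SOME p. is_BV_decomp L u p)"


section \<open>The limit energy\<close>

definition W_dens :: "real \<Rightarrow> real \<Rightarrow> real \<Rightarrow> real" where
  "W_dens E0 \<sigma>c s = f_dens E0 \<sigma>c s 0"

definition phi :: "real \<Rightarrow> real \<Rightarrow> real \<Rightarrow> ennreal" where
  "phi \<sigma>c Gc s = (if 0 \<le> s then ennreal (Gc * \<sigma>c * s / (Gc + \<sigma>c * s)) else \<infinity>)"

definition F_lim :: "real \<Rightarrow> real \<Rightarrow> real \<Rightarrow> real \<Rightarrow> (real \<Rightarrow> real) \<Rightarrow> (real \<Rightarrow> real) \<Rightarrow> ennreal" where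
  "F_lim L E0 \<sigma>c Gc g u =
     (\<integral>\<^sup>+x\<in>{-L..L}. ennreal (W_dens E0 \<sigma>c (ac_density L u x)) \<partial>lebesgue)
   + ennreal \<sigma>c * sm_total_variation (cantor_part L u) {-L<..<L}
   + (\<Sum>\<^sub>\<infinity>x\<in>jump_set L u. phi \<sigma>c Gc (jump u x))
   + phi \<sigma>c Gc (g L - left_lim u L)
   + phi \<sigma>c Gc (right_lim u (-L) - g (-L))"

definition F_lim_ext ::
  "real \<Rightarrow> real \<Rightarrow> real \<Rightarrow> real \<Rightarrow> (real \<Rightarrow> real) \<Rightarrow> (real \<Rightarrow> real) \<times> (real \<Rightarrow> real) \<Rightarrow> ennreal" where
  "F_lim_ext L E0 \<sigma>c Gc g = (\<lambda>(u, d).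
     if u \<in> BV L \<and>
        (AE x in lebesgue. x \<in> {-L..L} \<longrightarrow> \<bar>u x\<bar> \<le> bdry_norm L g) \<and>
        (\<forall>x\<in>jump_set L u. 0 < jump u x) \<and>
        sm_nonneg (cantor_part L u) \<and>
        (AE x in lebesgue. x \<in> {-L..L} \<longrightarrow> d x = 0)
     then F_lim L E0 \<sigma>c Gc g u
     else \<infinity>)"

end

theory Submission
  imports Defs "HOL-Probability.Distribution_Functions" "HOL-Complex_Analysis.Great_Picard"
begin

text \<open>
  A displacement is split as \<open>u(x) = g(-L) + \<integral>\<^bsub>-L\<^esub>\<^bsup>x\<^esup> e + \<nu> (-\<infinity>, x]\<close> with an elastic strain \<open>e\<close> and a
  nonnegative measure \<open>\<nu>\<close> on \<open>[-L,L]\<close>. The limit energy of \<open>u\<close> is the least value of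
  \<open>\<integral> E0/2 e\<^sup>2 + \<integral> Gc \<sigma>c / (Gc + \<sigma>c \<nu>{x}) d\<nu>(x)\<close>, since \<open>W\<close> is the inf-convolution of \<open>E0/2 s\<^sup>2\<close> and \<open>\<sigma>c s\<^sup>+\<close>;
  this avoids all lower-semicontinuity theory in BV.

  Liminf inequality: the primitives of the discrete elastic strains are equi-Hoelder, those of the plastic
  strains are monotone, so both converge. On a block between two points where the damage tends to
  zero, with \<open>M\<close> the maximal damage there, \<open>\<integral> \<eta> = r\<close> and the phase-field term cost at least
  \<open>(1 - M)\<^sup>2 \<sigma>c r + Gc M\<^sup>2 \<ge> \<phi>(r)\<close> up to errors of order \<open>sqrt (h / \<epsilon>)\<close>. Refining the blocks turns
  \<open>\<Sum> \<phi>(\<nu> B)\<close> into the cohesive energy of \<open>\<nu>\<close>, by Fatou.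

  Recovery sequence: the mass of \<open>\<nu>\<close> is concentrated cell by cell, and finitely many atoms carry a
  discrete exponential damage profile with decay factor \<open>1 - h/\<epsilon>\<close>, whose phase-field energy telescopes.
\<close>

section \<open>Essential limits and cumulative distribution functions\<close>

text \<open>\<open>phi\<close> is itself a minimum: (1 - m)^2 \<open>\<sigma>c\<close> r + Gc m^2 is
  smallest at m = \<open>\<sigma>c\<close> r / (Gc + \<open>\<sigma>c\<close> r), with value phi(r).
  Its second coefficient is Gc/2 times 2, because damage has to climb from 0 to m and come back,
  each way costing m^2 by Young's inequality. The discrete energy sees (1 - m)^2 only through
  element means of the damage; these exceed point values by at most sqrt(K h / \<epsilon>), which is
  where h = o(\<epsilon>) enters the lower bound. Boundary values may be lost in the limit, so the
  opening measure lives on the closed interval and its endpoint atoms are the boundary terms. The BV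
  part is shaped by two obstacles: functions are known up to null sets, and
  \<open>distr_deriv\<close>, \<open>ac_density\<close>, \<open>cantor_part\<close> are arbitrary
  choices. Facts about the derivative are therefore read off from cumulative distribution functions,
  whose one-sided limits are rigid. In the recovery sequence the bound on the displacement comes
  from truncation. It scales each increment by a factor in [0, 1], applied alike to its elastic and
  plastic shares, so no energy estimate deteriorates.\<close>

lemma ess_at_right_nontrivial: "ess_at_right x \<noteq> bot"
proof
  assume "ess_at_right x = bot"
  then have "eventually (\<lambda>_. False) (inf (at_right x) (ae_filter lebesgue))"
    by (simp add: ess_at_right_def)
  then obtain Q R where QR: "eventually Q (at_right x)" "AE y in lebesgue. R y"
      "\<And>y. Q y \<Longrightarrow> R y \<Longrightarrow> False"
    by (auto simp: eventually_inf)
  obtain b where b: "b > x" "\<And>y. x < y \<Longrightarrow> y < b \<Longrightarrow> Q y"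
    using QR(1) by (auto simp: eventually_at_right_field)
  have "AE y in lebesgue. y \<notin> {x<..<b}"
    using QR(2) by eventually_elim (use b QR(3) in auto)
  then have "emeasure lebesgue {x<..<b} = 0"
    by (subst (asm) AE_iff_measurable[where N="{x<..<b}"]) auto
  then show False using b by simp
qed

lemma ess_at_left_nontrivial: "ess_at_left x \<noteq> bot"
proof
  assume "ess_at_left x = bot"
  then have "eventually (\<lambda>_. False) (inf (at_left x) (ae_filter lebesgue))"
    by (simp add: ess_at_left_def)
  then obtain Q R where QR: "eventually Q (at_left x)" "AE y in lebesgue. R y"
      "\<And>y. Q y \<Longrightarrow> R y \<Longrightarrow> False"
    by (auto simp: eventually_inf)
  obtain b where b: "b < x" "\<And>y. b < y \<Longrightarrow> y < x \<Longrightarrow> Q y"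
    using QR(1) by (auto simp: eventually_at_left_field)
  have "AE y in lebesgue. y \<notin> {b<..<x}"
    using QR(2) by eventually_elim (use b QR(3) in auto)
  then have "emeasure lebesgue {b<..<x} = 0"
    by (subst (asm) AE_iff_measurable[where N="{b<..<x}"]) auto
  then show False using b by simp
qed

lemma tendsto_ess_at_right:
  assumes "AE y in lebesgue. y \<in> {-L..L} \<longrightarrow> u y = f y" "-L \<le> x" "x < L"
    and "(f \<longlongrightarrow> l) (at_right x)"
  shows "(u \<longlongrightarrow> l) (ess_at_right x)"
proof -
  have "eventually (\<lambda>y. f y = u y) (ess_at_right x)"
    unfolding ess_at_right_def eventually_inf
  proof (intro exI conjI)
    show "eventually (\<lambda>y. x < y \<and> y < L) (at_right x)"
      using assms by (auto simp: eventually_at_right_field)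
    show "AE y in lebesgue. y \<in> {-L..L} \<longrightarrow> u y = f y" by fact
  qed (use assms in auto)
  moreover have "(f \<longlongrightarrow> l) (ess_at_right x)"
    using assms(4) unfolding ess_at_right_def by (rule tendsto_mono[rotated]) simp
  ultimately show ?thesis
    by (rule Lim_transform_eventually[rotated])
qed

lemma tendsto_ess_at_left:
  assumes "AE y in lebesgue. y \<in> {-L..L} \<longrightarrow> u y = f y" "-L < x" "x \<le> L"
    and "(f \<longlongrightarrow> l) (at_left x)"
  shows "(u \<longlongrightarrow> l) (ess_at_left x)"
proof -
  have "eventually (\<lambda>y. f y = u y) (ess_at_left x)"
    unfolding ess_at_left_def eventually_inf
  proof (intro exI conjI)
    show "eventually (\<lambda>y. - L < y \<and> y < x) (at_left x)"
      using assms by (auto simp: eventually_at_left_field)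
    show "AE y in lebesgue. y \<in> {-L..L} \<longrightarrow> u y = f y" by fact
  qed (use assms in auto)
  moreover have "(f \<longlongrightarrow> l) (ess_at_left x)"
    using assms(4) unfolding ess_at_left_def by (rule tendsto_mono[rotated]) simp
  ultimately show ?thesis
    by (rule Lim_transform_eventually[rotated])
qed

text \<open>\<open>Lim\<close> denotes a definite value only if limits are unique. They are, because
  every one-sided neighbourhood has positive measure, so the essential filter is not
  \<open>bot\<close>.\<close>

lemma right_lim_eq:
  assumes "AE y in lebesgue. y \<in> {-L..L} \<longrightarrow> u y = f y" "-L \<le> x" "x < L"
    and "(f \<longlongrightarrow> l) (at_right x)"
  shows "right_lim u x = l"
  unfolding right_lim_def using tendsto_ess_at_right[OF assms] ess_at_right_nontrivial
  by (rule tendsto_Lim[rotated])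

lemma left_lim_eq:
  assumes "AE y in lebesgue. y \<in> {-L..L} \<longrightarrow> u y = f y" "-L < x" "x \<le> L"
    and "(f \<longlongrightarrow> l) (at_left x)"
  shows "left_lim u x = l"
  unfolding left_lim_def using tendsto_ess_at_left[OF assms] ess_at_left_nontrivial
  by (rule tendsto_Lim[rotated])

text \<open>Sums turn an identity between signed differences, P - N = P' - N', into one between
  finite positive measures, P + N' = P' + N, which cumulative distribution functions can
  decide.\<close>

definition measure_add :: "real measure \<Rightarrow> real measure \<Rightarrow> real measure" where
  "measure_add \<mu> \<nu> = measure_of UNIV (sets borel) (\<lambda>A. emeasure \<mu> A + emeasure \<nu> A)"

lemma sets_measure_add [simp]: "sets (measure_add \<mu> \<nu>) = sets borel"
  by (simp add: measure_add_def) (metis sets.sigma_sets_eq space_borel)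

lemma emeasure_measure_add:
  assumes "sets \<mu> = sets borel" "sets \<nu> = sets borel" "A \<in> sets borel"
  shows "emeasure (measure_add \<mu> \<nu>) A = emeasure \<mu> A + emeasure \<nu> A"
  unfolding measure_add_def
proof (subst emeasure_measure_of_sigma)
  show "sigma_algebra UNIV (sets (borel::real measure))"
    by (metis sets.sigma_algebra_axioms space_borel)
  show "positive (sets borel) (\<lambda>A. emeasure \<mu> A + emeasure \<nu> A)"
    by (simp add: positive_def)
  show "countably_additive (sets borel) (\<lambda>A. emeasure \<mu> A + emeasure \<nu> A)"
  proof (rule countably_additiveI)
    fix F :: "nat \<Rightarrow> real set" assume "range F \<subseteq> sets borel" "disjoint_family F" "\<Union> (range F) \<in> sets borel"
    then show "(\<Sum>i. emeasure \<mu> (F i) + emeasure \<nu> (F i)) = emeasure \<mu> (\<Union> (range F)) + emeasure \<nu> (\<Union> (range F))"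
      using assms by (subst suminf_add[symmetric]) (auto simp: suminf_emeasure)
  qed
qed (use assms in auto)

lemma finite_borel_measureI:
  assumes "sets \<mu> = sets borel" "finite_measure \<mu>"
  shows "finite_borel_measure \<mu>"
  using assms by (simp add: finite_borel_measure_def finite_borel_measure_axioms_def)

lemma finite_borel_measure_add:
  assumes "finite_borel_measure \<mu>" "finite_borel_measure \<nu>"
  shows "finite_borel_measure (measure_add \<mu> \<nu>)"
proof (rule finite_borel_measureI)
  interpret a: finite_borel_measure \<mu> by fact
  interpret b: finite_borel_measure \<nu> by fact
  show "finite_measure (measure_add \<mu> \<nu>)"
    by (rule finite_measureI) (simp add: emeasure_measure_add a.M_is_borel b.M_is_borel
      sets_eq_imp_space_eq[OF sets_measure_add] a.emeasure_finite b.emeasure_finite)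
qed simp

lemma measure_measure_add:
  assumes "finite_borel_measure \<mu>" "finite_borel_measure \<nu>" "A \<in> sets borel"
  shows "measure (measure_add \<mu> \<nu>) A = measure \<mu> A + measure \<nu> A"
proof -
  interpret a: finite_borel_measure \<mu> by fact
  interpret b: finite_borel_measure \<nu> by fact
  have "emeasure \<mu> A < top" "emeasure \<nu> A < top"
    by (simp_all add: less_top[symmetric])
  then show ?thesis
    by (simp add: measure_def emeasure_measure_add a.M_is_borel b.M_is_borel assms(3) enn2real_plus)
qed

lemma cdf_measure_add:
  assumes "finite_borel_measure \<mu>" "finite_borel_measure \<nu>"
  shows "cdf (measure_add \<mu> \<nu>) x = cdf \<mu> x + cdf \<nu> x"
  by (simp add: cdf_def measure_measure_add assms)

section \<open>Test functions and integration by parts against a cumulative distribution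
  function\<close>

lemma C1c_props:
  assumes "\<psi> \<in> C1c {-L<..<L}"
  shows "continuous_on UNIV (deriv \<psi>)" "\<And>x. (\<psi> has_real_derivative deriv \<psi> x) (at x)"
    "\<And>x. x \<notin> {-L<..<L} \<Longrightarrow> \<psi> x = 0" "continuous_on UNIV \<psi>"
proof -
  show "continuous_on UNIV (deriv \<psi>)" "\<And>x. x \<notin> {-L<..<L} \<Longrightarrow> \<psi> x = 0"
    using assms by (auto simp: C1c_def)
  show d: "(\<psi> has_real_derivative deriv \<psi> x) (at x)" for x
    using assms by (auto simp: C1c_def DERIV_deriv_iff_real_differentiable)
  show "continuous_on UNIV \<psi>"
    using d DERIV_isCont by (intro continuous_at_imp_continuous_on) blast
qed

lemma C1c_bounded:
  assumes "\<psi> \<in> C1c {-L<..<L}"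
  obtains K where "\<And>x. x \<in> {-L..L} \<Longrightarrow> \<bar>deriv \<psi> x\<bar> \<le> K" "0 \<le> K"
proof -
  have "bounded (deriv \<psi> ` {-L..L})"
    using C1c_props(1)[OF assms]
    by (intro compact_imp_bounded compact_continuous_image) (auto intro: continuous_on_subset)
  then obtain K where "\<And>x. x \<in> {-L..L} \<Longrightarrow> \<bar>deriv \<psi> x\<bar> \<le> K" "0 < K"
    by (force simp: bounded_pos)
  then show ?thesis using that[of K] by auto
qed

lemma LINT_lebesgue_lborel:
  fixes f :: "real \<Rightarrow> real"
  assumes "f \<in> borel_measurable borel" "A \<in> sets borel"
  shows "(LINT x:A|lebesgue. f x) = (LINT x:A|lborel. f x)"
  unfolding set_lebesgue_integral_def
  by (rule integral_completion) (use assms in measurable)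

lemma LINT_deriv:
  assumes "\<And>x. (\<psi> has_real_derivative \<psi>' x) (at x)" "continuous_on UNIV \<psi>'" "a \<le> b"
  shows "(LINT x:{a..b}|lebesgue. \<psi>' x) = \<psi> b - \<psi> a"
proof -
  have "set_integrable lebesgue {a..b} \<psi>'"
    using assms(2) by (intro absolutely_integrable_continuous_real) (auto intro: continuous_on_subset)
  moreover have "(\<psi>' has_integral \<psi> b - \<psi> a) {a..b}"
    using assms by (intro fundamental_theorem_of_calculus)
      (auto simp flip: has_real_derivative_iff_has_vector_derivative intro: has_field_derivative_at_within)
  ultimately show ?thesis
    by (simp add: set_lebesgue_integral_eq_integral integral_unique)
qed

lemma cdf_measurable [measurable]:
  assumes "finite_borel_measure \<rho>"
  shows "cdf \<rho> \<in> borel_measurable borel"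
  by (rule borel_measurable_mono) (simp add: mono_def finite_borel_measure.cdf_nondecreasing[OF assms])

text \<open>Fubini on the region y \<le> x: the inner integral of \<open>deriv \<psi>\<close> over
  [y, L] is -\<psi>(y), because \<psi> vanishes at L.\<close>

lemma integration_by_parts_cdf:
  assumes \<rho>: "finite_borel_measure \<rho>" and supp: "emeasure \<rho> (- {-L<..<L}) = 0"
    and \<psi>: "\<psi> \<in> C1c {-L<..<L}" and L: "0 < L"
  shows "(LINT x:{-L..L}|lebesgue. cdf \<rho> x * deriv \<psi> x) = - (\<integral>x. \<psi> x \<partial>\<rho>)"
proof -
  interpret \<rho>: finite_borel_measure \<rho> by fact
  note C = C1c_props[OF \<psi>]
  obtain K where K: "\<And>x. x \<in> {-L..L} \<Longrightarrow> \<bar>deriv \<psi> x\<bar> \<le> K" "0 \<le> K"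
    using C1c_bounded[OF \<psi>] by blast
  have sets\<rho>[measurable_cong]: "sets \<rho> = sets borel" by (rule \<rho>.M_is_borel)
  have [measurable]: "deriv \<psi> \<in> borel_measurable borel"
    using C(1) by (rule borel_measurable_continuous_onI)
  interpret PS: pair_sigma_finite lborel \<rho>
    by (simp add: pair_sigma_finite_def \<rho>.sigma_finite_measure_axioms sigma_finite_lborel)
  \<comment> \<open>The last factor encodes y \<le> x. Read in y it produces
    \<open>cdf \<rho> x\<close>; read in x it cuts the integral down to [y, L].\<close>
  define f where "f = (\<lambda>x y. indicat_real {-L..L} x * deriv \<psi> x * indicat_real {y..} x)"
  have fm[measurable]: "(\<lambda>(x,y). f x y) \<in> borel_measurable (lborel \<Otimes>\<^sub>M \<rho>)"
  proof -
    have "(\<lambda>(x,y). f x y) = (\<lambda>p. indicat_real {-L..L} (fst p) * deriv \<psi> (fst p) * (if snd p \<le> fst p then 1 else 0))"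
      by (auto simp: f_def indicator_def)
    then show ?thesis by simp
  qed
  have int: "integrable (lborel \<Otimes>\<^sub>M \<rho>) (\<lambda>(x,y). f x y)"
  proof (rule Bochner_Integration.integrable_bound)
    have "integrable (lborel \<Otimes>\<^sub>M \<rho>) (\<lambda>p. indicat_real {-L..L} (fst p) * K)"
    proof (rule integrableI_bounded)
      have "(\<integral>\<^sup>+ p. ennreal (norm (indicat_real {- L..L} (fst p) * K)) \<partial>(lborel \<Otimes>\<^sub>M \<rho>))
          = (\<integral>\<^sup>+ p. ennreal K * indicator ({-L..L} \<times> UNIV) p \<partial>(lborel \<Otimes>\<^sub>M \<rho>))"
        using K by (intro nn_integral_cong) (auto simp: indicator_def)
      also have "\<dots> = ennreal K * (emeasure lborel {-L..L} * emeasure \<rho> UNIV)"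
        by (subst nn_integral_cmult_indicator) (auto simp: \<rho>.emeasure_pair_measure_Times sets\<rho>)
      also have "\<dots> < \<infinity>"
        using L \<rho>.emeasure_finite[of UNIV] by (simp add: ennreal_mult_eq_top_iff less_top[symmetric])
      finally show "(\<integral>\<^sup>+ p. ennreal (norm (indicat_real {- L..L} (fst p) * K)) \<partial>(lborel \<Otimes>\<^sub>M \<rho>)) < \<infinity>" .
    qed simp
    then show "integrable (lborel \<Otimes>\<^sub>M \<rho>) (\<lambda>p. indicat_real {-L..L} (fst p) * K)" .
    show "AE p in lborel \<Otimes>\<^sub>M \<rho>. norm (case p of (x, y) \<Rightarrow> f x y) \<le> norm (indicat_real {- L..L} (fst p) * K)"
      using K by (intro AE_I2) (auto simp: f_def indicator_def)
  qed simp
  have "(LINT x:{-L..L}|lebesgue. cdf \<rho> x * deriv \<psi> x) = (LINT x:{-L..L}|lborel. cdf \<rho> x * deriv \<psi> x)"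
    by (rule LINT_lebesgue_lborel) (use \<rho> in measurable)
  also have "\<dots> = (\<integral>x. (\<integral>y. f x y \<partial>\<rho>) \<partial>lborel)"
    unfolding set_lebesgue_integral_def
  proof (rule Bochner_Integration.integral_cong[OF refl])
    fix x
    have "(\<integral>y. f x y \<partial>\<rho>) = (\<integral>y. (indicat_real {-L..L} x * deriv \<psi> x) * indicat_real {..x} y \<partial>\<rho>)"
      by (intro Bochner_Integration.integral_cong) (auto simp: f_def indicator_def)
    also have "\<dots> = indicat_real {-L..L} x * deriv \<psi> x * cdf \<rho> x"
      by (simp add: cdf_def \<rho>.borel_UNIV)
    finally show "indicat_real {- L..L} x *\<^sub>R (cdf \<rho> x * deriv \<psi> x) = (\<integral>y. f x y \<partial>\<rho>)"
      by simp
  qed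
  also have "\<dots> = (\<integral>y. (\<integral>x. f x y \<partial>lborel) \<partial>\<rho>)"
    using PS.Fubini_integral[OF int] by simp
  also have "\<dots> = (\<integral>y. - \<psi> y \<partial>\<rho>)"
  proof (rule integral_cong_AE)
    have "AE y in \<rho>. y \<in> {-L<..<L}"
      using supp by (subst AE_iff_measurable[where N="- {-L<..<L}"]) (auto simp: sets\<rho> \<rho>.borel_UNIV)
    then show "AE y in \<rho>. (\<integral>x. f x y \<partial>lborel) = - \<psi> y"
    proof eventually_elim
      case (elim y)
      have "(\<integral>x. f x y \<partial>lborel) = (LINT x:{y..L}|lborel. deriv \<psi> x)"
        unfolding set_lebesgue_integral_def
        using elim by (intro Bochner_Integration.integral_cong) (auto simp: f_def indicator_def)
      also have "\<dots> = (LINT x:{y..L}|lebesgue. deriv \<psi> x)"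
        by (subst LINT_lebesgue_lborel) auto
      also have "\<dots> = \<psi> L - \<psi> y"
        using elim C by (intro LINT_deriv) auto
      finally show ?case using C(3)[of L] by simp
    qed
    show "(\<lambda>y. - \<psi> y) \<in> borel_measurable \<rho>"
      using borel_measurable_continuous_onI[OF C(4)] by measurable
  qed measurable
  finally show ?thesis by simp
qed

section \<open>Functions of bounded variation in one dimension\<close>

text \<open>The primitive is normalised at \<alpha>. It vanishes to the left because \<theta> does,
  and to the right of \<beta> because the total integral is zero. Strict inclusion of
  [\<alpha>, \<beta>] in the open interval supplies the compact support.\<close>

lemma C1c_antiderivative:
  fixes \<theta> :: "real \<Rightarrow> real"
  assumes cont: "continuous_on UNIV \<theta>" and supp: "\<And>x. x \<notin> {\<alpha><..<\<beta>} \<Longrightarrow> \<theta> x = 0"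
    and ab: "-L < \<alpha>" "\<alpha> \<le> \<beta>" "\<beta> < L" and zero: "(LINT x:{-L..L}|lebesgue. \<theta> x) = 0"
  obtains \<psi> where "\<psi> \<in> C1c {-L<..<L}" "deriv \<psi> = \<theta>"
proof -
  have "\<exists>F. \<forall>x. - \<infinity> < ereal x \<longrightarrow> ereal x < \<infinity> \<longrightarrow> (F has_vector_derivative \<theta> x) (at x)"
    using cont by (intro einterval_antiderivative) (auto simp: continuous_on_eq_continuous_at)
  then obtain F where F: "\<And>x. (F has_real_derivative \<theta> x) (at x)"
    by (auto simp: has_real_derivative_iff_has_vector_derivative)
  define \<psi> where "\<psi> x = F x - F \<alpha>" for x
  have d: "(\<psi> has_real_derivative \<theta> x) (at x)" for x
    unfolding \<psi>_def by (auto intro!: derivative_eq_intros F)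
  then have deriv: "deriv \<psi> = \<theta>"
    by (auto intro: DERIV_imp_deriv)
  have "\<psi> x = 0" if "x \<notin> {\<alpha>..\<beta>}" for x
  proof (cases "x < \<alpha>")
    case True
    have "F \<alpha> - F x = (LINT y:{x..\<alpha>}|lebesgue. \<theta> y)"
      using LINT_deriv[OF F cont, of x \<alpha>] True by simp
    also have "\<dots> = (LINT y:{x..\<alpha>}|lebesgue. 0)"
      using supp by (intro set_lebesgue_integral_cong) auto
    finally show ?thesis by (simp add: \<psi>_def)
  next
    case False
    with that have x: "x > \<beta>" by auto
    have "F x - F \<alpha> = (LINT y:{\<alpha>..x}|lebesgue. \<theta> y)"
      using LINT_deriv[OF F cont, of \<alpha> x] False by simp
    also have "\<dots> = (LINT y:{-L..L}|lebesgue. \<theta> y)"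
      unfolding set_lebesgue_integral_def
    proof (rule Bochner_Integration.integral_cong[OF refl])
      fix y
      show "indicat_real {\<alpha>..x} y *\<^sub>R \<theta> y = indicat_real {-L..L} y *\<^sub>R \<theta> y"
        using supp[of y] x ab by (cases "y \<in> {\<alpha><..<\<beta>}") auto
    qed
    finally show ?thesis using zero by (simp add: \<psi>_def)
  qed
  then have "\<exists>K. compact K \<and> K \<subseteq> {-L<..<L} \<and> (\<forall>x. x \<notin> K \<longrightarrow> \<psi> x = 0)"
    using ab by (intro exI[of _ "{\<alpha>..\<beta>}"]) auto
  then have "\<psi> \<in> C1c {-L<..<L}"
    using d cont deriv by (auto simp: C1c_def real_differentiable_def)
  then show ?thesis using that deriv by blast
qed

text \<open>Continuous approximations of the indicator of (a, b), with flanks of slope k.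
  Combinations of them with mean zero serve as derivatives of test functions.\<close>

definition trapezoid :: "real \<Rightarrow> real \<Rightarrow> real \<Rightarrow> real \<Rightarrow> real" where
  "trapezoid a b k x = max 0 (min 1 (k * min (x - a) (b - x)))"

lemma trapezoid_cont: "continuous_on UNIV (trapezoid a b k)"
  unfolding trapezoid_def by (intro continuous_intros)

lemma trapezoid_bounds: "0 \<le> trapezoid a b k x" "trapezoid a b k x \<le> 1"
  by (auto simp: trapezoid_def)

lemma trapezoid_supp: "x \<notin> {a<..<b} \<Longrightarrow> 0 \<le> k \<Longrightarrow> trapezoid a b k x = 0"
  unfolding trapezoid_def
proof -
  assume "x \<notin> {a<..<b}" "0 \<le> k"
  then have "k * min (x - a) (b - x) \<le> 0" by (intro mult_nonneg_nonpos) auto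
  then show "max 0 (min 1 (k * min (x - a) (b - x))) = 0" by simp
qed

lemma trapezoid_lim: "(\<lambda>n. trapezoid a b (real n) x) \<longlonglongrightarrow> indicator {a<..<b} x"
proof (cases "x \<in> {a<..<b}")
  case True
  define m where "m = min (x - a) (b - x)"
  have m: "m > 0" using True by (auto simp: m_def)
  obtain N where N: "real N * m > 1" using m reals_Archimedean3 by blast
  have "eventually (\<lambda>n. trapezoid a b (real n) x = 1) sequentially"
  proof (rule eventually_sequentiallyI[of N])
    fix n assume "n \<ge> N"
    then have "real n * m \<ge> real N * m" using m by simp
    then show "trapezoid a b (real n) x = 1" using N by (simp add: trapezoid_def m_def[symmetric])
  qed
  then show ?thesis using True by (simp add: tendsto_eventually)
next
  case False
  then show ?thesis using trapezoid_supp[OF False] by simp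
qed

lemma trapezoid_integral_lim:
  fixes w :: "real \<Rightarrow> real"
  assumes w: "w absolutely_integrable_on {-L..L}" and ab: "-L \<le> a" "b \<le> L"
  shows "(\<lambda>n. LINT x:{-L..L}|lebesgue. w x * trapezoid a b (real n) x) \<longlonglongrightarrow> (LINT x:{a<..<b}|lebesgue. w x)"
proof -
  have wm: "(\<lambda>x. indicator {-L..L} x * w x) \<in> borel_measurable lebesgue"
    using w unfolding set_integrable_def by (auto dest: borel_measurable_integrable)
  have tm [measurable]: "trapezoid a b k \<in> borel_measurable lebesgue" for k
    using borel_measurable_continuous_onI[OF trapezoid_cont] by (intro measurable_completion) simp
  have "(\<lambda>n. LINT x|lebesgue. indicator {-L..L} x *\<^sub>R (w x * trapezoid a b (real n) x))
      \<longlonglongrightarrow> (LINT x|lebesgue. indicator {a<..<b} x *\<^sub>R w x)"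
  proof (rule integral_dominated_convergence)
    have *: "(\<lambda>x. indicator {a<..<b} x *\<^sub>R w x) = (\<lambda>x. indicator {a<..<b} x * (indicator {-L..L} x * w x))"
      using ab by (auto simp: indicator_def)
    show "(\<lambda>x. indicator {a<..<b} x *\<^sub>R w x) \<in> borel_measurable lebesgue"
      unfolding * by (intro borel_measurable_times[OF _ wm] borel_measurable_indicator) auto
    have **: "(\<lambda>x. indicator {-L..L} x *\<^sub>R (w x * trapezoid a b (real n) x)) =
        (\<lambda>x. (indicator {-L..L} x * w x) * trapezoid a b (real n) x)" for n
      by (auto simp: algebra_simps)
    show "(\<lambda>x. indicator {-L..L} x *\<^sub>R (w x * trapezoid a b (real n) x)) \<in> borel_measurable lebesgue" for n
      unfolding ** by (rule borel_measurable_times[OF wm tm])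
    show "integrable lebesgue (\<lambda>x. \<bar>indicator {-L..L} x * w x\<bar>)"
      using w by (intro integrable_abs) (simp add: set_integrable_def)
    show "AE x in lebesgue. (\<lambda>n. indicat_real {-L..L} x *\<^sub>R (w x * trapezoid a b (real n) x))
        \<longlonglongrightarrow> indicat_real {a<..<b} x *\<^sub>R w x"
    proof (intro AE_I2)
      fix x
      have "(\<lambda>n. indicat_real {-L..L} x * (w x * trapezoid a b (real n) x))
          \<longlonglongrightarrow> indicat_real {-L..L} x * (w x * indicator {a<..<b} x)"
        by (intro tendsto_intros trapezoid_lim)
      also have "indicat_real {-L..L} x * (w x * indicator {a<..<b} x) = indicator {a<..<b} x * w x"
        using ab by (auto simp: indicator_def)
      finally show "(\<lambda>n. indicat_real {-L..L} x *\<^sub>R (w x * trapezoid a b (real n) x))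
          \<longlonglongrightarrow> indicat_real {a<..<b} x *\<^sub>R w x" by simp
    qed
    show "AE x in lebesgue. norm (indicat_real {-L..L} x *\<^sub>R (w x * trapezoid a b (real n) x))
        \<le> \<bar>indicat_real {-L..L} x * w x\<bar>" for n
      using trapezoid_bounds[of a b n] by (intro AE_I2) (auto simp: abs_mult indicator_def mult_left_le)
  qed
  then show ?thesis by (simp add: set_lebesgue_integral_def)
qed

text \<open>Lebesgue differentiation: at almost every point the value is the limit of the means over
  small intervals to its right, and all these means are zero.\<close>

lemma AE_zero_if_integral_zero:
  fixes f :: "real \<Rightarrow> real"
  assumes f: "f absolutely_integrable_on {-L..L}"
    and zero: "\<And>a b. -L < a \<Longrightarrow> a < b \<Longrightarrow> b < L \<Longrightarrow> (LINT x:{a<..<b}|lebesgue. f x) = 0"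
  shows "AE x in lebesgue. x \<in> {-L..L} \<longrightarrow> f x = 0"
proof -
  define F where "F x = indicator {-L..L} x * f x" for x
  have iF: "integrable lebesgue F"
    using f by (simp add: set_integrable_def F_def[abs_def])
  then have Fm: "F \<in> borel_measurable lebesgue" by (rule borel_measurable_integrable)
  have int: "F absolutely_integrable_on A" if "A \<in> sets lebesgue" for A
    unfolding set_integrable_def using that iF by (rule integrable_mult_indicator)
  have "F integrable_on cbox a b" for a b
    by (rule set_lebesgue_integral_eq_integral) (rule int, simp)
  then obtain N where N: "negligible N"
    "\<And>x e. x \<notin> N \<Longrightarrow> 0 < e \<Longrightarrow> \<exists>d>0. \<forall>h. 0 < h \<and> h < d \<longrightarrow>
        norm (integral (cbox x (x + h *\<^sub>R One)) F /\<^sub>R h ^ DIM(real) - F x) < e"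
    by (rule integrable_ccontinuous_explicit[of F]) blast
  have "F x = 0" if x: "x \<in> {-L<..<L}" "x \<notin> N" for x
  proof (rule ccontr)
    assume "F x \<noteq> 0"
    then obtain d where d: "d > 0" "\<And>h. 0 < h \<Longrightarrow> h < d \<Longrightarrow>
        norm (integral (cbox x (x + h *\<^sub>R One)) F /\<^sub>R h ^ DIM(real) - F x) < \<bar>F x\<bar>"
      using N(2)[OF x(2), of "\<bar>F x\<bar>"] by auto
    define h where "h = min (d/2) ((L - x) / 2)"
    have h: "0 < h" "h < d" "x + h < L" using d x by (auto simp: h_def min_def field_simps)
    have "integral {x..x+h} F = (LINT y:{x..x+h}|lebesgue. F y)"
      using int by (intro set_lebesgue_integral_eq_integral(2)[symmetric]) auto
    also have "\<dots> = (LINT y:{x<..<x+h}|lebesgue. f y)"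
      unfolding set_lebesgue_integral_def
    proof (rule integral_cong_AE)
      show "(\<lambda>y. indicat_real {x..x + h} y *\<^sub>R F y) \<in> borel_measurable lebesgue"
        unfolding real_scaleR_def by (intro borel_measurable_times[OF _ Fm] borel_measurable_indicator) auto
      have *: "(\<lambda>y. indicat_real {x<..<x + h} y *\<^sub>R f y) = (\<lambda>y. indicat_real {x<..<x + h} y *\<^sub>R F y)"
        using x h by (auto simp: F_def indicator_def)
      show "(\<lambda>y. indicat_real {x<..<x + h} y *\<^sub>R f y) \<in> borel_measurable lebesgue"
        unfolding * unfolding real_scaleR_def by (intro borel_measurable_times[OF _ Fm] borel_measurable_indicator) auto
      have "AE y in lebesgue. y \<notin> {x, x + h}"
        by (rule AE_not_in) (auto simp: negligible_iff_null_sets[symmetric])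
      then show "AE y in lebesgue. indicat_real {x..x + h} y *\<^sub>R F y = indicat_real {x<..<x + h} y *\<^sub>R f y"
        by eventually_elim (use x h in \<open>auto simp: indicator_def F_def\<close>)
    qed
    also have "\<dots> = 0" using zero x h by auto
    finally show False using d(2)[of h] h by simp
  qed
  then have "{x. \<not> (x \<in> {-L..L} \<longrightarrow> f x = 0)} \<subseteq> N \<union> {-L, L}"
    by (force simp: F_def indicator_def)
  moreover have "negligible (N \<union> {-L,L})" using N(1) by auto
  ultimately show ?thesis
    by (intro AE_I'[of "N \<union> {-L,L}"]) (auto simp: negligible_iff_null_sets)
qed

text \<open>Any two intervals are compared through a combination of their trapezoids with mean zero,
  which is the derivative of a test function. In the limit the integral of \<open>w\<close> over an
  interval is proportional to its length, and the factor is the constant sought.\<close>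

lemma du_Bois_Reymond:
  fixes w :: "real \<Rightarrow> real"
  assumes w: "w absolutely_integrable_on {-L..L}" and L: "0 < L"
    and zero: "\<And>\<psi>. \<psi> \<in> C1c {-L<..<L} \<Longrightarrow> (LINT x:{-L..L}|lebesgue. w x * deriv \<psi> x) = 0"
  shows "\<exists>c. AE x in lebesgue. x \<in> {-L..L} \<longrightarrow> w x = c"
proof -
  let ?I = "\<lambda>a b n. LINT x:{-L..L}|lebesgue. trapezoid a b (real n) x"
  let ?J = "\<lambda>a b n. LINT x:{-L..L}|lebesgue. w x * trapezoid a b (real n) x"
  have one: "(\<lambda>_. 1::real) absolutely_integrable_on {-L..L}" by (intro absolutely_integrable_on_const) auto
  have ti: "trapezoid a b k absolutely_integrable_on {-L..L}" for a b k
    by (intro absolutely_integrable_continuous_real continuous_on_subset[OF trapezoid_cont]) simp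
  have twi: "(\<lambda>x. w x * trapezoid a b k x) absolutely_integrable_on {-L..L}" for a b k
  proof -
    have "(\<lambda>x. trapezoid a b k x * w x) absolutely_integrable_on {-L..L}"
    proof (rule absolutely_integrable_bounded_measurable_product_real[OF _ _ _ w])
      show "trapezoid a b k \<in> borel_measurable (lebesgue_on {-L..L})"
        by (intro continuous_imp_measurable_on_sets_lebesgue continuous_on_subset[OF trapezoid_cont]) auto
      show "bounded (trapezoid a b k ` {-L..L})"
        using trapezoid_bounds[of a b k] by (auto simp: bounded_iff intro!: exI[of _ 1])
    qed auto
    then show ?thesis by (simp add: mult.commute)
  qed
  have key: "?I c d n * ?J a b n = ?I a b n * ?J c d n"
    if "-L < a" "a < b" "b < L" "-L < c" "c < d" "d < L" for a b c d n
  proof -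
    \<comment> \<open>Each trapezoid is weighted by the integral of the other one, so the mean is
      zero.\<close>
    define \<theta> where "\<theta> x = ?I c d n * trapezoid a b (real n) x - ?I a b n * trapezoid c d (real n) x" for x
    have z: "(LINT x:{-L..L}|lebesgue. \<theta> x) = 0"
      unfolding \<theta>_def by (subst set_integral_diff) (use ti in \<open>auto simp: mult.commute\<close>)
    have c: "continuous_on UNIV \<theta>"
      unfolding \<theta>_def by (intro continuous_intros trapezoid_cont)
    have s: "\<theta> x = 0" if "x \<notin> {min a c<..<max b d}" for x
      unfolding \<theta>_def by (subst (1 2) trapezoid_supp) (use that in auto)
    have "-L < min a c" "min a c \<le> max b d" "max b d < L" using that by auto
    then obtain \<psi> where \<psi>: "\<psi> \<in> C1c {-L<..<L}" "deriv \<psi> = \<theta>"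
      using C1c_antiderivative[OF c s _ _ _ z] by blast
    have "0 = (LINT x:{-L..L}|lebesgue. w x * \<theta> x)" using zero[OF \<psi>(1)] \<psi>(2) by simp
    also have "\<dots> = (LINT x:{-L..L}|lebesgue. ?I c d n * (w x * trapezoid a b (real n) x) - ?I a b n * (w x * trapezoid c d (real n) x))"
      by (simp add: \<theta>_def algebra_simps)
    also have "\<dots> = ?I c d n * ?J a b n - ?I a b n * ?J c d n"
      by (subst set_integral_diff) (use twi in auto)
    finally show ?thesis by simp
  qed
  have ratio: "(d - c) * (LINT x:{a<..<b}|lebesgue. w x) = (b - a) * (LINT x:{c<..<d}|lebesgue. w x)"
    if h: "-L < a" "a < b" "b < L" "-L < c" "c < d" "d < L" for a b c d
  proof (rule LIMSEQ_unique)
    have I: "?I a b \<longlonglongrightarrow> b - a" if "-L < a" "a < b" "b < L" for a b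
      using trapezoid_integral_lim[OF one, of a b] that by (simp add: set_lebesgue_integral_def)
    show "(\<lambda>n. ?I c d n * ?J a b n) \<longlonglongrightarrow> (d - c) * (LINT x:{a<..<b}|lebesgue. w x)"
      using h by (intro tendsto_mult I trapezoid_integral_lim[OF w]) auto
    show "(\<lambda>n. ?I c d n * ?J a b n) \<longlonglongrightarrow> (b - a) * (LINT x:{c<..<d}|lebesgue. w x)"
      unfolding key[OF h] using h by (intro tendsto_mult I trapezoid_integral_lim[OF w]) auto
  qed
  \<comment> \<open>A reference interval of length L, compactly inside the domain, fixes the
    constant as a mean value.\<close>
  define c where "c = (LINT x:{-L/2<..<L/2}|lebesgue. w x) / L"
  have "AE x in lebesgue. x \<in> {-L..L} \<longrightarrow> w x - c = 0"
  proof (rule AE_zero_if_integral_zero)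
    show "(\<lambda>x. w x - c) absolutely_integrable_on {-L..L}" using w by (intro set_integral_diff) auto
    fix a b assume h: "-L < a" "a < b" "b < L"
    have wi: "w absolutely_integrable_on {a<..<b}"
      by (rule set_integrable_subset[OF w]) (use h in auto)
    have "(LINT x:{a<..<b}|lebesgue. w x - c) = (LINT x:{a<..<b}|lebesgue. w x) - (LINT x:{a<..<b}|lebesgue. c)"
      using wi by (intro set_integral_diff absolutely_integrable_on_const) auto
    also have "(LINT x:{a<..<b}|lebesgue. c) = (b - a) * c"
      using h by (simp add: set_lebesgue_integral_def)
    also have "(LINT x:{a<..<b}|lebesgue. w x) = (b - a) * c"
      using ratio[OF h, of "-L/2" "L/2"] L by (simp add: c_def field_simps)
    finally show "(LINT x:{a<..<b}|lebesgue. w x - c) = 0" by simp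
  qed
  then show ?thesis by (intro exI[of _ c]) simp
qed

section \<open>Representing measures of a BV function\<close>

abbreviation restr :: "real measure \<Rightarrow> real set \<Rightarrow> real measure" where
  "restr \<rho> Y \<equiv> density \<rho> (indicator Y)"

lemma emeasure_restr:
  "sets \<rho> = sets borel \<Longrightarrow> Y \<in> sets borel \<Longrightarrow> B \<in> sets borel \<Longrightarrow> emeasure (restr \<rho> Y) B = emeasure \<rho> (Y \<inter> B)"
  by (simp add: emeasure_restricted)

lemma measure_restr:
  "sets \<rho> = sets borel \<Longrightarrow> Y \<in> sets borel \<Longrightarrow> B \<in> sets borel \<Longrightarrow> measure (restr \<rho> Y) B = measure \<rho> (Y \<inter> B)"
  by (simp add: measure_def emeasure_restr)

lemma finite_borel_restr:
  assumes "finite_borel_measure \<rho>" "Y \<in> sets borel"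
  shows "finite_borel_measure (restr \<rho> Y)"
proof -
  interpret finite_borel_measure \<rho> by fact
  show ?thesis
    by (rule finite_borel_measureI)
      (auto simp: M_is_borel assms borel_UNIV emeasure_restr intro!: finite_measureI)
qed

lemma cdf_open_support:
  assumes \<rho>: "finite_borel_measure \<rho>" and supp: "emeasure \<rho> (- {-L<..<L}) = 0" and L: "0 < L"
  shows "x \<le> -L \<Longrightarrow> cdf \<rho> x = 0" "L \<le> x \<Longrightarrow> cdf \<rho> x = measure \<rho> UNIV"
    "L \<le> x \<Longrightarrow> measure \<rho> {..<x} = measure \<rho> UNIV"
    "B \<in> sets borel \<Longrightarrow> measure \<rho> (B \<inter> {-L<..<L}) = measure \<rho> B"
proof -
  interpret finite_borel_measure \<rho> by fact
  have null: "AE x in \<rho>. x \<in> {-L<..<L}"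
    using supp by (subst AE_iff_measurable[where N="- {-L<..<L}"]) (auto simp: M_is_borel borel_UNIV)
  show "x \<le> -L \<Longrightarrow> cdf \<rho> x = 0"
    unfolding cdf_def measure_eq_0_null_sets
  proof -
    assume "x \<le> -L"
    then have "measure \<rho> {..x} = measure \<rho> {}"
      using null by (intro measure_eq_AE) (auto simp: M_is_borel)
    then show "measure \<rho> {..x} = 0" by simp
  qed
  show "L \<le> x \<Longrightarrow> cdf \<rho> x = measure \<rho> UNIV" "L \<le> x \<Longrightarrow> measure \<rho> {..<x} = measure \<rho> UNIV"
    unfolding cdf_def using null by (auto intro!: measure_eq_AE simp: M_is_borel)
  show "B \<in> sets borel \<Longrightarrow> measure \<rho> (B \<inter> {-L<..<L}) = measure \<rho> B"
    using null by (auto intro!: measure_eq_AE simp: M_is_borel)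
qed

lemma bounded_borel_absint:
  fixes f :: "real \<Rightarrow> real"
  assumes [measurable]: "f \<in> borel_measurable borel" and b: "\<And>x. x \<in> {-L..L} \<Longrightarrow> \<bar>f x\<bar> \<le> K"
  shows "f absolutely_integrable_on {-L..L}"
proof (rule measurable_bounded_by_integrable_imp_absolutely_integrable)
  show "f \<in> borel_measurable (lebesgue_on {-L..L})"
    by (intro measurable_restrict_space1 measurable_completion) simp
qed (use b in auto)

text \<open>The constant contributes \<open>c\<close> times the increment of \<psi> over the
  interval, which is zero; each distribution function contributes through integration by
  parts.\<close>

lemma is_distr_deriv_cdfI:
  assumes u: "u \<in> L1 L" and L: "0 < L"
    and ae: "AE x in lebesgue. x \<in> {-L..L} \<longrightarrow> u x = c + cdf P x - cdf N x"
    and sm: "signed_measure_on {-L<..<L} (P, N)"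
  shows "is_distr_deriv L u (P, N)"
  unfolding is_distr_deriv_def
proof (intro conjI ballI)
  have P: "finite_borel_measure P" and N: "finite_borel_measure N"
    and sP: "emeasure P (- {-L<..<L}) = 0" and sN: "emeasure N (- {-L<..<L}) = 0"
    using sm by (auto simp: signed_measure_on_def intro: finite_borel_measureI)
  show "signed_measure_on {-L<..<L} (P, N)" by fact
  fix \<psi> assume \<psi>: "\<psi> \<in> C1c {-L<..<L}"
  obtain K where K: "\<And>x. x \<in> {-L..L} \<Longrightarrow> \<bar>deriv \<psi> x\<bar> \<le> K" "0 \<le> K"
    using C1c_bounded[OF \<psi>] by blast
  have dm: "deriv \<psi> \<in> borel_measurable borel"
    using C1c_props(1)[OF \<psi>] by (rule borel_measurable_continuous_onI)
  have ai: "(\<lambda>x. cdf Q x * deriv \<psi> x) absolutely_integrable_on {-L..L}" if "finite_borel_measure Q" for Q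
  proof (rule bounded_borel_absint)
    interpret finite_borel_measure Q by fact
    show "(\<lambda>x. cdf Q x * deriv \<psi> x) \<in> borel_measurable borel"
      using dm cdf_measurable[OF that] by simp
    show "\<bar>cdf Q x * deriv \<psi> x\<bar> \<le> measure Q (space Q) * K" if "x \<in> {-L..L}" for x
      using K that cdf_bounded[of x] cdf_nonneg[of x] by (auto simp: abs_mult intro!: mult_mono)
  qed
  have ac: "(\<lambda>x. c * deriv \<psi> x) absolutely_integrable_on {-L..L}"
    using K dm by (intro bounded_borel_absint[where K="\<bar>c\<bar> * K"]) (auto simp: abs_mult intro!: mult_left_mono)
  have "(LINT x:{-L..L}|lebesgue. u x * deriv \<psi> x)
      = (LINT x:{-L..L}|lebesgue. c * deriv \<psi> x + cdf P x * deriv \<psi> x - cdf N x * deriv \<psi> x)"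
    unfolding set_lebesgue_integral_def
  proof (rule integral_cong_AE)
    have um: "(\<lambda>x. indicator {-L..L} x * u x) \<in> borel_measurable lebesgue"
      using u unfolding L1_def set_integrable_def by (auto dest: borel_measurable_integrable)
    have dl: "deriv \<psi> \<in> borel_measurable lebesgue" using dm by (intro measurable_completion) simp
    show "(\<lambda>x. indicat_real {-L..L} x *\<^sub>R (u x * deriv \<psi> x)) \<in> borel_measurable lebesgue"
      using borel_measurable_times[OF um dl] by (simp add: mult.assoc)
    show "(\<lambda>x. indicat_real {-L..L} x *\<^sub>R (c * deriv \<psi> x + cdf P x * deriv \<psi> x - cdf N x * deriv \<psi> x))
        \<in> borel_measurable lebesgue"
      using set_integral_diff(1)[OF set_integral_add(1)[OF ac ai[OF P]] ai[OF N]]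
      unfolding set_integrable_def by (rule borel_measurable_integrable)
    show "AE x in lebesgue. indicat_real {-L..L} x *\<^sub>R (u x * deriv \<psi> x) =
        indicat_real {-L..L} x *\<^sub>R (c * deriv \<psi> x + cdf P x * deriv \<psi> x - cdf N x * deriv \<psi> x)"
      using ae by eventually_elim (auto simp: indicator_def left_diff_distrib distrib_right)
  qed
  also have "\<dots> = (LINT x:{-L..L}|lebesgue. c * deriv \<psi> x) + (LINT x:{-L..L}|lebesgue. cdf P x * deriv \<psi> x)
      - (LINT x:{-L..L}|lebesgue. cdf N x * deriv \<psi> x)"
    using set_integral_diff(2)[OF set_integral_add(1)[OF ac ai[OF P]] ai[OF N]]
      set_integral_add(2)[OF ac ai[OF P]] by simp
  also have "(LINT x:{-L..L}|lebesgue. c * deriv \<psi> x) = c * (\<psi> L - \<psi> (-L))"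
    using LINT_deriv[OF C1c_props(2,1)[OF \<psi>], of "-L" L] L by simp
  also have "\<dots> = 0" using C1c_props(3)[OF \<psi>] by simp
  finally show "(LINT x:{-L..L}|lebesgue. u x * deriv \<psi> x) = - sm_integral (P, N) \<psi>"
    by (simp add: integration_by_parts_cdf[OF P sP \<psi> L] integration_by_parts_cdf[OF N sN \<psi> L] sm_integral_def)
qed

text \<open>\<open>u\<close> and the difference \<open>z\<close> of the distribution functions have
  the same distributional derivative, so the du Bois-Reymond lemma applies to
  \<open>u - z\<close>.\<close>

lemma distr_deriv_cdfD:
  assumes u: "u \<in> L1 L" and L: "0 < L" and dd: "is_distr_deriv L u (P, N)"
  obtains c where "AE x in lebesgue. x \<in> {-L..L} \<longrightarrow> u x = c + cdf P x - cdf N x"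
proof -
  have sm: "signed_measure_on {-L<..<L} (P, N)"
    using dd by (simp add: is_distr_deriv_def)
  have P: "finite_borel_measure P" and N: "finite_borel_measure N"
    using sm by (auto simp: signed_measure_on_def intro: finite_borel_measureI)
  have ai: "cdf Q absolutely_integrable_on {-L..L}" if "finite_borel_measure Q" for Q
  proof (rule bounded_borel_absint)
    interpret finite_borel_measure Q by fact
    show "cdf Q \<in> borel_measurable borel" by (rule cdf_measurable[OF that])
    show "\<bar>cdf Q x\<bar> \<le> measure Q (space Q)" for x
      using cdf_bounded[of x] cdf_nonneg[of x] by auto
  qed
  define z where "z x = cdf P x - cdf N x" for x
  have zi: "z absolutely_integrable_on {-L..L}"
    unfolding z_def[abs_def] using ai[OF P] ai[OF N] by (rule set_integral_diff(1))
  have ui: "u absolutely_integrable_on {-L..L}" using u by (simp add: L1_def)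
  have dz: "is_distr_deriv L z (P, N)"
    using zi by (intro is_distr_deriv_cdfI[OF _ L _ sm, of _ 0]) (auto simp: z_def L1_def)
  have "\<exists>c. AE x in lebesgue. x \<in> {-L..L} \<longrightarrow> u x - z x = c"
  proof (rule du_Bois_Reymond[OF _ L])
    show "(\<lambda>x. u x - z x) absolutely_integrable_on {-L..L}" using ui zi by (rule set_integral_diff(1))
    fix \<psi> assume \<psi>: "\<psi> \<in> C1c {-L<..<L}"
    obtain K where K: "\<And>x. x \<in> {-L..L} \<Longrightarrow> \<bar>deriv \<psi> x\<bar> \<le> K" "0 \<le> K"
      using C1c_bounded[OF \<psi>] by blast
    have m: "(\<lambda>x. f x * deriv \<psi> x) absolutely_integrable_on {-L..L}" if "f absolutely_integrable_on {-L..L}" for f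
    proof -
      have "(\<lambda>x. deriv \<psi> x * f x) absolutely_integrable_on {-L..L}"
      proof (rule absolutely_integrable_bounded_measurable_product_real[OF _ _ _ that])
        show "deriv \<psi> \<in> borel_measurable (lebesgue_on {-L..L})"
          by (intro continuous_imp_measurable_on_sets_lebesgue continuous_on_subset[OF C1c_props(1)[OF \<psi>]]) auto
        show "bounded (deriv \<psi> ` {-L..L})" using K by (auto simp: bounded_iff intro!: exI[of _ K])
      qed auto
      then show ?thesis by (simp add: mult.commute)
    qed
    have "(LINT x:{-L..L}|lebesgue. (u x - z x) * deriv \<psi> x) =
        (LINT x:{-L..L}|lebesgue. u x * deriv \<psi> x) - (LINT x:{-L..L}|lebesgue. z x * deriv \<psi> x)"
      using set_integral_diff(2)[OF m[OF ui] m[OF zi]] by (simp add: algebra_simps)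
    also have "\<dots> = 0" using dd dz \<psi> by (simp add: is_distr_deriv_def)
    finally show "(LINT x:{-L..L}|lebesgue. (u x - z x) * deriv \<psi> x) = 0" .
  qed
  then obtain c where "AE x in lebesgue. x \<in> {-L..L} \<longrightarrow> u x - z x = c" by blast
  then have "AE x in lebesgue. x \<in> {-L..L} \<longrightarrow> u x = c + cdf P x - cdf N x"
    by eventually_elim (auto simp: z_def)
  then show ?thesis by (rule that)
qed

lemma cdf_diff_right_limit:
  assumes "finite_borel_measure P" "finite_borel_measure N"
  shows "((\<lambda>x. c + cdf P x - cdf N x) \<longlongrightarrow> c + cdf P a - cdf N a) (at_right a)"
  using finite_borel_measure.cdf_is_right_cont[OF assms(1), of a] finite_borel_measure.cdf_is_right_cont[OF assms(2), of a]
  unfolding continuous_within by (intro tendsto_intros)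

lemma cdf_diff_left_limit:
  assumes "finite_borel_measure P" "finite_borel_measure N"
  shows "((\<lambda>x. c + cdf P x - cdf N x) \<longlongrightarrow> c + measure P {..<a} - measure N {..<a}) (at_left a)"
  using finite_borel_measure.cdf_at_left[OF assms(1), of a] finite_borel_measure.cdf_at_left[OF assms(2), of a]
  by (intro tendsto_intros)

text \<open>Right continuity upgrades the a.e. identity to every point of [-L, L), and evaluation at
  -L, where all distribution functions vanish, separates the constants. The sums P + N' and P' + N
  then have equal distribution functions.\<close>

lemma cdf_diff_unique:
  assumes L: "0 < L" and fb: "finite_borel_measure P" "finite_borel_measure N" "finite_borel_measure P'" "finite_borel_measure N'"
    and supp: "emeasure P (- {-L<..<L}) = 0" "emeasure N (- {-L<..<L}) = 0"
      "emeasure P' (- {-L<..<L}) = 0" "emeasure N' (- {-L<..<L}) = 0"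
    and ae: "AE x in lebesgue. x \<in> {-L..L} \<longrightarrow> c + cdf P x - cdf N x = c' + cdf P' x - cdf N' x"
    and B: "B \<in> sets borel"
  shows "measure P B - measure N B = measure P' B - measure N' B"
proof -
  have aer: "AE x in lebesgue. x \<in> {-L..L} \<longrightarrow> c + cdf P x - cdf N x = c + cdf P x - cdf N x" by simp
  have eq: "c + cdf P x - cdf N x = c' + cdf P' x - cdf N' x" if "-L \<le> x" "x < L" for x
    using right_lim_eq[OF ae that cdf_diff_right_limit[OF fb(3,4)]]
      right_lim_eq[OF aer that cdf_diff_right_limit[OF fb(1,2)]] by simp
  have c: "c = c'" using eq[of "-L"] L by (simp add: cdf_open_support(1)[OF _ _ L] fb supp)
  \<comment> \<open>At L only the limit from the left is available. It suffices because none of the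
    measures charges L.\<close>
  have eqL: "c + measure P {..<L} - measure N {..<L} = c' + measure P' {..<L} - measure N' {..<L}"
    using left_lim_eq[OF ae _ _ cdf_diff_left_limit[OF fb(3,4)], of L]
      left_lim_eq[OF aer _ _ cdf_diff_left_limit[OF fb(1,2)], of L] L by simp
  have "cdf P x + cdf N' x = cdf P' x + cdf N x" for x
  proof -
    consider "x < -L" | "-L \<le> x" "x < L" | "L \<le> x" by linarith
    then show ?thesis
    proof cases
      case 1 then show ?thesis using L by (simp add: cdf_open_support[OF _ _ L] fb supp)
    next
      case 2 then show ?thesis using eq[of x] c by simp
    next
      case 3 then show ?thesis using eqL c L by (simp add: cdf_open_support[OF _ _ L] fb supp)
    qed
  qed
  then have "measure_add P N' = measure_add P' N"
    by (intro cdf_unique' finite_borel_measure_add fb) (auto simp: cdf_measure_add fb fun_eq_iff)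
  then have "measure (measure_add P N') B = measure (measure_add P' N) B" by simp
  then show ?thesis by (simp add: measure_measure_add fb B)
qed

text \<open>With a Hahn set Y, \<open>P\<close> is \<mu> - \<nu> on Y and \<open>N\<close> is \<nu>
  - \<mu> off Y. This supplies the mutual singularity built into \<open>signed_measure_on\<close>;
  domination by \<mu> and \<nu> lets support conditions carry over.\<close>

lemma Jordan_decomposition:
  assumes "finite_borel_measure \<mu>" "finite_borel_measure \<nu>"
  obtains P N where "finite_borel_measure P" "finite_borel_measure N" "mutually_singular P N"
    "\<And>B. B \<in> sets borel \<Longrightarrow> emeasure P B \<le> emeasure \<mu> B"
    "\<And>B. B \<in> sets borel \<Longrightarrow> emeasure N B \<le> emeasure \<nu> B"
    "\<And>B. B \<in> sets borel \<Longrightarrow> measure P B - measure N B = measure \<mu> B - measure \<nu> B"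
proof -
  interpret m: finite_borel_measure \<mu> by fact
  interpret n: finite_borel_measure \<nu> by fact
  note [simp] = m.M_is_borel n.M_is_borel
  obtain Y where Y: "Y \<in> sets borel" "\<And>X. X \<in> sets borel \<Longrightarrow> X \<subseteq> Y \<Longrightarrow> emeasure \<nu> X \<le> emeasure \<mu> X"
    "\<And>X. X \<in> sets borel \<Longrightarrow> X \<inter> Y = {} \<Longrightarrow> emeasure \<mu> X \<le> emeasure \<nu> X"
    using finite_unsigned_Hahn_decomposition[of \<mu> \<nu>] m.finite_measure_axioms n.finite_measure_axioms by auto
  define P where "P = diff_measure (restr \<mu> Y) (restr \<nu> Y)"
  define N where "N = diff_measure (restr \<nu> (-Y)) (restr \<mu> (-Y))"
  have fin: "finite_measure (restr \<mu> X)" "finite_measure (restr \<nu> X)" if "X \<in> sets borel" for X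
    using finite_borel_restr[OF assms(1) that] finite_borel_restr[OF assms(2) that]
    by (auto simp: finite_borel_measure_def)
  have eP: "emeasure P B = emeasure \<mu> (Y \<inter> B) - emeasure \<nu> (Y \<inter> B)" if "B \<in> sets borel" for B
    unfolding P_def using Y that fin by (subst emeasure_diff_measure) (auto simp: emeasure_restr)
  have eN: "emeasure N B = emeasure \<nu> (-Y \<inter> B) - emeasure \<mu> (-Y \<inter> B)" if "B \<in> sets borel" for B
    unfolding N_def using Y that fin by (subst emeasure_diff_measure) (auto simp: emeasure_restr)
  have sPN: "sets P = sets borel" "sets N = sets borel" by (auto simp: P_def N_def)
  have leP: "emeasure P B \<le> emeasure \<mu> B" if "B \<in> sets borel" for B
  proof -
    have "emeasure P B \<le> emeasure \<mu> (Y \<inter> B)" using that by (simp add: eP diff_le_self_ennreal)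
    also have "\<dots> \<le> emeasure \<mu> B" using that by (intro emeasure_mono) auto
    finally show ?thesis .
  qed
  have leN: "emeasure N B \<le> emeasure \<nu> B" if "B \<in> sets borel" for B
  proof -
    have "emeasure N B \<le> emeasure \<nu> (-Y \<inter> B)" using that by (simp add: eN diff_le_self_ennreal)
    also have "\<dots> \<le> emeasure \<nu> B" using that by (intro emeasure_mono) auto
    finally show ?thesis .
  qed
  have fP: "finite_borel_measure P" "finite_borel_measure N"
    using sPN leP[of UNIV] leN[of UNIV]
    by (auto intro!: finite_borel_measureI finite_measureI simp: sets_eq_imp_space_eq[OF sPN(1)]
        sets_eq_imp_space_eq[OF sPN(2)] top_unique)
  have mP: "measure P B = measure \<mu> (Y \<inter> B) - measure \<nu> (Y \<inter> B)" if "B \<in> sets borel" for B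
    unfolding measure_def[of P] eP[OF that] m.emeasure_eq_measure n.emeasure_eq_measure
    using Y(2)[of "Y \<inter> B"] Y(1) that
    by (simp add: ennreal_minus m.emeasure_eq_measure n.emeasure_eq_measure)
  have mN: "measure N B = measure \<nu> (-Y \<inter> B) - measure \<mu> (-Y \<inter> B)" if "B \<in> sets borel" for B
    unfolding measure_def[of N] eN[OF that] m.emeasure_eq_measure n.emeasure_eq_measure
    using Y(3)[of "-Y \<inter> B"] Y(1) that
    by (auto simp: ennreal_minus m.emeasure_eq_measure n.emeasure_eq_measure)
  show ?thesis
  proof (rule that[OF fP _ leP leN])
    show "mutually_singular P N"
      unfolding mutually_singular_def
      using Y(1) by (intro bexI[of _ "-Y"]) (auto simp: eP eN)
    fix B :: "real set" assume B: "B \<in> sets borel"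
    have "measure \<mu> B = measure \<mu> (Y \<inter> B) + measure \<mu> (-Y \<inter> B)"
      using B Y(1) by (subst m.finite_measure_Union[symmetric]) (auto intro!: arg_cong[where f="measure \<mu>"])
    moreover have "measure \<nu> B = measure \<nu> (Y \<inter> B) + measure \<nu> (-Y \<inter> B)"
      using B Y(1) by (subst n.finite_measure_Union[symmetric]) (auto intro!: arg_cong[where f="measure \<nu>"])
    ultimately show "measure P B - measure N B = measure \<mu> B - measure \<nu> B"
      using B by (simp add: mP mN)
  qed
qed

text \<open>The given pair may overlap, so its Jordan decomposition is taken as the witness.
  \<open>distr_deriv\<close> is an arbitrary choice among such witnesses, but uniqueness forces its
  signed values to be those of the given pair.\<close>

lemma BV_cdfI:
  assumes u: "u \<in> L1 L" and L: "0 < L" and fb: "finite_borel_measure \<mu>" "finite_borel_measure \<nu>"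
    and supp: "emeasure \<mu> (- {-L<..<L}) = 0" "emeasure \<nu> (- {-L<..<L}) = 0"
    and ae: "AE x in lebesgue. x \<in> {-L..L} \<longrightarrow> u x = c + cdf \<mu> x - cdf \<nu> x"
  shows "u \<in> BV L" "\<And>B. B \<in> sets borel \<Longrightarrow> sm_val (distr_deriv L u) B = measure \<mu> B - measure \<nu> B"
proof -
  from Jordan_decomposition[OF fb] obtain P N where PN: "finite_borel_measure P" "finite_borel_measure N"
    "mutually_singular P N"
    "\<And>B. B \<in> sets borel \<Longrightarrow> emeasure P B \<le> emeasure \<mu> B"
    "\<And>B. B \<in> sets borel \<Longrightarrow> emeasure N B \<le> emeasure \<nu> B"
    "\<And>B. B \<in> sets borel \<Longrightarrow> measure P B - measure N B = measure \<mu> B - measure \<nu> B" by blast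
  have s: "emeasure P (- {-L<..<L}) = 0" "emeasure N (- {-L<..<L}) = 0"
    using PN(4,5)[of "- {-L<..<L}"] supp by auto
  have "signed_measure_on {-L<..<L} (P, N)"
    using PN s by (auto simp: signed_measure_on_def finite_borel_measure_def finite_borel_measure_axioms_def)
  moreover have e: "c + cdf \<mu> x - cdf \<nu> x = c + cdf P x - cdf N x" for x
    using PN(6)[of "{..x}"] by (simp add: cdf_def)
  ultimately have ex: "is_distr_deriv L u (P, N)"
    using is_distr_deriv_cdfI[OF u L, of c P N] ae unfolding e by blast
  then show "u \<in> BV L" using u by (auto simp: BV_def)
  have "is_distr_deriv L u (distr_deriv L u)"
    unfolding distr_deriv_def using ex by (rule someI)
  then obtain P' N' where eq: "distr_deriv L u = (P', N')" and dd: "is_distr_deriv L u (P', N')"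
    by (cases "distr_deriv L u") auto
  obtain c' where c': "AE x in lebesgue. x \<in> {-L..L} \<longrightarrow> u x = c' + cdf P' x - cdf N' x"
    using distr_deriv_cdfD[OF u L dd] by blast
  have sm: "signed_measure_on {-L<..<L} (P', N')"
    using dd by (simp add: is_distr_deriv_def)
  have "AE x in lebesgue. x \<in> {-L..L} \<longrightarrow> c' + cdf P' x - cdf N' x = c + cdf \<mu> x - cdf \<nu> x"
    using c' ae by eventually_elim auto
  from cdf_diff_unique[OF L _ _ fb _ _ supp this]
  show "sm_val (distr_deriv L u) B = measure \<mu> B - measure \<nu> B" if "B \<in> sets borel" for B
    unfolding eq sm_val_def using sm that by (auto simp: signed_measure_on_def intro: finite_borel_measureI)
qed

section \<open>Traces and jumps\<close>

lemma right_lim_cdf: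
  assumes fb: "finite_borel_measure P" "finite_borel_measure N"
    and ae: "AE x in lebesgue. x \<in> {-L..L} \<longrightarrow> u x = c + cdf P x - cdf N x"
    and x: "-L \<le> x" "x < L"
  shows "right_lim u x = c + cdf P x - cdf N x"
  using right_lim_eq[OF ae x cdf_diff_right_limit[OF fb]] .

lemma left_lim_cdf:
  assumes fb: "finite_borel_measure P" "finite_borel_measure N"
    and ae: "AE x in lebesgue. x \<in> {-L..L} \<longrightarrow> u x = c + cdf P x - cdf N x"
    and x: "-L < x" "x \<le> L"
  shows "left_lim u x = c + measure P {..<x} - measure N {..<x}"
  using left_lim_eq[OF ae x cdf_diff_left_limit[OF fb]] .

lemma cdf_minus_left:
  assumes "finite_borel_measure P"
  shows "cdf P x - measure P {..<x} = measure P {x}"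
proof -
  interpret finite_borel_measure P by fact
  have "measure P {..x} = measure P {..<x} + measure P {x}"
    using finite_measure_Union[of "{..<x}" "{x}"] by (simp add: M_is_borel ivl_disj_un(2) del: Un_insert_right)
  then show ?thesis by (simp add: cdf_def)
qed

lemma jump_cdf:
  assumes fb: "finite_borel_measure P" "finite_borel_measure N"
    and ae: "AE x in lebesgue. x \<in> {-L..L} \<longrightarrow> u x = c + cdf P x - cdf N x"
    and x: "x \<in> {-L<..<L}"
  shows "jump u x = measure P {x} - measure N {x}"
  using x cdf_minus_left[OF fb(1), of x] cdf_minus_left[OF fb(2), of x]
  by (simp add: jump_def right_lim_cdf[OF fb ae] left_lim_cdf[OF fb ae])

text \<open>Limits along the nontrivial essential filters are unique, so the existential in
  \<open>jump_set\<close> can be evaluated at the explicit one-sided limits, whose gap is the signed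
  mass of the point.\<close>

lemma jump_set_cdf:
  assumes fb: "finite_borel_measure P" "finite_borel_measure N"
    and ae: "AE x in lebesgue. x \<in> {-L..L} \<longrightarrow> u x = c + cdf P x - cdf N x"
  shows "jump_set L u = {x \<in> {-L<..<L}. measure P {x} \<noteq> measure N {x}}"
proof -
  have "(\<exists>l r. (u \<longlongrightarrow> l) (ess_at_left x) \<and> (u \<longlongrightarrow> r) (ess_at_right x) \<and> l \<noteq> r) \<longleftrightarrow>
      measure P {x} \<noteq> measure N {x}" if x: "x \<in> {-L<..<L}" for x
  proof -
    have r: "(u \<longlongrightarrow> c + cdf P x - cdf N x) (ess_at_right x)"
      using x by (intro tendsto_ess_at_right[OF ae] cdf_diff_right_limit[OF fb]) auto
    have l: "(u \<longlongrightarrow> c + measure P {..<x} - measure N {..<x}) (ess_at_left x)"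
      using x by (intro tendsto_ess_at_left[OF ae] cdf_diff_left_limit[OF fb]) auto
    have "(\<exists>l r. (u \<longlongrightarrow> l) (ess_at_left x) \<and> (u \<longlongrightarrow> r) (ess_at_right x) \<and> l \<noteq> r) \<longleftrightarrow>
      c + measure P {..<x} - measure N {..<x} \<noteq> c + cdf P x - cdf N x"
      using l r tendsto_unique[OF ess_at_left_nontrivial l] tendsto_unique[OF ess_at_right_nontrivial r] by metis
    then show ?thesis
      using cdf_minus_left[OF fb(1), of x] cdf_minus_left[OF fb(2), of x] by auto
  qed
  then show ?thesis by (auto simp: jump_set_def)
qed

text \<open>Radon-Nikodym is used twice. The density of a finite version of Lebesgue measure with
  respect to its sum with \<nu> locates the null set \<open>S\<close> carrying the singular part;
  off \<open>S\<close> the measure \<nu> is absolutely continuous and has a density itself.\<close>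

lemma Lebesgue_decomposition:
  assumes "finite_borel_measure \<nu>"
  obtains S f where "S \<in> sets borel" "emeasure lborel S = 0" "integrable lborel f" "\<And>x. 0 \<le> f x"
    "\<And>B. B \<in> sets borel \<Longrightarrow> measure \<nu> B = (LINT x:B|lborel. f x) + measure \<nu> (S \<inter> B)"
proof -
  interpret n: finite_borel_measure \<nu> by fact
  note [simp] = n.M_is_borel
  obtain h :: "real \<Rightarrow> ennreal" where h: "h \<in> borel_measurable lborel" "integral\<^sup>N lborel h \<noteq> \<infinity>" "\<And>x. 0 < h x"
    using sigma_finite_measure.Ex_finite_integrable_function[OF sigma_finite_lborel] by auto
  have hb [measurable]: "h \<in> borel_measurable borel" using h(1) by simp
  \<comment> \<open>Lebesgue measure is only sigma-finite. Weighting it by a positive integrable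
    \<open>h\<close> gives a finite measure with the same null sets.\<close>
  define \<kappa> where "\<kappa> = density lborel h"
  have l': "finite_borel_measure \<kappa>"
    unfolding \<kappa>_def using h
    by (intro finite_borel_measureI finite_measureI) (auto simp: emeasure_density)
  interpret l: finite_borel_measure \<kappa> by fact
  have null: "emeasure \<kappa> B = 0 \<longleftrightarrow> emeasure lborel B = 0" if "B \<in> sets borel" for B
  proof -
    have "emeasure \<kappa> B = (\<integral>\<^sup>+x. h x * indicator B x \<partial>lborel)"
      using that by (simp add: \<kappa>_def emeasure_density)
    also have "\<dots> = 0 \<longleftrightarrow> (AE x in lborel. h x * indicator B x = 0)"
      using that by (intro nn_integral_0_iff_AE) simp
    also have "\<dots> \<longleftrightarrow> (AE x in lborel. x \<notin> B)"
      using h(3) by (intro AE_cong) (auto simp: indicator_def less_le)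
    also have "\<dots> \<longleftrightarrow> emeasure lborel B = 0"
      using that by (subst AE_iff_measurable[where N=B]) auto
    finally show ?thesis .
  qed
  define \<rho> where "\<rho> = measure_add \<kappa> \<nu>"
  have sr [simp]: "sets \<rho> = sets borel" by (simp add: \<rho>_def)
  have er: "emeasure \<rho> B = emeasure \<kappa> B + emeasure \<nu> B" if "B \<in> sets borel" for B
    unfolding \<rho>_def by (rule emeasure_measure_add) (auto simp: l.M_is_borel that)
  interpret r: finite_borel_measure \<rho>
    unfolding \<rho>_def by (rule finite_borel_measure_add) fact+
  have "absolutely_continuous \<rho> \<kappa>"
    unfolding absolutely_continuous_def using er by (auto simp: null_sets_def l.M_is_borel)
  then obtain k where k: "k \<in> borel_measurable \<rho>" "density \<rho> k = \<kappa>"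
    using r.Radon_Nikodym[of \<kappa>] by (auto simp: l.M_is_borel)
  have kb [measurable]: "k \<in> borel_measurable borel" using k(1) by (simp cong: measurable_cong_sets)
  \<comment> \<open>Where the density of \<kappa> with respect to \<kappa> + \<nu> vanishes there is
    no Lebesgue mass; elsewhere a Lebesgue null set is \<nu>-null as well.\<close>
  define S where "S = {x. k x = 0}"
  have S [measurable]: "S \<in> sets borel" unfolding S_def by measurable
  have el: "emeasure \<kappa> B = (\<integral>\<^sup>+x. k x * indicator B x \<partial>\<rho>)" if "B \<in> sets borel" for B
    using that k by (subst k(2)[symmetric], subst emeasure_density) auto
  have "emeasure \<kappa> S = (\<integral>\<^sup>+x. 0 \<partial>\<rho>)"
    unfolding el[OF S] by (intro nn_integral_cong) (auto simp: S_def indicator_def)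
  then have S0: "emeasure lborel S = 0" using null[OF S] by simp
  let ?n = "restr \<nu> (-S)"
  have "emeasure ?n B = 0" if "B \<in> sets borel" "emeasure lborel B = 0" for B
  proof -
    have "(\<integral>\<^sup>+x. k x * indicator B x \<partial>\<rho>) = 0" using null[OF that(1)] that el by simp
    then have "AE x in \<rho>. k x * indicator B x = 0"
      using that by (subst (asm) nn_integral_0_iff_AE) (auto cong: measurable_cong_sets)
    then have "AE x in \<rho>. x \<notin> -S \<inter> B"
      by eventually_elim (auto simp: S_def indicator_def split: if_splits)
    then have "emeasure \<rho> (-S \<inter> B) = 0"
      using that S by (subst (asm) AE_iff_measurable[where N="-S \<inter> B"]) (auto simp: r.borel_UNIV)
    then show ?thesis using that S by (simp add: er emeasure_restr)
  qed
  then have "absolutely_continuous lborel ?n"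
    unfolding absolutely_continuous_def by (auto simp: null_sets_def)
  then obtain f where f: "f \<in> borel_measurable lborel" "density lborel f = ?n"
    using sigma_finite_measure.Radon_Nikodym[OF sigma_finite_lborel, of ?n] by auto
  have fb [measurable]: "f \<in> borel_measurable borel" using f(1) by simp
  have ef: "emeasure \<nu> (-S \<inter> B) = (\<integral>\<^sup>+x. f x * indicator B x \<partial>lborel)" if "B \<in> sets borel" for B
    using that S f by (subst emeasure_restr[symmetric]) (auto simp: f(2)[symmetric] emeasure_density)
  have fin: "(\<integral>\<^sup>+x. f x \<partial>lborel) \<noteq> \<infinity>" using ef[of UNIV] n.emeasure_finite[of "-S"] by simp
  then have aef: "AE x in lborel. f x \<noteq> \<infinity>" by (intro nn_integral_PInf_AE) auto
  define g where "g x = enn2real (f x)" for x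
  have gb [measurable]: "g \<in> borel_measurable borel" unfolding g_def[abs_def] by measurable
  have gf: "AE x in lborel. ennreal (g x) = f x"
    using aef by eventually_elim (auto simp: g_def less_top)
  have gi: "integrable lborel g"
  proof (rule integrableI_nonneg)
    have "(\<integral>\<^sup>+ x. ennreal (g x) \<partial>lborel) = (\<integral>\<^sup>+x. f x \<partial>lborel)"
      using gf by (rule nn_integral_cong_AE)
    then show "(\<integral>\<^sup>+ x. ennreal (g x) \<partial>lborel) < \<infinity>" using fin by (simp add: less_top)
  qed (auto simp: g_def)
  show ?thesis
  proof (rule that[OF S S0 gi])
    show "0 \<le> g x" for x by (simp add: g_def)
    fix B :: "real set" assume B: "B \<in> sets borel"
    have "ennreal (LINT x:B|lborel. g x) = (\<integral>\<^sup>+x. ennreal (indicator B x * g x) \<partial>lborel)"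
      unfolding set_lebesgue_integral_def using B gi
      by (subst nn_integral_eq_integral)
        (auto simp: g_def[symmetric] intro!: integrable_mult_indicator[where 'b=real, simplified], simp add: g_def)
    also have "\<dots> = (\<integral>\<^sup>+x. f x * indicator B x \<partial>lborel)"
      by (intro nn_integral_cong_AE) (use gf in eventually_elim, auto simp: indicator_def)
    also have "\<dots> = ennreal (measure \<nu> (-S \<inter> B))"
      by (simp add: ef[OF B, symmetric] n.emeasure_eq_measure)
    finally have "(LINT x:B|lborel. g x) = measure \<nu> (-S \<inter> B)"
      by (subst (asm) ennreal_inj) (auto simp: set_lebesgue_integral_def g_def intro!: integral_nonneg)
    moreover have "measure \<nu> B = measure \<nu> (-S \<inter> B) + measure \<nu> (S \<inter> B)"
      using B S by (subst n.finite_measure_Union[symmetric]) (auto intro!: arg_cong[where f="measure \<nu>"])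
    ultimately show "measure \<nu> B = (LINT x:B|lborel. g x) + measure \<nu> (S \<inter> B)" by simp
  qed
qed

lemma has_sum_atoms:
  assumes "finite_borel_measure \<nu>" "countable A"
  shows "((\<lambda>x. measure \<nu> {x}) has_sum measure \<nu> A) A"
proof -
  interpret finite_borel_measure \<nu> by fact
  note [simp] = M_is_borel
  show ?thesis
  proof (cases "finite A")
    case True
    then have "measure \<nu> A = (\<Sum>x\<in>A. measure \<nu> {x})"
      by (intro finite_measure_eq_sum_singleton) auto
    then show ?thesis using True by simp
  next
    case False
    let ?g = "from_nat_into A"
    have bij: "bij_betw ?g UNIV A" using assms(2) False by (rule bij_betw_from_nat_into)
    have "(\<lambda>i. measure \<nu> {?g i}) sums measure \<nu> (\<Union>i. {?g i})"
      using bij by (intro finite_measure_UNION)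
        (auto simp: disjoint_family_on_def bij_betw_def inj_eq)
    also have "(\<Union>i. {?g i}) = A" using bij by (auto simp: bij_betw_def)
    finally have "((\<lambda>i. measure \<nu> {?g i}) has_sum measure \<nu> A) UNIV"
      by (rule sums_nonneg_imp_has_sum) simp
    then show ?thesis by (subst (asm) has_sum_reindex_bij_betw[OF bij])
  qed
qed

text \<open>For arbitrary \<open>f\<close> measurability is at hand on single points, so the
  integrand is split over singletons. In \<open>ennreal\<close> both the series and
  \<open>infsum\<close> are suprema of finite sums.\<close>

lemma nn_integral_countable_atoms:
  fixes f :: "real \<Rightarrow> ennreal"
  assumes "finite_borel_measure \<nu>" "countable A"
  shows "(\<integral>\<^sup>+x. f x * indicator A x \<partial>\<nu>) = (\<Sum>\<^sub>\<infinity>x\<in>A. f x * emeasure \<nu> {x})"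
proof -
  interpret finite_borel_measure \<nu> by fact
  note [simp] = M_is_borel
  have point: "(\<integral>\<^sup>+x. f x * indicator {a} x \<partial>\<nu>) = f a * emeasure \<nu> {a}" for a
  proof -
    have "(\<integral>\<^sup>+x. f x * indicator {a} x \<partial>\<nu>) = (\<integral>\<^sup>+x. f a * indicator {a} x \<partial>\<nu>)"
      by (intro nn_integral_cong) (auto simp: indicator_def)
    then show ?thesis by (simp add: nn_integral_cmult_indicator)
  qed
  have pm: "(\<lambda>x. f x * indicator {a} x) \<in> borel_measurable \<nu>" for a
  proof -
    have "(\<lambda>x. f x * indicator {a} x) = (\<lambda>x. f a * indicator {a} x)"
      by (auto simp: indicator_def)
    also have "\<dots> \<in> borel_measurable \<nu>" by (intro borel_measurable_times_ennreal borel_measurable_indicator) auto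
    finally show ?thesis .
  qed
  have sup: "(\<Sum>\<^sub>\<infinity>x\<in>A. f x * emeasure \<nu> {x}) = (SUP F\<in>{F. finite F \<and> F \<subseteq> A}. (\<Sum>x\<in>F. f x * emeasure \<nu> {x}))"
    by (rule nonneg_infsum_complete) simp
  show ?thesis
  proof (cases "finite A")
    case True
    have "(\<integral>\<^sup>+x. f x * indicator A x \<partial>\<nu>) = (\<integral>\<^sup>+x. (\<Sum>a\<in>A. f x * indicator {a} x) \<partial>\<nu>)"
    proof (intro nn_integral_cong)
      fix x
      have "(\<Sum>a\<in>A. f x * indicator {a} x) = (\<Sum>a\<in>A. if a = x then f x else 0)"
        by (intro sum.cong) (auto simp: indicator_def)
      also have "\<dots> = f x * indicator A x" using True by (simp add: indicator_def)
      finally show "f x * indicator A x = (\<Sum>a\<in>A. f x * indicator {a} x)" by simp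
    qed
    also have "\<dots> = (\<Sum>a\<in>A. f a * emeasure \<nu> {a})"
      by (subst nn_integral_sum) (auto intro: pm simp: point)
    finally show ?thesis using True by simp
  next
    case False
    let ?g = "from_nat_into A"
    have bij: "bij_betw ?g UNIV A" using assms(2) False by (rule bij_betw_from_nat_into)
    have inj: "inj ?g" and rng: "range ?g = A" using bij by (auto simp: bij_betw_def)
    have "(\<integral>\<^sup>+x. f x * indicator A x \<partial>\<nu>) = (\<integral>\<^sup>+x. (\<Sum>i. f x * indicator {?g i} x) \<partial>\<nu>)"
    proof (intro nn_integral_cong)
      fix x
      have "disjoint_family (\<lambda>i. {?g i})" using inj by (auto simp: disjoint_family_on_def inj_eq)
      then have "(\<Sum>i. indicator {?g i} x :: ennreal) = indicator (\<Union>i. {?g i}) x"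
        by (rule suminf_indicator)
      also have "(\<Union>i. {?g i}) = A" using rng by auto
      finally show "f x * indicator A x = (\<Sum>i. f x * indicator {?g i} x)" by simp
    qed
    also have "\<dots> = (\<Sum>i. f (?g i) * emeasure \<nu> {?g i})"
      by (subst nn_integral_suminf) (auto intro: pm simp: point)
    also have "\<dots> = (SUP n. \<Sum>i<n. f (?g i) * emeasure \<nu> {?g i})"
      by (rule suminf_eq_SUP)
    also have "\<dots> = (\<Sum>\<^sub>\<infinity>x\<in>A. f x * emeasure \<nu> {x})"
      unfolding sup
    proof (rule antisym)
      show "(SUP n. \<Sum>i<n. f (?g i) * emeasure \<nu> {?g i}) \<le>
          (SUP F\<in>{F. finite F \<and> F \<subseteq> A}. (\<Sum>x\<in>F. f x * emeasure \<nu> {x}))"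
      proof (rule SUP_least)
        fix n
        have "(\<Sum>i<n. f (?g i) * emeasure \<nu> {?g i}) = (\<Sum>x\<in>?g ` {..<n}. f x * emeasure \<nu> {x})"
          using inj by (subst sum.reindex) (auto intro: inj_on_subset)
        also have "\<dots> \<le> (SUP F\<in>{F. finite F \<and> F \<subseteq> A}. (\<Sum>x\<in>F. f x * emeasure \<nu> {x}))"
          using rng by (intro SUP_upper) auto
        finally show "(\<Sum>i<n. f (?g i) * emeasure \<nu> {?g i}) \<le>
          (SUP F\<in>{F. finite F \<and> F \<subseteq> A}. (\<Sum>x\<in>F. f x * emeasure \<nu> {x}))" .
      qed
      show "(SUP F\<in>{F. finite F \<and> F \<subseteq> A}. (\<Sum>x\<in>F. f x * emeasure \<nu> {x})) \<le>
          (SUP n. \<Sum>i<n. f (?g i) * emeasure \<nu> {?g i})"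
      proof (rule SUP_least)
        fix F assume F: "F \<in> {F. finite F \<and> F \<subseteq> A}"
        have "finite (?g -` F)" using F inj by (auto intro: finite_vimageI)
        then obtain n where n: "?g -` F \<subseteq> {..<n}"
          by (metis finite_nat_iff_bounded)
        have "F \<subseteq> ?g ` {..<n}"
        proof
          fix x assume "x \<in> F"
          moreover then obtain i where "x = ?g i" using F rng by auto
          ultimately show "x \<in> ?g ` {..<n}" using n by auto
        qed
        then have "(\<Sum>x\<in>F. f x * emeasure \<nu> {x}) \<le> (\<Sum>x\<in>?g ` {..<n}. f x * emeasure \<nu> {x})"
          by (intro sum_mono2) auto
        also have "\<dots> = (\<Sum>i<n. f (?g i) * emeasure \<nu> {?g i})"
          using inj by (subst sum.reindex) (auto intro: inj_on_subset)
        also have "\<dots> \<le> (SUP n. \<Sum>i<n. f (?g i) * emeasure \<nu> {?g i})" by (rule SUP_upper) simp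
        finally show "(\<Sum>x\<in>F. f x * emeasure \<nu> {x}) \<le> (SUP n. \<Sum>i<n. f (?g i) * emeasure \<nu> {?g i})" .
      qed
    qed
    finally show ?thesis .
  qed
qed

text \<open>Both halves of the derivative are split by Lebesgue's theorem, and their singular parts
  are cut along the countable set \<open>A\<close> of atoms: the part on \<open>A\<close> is the
  jump part, the part off \<open>A\<close> the Cantor part.\<close>

lemma BV_decomposition:
  assumes u: "u \<in> BV L" and L: "0 < L"
  shows "\<exists>p. is_BV_decomp L u p"
proof -
  have uL: "u \<in> L1 L" and ex: "\<exists>\<mu>. is_distr_deriv L u \<mu>" using u by (auto simp: BV_def)
  have "is_distr_deriv L u (distr_deriv L u)"
    unfolding distr_deriv_def using ex by (rule someI_ex)
  then obtain P N where eq: "distr_deriv L u = (P, N)" and dd: "is_distr_deriv L u (P, N)"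
    by (cases "distr_deriv L u") auto
  obtain c where ae: "AE x in lebesgue. x \<in> {-L..L} \<longrightarrow> u x = c + cdf P x - cdf N x"
    using distr_deriv_cdfD[OF uL L dd] by blast
  have P: "finite_borel_measure P" and N: "finite_borel_measure N"
    and sP: "emeasure P (- {-L<..<L}) = 0" and sN: "emeasure N (- {-L<..<L}) = 0"
    and sing: "mutually_singular P N"
    using dd by (auto simp: is_distr_deriv_def signed_measure_on_def intro: finite_borel_measureI)
  interpret P: finite_borel_measure P by fact
  interpret N: finite_borel_measure N by fact
  note [simp] = P.M_is_borel N.M_is_borel
  obtain S f where S: "S \<in> sets borel" "emeasure lborel S = 0" "integrable lborel f" "\<And>x. 0 \<le> f x"
    "\<And>B. B \<in> sets borel \<Longrightarrow> measure P B = (LINT x:B|lborel. f x) + measure P (S \<inter> B)"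
    using Lebesgue_decomposition[OF P] by blast
  obtain S' f' where S': "S' \<in> sets borel" "emeasure lborel S' = 0" "integrable lborel f'" "\<And>x. 0 \<le> f' x"
    "\<And>B. B \<in> sets borel \<Longrightarrow> measure N B = (LINT x:B|lborel. f' x) + measure N (S' \<inter> B)"
    using Lebesgue_decomposition[OF N] by blast
  define A where "A = {x. measure P {x} \<noteq> 0 \<or> measure N {x} \<noteq> 0}"
  have A: "countable A"
    using P.countable_support N.countable_support unfolding A_def Collect_disj_eq by simp
  then have A_borel [simp]: "A \<in> sets borel" by (rule sets.countable[rotated]) simp
  have SA [simp]: "S \<inter> - A \<in> sets borel" "S' \<inter> - A \<in> sets borel"
    by (rule sets.Int[OF S(1) borel_comp[OF A_borel]], rule sets.Int[OF S'(1) borel_comp[OF A_borel]])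
  have count0: "(LINT x:C|lborel. h x) = 0" if "countable C" for C and h :: "real \<Rightarrow> real"
  proof -
    have "C \<in> null_sets lborel" using that by (rule countable_imp_null_set_lborel)
    then have "AE x in lborel. x \<notin> C" by (rule AE_not_in)
    then have "AE x in lborel. indicat_real C x *\<^sub>R h x = 0" by eventually_elim simp
    then show ?thesis unfolding set_lebesgue_integral_def by (rule integral_eq_zero_AE)
  qed
  \<comment> \<open>Mutual singularity forbids a common atom, so nothing cancels and the jump set is
    exactly the set of atoms inside the open interval.\<close>
  have disj: "measure P {x} = 0 \<or> measure N {x} = 0" for x
  proof -
    obtain Y where Y: "Y \<in> sets borel" "emeasure P Y = 0" "emeasure N (-Y) = 0"
      using sing by (auto simp: mutually_singular_def)
    show ?thesis
    proof (cases "x \<in> Y")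
      case True
      then have "emeasure P {x} \<le> emeasure P Y" using Y by (intro emeasure_mono) auto
      then show ?thesis using Y by (simp add: measure_def)
    next
      case False
      then have "emeasure N {x} \<le> emeasure N (-Y)" using Y by (intro emeasure_mono) auto
      then show ?thesis using Y by (simp add: measure_def)
    qed
  qed
  have "(measure P {x} \<noteq> measure N {x}) = (x \<in> A)" for x
    using disj[of x] by (auto simp: A_def)
  then have J: "jump_set L u = A \<inter> {-L<..<L}"
    unfolding jump_set_cdf[OF P N ae] by auto
  have jmp: "jump u x = measure P {x} - measure N {x}" if "x \<in> {-L<..<L}" for x
    using jump_cdf[OF P N ae that] .
  define w where "w x = f x - f' x" for x
  define p where "p = restr P (S \<inter> - A)"
  define n where "n = restr N (S' \<inter> - A)"
  have fp: "finite_borel_measure p" "finite_borel_measure n"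
    unfolding p_def n_def by (auto intro!: finite_borel_restr P N)
  have ep: "emeasure p B = emeasure P (S \<inter> - A \<inter> B)" "emeasure n B = emeasure N (S' \<inter> - A \<inter> B)"
    if "B \<in> sets borel" for B
    using that by (simp_all add: p_def n_def emeasure_restr)
  have mp: "measure p B = measure P (S \<inter> - A \<inter> B)" "measure n B = measure N (S' \<inter> - A \<inter> B)"
    if "B \<in> sets borel" for B
    using ep[OF that] by (auto simp: measure_def)
  have le: "emeasure p B \<le> emeasure P B" "emeasure n B \<le> emeasure N B" if "B \<in> sets borel" for B
    using that S S' unfolding ep[OF that] by (auto intro!: emeasure_mono)
  have wi: "integrable lborel w" unfolding w_def using S S' by simp
  then have wI: "w absolutely_integrable_on B" if "B \<in> sets borel" for B
    using that unfolding set_integrable_def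
    by (intro integrable_mult_indicator) (auto simp: integrable_completion)
  have LINT_eq: "(LINT x:B|lebesgue. h x) = (LINT x:B|lborel. h x)" if "B \<in> sets borel" "h \<in> borel_measurable borel"
    for B and h :: "real \<Rightarrow> real" by (rule LINT_lebesgue_lborel[OF that(2,1)])
  have main: "((\<lambda>x. jump u x) has_sum (measure P (A \<inter> B) - measure N (A \<inter> B))) (jump_set L u \<inter> B)"
    "measure P B - measure N B = (LINT x:B|lebesgue. w x) + (measure P (A \<inter> B) - measure N (A \<inter> B)) + (measure p B - measure n B)"
    if B: "B \<in> sets borel" "B \<subseteq> {-L<..<L}" for B
  proof -
    have JB: "jump_set L u \<inter> B = A \<inter> B" using B by (auto simp: J)
    have "((\<lambda>x. measure P {x} - measure N {x}) has_sum (measure P (A \<inter> B) - measure N (A \<inter> B))) (A \<inter> B)"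
    proof -
      have cAB: "countable (A \<inter> B)" using A by auto
      have "((\<lambda>x. - measure N {x}) has_sum - measure N (A \<inter> B)) (A \<inter> B)"
        using has_sum_atoms[OF N cAB] by (simp add: has_sum_uminus)
      from has_sum_add[OF has_sum_atoms[OF P cAB] this] show ?thesis by simp
    qed
    then show "((\<lambda>x. jump u x) has_sum (measure P (A \<inter> B) - measure N (A \<inter> B))) (jump_set L u \<inter> B)"
      unfolding JB by (rule has_sum_cong[THEN iffD1, rotated]) (use B jmp in auto)
    have AB: "A \<inter> B \<in> sets borel" "- A \<inter> B \<in> sets borel"
      by (rule sets.Int[OF A_borel B(1)], rule sets.Int[OF borel_comp[OF A_borel] B(1)])
    have cAB: "countable (A \<inter> B)" using A by auto
    have SAB: "S \<inter> (A \<inter> B) \<in> sets borel" "S \<inter> - A \<inter> B \<in> sets borel"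
      "S' \<inter> (A \<inter> B) \<in> sets borel" "S' \<inter> - A \<inter> B \<in> sets borel"
      using sets.Int[OF S(1) AB(1)] sets.Int[OF S(1) AB(2)] sets.Int[OF S'(1) AB(1)] sets.Int[OF S'(1) AB(2)]
      by (simp_all add: Int_assoc)
    have "measure P (A \<inter> B) = measure P (S \<inter> (A \<inter> B))"
      using S(5)[OF AB(1)] count0[OF cAB, of f] by simp
    moreover have "measure P (S \<inter> B) = measure P (S \<inter> (A \<inter> B)) + measure P (S \<inter> - A \<inter> B)"
      using SAB by (subst P.finite_measure_Union[symmetric]) (auto simp: Int_assoc intro!: arg_cong[where f="measure P"])
    moreover have "measure N (A \<inter> B) = measure N (S' \<inter> (A \<inter> B))"
      using S'(5)[OF AB(1)] count0[OF cAB, of f'] by simp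
    moreover have "measure N (S' \<inter> B) = measure N (S' \<inter> (A \<inter> B)) + measure N (S' \<inter> - A \<inter> B)"
      using SAB by (subst N.finite_measure_Union[symmetric]) (auto simp: Int_assoc intro!: arg_cong[where f="measure N"])
    moreover have "(LINT x:B|lebesgue. w x) = (LINT x:B|lborel. f x) - (LINT x:B|lborel. f' x)"
    proof -
      have "w \<in> borel_measurable borel" using borel_measurable_integrable[OF wi] by simp
      then have "(LINT x:B|lebesgue. w x) = (LINT x:B|lborel. w x)" using B by (intro LINT_eq)
      also have "\<dots> = (LINT x:B|lborel. f x) - (LINT x:B|lborel. f' x)"
        unfolding w_def using S(3) S'(3) B
        by (intro set_integral_diff; unfold set_integrable_def; intro integrable_mult_indicator) auto
      finally show ?thesis .
    qed
    ultimately show "measure P B - measure N B = (LINT x:B|lebesgue. w x) + (measure P (A \<inter> B) - measure N (A \<inter> B)) + (measure p B - measure n B)"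
      using S(5)[OF B(1)] S'(5)[OF B(1)] mp[OF B(1)] by simp
  qed
  have "is_BV_decomp L u (w, (p, n))"
    unfolding is_BV_decomp_def prod.case fst_conv snd_conv
  proof (intro conjI ballI allI impI)
    show "w absolutely_integrable_on {-L..L}" by (rule wI) simp
    obtain Y where Y: "Y \<in> sets borel" "emeasure P Y = 0" "emeasure N (-Y) = 0"
      using sing by (auto simp: mutually_singular_def)
    have "mutually_singular p n"
      unfolding mutually_singular_def using Y le[of Y] le[of "-Y"] by (intro bexI[of _ Y]) auto
    then show "signed_measure_on {-L<..<L} (p, n)"
      using fp le[of "- {-L<..<L}"] sP sN
      by (auto simp: signed_measure_on_def finite_borel_measure_def finite_borel_measure_axioms_def)
    show "mutually_singular p lborel"
      unfolding mutually_singular_def using S(1,2) by (intro bexI[of _ "-S"]) (auto simp: ep)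
    show "mutually_singular n lborel"
      unfolding mutually_singular_def using S'(1,2) by (intro bexI[of _ "-S'"]) (auto simp: ep)
    fix x
    have e1: "emeasure p {x} = 0"
    proof (cases "x \<in> A")
      case True then have "S \<inter> - A \<inter> {x} = {}" by auto
      then show ?thesis by (simp add: ep)
    next
      case False
      then have "emeasure P {x} = 0" by (simp add: A_def P.emeasure_eq_measure)
      then show ?thesis using le(1)[of "{x}"] by simp
    qed
    have e2: "emeasure n {x} = 0"
    proof (cases "x \<in> A")
      case True then have "S' \<inter> - A \<inter> {x} = {}" by auto
      then show ?thesis by (simp add: ep)
    next
      case False
      then have "emeasure N {x} = 0" by (simp add: A_def N.emeasure_eq_measure)
      then show ?thesis using le(2)[of "{x}"] by simp
    qed
    show "emeasure p {x} = 0" "emeasure n {x} = 0" by fact+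
  next
    have "jump_set L u \<inter> {-L<..<L} = jump_set L u" by (auto simp: J)
    then show "(\<lambda>x. jump u x) summable_on jump_set L u"
      using main(1)[of "{-L<..<L}"] by (auto simp: summable_on_def)
    fix B :: "real set" assume B: "B \<in> sets borel" "B \<subseteq> {-L<..<L}"
    show "sm_val (distr_deriv L u) B = (LINT x:B|lebesgue. w x) + (\<Sum>\<^sub>\<infinity>x\<in>jump_set L u \<inter> B. jump u x) + sm_val (p, n) B"
      using main(2)[OF B] infsumI[OF main(1)[OF B]] by (simp add: eq sm_val_def)
  qed
  then show ?thesis by blast
qed

section \<open>The limit energy as a minimum over elastic-plastic splittings\<close>

text \<open>\<open>f\<close> is only Lebesgue measurable, so the density is formed over
  \<open>lebesgue\<close> and then pushed forward by the identity to obtain a measure on the Borel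
  sets.\<close>

definition ac_measure :: "real \<Rightarrow> (real \<Rightarrow> real) \<Rightarrow> real measure" where
  "ac_measure L f = distr (density lebesgue (\<lambda>x. ennreal (indicator {-L<..<L} x * f x))) borel (\<lambda>x. x)"

lemma absint_borel_measurable:
  fixes f :: "real \<Rightarrow> real"
  assumes "f absolutely_integrable_on {-L..L}"
  shows "(\<lambda>x. indicator {-L..L} x * f x) \<in> borel_measurable lebesgue"
  using assms unfolding set_integrable_def by (auto dest: borel_measurable_integrable)

lemma ac_measure_props:
  assumes f: "f absolutely_integrable_on {-L..L}" and pos: "\<And>x. 0 \<le> f x"
  shows "finite_borel_measure (ac_measure L f)"
    "B \<in> sets borel \<Longrightarrow> measure (ac_measure L f) B = (LINT x:B \<inter> {-L<..<L}|lebesgue. f x)"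
    "emeasure (ac_measure L f) (- {-L<..<L}) = 0"
    "measure (ac_measure L f) {x} = 0"
    "- L \<le> x \<Longrightarrow> x \<le> L \<Longrightarrow> cdf (ac_measure L f) x = (LINT y:{-L..x}|lebesgue. f y)"
proof -
  have fo: "f absolutely_integrable_on {-L<..<L}"
    by (rule set_integrable_subset[OF f]) auto
  then have iof: "integrable lebesgue (\<lambda>x. indicator {-L<..<L} x * f x)"
    by (simp add: set_integrable_def)
  then have mo [measurable]: "(\<lambda>x. indicator {-L<..<L} x * f x) \<in> borel_measurable lebesgue"
    by (rule borel_measurable_integrable)
  have idm: "(\<lambda>x. x) \<in> measurable lebesgue borel"
    using measurable_completion[of "\<lambda>x. x" lborel borel] by simp
  have em: "emeasure (ac_measure L f) B = ennreal (LINT x:B \<inter> {-L<..<L}|lebesgue. f x)" if B: "B \<in> sets borel" for B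
  proof -
    have Bl: "B \<in> sets lebesgue" using B by simp
    have "emeasure (ac_measure L f) B
        = emeasure (density lebesgue (\<lambda>x. ennreal (indicator {-L<..<L} x * f x))) B"
      unfolding ac_measure_def using B idm by (subst emeasure_distr) (auto simp: measurable_def)
    also have "\<dots> = (\<integral>\<^sup>+x. ennreal (indicator {-L<..<L} x * f x) * indicator B x \<partial>lebesgue)"
      by (rule emeasure_density) (use Bl in auto)
    also have "\<dots> = (\<integral>\<^sup>+x. ennreal (indicator (B \<inter> {-L<..<L}) x * f x) \<partial>lebesgue)"
      by (intro nn_integral_cong) (auto simp: indicator_def)
    also have "\<dots> = ennreal (LINT x|lebesgue. indicator (B \<inter> {-L<..<L}) x * f x)"
    proof (rule nn_integral_eq_integral)
      have "(\<lambda>x. indicator B x *\<^sub>R (indicator {-L<..<L} x * f x)) = (\<lambda>x. indicator (B \<inter> {-L<..<L}) x * f x)"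
        by (auto simp: indicator_def)
      then show "integrable lebesgue (\<lambda>x. indicator (B \<inter> {-L<..<L}) x * f x)"
        using integrable_mult_indicator[OF Bl iof] by simp
    qed (use pos in auto)
    finally show ?thesis by (simp add: set_lebesgue_integral_def)
  qed
  show fb: "finite_borel_measure (ac_measure L f)"
  proof (intro finite_borel_measureI finite_measureI)
    show s: "sets (ac_measure L f) = sets borel" by (simp add: ac_measure_def)
    show "emeasure (ac_measure L f) (space (ac_measure L f)) \<noteq> \<infinity>"
      using em[of UNIV] sets_eq_imp_space_eq[OF s] by simp
  qed
  show m: "measure (ac_measure L f) B = (LINT x:B \<inter> {-L<..<L}|lebesgue. f x)" if "B \<in> sets borel" for B
    unfolding measure_def em[OF that] using pos
    by (auto simp: set_lebesgue_integral_def intro!: integral_nonneg enn2real_ennreal)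
  show "emeasure (ac_measure L f) (- {-L<..<L}) = 0"
    by (subst em) (auto simp: set_lebesgue_integral_def)
  have AEn: "AE y in lebesgue. y \<noteq> a" for a :: real
    using AE_lborel_singleton[of a] by (rule AE_completion)
  have null: "(LINT y:A|lebesgue. f y) = (LINT y:A'|lebesgue. f y)"
    if "A \<in> sets lebesgue" "A' \<in> sets lebesgue" "A \<subseteq> {-L..L}" "A' \<subseteq> {-L..L}" "\<And>y. y \<noteq> a \<Longrightarrow> y \<noteq> b \<Longrightarrow> y \<in> A \<longleftrightarrow> y \<in> A'" for A A' a b
    unfolding set_lebesgue_integral_def
  proof (rule integral_cong_AE)
    have *: "(\<lambda>y. indicator C y *\<^sub>R f y) \<in> borel_measurable lebesgue" if "C \<in> sets lebesgue" "C \<subseteq> {-L..L}" for C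
      using set_integrable_subset[OF f that] unfolding set_integrable_def by (rule borel_measurable_integrable)
    show "(\<lambda>y. indicator A y *\<^sub>R f y) \<in> borel_measurable lebesgue" using * that by blast
    show "(\<lambda>y. indicator A' y *\<^sub>R f y) \<in> borel_measurable lebesgue" using * that by blast
    show "AE y in lebesgue. indicator A y *\<^sub>R f y = indicator A' y *\<^sub>R f y"
      using AEn[of a] AEn[of b] by eventually_elim (use that(5) in \<open>auto simp: indicator_def\<close>)
  qed
  show "measure (ac_measure L f) {x} = 0"
  proof -
    have "(LINT y:{x} \<inter> {-L<..<L}|lebesgue. f y) = (LINT y:{}|lebesgue. f y)"
      by (rule null[of _ _ x x]) auto
    then show ?thesis using m[of "{x}"] by (simp add: set_lebesgue_integral_def)
  qed
  show "cdf (ac_measure L f) x = (LINT y:{-L..x}|lebesgue. f y)" if "- L \<le> x" "x \<le> L"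
  proof -
    have "(LINT y:{..x} \<inter> {-L<..<L}|lebesgue. f y) = (LINT y:{-L..x}|lebesgue. f y)"
      by (rule null[of _ _ "-L" L]) (use that in auto)
    then show ?thesis using m[of "{..x}"] by (simp add: cdf_def)
  qed
qed

text \<open>The mass at \<open>a\<close> is the image of \<alpha> times the uniform measure on
  [0, 1] under a constant map.\<close>

lemma point_mass:
  assumes "0 \<le> \<alpha>"
  obtains \<delta> where "finite_borel_measure \<delta>" "\<And>B. B \<in> sets borel \<Longrightarrow> emeasure \<delta> B = ennreal \<alpha> * indicator B a"
proof -
  define \<delta> where "\<delta> = distr (density lborel (\<lambda>x. ennreal \<alpha> * indicator {0..1::real} x)) borel (\<lambda>_. a::real)"
  have em: "emeasure \<delta> B = ennreal \<alpha> * indicator B a" if "B \<in> sets borel" for B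
  proof -
    have "emeasure \<delta> B = emeasure (density lborel (\<lambda>x. ennreal \<alpha> * indicator {0..1::real} x)) (if a \<in> B then UNIV else {})"
      unfolding \<delta>_def using that by (subst emeasure_distr) (auto intro!: arg_cong2[where f=emeasure])
    also have "\<dots> = ennreal \<alpha> * indicator B a"
      by (auto simp: emeasure_density nn_integral_cmult_indicator)
    finally show ?thesis .
  qed
  have s: "sets \<delta> = sets borel" by (simp add: \<delta>_def)
  have "finite_borel_measure \<delta>"
    using s em[of UNIV] sets_eq_imp_space_eq[OF s]
    by (intro finite_borel_measureI finite_measureI) (auto simp: ennreal_mult_eq_top_iff)
  then show ?thesis using em that by blast
qed

text \<open>The density of \<open>\<phi>\<close>-energy per unit of opening: diffuse mass is weighted by \<open>\<sigma>\<^sub>c\<close>, and an atom of mass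
  \<open>s\<close> contributes \<open>\<phi>(s)\<close>. Absolutely continuous opening is thus allowed in \<open>\<nu>\<close>.\<close>

definition cohesive :: "real \<Rightarrow> real \<Rightarrow> real measure \<Rightarrow> ennreal" where
  "cohesive \<sigma>c Gc \<nu> = (\<integral>\<^sup>+x. ennreal (Gc * \<sigma>c / (Gc + \<sigma>c * measure \<nu> {x})) \<partial>\<nu>)"

lemma phi_point:
  assumes "finite_borel_measure \<nu>" "0 < \<sigma>c" "0 < Gc"
  shows "ennreal (Gc * \<sigma>c / (Gc + \<sigma>c * measure \<nu> {x})) * emeasure \<nu> {x} = phi \<sigma>c Gc (measure \<nu> {x})"
proof -
  interpret finite_borel_measure \<nu> by fact
  have "0 < Gc + \<sigma>c * measure \<nu> {x}" using assms by (intro add_pos_nonneg) auto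
  then show ?thesis using assms
    by (simp add: phi_def emeasure_eq_measure ennreal_mult[symmetric] less_imp_le divide_simps)
qed

text \<open>The integrand equals \<open>\<sigma>c\<close> wherever \<nu> has no atom, and times the
  mass of an atom it is \<open>phi\<close> of that mass. The endpoints stand apart because they
  belong to the boundary terms and not to the jump set.\<close>

lemma cohesive_split:
  assumes \<nu>: "finite_borel_measure \<nu>" and supp: "emeasure \<nu> (- {-L..L}) = 0" and L: "0 < L"
    and pos: "0 < \<sigma>c" "0 < Gc"
  defines "J \<equiv> {x \<in> {-L<..<L}. measure \<nu> {x} \<noteq> 0}"
  shows "cohesive \<sigma>c Gc \<nu> = ennreal \<sigma>c * emeasure \<nu> ({-L<..<L} - J)
     + (\<Sum>\<^sub>\<infinity>x\<in>J. phi \<sigma>c Gc (measure \<nu> {x})) + phi \<sigma>c Gc (measure \<nu> {L}) + phi \<sigma>c Gc (measure \<nu> {-L})"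
    "countable J"
proof -
  interpret finite_borel_measure \<nu> by fact
  note [simp] = M_is_borel
  show J: "countable J" unfolding J_def by (rule countable_subset[OF _ countable_support]) auto
  have A: "countable {x. measure \<nu> {x} \<noteq> 0}" by (rule countable_support)
  have Jb [simp]: "J \<in> sets borel" by (rule sets.countable[OF _ J]) simp
  have Db [simp]: "{-L<..<L} - J \<in> sets borel" by (rule sets.Diff[OF _ Jb]) simp
  have Dm: "(\<lambda>x. ennreal \<sigma>c * indicator ({-L<..<L} - J) x) \<in> borel_measurable \<nu>"
    by (intro borel_measurable_times_ennreal borel_measurable_indicator) (simp_all only: borel_measurable_const M_is_borel Db)
  have Di: "(\<integral>\<^sup>+x. ennreal \<sigma>c * indicator ({-L<..<L} - J) x \<partial>\<nu>) = ennreal \<sigma>c * emeasure \<nu> ({-L<..<L} - J)"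
    by (rule nn_integral_cmult_indicator) (simp only: M_is_borel Db)
  let ?f = "\<lambda>x. ennreal (Gc * \<sigma>c / (Gc + \<sigma>c * measure \<nu> {x}))"
  have cm: "(\<lambda>x. ?f x * indicator C x) \<in> borel_measurable \<nu>" if C: "countable C" for C
  proof -
    have "(\<lambda>x. ?f x * indicator C x) = (\<lambda>x. if x \<in> C then ?f x else 0)" by (auto simp: indicator_def)
    moreover have "(\<lambda>x. if x \<in> C then ?f x else 0) \<in> borel_measurable borel"
      by (rule measurable_discrete_difference[of "\<lambda>_. 0" _ _ C]) (use C in auto)
    ultimately show ?thesis by (simp cong: measurable_cong_sets)
  qed
  have AEs: "AE x in \<nu>. x \<in> {-L..L}"
    using supp by (subst AE_iff_measurable[where N="- {-L..L}"]) (auto simp: borel_UNIV)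
  have "cohesive \<sigma>c Gc \<nu> = (\<integral>\<^sup>+x. (ennreal \<sigma>c * indicator ({-L<..<L} - J) x + ?f x * indicator J x)
      + (?f x * indicator {L} x + ?f x * indicator {-L} x) \<partial>\<nu>)"
    unfolding cohesive_def
  proof (rule nn_integral_cong_AE)
    show "AE x in \<nu>. ?f x = ennreal \<sigma>c * indicator ({-L<..<L} - J) x + ?f x * indicator J x
      + (?f x * indicator {L} x + ?f x * indicator {-L} x)"
      using AEs
    proof eventually_elim
      case (elim x)
      consider "x = L" | "x = -L" | "x \<in> J" | "x \<in> {-L<..<L} - J" using elim by fastforce
      then show ?case using L pos by cases (auto simp: J_def indicator_def)
    qed
  qed
  also have "\<dots> = (\<integral>\<^sup>+x. ennreal \<sigma>c * indicator ({-L<..<L} - J) x + ?f x * indicator J x \<partial>\<nu>)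
      + ((\<integral>\<^sup>+x. ?f x * indicator {L} x \<partial>\<nu>) + (\<integral>\<^sup>+x. ?f x * indicator {-L} x \<partial>\<nu>))"
    using cm[OF J] cm[of "{L}"] cm[of "{-L}"] Dm
    by (subst nn_integral_add) (auto simp: nn_integral_add intro!: borel_measurable_add)
  also have "(\<integral>\<^sup>+x. ennreal \<sigma>c * indicator ({-L<..<L} - J) x + ?f x * indicator J x \<partial>\<nu>)
      = ennreal \<sigma>c * emeasure \<nu> ({-L<..<L} - J) + (\<integral>\<^sup>+x. ?f x * indicator J x \<partial>\<nu>)"
    using cm[OF J] Dm by (subst nn_integral_add) (simp_all only: Di)
  also have "(\<integral>\<^sup>+x. ?f x * indicator J x \<partial>\<nu>) = (\<Sum>\<^sub>\<infinity>x\<in>J. phi \<sigma>c Gc (measure \<nu> {x}))"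
    using nn_integral_countable_atoms[OF \<nu> J, of ?f] by (simp add: phi_point[OF \<nu> pos])
  also have "(\<integral>\<^sup>+x. ?f x * indicator {L} x \<partial>\<nu>) = phi \<sigma>c Gc (measure \<nu> {L})"
    using nn_integral_countable_atoms[OF \<nu>, of "{L}" ?f] by (simp add: phi_point[OF \<nu> pos])
  also have "(\<integral>\<^sup>+x. ?f x * indicator {-L} x \<partial>\<nu>) = phi \<sigma>c Gc (measure \<nu> {-L})"
    using nn_integral_countable_atoms[OF \<nu>, of "{-L}" ?f] by (simp add: phi_point[OF \<nu> pos])
  finally show "cohesive \<sigma>c Gc \<nu> = ennreal \<sigma>c * emeasure \<nu> ({-L<..<L} - J)
     + (\<Sum>\<^sub>\<infinity>x\<in>J. phi \<sigma>c Gc (measure \<nu> {x})) + phi \<sigma>c Gc (measure \<nu> {L}) + phi \<sigma>c Gc (measure \<nu> {-L})"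
    by (simp add: add.assoc)
qed

text \<open>The boundary jumps are the atoms of \<open>\<nu>\<close> at \<open>-L\<close> and \<open>L\<close>.\<close>

definition represents :: "real \<Rightarrow> (real \<Rightarrow> real) \<Rightarrow> (real \<Rightarrow> real) \<Rightarrow> (real \<Rightarrow> real) \<Rightarrow> real measure \<Rightarrow> bool" where
  "represents L g u e \<nu> \<longleftrightarrow> e absolutely_integrable_on {-L..L} \<and> finite_borel_measure \<nu> \<and>
     emeasure \<nu> (- {-L..L}) = 0 \<and>
     (AE x in lebesgue. x \<in> {-L..L} \<longrightarrow> u x = g (-L) + (LINT y:{-L..x}|lebesgue. e y) + cdf \<nu> x) \<and>
     g L = g (-L) + (LINT y:{-L..L}|lebesgue. e y) + measure \<nu> UNIV"

text \<open>\<open>s\<close> is itself a competitor in the minimum defining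
  \<open>f_dens\<close>.\<close>

lemma W_dens_le:
  assumes "0 < E0" "0 < \<sigma>c" "0 \<le> s"
  shows "W_dens E0 \<sigma>c (e + s) \<le> 1/2 * E0 * e\<^sup>2 + \<sigma>c * s"
proof -
  have "f_dens E0 \<sigma>c (e + s) 0 \<le> 1/2 * E0 * (e + s - s)\<^sup>2 + degr 0 * \<sigma>c * s"
    unfolding f_dens_def
  proof (rule cINF_lower)
    show "bdd_below ((\<lambda>\<eta>. 1/2 * E0 * (e + s - \<eta>)\<^sup>2 + degr 0 * \<sigma>c * \<eta>) ` {0..})"
      using assms by (intro bdd_belowI2[of _ 0]) (auto simp: degr_def)
  qed (use assms in auto)
  then show ?thesis by (simp add: W_dens_def degr_def)
qed

text \<open>The minimum is reached by letting the elastic strain follow \<open>w\<close> up to the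
  yield value \<open>\<sigma>c/E0\<close> and putting the excess into opening.\<close>

lemma W_dens_split:
  assumes "0 < E0" "0 < \<sigma>c"
  shows "W_dens E0 \<sigma>c w = 1/2 * E0 * (min w (\<sigma>c/E0))\<^sup>2 + \<sigma>c * max 0 (w - \<sigma>c/E0)"
  unfolding W_dens_def f_dens_eq[OF assms] degr_def using assms
  by (auto simp: min_def max_def field_simps power2_eq_square)

lemma LINT_pos_neg:
  fixes e :: "real \<Rightarrow> real"
  assumes e: "e absolutely_integrable_on {-L..L}" and A: "A \<in> sets lebesgue" "A \<subseteq> {-L..L}"
  shows "(LINT x:A|lebesgue. e x) = (LINT x:A|lebesgue. max 0 (e x)) - (LINT x:A|lebesgue. max 0 (- e x))"
    "(\<lambda>x. max 0 (e x)) absolutely_integrable_on {-L..L}" "(\<lambda>x. max 0 (- e x)) absolutely_integrable_on {-L..L}"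
proof -
  show i: "(\<lambda>x. max 0 (e x)) absolutely_integrable_on {-L..L}" "(\<lambda>x. max 0 (- e x)) absolutely_integrable_on {-L..L}"
  proof -
    have "(\<lambda>x. max 0 (h x)) absolutely_integrable_on {-L..L}" if h: "h absolutely_integrable_on {-L..L}" for h :: "real \<Rightarrow> real"
    proof -
      have "integrable lebesgue (\<lambda>x. max 0 (indicator {-L..L} x *\<^sub>R h x))"
        using h unfolding set_integrable_def by (intro integrable_max) auto
      moreover have "(\<lambda>x. max 0 (indicator {-L..L} x *\<^sub>R h x)) = (\<lambda>x. indicator {-L..L} x *\<^sub>R max 0 (h x))"
        by (auto simp: indicator_def)
      ultimately show ?thesis by (simp add: set_integrable_def)
    qed
    moreover have "(\<lambda>x. - e x) absolutely_integrable_on {-L..L}"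
      using e by (simp add: set_integrable_def)
    ultimately show "(\<lambda>x. max 0 (e x)) absolutely_integrable_on {-L..L}" "(\<lambda>x. max 0 (- e x)) absolutely_integrable_on {-L..L}"
      using e by blast+
  qed
  have "(LINT x:A|lebesgue. max 0 (e x) - max 0 (- e x)) = (LINT x:A|lebesgue. max 0 (e x)) - (LINT x:A|lebesgue. max 0 (- e x))"
    using i A by (intro set_integral_diff set_integrable_subset[OF _ A]) auto
  moreover have "max 0 (e x) - max 0 (- e x) = e x" for x by auto
  ultimately show "(LINT x:A|lebesgue. e x) = (LINT x:A|lebesgue. max 0 (e x)) - (LINT x:A|lebesgue. max 0 (- e x))" by simp
qed

text \<open>Splitting the strain into positive and negative parts makes \<open>u\<close> a
  difference of distribution functions. Only the restriction of \<nu> to the open interval enters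
  the derivative; the endpoint atoms show up as gaps between the traces and the prescribed boundary
  values.\<close>

lemma represents_BV:
  assumes r: "represents L g u e \<nu>" and u: "u \<in> L1 L" and L: "0 < L"
  shows "u \<in> BV L"
    "\<And>B. B \<in> sets borel \<Longrightarrow> B \<subseteq> {-L<..<L} \<Longrightarrow> sm_val (distr_deriv L u) B = (LINT x:B|lebesgue. e x) + measure \<nu> B"
    "\<And>x. x \<in> {-L<..<L} \<Longrightarrow> jump u x = measure \<nu> {x}"
    "jump_set L u = {x \<in> {-L<..<L}. measure \<nu> {x} \<noteq> 0}"
    "right_lim u (-L) = g (-L) + measure \<nu> {-L}"
    "left_lim u L = g L - measure \<nu> {L}"
proof -
  have e: "e absolutely_integrable_on {-L..L}" and \<nu>: "finite_borel_measure \<nu>" and supp: "emeasure \<nu> (- {-L..L}) = 0"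
    and ae: "AE x in lebesgue. x \<in> {-L..L} \<longrightarrow> u x = g (-L) + (LINT y:{-L..x}|lebesgue. e y) + cdf \<nu> x"
    and tot: "g L = g (-L) + (LINT y:{-L..L}|lebesgue. e y) + measure \<nu> UNIV"
    using r by (auto simp: represents_def)
  interpret \<nu>: finite_borel_measure \<nu> by fact
  note [simp] = \<nu>.M_is_borel
  have AEs: "AE x in \<nu>. x \<in> {-L..L}"
    using supp by (subst AE_iff_measurable[where N="- {-L..L}"]) (auto simp: \<nu>.borel_UNIV)
  define \<nu>0 where "\<nu>0 = restr \<nu> {-L<..<L}"
  have n0: "finite_borel_measure \<nu>0" unfolding \<nu>0_def by (rule finite_borel_restr[OF \<nu>]) simp
  have m0: "measure \<nu>0 B = measure \<nu> ({-L<..<L} \<inter> B)" if "B \<in> sets borel" for B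
    unfolding \<nu>0_def using that by (intro measure_restr) auto
  have s0: "emeasure \<nu>0 (- {-L<..<L}) = 0" unfolding \<nu>0_def by (subst emeasure_restr) auto
  let ?p = "\<lambda>x. max 0 (e x)" and ?q = "\<lambda>x. max 0 (- e x)"
  have pi: "?p absolutely_integrable_on {-L..L}" "?q absolutely_integrable_on {-L..L}"
    using LINT_pos_neg(2,3)[OF e, of "{}"] by auto
  note P = ac_measure_props[OF pi(1), simplified] and N = ac_measure_props[OF pi(2), simplified]
  define \<mu> where "\<mu> = measure_add \<nu>0 (ac_measure L ?p)"
  have m: "finite_borel_measure \<mu>" unfolding \<mu>_def by (rule finite_borel_measure_add[OF n0 P(1)])
  have mm: "measure \<mu> B = measure \<nu> ({-L<..<L} \<inter> B) + measure (ac_measure L ?p) B" if "B \<in> sets borel" for B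
    unfolding \<mu>_def using measure_measure_add[OF n0 P(1) that] m0[OF that] by simp
  have ms: "emeasure \<mu> (- {-L<..<L}) = 0"
    unfolding \<mu>_def using s0 P(3) finite_borel_measure.M_is_borel[OF n0] finite_borel_measure.M_is_borel[OF P(1)]
    by (subst emeasure_measure_add) auto
  have cdf\<nu>: "cdf \<nu> x = measure \<nu> {-L} + measure \<nu> ({-L<..<L} \<inter> {..x})" if "-L \<le> x" "x < L" for x
  proof -
    have "cdf \<nu> x = measure \<nu> ({-L} \<union> ({-L<..<L} \<inter> {..x}))"
      unfolding cdf_def using AEs that L by (intro measure_eq_AE) auto
    then show ?thesis by (subst (asm) \<nu>.finite_measure_Union) auto
  qed
  \<comment> \<open>The right trace at -L: the prescribed value plus the opening concentrated at
    that endpoint.\<close>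
  define c where "c = g (-L) + measure \<nu> {-L}"
  have "AE x in lebesgue. x \<noteq> L" using AE_lborel_singleton[of L] by (rule AE_completion)
  with ae have ae': "AE x in lebesgue. x \<in> {-L..L} \<longrightarrow> u x = c + cdf \<mu> x - cdf (ac_measure L ?q) x"
  proof eventually_elim
    case (elim x)
    show ?case
    proof
      assume x: "x \<in> {-L..L}"
      then have "u x = g (-L) + ((LINT y:{-L..x}|lebesgue. ?p y) - (LINT y:{-L..x}|lebesgue. ?q y)) + cdf \<nu> x"
        using elim LINT_pos_neg(1)[OF e, of "{-L..x}"] by auto
      then show "u x = c + cdf \<mu> x - cdf (ac_measure L ?q) x"
        using x elim P(5)[of x] N(5)[of x] cdf\<nu>[of x] mm[of "{..x}"] by (auto simp: c_def cdf_def)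
    qed
  qed
  note bv = BV_cdfI[OF u L m N(1) ms N(3) ae']
  show "u \<in> BV L" by (rule bv(1))
  show "sm_val (distr_deriv L u) B = (LINT x:B|lebesgue. e x) + measure \<nu> B" if "B \<in> sets borel" "B \<subseteq> {-L<..<L}" for B
  proof -
    have "B \<inter> {-L<..<L} = B" "{-L<..<L} \<inter> B = B" "B \<subseteq> {-L..L}" using that by auto
    then show ?thesis
      using bv(2)[OF that(1)] mm[OF that(1)] P(2)[OF that(1)] N(2)[OF that(1)] LINT_pos_neg(1)[OF e, of B] that by simp
  qed
  have at: "measure \<mu> {x} = measure \<nu> {x}" if "x \<in> {-L<..<L}" for x
    using mm[of "{x}"] P(4)[of x] that by (auto simp: Int_insert_right)
  show "jump u x = measure \<nu> {x}" if "x \<in> {-L<..<L}" for x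
    using jump_cdf[OF m N(1) ae' that] at[OF that] N(4)[of x] by simp
  show "jump_set L u = {x \<in> {-L<..<L}. measure \<nu> {x} \<noteq> 0}"
    unfolding jump_set_cdf[OF m N(1) ae'] using at N(4) by auto
  show "right_lim u (-L) = g (-L) + measure \<nu> {-L}"
    using right_lim_cdf[OF m N(1) ae', of "-L"] L cdf_open_support(1)[OF m ms L, of "-L"]
      cdf_open_support(1)[OF N(1) N(3) L, of "-L"] by (simp add: c_def)
  have "measure \<nu> UNIV = measure \<nu> ({-L} \<union> {-L<..<L} \<union> {L})"
    using AEs L by (intro measure_eq_AE) auto
  also have "\<dots> = measure \<nu> {-L} + measure \<nu> {-L<..<L} + measure \<nu> {L}"
    using L by (subst \<nu>.finite_measure_Union; (subst \<nu>.finite_measure_Union)?) auto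
  finally have "measure \<nu> UNIV = measure \<nu> {-L} + measure \<nu> {-L<..<L} + measure \<nu> {L}" .
  moreover have "measure (ac_measure L ?p) UNIV - measure (ac_measure L ?q) UNIV = (LINT y:{-L..L}|lebesgue. e y)"
    using P(5)[of L] N(5)[of L] L LINT_pos_neg(1)[OF e, of "{-L..L}"]
      cdf_open_support(2)[OF P(1) P(3) L, of L] cdf_open_support(2)[OF N(1) N(3) L, of L] by simp
  moreover have "left_lim u L = c + measure \<mu> UNIV - measure (ac_measure L ?q) UNIV"
    using left_lim_cdf[OF m N(1) ae', of L] L cdf_open_support(3)[OF m ms L, of L]
      cdf_open_support(3)[OF N(1) N(3) L, of L] by simp
  moreover have "measure \<mu> UNIV = measure \<nu> {-L<..<L} + measure (ac_measure L ?p) UNIV"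
    using mm[of UNIV] by simp
  ultimately show "left_lim u L = g L - measure \<nu> {L}"
    using tot by (simp add: c_def)
qed

text \<open>On the set where \<open>P\<close> vanishes the domination removes \<open>N\<close>, and
  off that set \<open>N\<close> vanishes anyway. A signed measure known to be nonnegative loses its
  negative half in this way.\<close>

lemma singular_dominated_null:
  assumes "mutually_singular P N" "finite_borel_measure P" "finite_borel_measure N" "D \<in> sets borel"
    and le: "\<And>B. B \<in> sets borel \<Longrightarrow> B \<subseteq> D \<Longrightarrow> measure N B \<le> measure P B"
  shows "emeasure N D = 0"
proof -
  interpret P: finite_borel_measure P by fact
  interpret N: finite_borel_measure N by fact
  note [simp] = P.M_is_borel N.M_is_borel
  obtain A where A: "A \<in> sets borel" "emeasure P A = 0" "emeasure N (-A) = 0"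
    using assms(1) by (auto simp: mutually_singular_def)
  have "emeasure P (D \<inter> A) \<le> emeasure P A" using A by (intro emeasure_mono) auto
  then have "measure P (D \<inter> A) = 0" using A by (simp add: measure_def)
  then have "measure N (D \<inter> A) = 0"
    using le[of "D \<inter> A"] A assms(4) measure_nonneg[of N "D \<inter> A"] by auto
  then have "emeasure N (D \<inter> A) = 0" by (simp add: N.emeasure_eq_measure)
  moreover have "emeasure N (D - A) \<le> emeasure N (-A)" using A by (intro emeasure_mono) auto
  moreover have "emeasure N D = emeasure N (D \<inter> A) + emeasure N (D - A)"
    using A assms(4) by (subst plus_emeasure) (auto intro!: arg_cong[where f="emeasure N"])
  ultimately show ?thesis using A by simp
qed

lemma LINT_null_set:
  fixes h :: "real \<Rightarrow> real"
  assumes "B \<in> sets borel" "emeasure lborel B = 0"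
  shows "(LINT x:B|lebesgue. h x) = 0"
proof -
  have "AE x in lborel. x \<notin> B" using assms by (intro AE_not_in) auto
  then have "AE x in lebesgue. x \<notin> B" by (rule AE_completion)
  then have "AE x in lebesgue. indicat_real B x *\<^sub>R h x = 0" by eventually_elim simp
  then show ?thesis unfolding set_lebesgue_integral_def by (rule integral_eq_zero_AE)
qed

text \<open>The carriers of the two halves of the Cantor part are united, so that a single Lebesgue
  null set has to be removed.\<close>

lemma BV_decomp_carrier:
  assumes "is_BV_decomp L u (w, c1, c2)"
  obtains Z where "Z \<in> sets borel" "emeasure lborel Z = 0" "emeasure c1 (-Z) = 0" "emeasure c2 (-Z) = 0"
proof -
  have ms: "mutually_singular c1 lborel" "mutually_singular c2 lborel"
    and s: "sets c1 = sets borel" "sets c2 = sets borel"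
    using assms by (auto simp: is_BV_decomp_def signed_measure_on_def)
  obtain A B where A: "A \<in> sets borel" "emeasure c1 A = 0" "emeasure lborel (-A) = 0"
    and B: "B \<in> sets borel" "emeasure c2 B = 0" "emeasure lborel (-B) = 0"
    using ms by (auto simp: mutually_singular_def)
  have "emeasure c1 (- (-A \<union> -B)) \<le> emeasure c1 A" using A B s by (intro emeasure_mono) auto
  moreover have "emeasure c2 (- (-A \<union> -B)) \<le> emeasure c2 B" using A B s by (intro emeasure_mono) auto
  moreover have "emeasure lborel (-A \<union> -B) = 0"
    using A B by (intro emeasure_Un_null_set[THEN trans]) auto
  ultimately show ?thesis using that[of "-A \<union> -B"] A B by auto
qed

text \<open>Off a null set carrying the Cantor part and the jumps, comparing the given representation with
  the decomposition of \<open>Du\<close> shows that the excess \<open>u' - e\<close> is the density of the part of \<open>\<nu>\<close> there.\<close>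

lemma F_lim_ext_le:
  assumes r: "represents L g u e \<nu>" and u: "u \<in> L1 L"
    and pos: "0 < L" "0 < E0" "0 < \<sigma>c" "0 < Gc"
    and bd: "AE x in lebesgue. x \<in> {-L..L} \<longrightarrow> \<bar>u x\<bar> \<le> bdry_norm L g"
    and d0: "AE x in lebesgue. x \<in> {-L..L} \<longrightarrow> d x = 0"
  shows "F_lim_ext L E0 \<sigma>c Gc g (u, d)
     \<le> (\<integral>\<^sup>+x\<in>{-L..L}. ennreal (1/2 * E0 * (e x)\<^sup>2) \<partial>lebesgue) + cohesive \<sigma>c Gc \<nu>"
proof -
  have e: "e absolutely_integrable_on {-L..L}" and \<nu>: "finite_borel_measure \<nu>" and supp: "emeasure \<nu> (- {-L..L}) = 0"
    using r by (auto simp: represents_def)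
  interpret \<nu>: finite_borel_measure \<nu> by fact
  note [simp] = \<nu>.M_is_borel
  note BV = represents_BV[OF r u pos(1)]
  define J where "J = {x \<in> {-L<..<L}. measure \<nu> {x} \<noteq> 0}"
  note split = cohesive_split[OF \<nu> supp pos(1,3,4), folded J_def]
  have Jb: "J \<in> sets borel" by (rule sets.countable[OF _ split(2)]) simp
  have JI: "J \<subseteq> {-L<..<L}" by (auto simp: J_def)
  have J: "jump_set L u = J" using BV(4) by (simp add: J_def)
  define p where "p = (SOME p. is_BV_decomp L u p)"
  have "is_BV_decomp L u p" unfolding p_def using BV_decomposition[OF BV(1) pos(1)] by (rule someI_ex)
  then obtain w c1 c2 where peq: "p = (w, c1, c2)" and dec: "is_BV_decomp L u (w, c1, c2)"
    by (cases p) auto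
  have ac: "ac_density L u = w" and ct: "cantor_part L u = (c1, c2)"
    using peq by (simp_all add: ac_density_def cantor_part_def p_def[symmetric])
  have w: "w absolutely_integrable_on {-L..L}" and sm: "signed_measure_on {-L<..<L} (c1, c2)"
    and atoms: "\<And>x. emeasure c1 {x} = 0 \<and> emeasure c2 {x} = 0"
    and D: "\<And>B. B \<in> sets borel \<Longrightarrow> B \<subseteq> {-L<..<L} \<Longrightarrow> sm_val (distr_deriv L u) B =
          (LINT x:B|lebesgue. w x) + (\<Sum>\<^sub>\<infinity>x\<in>jump_set L u \<inter> B. jump u x) + sm_val (c1, c2) B"
    using dec by (auto simp: is_BV_decomp_def)
  have c: "finite_borel_measure c1" "finite_borel_measure c2" and sing: "mutually_singular c1 c2"
    and cs: "emeasure c1 (- {-L<..<L}) = 0" "emeasure c2 (- {-L<..<L}) = 0"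
    using sm by (auto simp: signed_measure_on_def intro: finite_borel_measureI)
  interpret c1: finite_borel_measure c1 by fact
  interpret c2: finite_borel_measure c2 by fact
  note [simp] = c1.M_is_borel c2.M_is_borel
  obtain Z where Z: "Z \<in> sets borel" "emeasure lborel Z = 0" "emeasure c1 (-Z) = 0" "emeasure c2 (-Z) = 0"
    using BV_decomp_carrier[OF dec] by blast
  have J0: "emeasure lborel J = 0" using countable_imp_null_set_lborel[OF split(2)] by auto
  have cJ: "emeasure c1 J = 0" "emeasure c2 J = 0"
    using emeasure_countable_singleton[OF _ split(2), of c1] emeasure_countable_singleton[OF _ split(2), of c2] atoms
    by simp_all
  \<comment> \<open>Two expressions for the derivative of \<open>u\<close> on B: the representation
    on the left, the BV decomposition on the right.\<close>
  have K: "(LINT x:B|lebesgue. e x) + measure \<nu> B = (LINT x:B|lebesgue. w x) + measure \<nu> (J \<inter> B) + (measure c1 B - measure c2 B)"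
    if B: "B \<in> sets borel" "B \<subseteq> {-L<..<L}" for B
  proof -
    have "((\<lambda>x. measure \<nu> {x}) has_sum measure \<nu> (J \<inter> B)) (J \<inter> B)"
      by (rule has_sum_atoms[OF \<nu>]) (use split(2) in auto)
    then have "(\<Sum>\<^sub>\<infinity>x\<in>J \<inter> B. measure \<nu> {x}) = measure \<nu> (J \<inter> B)" by (rule infsumI)
    moreover have "(\<Sum>\<^sub>\<infinity>x\<in>J \<inter> B. jump u x) = (\<Sum>\<^sub>\<infinity>x\<in>J \<inter> B. measure \<nu> {x})"
      using B BV(3) by (intro infsum_cong) auto
    ultimately show ?thesis using D[OF B] BV(2)[OF B] by (simp add: J sm_val_def)
  qed
  define I where "I = {-L<..<L}"
  have Ib: "I \<in> sets borel" by (simp add: I_def)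
  have ZJ: "I \<inter> Z - J \<in> sets borel" using Ib Z(1) Jb by (intro sets.Diff sets.Int)
  have AEc: "AE x in c1. x \<in> I \<inter> Z - J" "AE x in c2. x \<in> I \<inter> Z - J"
  proof -
    have 1: "AE x in c. x \<notin> A" if "emeasure c A = 0" "A \<in> sets borel" "sets c = sets borel" for c :: "real measure" and A
      using that by (intro AE_not_in) auto
    have "AE x in c1. x \<notin> -Z" "AE x in c1. x \<notin> -I" "AE x in c1. x \<notin> J"
      by (rule 1; use Z Jb cs cJ in \<open>simp add: I_def\<close>)+
    then show "AE x in c1. x \<in> I \<inter> Z - J" by eventually_elim auto
    have "AE x in c2. x \<notin> -Z" "AE x in c2. x \<notin> -I" "AE x in c2. x \<notin> J"
      by (rule 1; use Z Jb cs cJ in \<open>simp add: I_def\<close>)+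
    then show "AE x in c2. x \<in> I \<inter> Z - J" by eventually_elim auto
  qed
  \<comment> \<open>The Cantor part is carried by \<open>I \<inter> Z - J\<close>, a Lebesgue null
    set without jumps, so on it both density terms and the jump term drop out of
    \<open>K\<close>.\<close>
  have cval: "measure c1 B - measure c2 B = measure \<nu> (B \<inter> (I \<inter> Z - J))" if B: "B \<in> sets borel" for B
  proof -
    let ?B = "B \<inter> (I \<inter> Z - J)"
    have Bb: "?B \<in> sets borel" using B ZJ by (rule sets.Int)
    have "emeasure lborel ?B \<le> emeasure lborel Z" using Z by (intro emeasure_mono) auto
    then have B0: "emeasure lborel ?B = 0" using Z by simp
    have "J \<inter> ?B = {}" by auto
    then have "measure \<nu> ?B = measure c1 ?B - measure c2 ?B"
      using K[OF Bb] LINT_null_set[OF Bb B0, of e] LINT_null_set[OF Bb B0, of w] by (auto simp: I_def)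
    moreover have "measure c1 ?B = measure c1 B" "measure c2 ?B = measure c2 B"
      using AEc B Bb by (auto intro!: measure_eq_AE)
    ultimately show ?thesis by simp
  qed
  have nn: "sm_nonneg (cantor_part L u)"
    by (auto simp: sm_nonneg_def sm_val_def ct cval)
  \<comment> \<open>By \<open>cval\<close> the difference \<open>c1 - c2\<close> is nonnegative;
    mutual singularity turns this into the absence of \<open>c2\<close>, and the total variation
    becomes a mass of \<nu>.\<close>
  have "emeasure c2 UNIV = 0"
  proof (rule singular_dominated_null[OF sing c])
    show "measure c2 B \<le> measure c1 B" if "B \<in> sets borel" for B
      using cval[OF that] measure_nonneg[of \<nu> "B \<inter> (I \<inter> Z - J)"] by linarith
  qed simp
  then have c20: "emeasure c2 I = 0" "measure c2 I = 0"
    using emeasure_mono[of I UNIV c2] by (auto simp: measure_def)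
  have tv: "sm_total_variation (cantor_part L u) {-L<..<L} = emeasure \<nu> (I \<inter> Z - J)"
    using cval[OF Ib] c20 by (simp add: sm_total_variation_def ct I_def[symmetric] c1.emeasure_eq_measure
      \<nu>.emeasure_eq_measure Int_assoc[symmetric] Int_Diff)
  define Y where "Y = I - (Z \<union> J)"
  have Yb: "Y \<in> sets borel" unfolding Y_def using Ib Z(1) Jb by auto
  have YI: "Y \<subseteq> {-L<..<L}" by (auto simp: Y_def I_def)
  have KY: "(LINT x:B|lebesgue. w x - e x) = measure \<nu> B" if B: "B \<in> sets borel" "B \<subseteq> Y" for B
  proof -
    have 0: "B \<inter> (I \<inter> Z - J) = {}" "J \<inter> B = {}" "B \<subseteq> {-L..L}" using B by (auto simp: Y_def I_def)
    have "(LINT x:B|lebesgue. e x) + measure \<nu> B = (LINT x:B|lebesgue. w x)"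
      using K[of B] B YI cval[OF B(1)] 0 by auto
    moreover have "(LINT x:B|lebesgue. w x - e x) = (LINT x:B|lebesgue. w x) - (LINT x:B|lebesgue. e x)"
      using B 0 by (intro set_integral_diff set_integrable_subset[OF w] set_integrable_subset[OF e]) auto
    ultimately show ?thesis by simp
  qed
  define k where "k x = indicator {-L..L} x * (w x - e x)" for x
  have wei: "(\<lambda>x. w x - e x) absolutely_integrable_on {-L..L}" using w e by (rule set_integral_diff(1))
  have km: "k \<in> borel_measurable lebesgue"
    unfolding k_def[abs_def] using absint_borel_measurable[OF wei] .
  \<comment> \<open>A Borel version of the excess \<open>w - e\<close> is chosen so that the set
    where it is negative is Borel and \<open>KY\<close> applies to it.\<close>
  obtain k' where k': "k' \<in> borel_measurable lborel" "AE x in lborel. k x = k' x"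
    using completion_ex_borel_measurable_real[OF km] by blast
  have [measurable]: "k' \<in> borel_measurable borel" using k'(1) by simp
  have AEkk: "AE x in lebesgue. k x = k' x" using k'(2) by (rule AE_completion)
  \<comment> \<open>On this set the integral of the excess is at most 0 and also equal to \<nu>(B),
    which is at least 0; hence the excess vanishes almost everywhere on it.\<close>
  define B where "B = {x \<in> Y. k' x < 0}"
  have Bb: "B \<in> sets borel" unfolding B_def using Yb by measurable
  have wB: "(\<lambda>x. w x - e x) absolutely_integrable_on B"
    by (rule set_integrable_subset[OF wei]) (use Bb YI in \<open>auto simp: B_def\<close>)
  have nonneg: "AE x in lebesgue. x \<in> Y \<longrightarrow> 0 \<le> w x - e x"
  proof -
    have ii: "integrable lebesgue (\<lambda>x. - (indicator B x * (w x - e x)))"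
      using wB by (simp add: set_integrable_def)
    have posAE: "AE x in lebesgue. 0 \<le> - (indicator B x * (w x - e x))"
      using AEkk by eventually_elim (use YI in \<open>auto simp: B_def indicator_def k_def split: if_splits\<close>)
    have "integral\<^sup>L lebesgue (\<lambda>x. - (indicator B x * (w x - e x))) = - measure \<nu> B"
      using KY[of B] Bb by (simp add: set_lebesgue_integral_def B_def)
    moreover have "0 \<le> integral\<^sup>L lebesgue (\<lambda>x. - (indicator B x * (w x - e x)))"
      using posAE by (rule integral_nonneg_AE)
    ultimately have "integral\<^sup>L lebesgue (\<lambda>x. - (indicator B x * (w x - e x))) = 0"
      using measure_nonneg[of \<nu> B] by linarith
    then have "AE x in lebesgue. - (indicator B x * (w x - e x)) = 0"
      using integral_nonneg_eq_0_iff_AE[OF ii posAE] by simp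
    with AEkk show ?thesis
      by eventually_elim (use YI in \<open>auto simp: B_def indicator_def k_def split: if_splits\<close>)
  qed
  have "{-L, L} \<union> (Z \<union> J) \<in> null_sets lborel"
    using Z(1,2) Jb J0 finite_imp_null_set_lborel[of "{-L, L}"] by (intro null_sets.Un) auto
  then have "AE x in lborel. x \<notin> {-L, L} \<union> (Z \<union> J)" by (rule AE_not_in)
  then have "AE x in lebesgue. x \<notin> {-L, L} \<union> (Z \<union> J)" by (rule AE_completion)
  then have AEY: "AE x in lebesgue. x \<in> {-L..L} \<longleftrightarrow> x \<in> Y"
    by eventually_elim (auto simp: Y_def I_def)
  have W: "(\<integral>\<^sup>+x\<in>{-L..L}. ennreal (W_dens E0 \<sigma>c (w x)) \<partial>lebesgue)
      \<le> (\<integral>\<^sup>+x\<in>{-L..L}. ennreal (1/2 * E0 * (e x)\<^sup>2) \<partial>lebesgue) + ennreal \<sigma>c * emeasure \<nu> Y"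
  proof -
    have em: "(\<lambda>x. indicator {-L..L} x * e x) \<in> borel_measurable lebesgue" by (rule absint_borel_measurable[OF e])
    have eq1: "(\<lambda>x. ennreal (1/2 * E0 * (e x)\<^sup>2) * indicator {-L..L} x) = (\<lambda>x. ennreal (1/2 * E0 * (indicator {-L..L} x * e x)\<^sup>2))"
      by (auto simp: indicator_def)
    have m1: "(\<lambda>x. ennreal (1/2 * E0 * (e x)\<^sup>2) * indicator {-L..L} x) \<in> borel_measurable lebesgue"
      unfolding eq1 using em by measurable
    have Ym: "(\<lambda>x. w x - e x) absolutely_integrable_on Y"
      by (rule set_integrable_subset[OF wei]) (use Yb YI in auto)
    then have Ymi: "integrable lebesgue (\<lambda>x. indicator Y x * (w x - e x))" by (simp add: set_integrable_def)
    then have m2: "(\<lambda>x. indicator Y x * (w x - e x)) \<in> borel_measurable lebesgue" by (rule borel_measurable_integrable)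
    have "(\<integral>\<^sup>+x\<in>{-L..L}. ennreal (W_dens E0 \<sigma>c (w x)) \<partial>lebesgue) \<le>
      (\<integral>\<^sup>+x. ennreal (1/2 * E0 * (e x)\<^sup>2) * indicator {-L..L} x + ennreal \<sigma>c * ennreal (indicator Y x * (w x - e x)) \<partial>lebesgue)"
    proof (rule nn_integral_mono_AE)
      show "AE x in lebesgue. ennreal (W_dens E0 \<sigma>c (w x)) * indicator {-L..L} x \<le>
         ennreal (1/2 * E0 * (e x)\<^sup>2) * indicator {-L..L} x + ennreal \<sigma>c * ennreal (indicator Y x * (w x - e x))"
        using nonneg AEY
      proof eventually_elim
        case (elim x)
        show ?case
        proof (cases "x \<in> Y")
          case True
          then have "W_dens E0 \<sigma>c (w x) \<le> 1/2 * E0 * (e x)\<^sup>2 + \<sigma>c * (w x - e x)"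
            using W_dens_le[OF pos(2,3), of "w x - e x" "e x"] elim by simp
          then show ?thesis using True elim pos
            by (auto simp: ennreal_mult[symmetric] ennreal_plus[symmetric] simp del: ennreal_plus intro!: ennreal_leI)
        qed (use elim in auto)
      qed
    qed
    also have "\<dots> = (\<integral>\<^sup>+x\<in>{-L..L}. ennreal (1/2 * E0 * (e x)\<^sup>2) \<partial>lebesgue)
        + ennreal \<sigma>c * (\<integral>\<^sup>+x. ennreal (indicator Y x * (w x - e x)) \<partial>lebesgue)"
      using m1 m2 by (subst nn_integral_add) (auto simp: nn_integral_cmult)
    also have "(\<integral>\<^sup>+x. ennreal (indicator Y x * (w x - e x)) \<partial>lebesgue) = ennreal (LINT x|lebesgue. indicator Y x * (w x - e x))"
      using nonneg by (intro nn_integral_eq_integral[OF Ymi]) (auto simp: indicator_def elim: eventually_mono)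
    also have "\<dots> = emeasure \<nu> Y"
      using KY[OF Yb] by (simp add: set_lebesgue_integral_def \<nu>.emeasure_eq_measure)
    finally show ?thesis .
  qed
  have "emeasure \<nu> Y + emeasure \<nu> (I \<inter> Z - J) = emeasure \<nu> ({-L<..<L} - J)"
    using Yb ZJ by (subst plus_emeasure) (auto simp: Y_def I_def intro!: arg_cong[where f="emeasure \<nu>"])
  then have nuY: "ennreal \<sigma>c * emeasure \<nu> Y + ennreal \<sigma>c * emeasure \<nu> (I \<inter> Z - J) = ennreal \<sigma>c * emeasure \<nu> ({-L<..<L} - J)"
    by (simp add: distrib_left[symmetric])
  have "F_lim L E0 \<sigma>c Gc g u = (\<integral>\<^sup>+x\<in>{-L..L}. ennreal (W_dens E0 \<sigma>c (w x)) \<partial>lebesgue)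
     + ennreal \<sigma>c * emeasure \<nu> (I \<inter> Z - J) + (\<Sum>\<^sub>\<infinity>x\<in>J. phi \<sigma>c Gc (measure \<nu> {x}))
     + phi \<sigma>c Gc (measure \<nu> {L}) + phi \<sigma>c Gc (measure \<nu> {-L})"
  proof -
    have "(\<Sum>\<^sub>\<infinity>x\<in>J. phi \<sigma>c Gc (jump u x)) = (\<Sum>\<^sub>\<infinity>x\<in>J. phi \<sigma>c Gc (measure \<nu> {x}))"
      using JI BV(3) by (intro infsum_cong) auto
    then show ?thesis by (simp add: F_lim_def ac tv J BV(5,6))
  qed
  also have "\<dots> \<le> ((\<integral>\<^sup>+x\<in>{-L..L}. ennreal (1/2 * E0 * (e x)\<^sup>2) \<partial>lebesgue) + ennreal \<sigma>c * emeasure \<nu> Y)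
     + ennreal \<sigma>c * emeasure \<nu> (I \<inter> Z - J) + (\<Sum>\<^sub>\<infinity>x\<in>J. phi \<sigma>c Gc (measure \<nu> {x}))
     + phi \<sigma>c Gc (measure \<nu> {L}) + phi \<sigma>c Gc (measure \<nu> {-L})"
    by (intro add_right_mono W)
  also have "\<dots> = (\<integral>\<^sup>+x\<in>{-L..L}. ennreal (1/2 * E0 * (e x)\<^sup>2) \<partial>lebesgue) + cohesive \<sigma>c Gc \<nu>"
    unfolding split(1) nuY[symmetric] by (simp add: add.assoc)
  finally have "F_lim L E0 \<sigma>c Gc g u \<le> (\<integral>\<^sup>+x\<in>{-L..L}. ennreal (1/2 * E0 * (e x)\<^sup>2) \<partial>lebesgue) + cohesive \<sigma>c Gc \<nu>" .
  moreover have "\<forall>x\<in>jump_set L u. 0 < jump u x"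
    using BV(3) by (auto simp: J J_def less_le)
  ultimately show ?thesis using BV(1) bd d0 nn by (simp add: F_lim_ext_def)
qed

text \<open>The bound opposite to \<open>F_lim_ext_le\<close>, for one particular splitting. The
  Cantor part, the jumps and two boundary atoms make up \<nu>, while the absolutely continuous
  opening is kept apart as the function \<open>n\<close>.\<close>

lemma F_lim_ext_finite_repr:
  assumes u: "u \<in> L1 L" and pos: "0 < L" "0 < E0" "0 < \<sigma>c" "0 < Gc"
    and fin: "F_lim_ext L E0 \<sigma>c Gc g (u, d) \<noteq> \<infinity>"
  obtains e n \<nu> where "e absolutely_integrable_on {-L..L}" "n absolutely_integrable_on {-L..L}" "\<And>x. 0 \<le> n x"
    "represents L g u (\<lambda>x. e x + n x) \<nu>"
    "AE x in lebesgue. x \<in> {-L..L} \<longrightarrow> \<bar>u x\<bar> \<le> bdry_norm L g"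
    "AE x in lebesgue. x \<in> {-L..L} \<longrightarrow> d x = 0"
    "(\<integral>\<^sup>+x\<in>{-L..L}. ennreal (1/2 * E0 * (e x)\<^sup>2) \<partial>lebesgue) + ennreal \<sigma>c * (\<integral>\<^sup>+x\<in>{-L..L}. ennreal (n x) \<partial>lebesgue)
      + cohesive \<sigma>c Gc \<nu> \<le> F_lim_ext L E0 \<sigma>c Gc g (u, d)"
proof -
  have bv: "u \<in> BV L" and bd: "AE x in lebesgue. x \<in> {-L..L} \<longrightarrow> \<bar>u x\<bar> \<le> bdry_norm L g"
    and jpos: "\<forall>x\<in>jump_set L u. 0 < jump u x" and nn: "sm_nonneg (cantor_part L u)"
    and d0: "AE x in lebesgue. x \<in> {-L..L} \<longrightarrow> d x = 0"
    and F: "F_lim_ext L E0 \<sigma>c Gc g (u, d) = F_lim L E0 \<sigma>c Gc g u"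
    using fin by (auto simp: F_lim_ext_def split: if_splits)
  have Ffin: "F_lim L E0 \<sigma>c Gc g u \<noteq> \<infinity>" using fin F by simp
  define p where "p = (SOME p. is_BV_decomp L u p)"
  have "is_BV_decomp L u p" unfolding p_def using BV_decomposition[OF bv pos(1)] by (rule someI_ex)
  then obtain w c1 c2 where peq: "p = (w, c1, c2)" and dec: "is_BV_decomp L u (w, c1, c2)"
    by (cases p) auto
  have ac: "ac_density L u = w" and ct: "cantor_part L u = (c1, c2)"
    using peq by (simp_all add: ac_density_def cantor_part_def p_def[symmetric])
  have ex: "\<exists>\<mu>. is_distr_deriv L u \<mu>" using bv by (auto simp: BV_def)
  have "is_distr_deriv L u (distr_deriv L u)"
    unfolding distr_deriv_def using ex by (rule someI_ex)
  then obtain P N where eq: "distr_deriv L u = (P, N)" and dd: "is_distr_deriv L u (P, N)"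
    by (cases "distr_deriv L u") auto
  obtain c where ae: "AE x in lebesgue. x \<in> {-L..L} \<longrightarrow> u x = c + cdf P x - cdf N x"
    using distr_deriv_cdfD[OF u pos(1) dd] by blast
  have P: "finite_borel_measure P" and N: "finite_borel_measure N"
    and sP: "emeasure P (- {-L<..<L}) = 0" and sN: "emeasure N (- {-L<..<L}) = 0"
    and sing: "mutually_singular P N"
    using dd by (auto simp: is_distr_deriv_def signed_measure_on_def intro: finite_borel_measureI)
  interpret P: finite_borel_measure P by fact
  interpret N: finite_borel_measure N by fact
  note [simp] = P.M_is_borel N.M_is_borel
  have w: "w absolutely_integrable_on {-L..L}" and sm: "signed_measure_on {-L<..<L} (c1, c2)"
    and atoms: "\<And>x. emeasure c1 {x} = 0 \<and> emeasure c2 {x} = 0"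
    and D: "\<And>B. B \<in> sets borel \<Longrightarrow> B \<subseteq> {-L<..<L} \<Longrightarrow> measure P B - measure N B =
          (LINT x:B|lebesgue. w x) + (\<Sum>\<^sub>\<infinity>x\<in>jump_set L u \<inter> B. jump u x) + (measure c1 B - measure c2 B)"
    using dec by (auto simp: is_BV_decomp_def eq sm_val_def)
  have cc: "finite_borel_measure c1" "finite_borel_measure c2"
    using sm by (auto simp: signed_measure_on_def intro: finite_borel_measureI)
  interpret c1: finite_borel_measure c1 by fact
  interpret c2: finite_borel_measure c2 by fact
  note [simp] = c1.M_is_borel c2.M_is_borel
  obtain Z where Z: "Z \<in> sets borel" "emeasure lborel Z = 0" "emeasure c1 (-Z) = 0" "emeasure c2 (-Z) = 0"
    using BV_decomp_carrier[OF dec] by blast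
  have cnn: "measure c2 B \<le> measure c1 B" if "B \<in> sets borel" for B
    using nn that by (auto simp: ct sm_nonneg_def sm_val_def)
  define J where "J = jump_set L u"
  have JPN: "J = {x \<in> {-L<..<L}. measure P {x} \<noteq> measure N {x}}"
    unfolding J_def by (rule jump_set_cdf[OF P N ae])
  have Jc: "countable J"
  proof (rule countable_subset)
    show "J \<subseteq> {x. measure P {x} \<noteq> 0} \<union> {x. measure N {x} \<noteq> 0}" by (auto simp: JPN)
    show "countable ({x. measure P {x} \<noteq> 0} \<union> {x. measure N {x} \<noteq> 0})"
      using P.countable_support N.countable_support by simp
  qed
  have Jb: "J \<in> sets borel" by (rule sets.countable[OF _ Jc]) simp
  have J0: "emeasure lborel J = 0" using countable_imp_null_set_lborel[OF Jc] by auto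
  define I where "I = {-L<..<L}"
  have Ib: "I \<in> sets borel" by (simp add: I_def)
  have JI: "J \<subseteq> I" by (auto simp: JPN I_def)
  \<comment> \<open>A Lebesgue null set carrying the Cantor part and the jumps; on the rest of the
    open interval the derivative is just \<open>w\<close> times Lebesgue measure.\<close>
  define S where "S = I \<inter> (Z \<union> J)"
  have Sb: "S \<in> sets borel" unfolding S_def using Ib Z(1) Jb by auto
  have ZJb: "I \<inter> Z - J \<in> sets borel" using Ib Z(1) Jb by (intro sets.Diff sets.Int)
  have ZJ0: "emeasure lborel (Z \<union> J) = 0"
    using Z(1,2) Jb J0 by (intro emeasure_Un_null_set[THEN trans]) auto
  have S0: "emeasure lborel B = 0" if "B \<subseteq> S" for B
  proof -
    have "emeasure lborel B \<le> emeasure lborel (Z \<union> J)" using that Z(1) Jb by (intro emeasure_mono) (auto simp: S_def)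
    then show ?thesis using ZJ0 by simp
  qed
  \<comment> \<open>On subsets of \<open>S\<close> the derivative is a nonnegative Cantor part plus
    positive jumps. Singularity of \<open>P\<close> and \<open>N\<close> then clears
    \<open>N\<close> from \<open>S\<close>.\<close>
  have NS: "emeasure N S = 0"
  proof (rule singular_dominated_null[OF sing P N Sb])
    fix B assume B: "B \<in> sets borel" "B \<subseteq> S"
    have "0 \<le> (\<Sum>\<^sub>\<infinity>x\<in>jump_set L u \<inter> B. jump u x)" using jpos by (intro infsum_nonneg) (auto simp: less_imp_le)
    then show "measure N B \<le> measure P B"
      using D[OF B(1)] cnn[OF B(1)] LINT_null_set[OF B(1) S0[OF B(2)], of w] B by (auto simp: S_def I_def)
  qed
  have NS': "measure N B = 0" if "B \<in> sets borel" "B \<subseteq> S" for B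
  proof -
    have "emeasure N B \<le> emeasure N S" using that Sb by (intro emeasure_mono) auto
    then show ?thesis using NS by (simp add: measure_def)
  qed
  have jmp: "jump u x = measure P {x}" if "x \<in> J" for x
  proof -
    have "x \<in> {-L<..<L}" "{x} \<subseteq> S" using that JI by (auto simp: S_def I_def)
    then show ?thesis using jump_cdf[OF P N ae, of x] NS'[of "{x}"] by simp
  qed
  have offS: "measure P B - measure N B = (LINT x:B|lebesgue. w x)" if B: "B \<in> sets borel" "B \<subseteq> I - S" for B
  proof -
    have "jump_set L u \<inter> B = {}" using B by (auto simp: S_def J_def[symmetric])
    moreover have "emeasure c1 B \<le> emeasure c1 (-Z)" using B Z by (intro emeasure_mono) (auto simp: S_def)
    moreover have "emeasure c2 B \<le> emeasure c2 (-Z)" using B Z by (intro emeasure_mono) (auto simp: S_def)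
    ultimately show ?thesis using D[of B] B Z(3,4) by (auto simp: I_def measure_def)
  qed
  define \<nu>0 where "\<nu>0 = restr P S"
  have n0: "finite_borel_measure \<nu>0" unfolding \<nu>0_def by (rule finite_borel_restr[OF P Sb])
  interpret n0: finite_borel_measure \<nu>0 by fact
  have e0: "emeasure \<nu>0 B = emeasure P (S \<inter> B)" "measure \<nu>0 B = measure P (S \<inter> B)" if "B \<in> sets borel" for B
    unfolding \<nu>0_def using that Sb by (auto simp: emeasure_restr measure_restr)
  have PN: "measure P B - measure N B = measure \<nu>0 B + (LINT x:B|lebesgue. w x)" if B: "B \<in> sets borel" "B \<subseteq> I" for B
  proof -
    have b: "S \<inter> B \<in> sets borel" "B - S \<in> sets borel" using B Sb by auto
    have "measure P B = measure P (S \<inter> B) + measure P (B - S)"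
      using b by (subst P.finite_measure_Union[symmetric]) (auto intro!: arg_cong[where f="measure P"])
    moreover have "measure N B = measure N (S \<inter> B) + measure N (B - S)"
      using b by (subst N.finite_measure_Union[symmetric]) (auto intro!: arg_cong[where f="measure N"])
    moreover have "measure P (B - S) - measure N (B - S) = (LINT x:B - S|lebesgue. w x)"
      using B b by (intro offS) auto
    moreover have "(LINT x:B - S|lebesgue. w x) = (LINT x:B|lebesgue. w x)"
    proof -
      have wB: "w absolutely_integrable_on C" if "C \<in> sets borel" "C \<subseteq> B" for C
        by (rule set_integrable_subset[OF w]) (use that B in \<open>auto simp: I_def\<close>)
      have "(LINT x:(B - S) \<union> (S \<inter> B)|lebesgue. w x) = (LINT x:B - S|lebesgue. w x) + (LINT x:S \<inter> B|lebesgue. w x)"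
        using b by (intro set_integral_Un wB) auto
      moreover have "(B - S) \<union> (S \<inter> B) = B" by auto
      moreover have "(LINT x:S \<inter> B|lebesgue. w x) = 0"
        using b S0[of "S \<inter> B"] by (intro LINT_null_set) auto
      ultimately show ?thesis by simp
    qed
    ultimately show ?thesis using NS'[OF b(1)] e0(2)[OF B(1)] by simp
  qed
  have AEn: "AE x in lebesgue. x \<noteq> a" for a :: real
    using AE_lborel_singleton[of a] by (rule AE_completion)
  have Iint: "(LINT y:I \<inter> {..x}|lebesgue. w y) = (LINT y:{-L..x}|lebesgue. w y)" if "-L \<le> x" "x \<le> L" for x
    unfolding set_lebesgue_integral_def
  proof (rule integral_cong_AE)
    have *: "(\<lambda>y. indicator C y *\<^sub>R w y) \<in> borel_measurable lebesgue" if "C \<in> sets lebesgue" "C \<subseteq> {-L..L}" for C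
      using set_integrable_subset[OF w that] unfolding set_integrable_def by (rule borel_measurable_integrable)
    show "(\<lambda>y. indicator (I \<inter> {..x}) y *\<^sub>R w y) \<in> borel_measurable lebesgue" using that by (intro *) (auto simp: I_def)
    show "(\<lambda>y. indicator {-L..x} y *\<^sub>R w y) \<in> borel_measurable lebesgue" using that by (intro *) auto
    show "AE y in lebesgue. indicator (I \<inter> {..x}) y *\<^sub>R w y = indicator {-L..x} y *\<^sub>R w y"
      using AEn[of "-L"] AEn[of L] by eventually_elim (use that in \<open>auto simp: indicator_def I_def\<close>)
  qed
  have cdfs: "cdf P x - cdf N x = measure \<nu>0 {..x} + (LINT y:{-L..x}|lebesgue. w y)" if "-L \<le> x" "x \<le> L" for x
  proof -
    have "cdf P x - cdf N x = measure P (I \<inter> {..x}) - measure N (I \<inter> {..x})"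
      unfolding cdf_def I_def using cdf_open_support(4)[OF P sP pos(1), of "{..x}"] cdf_open_support(4)[OF N sN pos(1), of "{..x}"]
      by (simp add: Int_commute)
    also have "\<dots> = measure \<nu>0 (I \<inter> {..x}) + (LINT y:{-L..x}|lebesgue. w y)"
      using PN[of "I \<inter> {..x}"] Iint[OF that] Ib by auto
    also have "measure \<nu>0 (I \<inter> {..x}) = measure \<nu>0 {..x}"
    proof -
      have "S \<inter> (I \<inter> {..x}) = S \<inter> {..x}" by (auto simp: S_def)
      then show ?thesis using Ib by (simp add: e0)
    qed
    finally show ?thesis .
  qed
  have rl: "right_lim u (-L) = c"
    using right_lim_cdf[OF P N ae, of "-L"] pos cdf_open_support(1)[OF P sP pos(1), of "-L"]
      cdf_open_support(1)[OF N sN pos(1), of "-L"] by simp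
  have ll: "left_lim u L = c + measure \<nu>0 UNIV + (LINT y:{-L..L}|lebesgue. w y)"
  proof -
    have "left_lim u L = c + measure P {..<L} - measure N {..<L}"
      using pos by (intro left_lim_cdf[OF P N ae]) auto
    also have "\<dots> = c + (cdf P L - cdf N L)"
      using cdf_open_support(2,3)[OF P sP pos(1), of L] cdf_open_support(2,3)[OF N sN pos(1), of L] by simp
    also have "\<dots> = c + (measure \<nu>0 {..L} + (LINT y:{-L..L}|lebesgue. w y))"
      using cdfs[of L] pos by simp
    also have "measure \<nu>0 {..L} = measure \<nu>0 UNIV"
      by (simp add: e0) (rule arg_cong[where f="measure P"], auto simp: S_def I_def)
    finally show ?thesis by simp
  qed
  \<comment> \<open>The boundary openings. \<open>phi\<close> is infinite at negative arguments, so
    finite energy makes both nonnegative and they can serve as masses of atoms.\<close>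
  define \<alpha> where "\<alpha> = c - g (-L)"
  define \<beta> where "\<beta> = g L - left_lim u L"
  have "phi \<sigma>c Gc \<alpha> \<noteq> \<infinity>" "phi \<sigma>c Gc \<beta> \<noteq> \<infinity>"
    using Ffin by (auto simp: F_lim_def rl \<alpha>_def \<beta>_def)
  then have ab: "0 \<le> \<alpha>" "0 \<le> \<beta>" by (auto simp: phi_def split: if_splits)
  obtain \<delta>a where da: "finite_borel_measure \<delta>a" "\<And>B. B \<in> sets borel \<Longrightarrow> emeasure \<delta>a B = ennreal \<alpha> * indicator B (-L)"
    using point_mass[OF ab(1)] by blast
  obtain \<delta>b where db: "finite_borel_measure \<delta>b" "\<And>B. B \<in> sets borel \<Longrightarrow> emeasure \<delta>b B = ennreal \<beta> * indicator B L"
    using point_mass[OF ab(2)] by blast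
  define \<nu> where "\<nu> = measure_add \<nu>0 (measure_add \<delta>a \<delta>b)"
  have dab: "finite_borel_measure (measure_add \<delta>a \<delta>b)" by (rule finite_borel_measure_add[OF da(1) db(1)])
  have \<nu>: "finite_borel_measure \<nu>" unfolding \<nu>_def by (rule finite_borel_measure_add[OF n0 dab])
  interpret \<nu>: finite_borel_measure \<nu> by fact
  have e\<nu>: "emeasure \<nu> B = emeasure P (S \<inter> B) + (ennreal \<alpha> * indicator B (-L) + ennreal \<beta> * indicator B L)" if B: "B \<in> sets borel" for B
    unfolding \<nu>_def using B by (simp add: emeasure_measure_add n0.M_is_borel finite_borel_measure.M_is_borel[OF da(1)]
      finite_borel_measure.M_is_borel[OF db(1)] e0 da(2) db(2))
  have m\<nu>: "measure \<nu> B = measure \<nu>0 B + (\<alpha> * indicator B (-L) + \<beta> * indicator B L)" if B: "B \<in> sets borel" for B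
  proof -
    have "measure \<delta>a B = \<alpha> * indicator B (-L)" "measure \<delta>b B = \<beta> * indicator B L"
      using da(2)[OF B] db(2)[OF B] ab by (auto simp: measure_def indicator_def)
    then show ?thesis unfolding \<nu>_def by (simp add: measure_measure_add[OF n0 dab B] measure_measure_add[OF da(1) db(1) B])
  qed
  have \<nu>s: "emeasure \<nu> (- {-L..L}) = 0"
  proof -
    have "S \<inter> - {-L..L} = {}" by (auto simp: S_def I_def)
    then show ?thesis using pos by (subst e\<nu>) auto
  qed
  \<comment> \<open>Pointwise minimisers in the inf-convolution behind \<open>W\<close>, so the bulk
    energy splits with equality.\<close>
  define e where "e x = min (w x) (\<sigma>c / E0)" for x
  define n where "n x = max 0 (w x - \<sigma>c / E0)" for x
  have wen: "e x + n x = w x" for x by (auto simp: e_def n_def)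
  have wc: "(\<lambda>x. w x - \<sigma>c / E0) absolutely_integrable_on {-L..L}"
    by (intro set_integral_diff(1) w absolutely_integrable_on_const) simp
  have ni: "n absolutely_integrable_on {-L..L}"
    using LINT_pos_neg(2)[OF wc, of "{}"] by (simp add: n_def[abs_def])
  have "(\<lambda>x. w x - n x) absolutely_integrable_on {-L..L}" using w ni by (rule set_integral_diff(1))
  moreover have "(\<lambda>x. w x - n x) = e" using wen by (auto simp: fun_eq_iff algebra_simps)
  ultimately have ei: "e absolutely_integrable_on {-L..L}" by simp
  have rep: "represents L g u (\<lambda>x. e x + n x) \<nu>"
    unfolding represents_def wen
  proof (intro conjI w \<nu> \<nu>s)
    have mU: "measure \<nu> UNIV = measure \<nu>0 UNIV + (\<alpha> + \<beta>)" by (subst m\<nu>) auto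
    show "g L = g (-L) + (LINT y:{-L..L}|lebesgue. w y) + measure \<nu> UNIV"
      using mU ll by (simp add: \<alpha>_def \<beta>_def)
    show "AE x in lebesgue. x \<in> {-L..L} \<longrightarrow> u x = g (-L) + (LINT y:{-L..x}|lebesgue. w y) + cdf \<nu> x"
      using ae AEn[of L]
    proof eventually_elim
      case (elim x)
      show ?case
      proof
        assume x: "x \<in> {-L..L}"
        then have "cdf \<nu> x = measure \<nu>0 {..x} + \<alpha>" unfolding cdf_def using elim by (subst m\<nu>) auto
        then show "u x = g (-L) + (LINT y:{-L..x}|lebesgue. w y) + cdf \<nu> x"
          using elim x cdfs[of x] by (simp add: \<alpha>_def)
      qed
    qed
  qed
  define JJ where "JJ = {x \<in> {-L<..<L}. measure \<nu> {x} \<noteq> 0}"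
  note split = cohesive_split[OF \<nu> \<nu>s pos(1,3,4), folded JJ_def]
  have at: "measure \<nu> {x} = measure \<nu>0 {x}" if "x \<in> {-L<..<L}" for x
    using that by (subst m\<nu>) auto
  have cP: "measure P {x} = 0" if "x \<in> I \<inter> Z - J" for x
  proof -
    have "{x} \<subseteq> S" "x \<in> {-L<..<L}" using that by (auto simp: S_def I_def)
    then show ?thesis using NS'[of "{x}"] that by (auto simp: JPN I_def)
  qed
  have JJ: "JJ = J"
  proof
    show "JJ \<subseteq> J"
    proof
      fix x assume x: "x \<in> JJ"
      then have xI: "x \<in> {-L<..<L}" and "measure P (S \<inter> {x}) \<noteq> 0" using at by (auto simp: JJ_def e0)
      then have "x \<in> S" "measure P {x} \<noteq> 0" by (auto simp: Int_insert_right split: if_splits)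
      then show "x \<in> J" using cP[of x] by (auto simp: S_def)
    qed
    show "J \<subseteq> JJ"
    proof
      fix x assume x: "x \<in> J"
      then have xI: "x \<in> {-L<..<L}" and xS: "x \<in> S" using JI by (auto simp: I_def S_def)
      have "measure P {x} > 0" using jpos jmp[OF x] x by (auto simp: J_def)
      then show "x \<in> JJ" using at[OF xI] xI xS by (simp add: JJ_def e0 Int_insert_right)
    qed
  qed
  have atJ: "measure \<nu> {x} = jump u x" if "x \<in> J" for x
  proof -
    have "x \<in> {-L<..<L}" "x \<in> S" using that JI by (auto simp: S_def I_def)
    then show ?thesis using at jmp[OF that] by (simp add: e0 Int_insert_right)
  qed
  have "emeasure \<nu> ({-L<..<L} - J) = emeasure P (I \<inter> Z - J)"
  proof -
    have "S \<inter> ({-L<..<L} - J) = I \<inter> Z - J" by (auto simp: S_def I_def)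
    then show ?thesis using Jb by (subst e\<nu>) auto
  qed
  also have "\<dots> \<le> sm_total_variation (cantor_part L u) {-L<..<L}"
  proof -
    let ?B = "I \<inter> Z - J"
    have BS: "?B \<subseteq> S" by (auto simp: S_def)
    have "jump_set L u \<inter> ?B = {}" by (auto simp: J_def)
    then have "measure P ?B = measure c1 ?B - measure c2 ?B"
      using D[OF ZJb] NS'[OF ZJb BS] LINT_null_set[OF ZJb S0[OF BS], of w] by (auto simp: I_def)
    then have "measure P ?B \<le> measure c1 ?B" using measure_nonneg[of c2 ?B] by linarith
    also have "\<dots> \<le> measure c1 I" using Ib by (intro c1.finite_measure_mono) auto
    finally have "emeasure P ?B \<le> emeasure c1 I" by (simp add: P.emeasure_eq_measure c1.emeasure_eq_measure)
    also have "\<dots> \<le> emeasure c1 I + emeasure c2 I" by simp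
    finally show ?thesis by (simp add: sm_total_variation_def ct I_def)
  qed
  finally have cant: "ennreal \<sigma>c * emeasure \<nu> ({-L<..<L} - J) \<le> ennreal \<sigma>c * sm_total_variation (cantor_part L u) {-L<..<L}"
    by (rule mult_left_mono) simp
  have S_bd: "- L \<notin> S" "L \<notin> S" by (auto simp: S_def I_def)
  have bdm: "measure \<nu> {L} = \<beta>" "measure \<nu> {-L} = \<alpha>"
    using S_bd pos by (auto simp: m\<nu> e0 Int_insert_right)
  have "cohesive \<sigma>c Gc \<nu> \<le> ennreal \<sigma>c * sm_total_variation (cantor_part L u) {-L<..<L}
     + (\<Sum>\<^sub>\<infinity>x\<in>J. phi \<sigma>c Gc (jump u x)) + phi \<sigma>c Gc \<beta> + phi \<sigma>c Gc \<alpha>"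
  proof -
    have "(\<Sum>\<^sub>\<infinity>x\<in>J. phi \<sigma>c Gc (measure \<nu> {x})) = (\<Sum>\<^sub>\<infinity>x\<in>J. phi \<sigma>c Gc (jump u x))"
      by (intro infsum_cong) (simp add: atJ)
    then show ?thesis unfolding split(1) JJ bdm using cant by (simp add: add_right_mono)
  qed
  moreover have "(\<integral>\<^sup>+x\<in>{-L..L}. ennreal (W_dens E0 \<sigma>c (w x)) \<partial>lebesgue) =
      (\<integral>\<^sup>+x\<in>{-L..L}. ennreal (1/2 * E0 * (e x)\<^sup>2) \<partial>lebesgue) + ennreal \<sigma>c * (\<integral>\<^sup>+x\<in>{-L..L}. ennreal (n x) \<partial>lebesgue)"
  proof -
    have em: "(\<lambda>x. indicator {-L..L} x * e x) \<in> borel_measurable lebesgue" by (rule absint_borel_measurable[OF ei])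
    have nm: "(\<lambda>x. indicator {-L..L} x * n x) \<in> borel_measurable lebesgue" by (rule absint_borel_measurable[OF ni])
    have eq1: "(\<lambda>x. ennreal (1/2 * E0 * (e x)\<^sup>2) * indicator {-L..L} x) = (\<lambda>x. ennreal (1/2 * E0 * (indicator {-L..L} x * e x)\<^sup>2))"
      by (auto simp: indicator_def)
    have m1: "(\<lambda>x. ennreal (1/2 * E0 * (e x)\<^sup>2) * indicator {-L..L} x) \<in> borel_measurable lebesgue"
      unfolding eq1 using em by measurable
    have eq2: "(\<lambda>x. ennreal (n x) * indicator {-L..L} x) = (\<lambda>x. ennreal (indicator {-L..L} x * n x))"
      by (auto simp: indicator_def)
    have m2: "(\<lambda>x. ennreal (n x) * indicator {-L..L} x) \<in> borel_measurable lebesgue"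
      unfolding eq2 using nm by measurable
    have "(\<integral>\<^sup>+x\<in>{-L..L}. ennreal (W_dens E0 \<sigma>c (w x)) \<partial>lebesgue) =
      (\<integral>\<^sup>+x. ennreal (1/2 * E0 * (e x)\<^sup>2) * indicator {-L..L} x + ennreal \<sigma>c * (ennreal (n x) * indicator {-L..L} x) \<partial>lebesgue)"
    proof (rule nn_integral_cong)
      fix x
      have "0 \<le> 1/2 * E0 * (e x)\<^sup>2" "0 \<le> \<sigma>c * n x" using pos by (auto simp: n_def)
      then have "ennreal (W_dens E0 \<sigma>c (w x)) = ennreal (1/2 * E0 * (e x)\<^sup>2) + ennreal \<sigma>c * ennreal (n x)"
        using pos unfolding W_dens_split[OF pos(2,3)] e_def[symmetric] n_def[symmetric]
        by (simp add: ennreal_mult' ennreal_plus)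
      then show "ennreal (W_dens E0 \<sigma>c (w x)) * indicator {-L..L} x =
         ennreal (1/2 * E0 * (e x)\<^sup>2) * indicator {-L..L} x + ennreal \<sigma>c * (ennreal (n x) * indicator {-L..L} x)"
        by (auto simp: indicator_def)
    qed
    then show ?thesis using m1 m2 by (simp add: nn_integral_add nn_integral_cmult)
  qed
  ultimately have "(\<integral>\<^sup>+x\<in>{-L..L}. ennreal (1/2 * E0 * (e x)\<^sup>2) \<partial>lebesgue) + ennreal \<sigma>c * (\<integral>\<^sup>+x\<in>{-L..L}. ennreal (n x) \<partial>lebesgue)
      + cohesive \<sigma>c Gc \<nu> \<le> F_lim_ext L E0 \<sigma>c Gc g (u, d)"
    unfolding F F_lim_def ac rl \<alpha>_def[symmetric] \<beta>_def[symmetric] J_def[symmetric]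
    by (simp add: add.assoc add_left_mono)
  then show ?thesis using that[OF ei ni _ rep bd d0] by (simp add: n_def)
qed

section \<open>Uniform meshes and the discrete energy\<close>

definition node :: "real \<Rightarrow> real \<Rightarrow> nat \<Rightarrow> real" where
  "node L h i = - L + real i * h"

abbreviation cell :: "real \<Rightarrow> real \<Rightarrow> nat \<Rightarrow> real set" where
  "cell L h i \<equiv> {node L h i..node L h (Suc i)}"

lemma node_Suc: "node L h (Suc i) = node L h i + h"
  by (simp add: node_def algebra_simps)

lemma node_0: "node L h 0 = - L"
  by (simp add: node_def)

lemma node_less: "0 < h \<Longrightarrow> node L h i < node L h j \<longleftrightarrow> i < j"
  by (simp add: node_def)

lemma node_le: "0 < h \<Longrightarrow> node L h i \<le> node L h j \<longleftrightarrow> i \<le> j"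
  by (simp add: node_def)

text \<open>Elements have disjoint interiors and equal length. Walking from the left, the element
  that covers the points just after the end of the previous one has to start exactly at that
  end.\<close>

lemma mesh_structure:
  assumes mesh: "is_mesh L h T" and h: "0 < h" and L: "0 < L"
  obtains N where "0 < N" "real N * h = 2 * L" "T = cell L h ` {..<N}"
proof -
  have div: "T division_of {-L..L}" and m: "\<And>K. K \<in> T \<Longrightarrow> measure lebesgue K = h"
    using mesh by (auto simp: is_mesh_def)
  have fin: "finite T" and un: "\<Union>T = {-L..L}"
    and dis: "\<And>K K'. K \<in> T \<Longrightarrow> K' \<in> T \<Longrightarrow> K \<noteq> K' \<Longrightarrow> interior K \<inter> interior K' = {}"
    using div by (auto simp: division_of_def)
  have form: "\<exists>a. K = {a..a+h} \<and> -L \<le> a \<and> a + h \<le> L" if KT: "K \<in> T" for K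
  proof -
    obtain a b where K: "K = cbox a b" using division_ofD(4)[OF div KT] by blast
    have "K \<noteq> {}" using division_ofD(3)[OF div KT] by simp
    then have ab: "a \<le> b" using K by auto
    then have "b - a = h" using m[OF KT] K by simp
    moreover have "K \<subseteq> {-L..L}" using un KT by auto
    ultimately show ?thesis using K ab by (intro exI[of _ a]) (auto simp: algebra_simps)
  qed
  have dis': "a = b" if "{a..a+h} \<in> T" "{b..b+h} \<in> T" "a < b + h" "b < a + h" for a b
  proof (rule ccontr)
    assume "a \<noteq> b"
    then have "{a..a+h} \<noteq> {b..b+h}" using h by (simp add: Icc_eq_Icc)
    then have "{a<..<a+h} \<inter> {b<..<b+h} = {}" using dis[OF that(1,2)] by simp
    moreover have "(max a b + min (a+h) (b+h)) / 2 \<in> {a<..<a+h} \<inter> {b<..<b+h}" using that h by auto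
    ultimately show False by blast
  qed
  have step: "{x..x+h} \<in> T" if x: "-L \<le> x" "x < L" and prev: "x = -L \<or> {x-h..x} \<in> T" for x
  proof -
    \<comment> \<open>The left endpoints of the elements starting beyond \<open>x\<close>, with L as
      a default. They are finitely many, so a point \<open>y\<close> fits between \<open>x\<close>
      and all of them, and the element containing \<open>y\<close> starts at or before
      \<open>x\<close>.\<close>
    define A where "A = insert L {a. {a..a+h} \<in> T \<and> x < a}"
    have "finite {a. {a..a+h} \<in> T \<and> x < a}"
      by (rule finite_subset[OF _ finite_imageI[OF fin, of Inf]]) (use h in \<open>force simp: image_iff\<close>)
    then have A: "finite A" "A \<noteq> {}" by (auto simp: A_def)
    define y where "y = (x + Min A) / 2"
    have "x < Min A" using A x by (auto simp: A_def)
    then have y: "x < y" "y < Min A" by (auto simp: y_def)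
    then have "y < L" using A by (auto simp: A_def)
    then have "y \<in> \<Union>T" using un x y by auto
    then obtain a where a: "{a..a+h} \<in> T" "a \<le> y" "y \<le> a + h" "-L \<le> a"
      using form by fastforce
    have "a \<le> x"
    proof (rule ccontr)
      assume "\<not> a \<le> x"
      then have "a \<in> A" using a by (auto simp: A_def)
      then have "Min A \<le> a" using A by auto
      then show False using a y by simp
    qed
    \<comment> \<open>An element starting before \<open>x\<close> would overlap the previous
      element, or stick out of the interval when x = -L.\<close>
    moreover have "\<not> a < x"
    proof
      assume "a < x"
      then have "{x-h..x-h+h} \<in> T" using prev a by auto
      from dis'[OF a(1) this] show False using \<open>a < x\<close> a y h by auto
    qed
    ultimately show ?thesis using a by simp
  qed
  have nodes: "node L h i < L \<Longrightarrow> cell L h i \<in> T" for i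
  proof (induction i)
    case 0
    show ?case using step[of "-L"] L by (simp add: node_0 node_Suc)
  next
    case (Suc i)
    then have "node L h i < L" using h by (simp add: node_Suc)
    then have "cell L h i \<in> T" by (rule Suc.IH)
    moreover have "-L \<le> node L h (Suc i)" using h by (simp add: node_def)
    ultimately show ?case using step[of "node L h (Suc i)"] Suc.prems by (simp add: node_Suc)
  qed
  obtain n where n: "real n * h > 2 * L" using h reals_Archimedean3 by blast
  define N where "N = (LEAST i. L \<le> node L h i)"
  have ex: "L \<le> node L h n" using n by (simp add: node_def)
  have N: "L \<le> node L h N" unfolding N_def using ex by (rule LeastI)
  have lt: "node L h i < L" if "i < N" for i using not_less_Least[of i] that by (force simp: N_def not_le)
  have N0: "0 < N" using N L by (cases N) (auto simp: node_0)
  obtain M where NM: "N = Suc M" using N0 by (cases N) auto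
  then have "cell L h M \<in> T" using nodes lt by simp
  moreover have "node L h N \<in> cell L h M" using NM h by (auto simp: node_le)
  ultimately have "node L h N \<in> {-L..L}" using un by blast
  then have "node L h N \<le> L" by simp
  then have NL: "node L h N = L" using N by simp
  have "T \<subseteq> cell L h ` {..<N}"
  proof
    fix K assume K: "K \<in> T"
    then obtain a where a: "K = {a..a+h}" "-L \<le> a" "a + h \<le> L" using form by blast
    \<comment> \<open>The index of the cell containing the midpoint of \<open>K\<close>; overlapping
      interiors force the two to coincide.\<close>
    define i where "i = nat \<lfloor>(a + h/2 + L) / h\<rfloor>"
    have q: "0 \<le> (a + h/2 + L) / h" using a h by simp
    have "real i \<le> (a + h/2 + L) / h" "(a + h/2 + L) / h < real i + 1"
      using q unfolding i_def by linarith+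
    then have i: "node L h i \<le> a + h/2" "a + h/2 < node L h (Suc i)"
      using h by (auto simp: node_def field_simps)
    then have "node L h i < L" using a h by linarith
    then have iT: "cell L h i \<in> T" and "i < N" using nodes NL node_less[OF h, of L i N] by auto
    have "a = node L h i"
      by (rule dis') (use iT K a i h in \<open>auto simp: node_Suc\<close>)
    then have "K = cell L h i" using a by (simp add: node_Suc)
    then show "K \<in> cell L h ` {..<N}" using \<open>i < N\<close> by blast
  qed
  then have "T = cell L h ` {..<N}" using nodes lt by auto
  then show ?thesis using that[OF N0, of] NL by (simp add: node_def)
qed

section \<open>Piecewise constant and piecewise affine functions on the uniform mesh\<close>

lemma sum_single:
  assumes "finite A" "i \<in> A" "\<And>j. j \<in> A \<Longrightarrow> j \<noteq> i \<Longrightarrow> g j = 0"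
  shows "sum g A = g i"
  using assms by (subst sum.remove[of A i]) (auto intro!: sum.neutral)

lemma cell_unique:
  assumes "0 < h" "x \<in> interior (cell L h i)" "x \<in> interior (cell L h j)"
  shows "i = j"
proof -
  have "node L h j < node L h (Suc i)" "node L h i < node L h (Suc j)" using assms by auto
  then have "j < Suc i" "i < Suc j" using node_less[OF assms(1)] by blast+
  then show ?thesis by simp
qed

lemma cell_cover:
  assumes h: "0 < h" and N: "real N * h = 2 * L" and x: "x \<in> {-L..L}"
    and nn: "x \<notin> node L h ` {..N}"
  obtains i where "i < N" "x \<in> interior (cell L h i)"
proof -
  define i where "i = nat \<lfloor>(x + L) / h\<rfloor>"
  have q: "0 \<le> (x + L) / h" using x h by simp
  have "real i \<le> (x + L) / h" "(x + L) / h < real i + 1"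
    using q unfolding i_def by linarith+
  then have i: "node L h i \<le> x" "x < node L h (Suc i)"
    using h by (auto simp: node_def field_simps)
  have "node L h N = L" using N by (simp add: node_def)
  then have xN: "x < node L h N" using x nn by (metis atLeastAtMost_iff atMost_iff image_eqI le_less order_refl)
  then have iN: "i < N" using i node_less[OF h, of L i N] by linarith
  then have "x \<noteq> node L h i" using nn by auto
  then show ?thesis using i iN that[of i] by auto
qed

lemma P0_cell: "\<eta> \<in> P0 (cell L h ` {..<N}) \<Longrightarrow> i < N \<Longrightarrow> \<exists>c. \<forall>x\<in>interior (cell L h i). \<eta> x = c"
  by (auto simp: P0_def)

text \<open>\<open>P0\<close> leaves the values at the nodes free, so integrability is transferred
  from the step function \<open>z\<close>, which agrees off a finite set.\<close>

lemma P0_integrable: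
  assumes h: "0 < h" and N: "real N * h = 2 * L" and \<eta>: "\<eta> \<in> P0 (cell L h ` {..<N})"
  shows "\<eta> absolutely_integrable_on {-L..L}"
proof -
  obtain c where c: "\<And>i. i < N \<Longrightarrow> \<forall>x\<in>interior (cell L h i). \<eta> x = c i"
    using P0_cell[OF \<eta>] by metis
  define z where "z x = (\<Sum>i<N. c i * indicator (interior (cell L h i)) x)" for x
  have zi: "z absolutely_integrable_on {-L..L}"
  proof (rule bounded_borel_absint)
    show "z \<in> borel_measurable borel" unfolding z_def interior_atLeastAtMost_real by measurable
    show "\<bar>z x\<bar> \<le> (\<Sum>i<N. \<bar>c i\<bar>)" for x
      unfolding z_def by (rule order_trans[OF sum_abs]) (auto intro!: sum_mono simp: indicator_def)
  qed
  show ?thesis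
  proof (rule absolutely_integrable_spike[OF zi])
    show "negligible (node L h ` {..N})" by (intro negligible_finite) auto
    fix x assume x: "x \<in> {-L..L} - node L h ` {..N}"
    then obtain i where i: "i < N" "x \<in> interior (cell L h i)" using cell_cover[OF h N] by blast
    have "z x = c i * indicator (interior (cell L h i)) x"
      unfolding z_def
    proof (rule sum_single)
      fix j assume "j \<in> {..<N}" "j \<noteq> i"
      then have "x \<notin> interior (cell L h j)" using cell_unique[OF h i(2)] by blast
      then show "c j * indicator (interior (cell L h j)) x = 0" by (auto simp: indicator_def)
    qed (use i in auto)
    then have "z x = c i" using i(2) by (auto simp: indicator_def)
    then show "\<eta> x = z x" using i c by auto
  qed
qed

lemma P0_compose2:
  assumes "\<eta> \<in> P0 T" "\<zeta> \<in> P0 T"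
  shows "(\<lambda>x. f (\<eta> x) (\<zeta> x)) \<in> P0 T"
  unfolding P0_def
proof (intro CollectI ballI)
  fix K assume "K \<in> T"
  then obtain c c' where "\<forall>x\<in>interior K. \<eta> x = c" "\<forall>x\<in>interior K. \<zeta> x = c'"
    using assms by (fastforce simp: P0_def)
  then show "\<exists>c. \<forall>x\<in>interior K. f (\<eta> x) (\<zeta> x) = c" by (intro exI[of _ "f c c'"]) auto
qed

text \<open>Confined to interiors: at a node the slopes of adjacent elements may differ and
  \<open>deriv\<close> has no controlled value there.\<close>

lemma P1_deriv:
  assumes v: "v \<in> P1 T" and K: "K \<in> T"
  shows "\<exists>p q. (\<forall>x\<in>K. v x = p + q * x) \<and>
    (\<forall>x\<in>interior K. (v has_real_derivative q) (at x) \<and> deriv v x = q)"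
proof -
  obtain p q where pq: "\<And>x. x \<in> K \<Longrightarrow> v x = p + q * x" using v K by (auto simp: P1_def)
  have d: "(v has_real_derivative q) (at x)" if "x \<in> interior K" for x
  proof (rule has_field_derivative_transform_within_open[where S="interior K" and f="\<lambda>x. p + q * x"])
    show "((\<lambda>x. p + q * x) has_real_derivative q) (at x)" by (auto intro!: derivative_eq_intros)
    show "p + q * y = v y" if "y \<in> interior K" for y using pq[of y] that interior_subset[of K] by auto
  qed (use that in auto)
  then show ?thesis using pq by (intro exI[of _ p] exI[of _ q]) (auto intro: DERIV_imp_deriv)
qed

lemma P1_deriv_P0:
  assumes "v \<in> P1 T"
  shows "deriv v \<in> P0 T"
  unfolding P0_def
proof (intro CollectI ballI)
  fix K assume "K \<in> T"
  from P1_deriv[OF assms this] show "\<exists>c. \<forall>x\<in>interior K. deriv v x = c"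
    by (elim exE conjE) (rule exI, auto)
qed

lemma elem_mean_cell:
  assumes h: "0 < h" and i: "i < N" and x: "x \<in> interior (cell L h i)"
  shows "elem_mean (cell L h ` {..<N}) d x = (LINT y:cell L h i|lebesgue. d y) / h"
proof -
  have inj: "inj_on (cell L h) {..<N}"
    using node_less[OF h] h by (auto simp: inj_on_def Icc_eq_Icc node_def)
  have "elem_mean (cell L h ` {..<N}) d x
      = (\<Sum>j<N. indicator (interior (cell L h j)) x * ((LINT y:cell L h j|lebesgue. d y) / measure lebesgue (cell L h j)))"
    unfolding elem_mean_def by (subst sum.reindex[OF inj]) simp
  also have "\<dots> = indicator (interior (cell L h i)) x * ((LINT y:cell L h i|lebesgue. d y) / measure lebesgue (cell L h i))"
  proof (rule sum_single)
    fix j assume "j \<in> {..<N}" "j \<noteq> i"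
    then have "x \<notin> interior (cell L h j)" using cell_unique[OF h x] by blast
    then show "indicator (interior (cell L h j)) x * ((LINT y:cell L h j|lebesgue. d y) / measure lebesgue (cell L h j)) = 0"
      by (auto simp: indicator_def)
  qed (use i in auto)
  also have "\<dots> = (LINT y:cell L h i|lebesgue. d y) / h" using x h by (simp add: node_Suc)
  finally show ?thesis .
qed

lemma elem_mean_P1:
  assumes h: "0 < h" and d: "d \<in> P1 (cell L h ` {..<N})" and i: "i < N" and x: "x \<in> interior (cell L h i)"
  shows "elem_mean (cell L h ` {..<N}) d x = (d (node L h i) + d (node L h (Suc i))) / 2"
proof -
  have "cell L h i \<in> cell L h ` {..<N}" using i by auto
  from P1_deriv[OF d this] obtain p q where pq: "\<forall>y\<in>cell L h i. d y = p + q * y"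
    by (elim exE conjE) (rule that)
  let ?a = "node L h i" and ?b = "node L h (Suc i)"
  have ab: "?a \<le> ?b" using h by (simp add: node_le)
  have "(LINT y:cell L h i|lebesgue. d y) = (LINT y:cell L h i|lebesgue. p + q * y)"
    using pq by (intro set_lebesgue_integral_cong) auto
  also have "\<dots> = (p * ?b + q * ?b\<^sup>2 / 2) - (p * ?a + q * ?a\<^sup>2 / 2)"
    by (rule LINT_deriv[OF _ _ ab]) (auto intro!: derivative_eq_intros continuous_intros)
  also have "\<dots> = h * ((d ?a + d ?b) / 2)"
  proof -
    have b: "?b = ?a + h" by (rule node_Suc)
    have "d ?a = p + q * ?a" "d ?b = p + q * ?b" using pq ab by auto
    then show ?thesis unfolding b by (simp add: power2_eq_square algebra_simps)
  qed
  finally show ?thesis using elem_mean_cell[OF h i x, of d] h by simp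
qed

lemma elem_mean_P0:
  assumes h: "0 < h"
  shows "elem_mean (cell L h ` {..<N}) d \<in> P0 (cell L h ` {..<N})"
  unfolding P0_def using elem_mean_cell[OF h] by (auto intro!: exI)

text \<open>The quantity minimised in \<open>F_disc\<close>, for a fixed opening and as a real
  number. Gauge integrals are convenient because they add up over adjacent subintervals.\<close>

definition disc_energy where
  "disc_energy L E0 \<sigma>c Gc \<epsilon> T u d \<eta> = integral {-L..L} (\<lambda>x. 1/2 * E0 * (deriv u x - \<eta> x)\<^sup>2)
     + integral {-L..L} (\<lambda>x. degr (elem_mean T d x) * \<sigma>c * \<eta> x)
     + Gc / 2 * integral {-L..L} (\<lambda>x. 1 / \<epsilon> * (d x)\<^sup>2 + \<epsilon> * (deriv d x)\<^sup>2)"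

lemma nn_integral_integral_on:
  fixes f :: "real \<Rightarrow> real"
  assumes "f absolutely_integrable_on {-L..L}" "\<And>x. x \<in> {-L..L} \<Longrightarrow> 0 \<le> f x"
  shows "(\<integral>\<^sup>+x\<in>{-L..L}. ennreal (f x) \<partial>lebesgue) = ennreal (integral {-L..L} f)"
    "0 \<le> integral {-L..L} f"
proof -
  have "(\<integral>\<^sup>+x\<in>{-L..L}. ennreal (f x) \<partial>lebesgue) = (\<integral>\<^sup>+x. ennreal (indicator {-L..L} x *\<^sub>R f x) \<partial>lebesgue)"
    by (intro nn_integral_cong) (auto simp: indicator_def)
  also have "\<dots> = ennreal (LINT x:{-L..L}|lebesgue. f x)"
    unfolding set_lebesgue_integral_def using assms
    by (intro nn_integral_eq_integral) (auto simp: set_integrable_def indicator_def)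
  also have "(LINT x:{-L..L}|lebesgue. f x) = integral {-L..L} f"
    by (rule set_lebesgue_integral_eq_integral(2)[OF assms(1)])
  finally show "(\<integral>\<^sup>+x\<in>{-L..L}. ennreal (f x) \<partial>lebesgue) = ennreal (integral {-L..L} f)" .
  show "0 \<le> integral {-L..L} f"
    using assms by (intro integral_nonneg set_lebesgue_integral_eq_integral(1)) auto
qed

lemma P1_continuous:
  assumes h: "0 < h" and N: "real N * h = 2 * L" and L: "0 < L" and v: "v \<in> P1 (cell L h ` {..<N})"
  shows "continuous_on {-L..L} v"
proof -
  have "{-L..L} \<subseteq> \<Union> (cell L h ` {..<N})"
  proof
    fix x assume x: "x \<in> {-L..L}"
    show "x \<in> \<Union> (cell L h ` {..<N})"
    proof (cases "x \<in> node L h ` {..N}")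
      case True
      then obtain i where i: "i \<le> N" "x = node L h i" by auto
      show ?thesis
      proof (cases "i < N")
        case True then show ?thesis using i h by (auto simp: node_le)
      next
        case False
        then have "i = N" "0 < N" using i N L by (auto intro: Nat.gr0I)
        then have "x \<in> cell L h (N - 1)" "N - 1 < N" using i h by (auto simp: node_le)
        then show ?thesis by blast
      qed
    next
      case False
      then show ?thesis using cell_cover[OF h N x] interior_subset by blast
    qed
  qed
  then show ?thesis using v by (auto simp: P1_def intro: continuous_on_subset)
qed

lemma disc_energy_integrable:
  assumes h: "0 < h" and N: "real N * h = 2 * L" and L: "0 < L"
    and u: "u \<in> P1 (cell L h ` {..<N})" and d: "d \<in> P1 (cell L h ` {..<N})"
    and \<eta>: "\<eta> \<in> P0 (cell L h ` {..<N})"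
  shows "(\<lambda>x. deriv u x - \<eta> x) absolutely_integrable_on {-L..L}"
    "(\<lambda>x. (deriv u x - \<eta> x)\<^sup>2) absolutely_integrable_on {-L..L}"
    "(\<lambda>x. degr (elem_mean (cell L h ` {..<N}) d x) * \<sigma>c * \<eta> x) absolutely_integrable_on {-L..L}"
    "(\<lambda>x. 1 / \<epsilon> * (d x)\<^sup>2 + \<epsilon> * (deriv d x)\<^sup>2) absolutely_integrable_on {-L..L}"
    "(\<lambda>x. (d x)\<^sup>2) absolutely_integrable_on {-L..L}" "(\<lambda>x. (deriv d x)\<^sup>2) absolutely_integrable_on {-L..L}"
proof -
  note PI = P0_integrable[OF h N]
  show "(\<lambda>x. deriv u x - \<eta> x) absolutely_integrable_on {-L..L}"
    by (rule PI, rule P0_compose2[OF P1_deriv_P0[OF u] \<eta>])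
  show "(\<lambda>x. (deriv u x - \<eta> x)\<^sup>2) absolutely_integrable_on {-L..L}"
    by (rule PI, rule P0_compose2[OF P1_deriv_P0[OF u] \<eta>])
  show "(\<lambda>x. degr (elem_mean (cell L h ` {..<N}) d x) * \<sigma>c * \<eta> x) absolutely_integrable_on {-L..L}"
    by (rule PI, rule P0_compose2[OF elem_mean_P0[OF h] \<eta>])
  show 1: "(\<lambda>x. (d x)\<^sup>2) absolutely_integrable_on {-L..L}"
    by (intro absolutely_integrable_continuous_real continuous_intros P1_continuous[OF h N L d])
  show 2: "(\<lambda>x. (deriv d x)\<^sup>2) absolutely_integrable_on {-L..L}"
    by (rule PI, rule P0_compose2[OF P1_deriv_P0[OF d] P1_deriv_P0[OF d], of "\<lambda>x _. x\<^sup>2"])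
  show "(\<lambda>x. 1 / \<epsilon> * (d x)\<^sup>2 + \<epsilon> * (deriv d x)\<^sup>2) absolutely_integrable_on {-L..L}"
    using 1 2 by (intro set_integral_add(1)) auto
qed

lemma disc_energy_eq:
  assumes h: "0 < h" and N: "real N * h = 2 * L" and L: "0 < L"
    and u: "u \<in> P1 (cell L h ` {..<N})" and d: "d \<in> P1 (cell L h ` {..<N})"
    and \<eta>: "\<eta> \<in> P0 (cell L h ` {..<N})" and \<eta>0: "\<And>x. x \<in> {-L..L} \<Longrightarrow> 0 \<le> \<eta> x"
    and pos: "0 < E0" "0 < \<sigma>c" "0 < Gc" "0 < \<epsilon>"
  shows "(\<integral>\<^sup>+x\<in>{-L..L}. ennreal (1/2 * E0 * \<bar>deriv u x - \<eta> x\<bar>\<^sup>2) \<partial>lebesgue)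
      + (\<integral>\<^sup>+x\<in>{-L..L}. ennreal (degr (elem_mean (cell L h ` {..<N}) d x) * \<sigma>c * \<eta> x) \<partial>lebesgue)
      + ennreal (Gc / 2) * (\<integral>\<^sup>+x\<in>{-L..L}. ennreal (1 / \<epsilon> * (d x)\<^sup>2 + \<epsilon> * \<bar>deriv d x\<bar>\<^sup>2) \<partial>lebesgue)
    = ennreal (disc_energy L E0 \<sigma>c Gc \<epsilon> (cell L h ` {..<N}) u d \<eta>)"
proof -
  note DI = disc_energy_integrable[OF h N L u d \<eta>]
  have i1: "(\<lambda>x. 1/2 * E0 * (deriv u x - \<eta> x)\<^sup>2) absolutely_integrable_on {-L..L}"
    using DI(2) by simp
  let ?T = "cell L h ` {..<N}"
  define A where "A = integral {-L..L} (\<lambda>x. 1/2 * E0 * (deriv u x - \<eta> x)\<^sup>2)"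
  define B where "B = integral {-L..L} (\<lambda>x. degr (elem_mean ?T d x) * \<sigma>c * \<eta> x)"
  define C where "C = integral {-L..L} (\<lambda>x. 1 / \<epsilon> * (d x)\<^sup>2 + \<epsilon> * (deriv d x)\<^sup>2)"
  have A: "(\<integral>\<^sup>+x\<in>{-L..L}. ennreal (1/2 * E0 * (deriv u x - \<eta> x)\<^sup>2) \<partial>lebesgue) = ennreal A" "0 \<le> A"
    unfolding A_def using pos by (intro nn_integral_integral_on[OF i1]; simp)+
  have B: "(\<integral>\<^sup>+x\<in>{-L..L}. ennreal (degr (elem_mean ?T d x) * \<sigma>c * \<eta> x) \<partial>lebesgue) = ennreal B" "0 \<le> B"
    unfolding B_def using pos \<eta>0 by (intro nn_integral_integral_on[OF DI(3)]; simp add: degr_def)+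
  have C: "(\<integral>\<^sup>+x\<in>{-L..L}. ennreal (1 / \<epsilon> * (d x)\<^sup>2 + \<epsilon> * (deriv d x)\<^sup>2) \<partial>lebesgue) = ennreal C" "0 \<le> C"
    unfolding C_def using pos by (intro nn_integral_integral_on[OF DI(4)]; simp)+
  have "ennreal A + ennreal B + ennreal (Gc / 2) * ennreal C = ennreal (A + B + Gc / 2 * C)"
    using A(2) B(2) C(2) pos by (simp add: ennreal_mult[symmetric] ennreal_plus[symmetric] del: ennreal_plus)
  then show ?thesis
    unfolding power2_abs disc_energy_def A_def[symmetric] B_def[symmetric] C_def[symmetric] A(1) B(1) C(1) .
qed

section \<open>Monotone limits and dyadic slopes\<close>

lemma AE_ex_between:
  assumes "AE x in lebesgue. P x" "(a::real) < b"
  obtains x where "a < x" "x < b" "P x"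
proof -
  have "\<exists>x. a < x \<and> x < b \<and> P x"
  proof (rule ccontr)
    assume "\<not> ?thesis"
    then have "AE x in lebesgue. x \<notin> {a<..<b}" using assms(1) by (auto elim!: eventually_mono)
    then have "emeasure lebesgue {a<..<b} = 0"
      by (subst (asm) AE_iff_measurable[where N="{a<..<b}"]) auto
    then show False using assms(2) by simp
  qed
  then show ?thesis using that by blast
qed

text \<open>\<open>R\<close> is the right-continuous regularisation of \<open>N\<close>, and it
  agrees with \<open>N\<close> wherever the resulting measure has no atom. Setting \<open>R\<close>
  to 0 before -L and to \<open>K\<close> from L on turns the gaps at both ends into endpoint atoms,
  so the total mass is \<open>K\<close>.\<close>

lemma monotone_ae_measure:
  fixes N :: "real \<Rightarrow> real"
  assumes L: "0 < L" and D: "AE x in lebesgue. x \<in> {-L..L} \<longrightarrow> x \<in> D"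
    and mono: "\<And>x y. x \<in> D \<Longrightarrow> y \<in> D \<Longrightarrow> -L \<le> x \<Longrightarrow> x \<le> y \<Longrightarrow> y \<le> L \<Longrightarrow> N x \<le> N y"
    and bd: "\<And>x. x \<in> D \<Longrightarrow> -L \<le> x \<Longrightarrow> x \<le> L \<Longrightarrow> 0 \<le> N x \<and> N x \<le> K"
  obtains \<nu> where "finite_borel_measure \<nu>" "emeasure \<nu> (- {-L..L}) = 0" "measure \<nu> UNIV = K"
    "\<And>x. x \<in> D \<Longrightarrow> -L < x \<Longrightarrow> x < L \<Longrightarrow> measure \<nu> {x} = 0 \<Longrightarrow> cdf \<nu> x = N x"
proof -
  define R where "R x = (if x < -L then 0 else if L \<le> x then K else Inf (N ` (D \<inter> {x<..<L})))" for x
  have ne: "\<exists>z\<in>D. a < z \<and> z < b" if "-L \<le> a" "a < b" "b \<le> L" for a b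
    using AE_ex_between[OF D that(2)] that by force
  have K0: "0 \<le> K" using ne[of "-L" L] bd L by force
  have bb: "bdd_below (N ` (D \<inter> {x<..<L}))" if "-L \<le> x" for x
    using bd that by (intro bdd_belowI2[of _ 0]) auto
  have Rle: "R x \<le> N z" if "-L \<le> x" "x < z" "z < L" "z \<in> D" for x z
  proof -
    have "Inf (N ` (D \<inter> {x<..<L})) \<le> N z" by (rule cInf_lower) (use that bb in auto)
    then show ?thesis using that by (simp add: R_def)
  qed
  have Rge: "c \<le> R x" if "-L \<le> x" "x < L" "\<And>z. z \<in> D \<Longrightarrow> x < z \<Longrightarrow> z < L \<Longrightarrow> c \<le> N z" for x c
  proof -
    have "c \<le> Inf (N ` (D \<inter> {x<..<L}))"
      using ne[of x L] that by (intro cInf_greatest) auto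
    then show ?thesis using that by (simp add: R_def)
  qed
  have R0: "0 \<le> R x" for x
    using Rge[of x 0] bd K0 by (cases "-L \<le> x \<and> x < L") (auto simp: R_def)
  have RK: "R x \<le> K" for x
  proof (cases "-L \<le> x \<and> x < L")
    case True
    then obtain z where "z \<in> D" "x < z" "z < L" using ne[of x L] by auto
    then show ?thesis using Rle[of x z] bd[of z] True by auto
  qed (use K0 in \<open>auto simp: R_def\<close>)
  have Rmono: "R x \<le> R y" if "x \<le> y" for x y
  proof -
    consider "x < -L" | "L \<le> y" | "-L \<le> x" "y < L" by linarith
    then show ?thesis
    proof cases
      case 1 then show ?thesis using R0[of y] by (simp add: R_def[of x])
    next
      case 2 then show ?thesis using RK[of x] L by (simp add: R_def[of y])
    next
      case 3 then show ?thesis using that by (intro Rge) (auto intro!: Rle)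
    qed
  qed
  have Rcont: "continuous (at_right a) R" for a
  proof -
    have "(R \<longlongrightarrow> R a) (at_right a)"
    proof (rule order_tendstoI)
      fix c assume "c < R a"
      then show "\<forall>\<^sub>F x in at_right a. c < R x"
        by (intro eventually_at_right_less[THEN eventually_mono]) (use Rmono in \<open>auto intro: less_le_trans\<close>)
    next
      fix c assume c: "R a < c"
      consider "a < -L" | "L \<le> a" | "-L \<le> a" "a < L" by linarith
      then show "\<forall>\<^sub>F x in at_right a. R x < c"
      proof cases
        case 1
        then have "\<forall>\<^sub>F x in at_right a. x < -L" by (auto simp: eventually_at_right_field)
        then show ?thesis by eventually_elim (use c 1 in \<open>auto simp: R_def\<close>)
      next
        case 2
        have "\<forall>\<^sub>F x in at_right a. a < x" by (rule eventually_at_right_less)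
        then show ?thesis by eventually_elim (use c 2 L in \<open>auto simp: R_def\<close>)
      next
        case 3
        then have "Inf (N ` (D \<inter> {a<..<L})) < c" using c by (simp add: R_def)
        then obtain z where z: "z \<in> D" "a < z" "z < L" "N z < c"
        proof -
          have "N ` (D \<inter> {a<..<L}) \<noteq> {}" using ne[of a L] 3 by auto
          from cInf_lessD[OF this \<open>Inf _ < c\<close>] show ?thesis using that by auto
        qed
        have "\<forall>\<^sub>F x in at_right a. a < x \<and> x < z" using z by (auto simp: eventually_at_right_field)
        then show ?thesis
        proof eventually_elim
          case (elim x)
          then have "R x \<le> N z" using Rle[of x z] z 3 by simp
          then show ?case using z(4) by simp
        qed
      qed
    qed
    then show ?thesis by (simp add: continuous_within)
  qed
  have Rbot: "(R \<longlongrightarrow> 0) at_bot"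
    by (rule tendsto_eventually) (auto simp: eventually_at_bot_linorder R_def intro!: exI[of _ "-L - 1"])
  have Rtop: "(R \<longlongrightarrow> K) at_top"
    by (rule tendsto_eventually) (use L in \<open>auto simp: eventually_at_top_linorder R_def intro!: exI[of _ L]\<close>)
  define \<nu> where "\<nu> = interval_measure R"
  have cdf: "cdf \<nu> = R" unfolding \<nu>_def by (rule cdf_interval_measure[OF Rmono Rcont Rbot])
  have s: "sets \<nu> = sets borel" by (simp add: \<nu>_def)
  have emU: "emeasure \<nu> UNIV = ennreal K"
    unfolding \<nu>_def by (rule interval_measure_UNIV[OF Rmono Rcont Rbot Rtop K0])
  have fb: "finite_borel_measure \<nu>"
    using emU s by (intro finite_borel_measureI finite_measureI) (auto simp: sets_eq_imp_space_eq[OF s])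
  interpret finite_borel_measure \<nu> by fact
  note [simp] = s
  have mU: "measure \<nu> UNIV = K" using emU K0 by (simp add: measure_def)
  have "measure \<nu> {..<-L} = 0"
  proof (rule tendsto_unique[OF _ cdf_at_left])
    have "\<forall>\<^sub>F x in at_left (-L). R x = 0"
      unfolding eventually_at_left_field by (intro exI[of _ "-L - 1"]) (auto simp: R_def)
    then show "(cdf \<nu> \<longlongrightarrow> 0) (at_left (- L))" unfolding cdf by (rule tendsto_eventually)
  qed simp
  moreover have "measure \<nu> {L<..} = measure \<nu> UNIV - measure \<nu> {..L}"
    by (subst finite_measure_Diff[symmetric]) (auto intro!: arg_cong[where f="measure \<nu>"])
  moreover have "measure \<nu> {..L} = K" using fun_cong[OF cdf, of L] L by (simp add: cdf_def R_def)
  ultimately have "emeasure \<nu> {..<-L} = 0" "emeasure \<nu> {L<..} = 0" using mU by (auto simp: emeasure_eq_measure)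
  moreover have "- {-L..L} = {..<-L} \<union> {L<..}" by auto
  ultimately have supp: "emeasure \<nu> (- {-L..L}) = 0"
    by (simp only:) (rule emeasure_Un_null_set[THEN trans], auto)
  have "cdf \<nu> x = N x" if x: "x \<in> D" "-L < x" "x < L" "measure \<nu> {x} = 0" for x
  proof (rule antisym)
    have "measure \<nu> {..<x} \<le> N x"
    proof (rule tendsto_le[OF _ tendsto_const cdf_at_left])
      have "\<forall>\<^sub>F y in at_left x. -L < y \<and> y < x" using x by (auto simp: eventually_at_left_field)
      then show "\<forall>\<^sub>F y in at_left x. cdf \<nu> y \<le> N x"
        by eventually_elim (use x Rle in \<open>auto simp: cdf\<close>)
    qed simp
    then show "cdf \<nu> x \<le> N x" using cdf_minus_left[OF fb, of x] x by simp
    show "N x \<le> cdf \<nu> x" unfolding cdf using x mono by (intro Rge) auto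
  qed
  then show ?thesis using that[OF fb supp mU] by blast
qed

text \<open>In a fine partition the block of \<open>x\<close> lies in a small interval around
  \<open>x\<close>, and the weight \<Phi>(s) = phi(s) / s decreases in s. Hence the integral of
  \<Phi> at the mass of that interval is at most the sum of \<open>phi\<close> over the blocks. As
  the interval shrinks to {x}, Fatou's lemma gives the cohesive energy.\<close>

lemma cohesive_le_partitions:
  assumes \<nu>: "finite_borel_measure \<nu>" and supp: "emeasure \<nu> (- {-L..L}) = 0" and L: "0 < L"
    and pos: "0 < \<sigma>c" "0 < Gc"
    and D: "AE x in lebesgue. x \<in> {-L..L} \<longrightarrow> x \<in> D"
    and part: "\<And>m t. t 0 = -L \<Longrightarrow> t m = L \<Longrightarrow> (\<And>k. k < m \<Longrightarrow> t k < t (Suc k)) \<Longrightarrow>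
        (\<And>k. 0 < k \<Longrightarrow> k < m \<Longrightarrow> t k \<in> D \<and> measure \<nu> {t k} = 0) \<Longrightarrow>
        (\<Sum>k<m. Gc * \<sigma>c * measure \<nu> (if k = 0 then {-L..t 1} else {t k<..t (Suc k)})
           / (Gc + \<sigma>c * measure \<nu> (if k = 0 then {-L..t 1} else {t k<..t (Suc k)}))) \<le> B"
  shows "cohesive \<sigma>c Gc \<nu> \<le> ennreal B"
proof -
  interpret finite_borel_measure \<nu> by fact
  note [simp] = M_is_borel
  define \<Phi> where "\<Phi> s = Gc * \<sigma>c / (Gc + \<sigma>c * s)" for s :: real
  have \<Phi>0: "0 \<le> \<Phi> s" if "0 \<le> s" for s using that pos by (simp add: \<Phi>_def)
  have \<Phi>anti: "\<Phi> s \<le> \<Phi> r" if "0 \<le> r" "r \<le> s" for r s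
    unfolding \<Phi>_def using that pos by (intro divide_left_mono mult_pos_pos add_pos_nonneg) auto
  define b where "b r x = measure \<nu> {x - r..x + r}" for r x :: real
  have bm [measurable]: "b r \<in> borel_measurable borel" for r
  proof (cases "0 \<le> r")
    case False
    then have "b r = (\<lambda>_. 0)" by (auto simp: b_def)
    then show ?thesis by simp
  next
    case True
    have "b r x = measure \<nu> {..x + r} - measure \<nu> {..<x - r}" for x
      unfolding b_def using True by (subst finite_measure_Diff[symmetric]) (auto intro!: arg_cong[where f="measure \<nu>"])
    then have "b r = (\<lambda>x. measure \<nu> {..x + r} - measure \<nu> {..<x - r})" by (rule ext)
    moreover have "(\<lambda>x. measure \<nu> {..x + r}) \<in> borel_measurable borel"
      by (rule borel_measurable_mono) (auto simp: mono_def intro!: finite_measure_mono)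
    moreover have "(\<lambda>x. measure \<nu> {..<x - r}) \<in> borel_measurable borel"
      by (rule borel_measurable_mono) (auto simp: mono_def intro!: finite_measure_mono)
    ultimately show ?thesis by simp
  qed
  have \<Phi>m: "(\<lambda>x. ennreal (\<Phi> (b r x))) \<in> borel_measurable \<nu>" for r
    unfolding \<Phi>_def by (simp cong: measurable_cong_sets)
  have AEs: "AE x in \<nu>. x \<in> {-L..L}"
    using supp by (subst AE_iff_measurable[where N="- {-L..L}"]) (auto simp: borel_UNIV)
  have AED: "AE x in lebesgue. x \<in> {-L..L} \<longrightarrow> x \<in> D \<and> measure \<nu> {x} = 0"
  proof -
    have "AE x in lborel. x \<notin> {x. measure \<nu> {x} \<noteq> 0}"
      by (intro AE_not_in countable_imp_null_set_lborel countable_support)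
    then have "AE x in lebesgue. x \<notin> {x. measure \<nu> {x} \<noteq> 0}" by (rule AE_completion)
    with D show ?thesis by eventually_elim auto
  qed
  have key: "(\<integral>\<^sup>+x. ennreal (\<Phi> (b (2 * (2 * L / real (Suc j))) x)) \<partial>\<nu>) \<le> ennreal B" for j
  proof -
    define J where "J = Suc j"
    define \<rho> where "\<rho> = 2 * L / real J"
    have \<rho>: "0 < \<rho>" "real J * \<rho> = 2 * L" using L by (auto simp: \<rho>_def J_def)
    \<comment> \<open>One division point inside each of J equal subintervals, avoiding the atoms and
      the exceptional null set. Together with the endpoints they give J + 1 blocks of length at most
      2 \<rho>.\<close>
    have "\<exists>s. -L + real k * \<rho> < s \<and> s < -L + real (Suc k) * \<rho> \<and> s \<in> D \<and> measure \<nu> {s} = 0" if "k < J" for k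
    proof -
      have lt: "-L + real k * \<rho> < -L + real (Suc k) * \<rho>" using \<rho> by (simp add: distrib_right)
      have "real (Suc k) * \<rho> \<le> real J * \<rho>" using that \<rho>(1) by (intro mult_right_mono) auto
      then have "-L + real (Suc k) * \<rho> \<le> L" using \<rho>(2) by linarith
      moreover obtain s where s: "-L + real k * \<rho> < s" "s < -L + real (Suc k) * \<rho>" "s \<in> {-L..L} \<longrightarrow> s \<in> D \<and> measure \<nu> {s} = 0"
        by (rule AE_ex_between[OF AED lt])
      moreover have "-L \<le> -L + real k * \<rho>" using \<rho> by simp
      ultimately show ?thesis by (intro exI[of _ s]) auto
    qed
    then obtain s where s: "\<And>k. k < J \<Longrightarrow> -L + real k * \<rho> < s k \<and> s k < -L + real (Suc k) * \<rho> \<and> s k \<in> D \<and> measure \<nu> {s k} = 0"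
      by metis
    define t where "t k = (if k = 0 then -L else if k \<le> J then s (k - 1) else L)" for k
    have t_lo: "-L + (real k - 1) * \<rho> \<le> t k" and t_hi: "t k \<le> -L + real k * \<rho>" if kk: "k \<le> Suc J" for k
    proof -
      consider "k = 0" | "0 < k" "k \<le> J" | "k = Suc J" using kk by linarith
      then have "-L + (real k - 1) * \<rho> \<le> t k \<and> t k \<le> -L + real k * \<rho>"
      proof cases
        case 1 then show ?thesis using \<rho> by (simp add: t_def)
      next
        case 2
        then obtain i where "k = Suc i" by (cases k) auto
        then show ?thesis using 2 s[of i] by (auto simp: t_def less_imp_le)
      next
        case 3 then show ?thesis using \<rho> L by (simp add: t_def algebra_simps)
      qed
      then show "-L + (real k - 1) * \<rho> \<le> t k" "t k \<le> -L + real k * \<rho>" by auto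
    qed
    have tS: "t k < t (Suc k)" if kk: "k < Suc J" for k
    proof -
      consider "k = 0" | "0 < k" "k < J" | "k = J" "0 < k" using kk by linarith
      then show ?thesis
      proof cases
        case 1 then show ?thesis using s[of 0] by (simp add: t_def J_def)
      next
        case 2
        then obtain i where "k = Suc i" by (cases k) auto
        then show ?thesis using 2 s[of i] s[of k] by (auto simp: t_def)
      next
        case 3
        then obtain i where "k = Suc i" by (cases k) auto
        then show ?thesis using 3 s[of i] \<rho> L by (auto simp: t_def)
      qed
    qed
    have tD: "t k \<in> D \<and> measure \<nu> {t k} = 0" if "0 < k" "k < Suc J" for k
      using s[of "k - 1"] that by (auto simp: t_def)
    define Bl where "Bl k = (if k = 0 then {-L..t 1} else {t k<..t (Suc k)})" for k
    have Blb [measurable, simp]: "Bl k \<in> sets borel" for k by (simp add: Bl_def)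
    have tm: "t i \<le> t k" if "i \<le> k" "k \<le> Suc J" for i k
      using that
    proof (induction k rule: dec_induct)
      case (step n) then show ?case using tS[of n] by simp
    qed simp
    have sumB: "(\<Sum>k<Suc J. \<Phi> (measure \<nu> (Bl k)) * measure \<nu> (Bl k)) \<le> B"
    proof -
      have "t 0 = -L" "t (Suc J) = L" by (simp_all add: t_def)
      from part[of t, OF this tS tD] show ?thesis by (simp add: \<Phi>_def Bl_def)
    qed
    have bb: "measure \<nu> (Bl k) \<le> b (2 * \<rho>) x" if "k < Suc J" "x \<in> Bl k" for k x
      unfolding b_def
    proof (rule finite_measure_mono)
      have "t (Suc k) - t k \<le> 2 * \<rho>" using t_lo[of k] t_hi[of "Suc k"] that by (simp add: algebra_simps)
      moreover have "t 0 = -L" by (simp add: t_def)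
      ultimately show "Bl k \<subseteq> {x - 2 * \<rho>..x + 2 * \<rho>}" using that by (auto simp: Bl_def split: if_splits)
    qed simp
    have cover: "\<exists>k<Suc J. x \<in> Bl k" if "x \<in> {-L..L}" for x
    proof -
      define k where "k = (LEAST k. x \<le> t (Suc k))"
      have "x \<le> t (Suc J)" using that by (simp add: t_def)
      then have 1: "x \<le> t (Suc k)" "k \<le> J" unfolding k_def by (auto intro: LeastI Least_le)
      moreover have "t k < x" if "k \<noteq> 0"
      proof -
        obtain i where "k = Suc i" using \<open>k \<noteq> 0\<close> by (cases k) auto
        then show ?thesis using not_less_Least[of i "\<lambda>k. x \<le> t (Suc k)"] by (auto simp: k_def[symmetric])
      qed
      ultimately show ?thesis using that by (intro exI[of _ k]) (auto simp: Bl_def)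
    qed
    have "(\<integral>\<^sup>+x. ennreal (\<Phi> (b (2 * \<rho>) x)) \<partial>\<nu>) \<le> (\<integral>\<^sup>+x. (\<Sum>k<Suc J. ennreal (\<Phi> (measure \<nu> (Bl k))) * indicator (Bl k) x) \<partial>\<nu>)"
    proof (rule nn_integral_mono_AE)
      show "AE x in \<nu>. ennreal (\<Phi> (b (2 * \<rho>) x)) \<le> (\<Sum>k<Suc J. ennreal (\<Phi> (measure \<nu> (Bl k))) * indicator (Bl k) x)"
        using AEs
      proof eventually_elim
        case (elim x)
        then obtain k where k: "k < Suc J" "x \<in> Bl k" using cover by blast
        have "ennreal (\<Phi> (b (2 * \<rho>) x)) \<le> ennreal (\<Phi> (measure \<nu> (Bl k))) * indicator (Bl k) x"
          using \<Phi>anti[OF _ bb[OF k]] k by (simp add: ennreal_leI)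
        also have "\<dots> \<le> (\<Sum>k<Suc J. ennreal (\<Phi> (measure \<nu> (Bl k))) * indicator (Bl k) x)"
          by (rule member_le_sum[of k _ "\<lambda>k. ennreal (\<Phi> (measure \<nu> (Bl k))) * indicator (Bl k) x"]) (use k in auto)
        finally show ?case .
      qed
    qed
    also have "\<dots> = (\<Sum>k<Suc J. ennreal (\<Phi> (measure \<nu> (Bl k))) * emeasure \<nu> (Bl k))"
      by (subst nn_integral_sum, intro borel_measurable_times_ennreal borel_measurable_indicator)
        (simp_all add: nn_integral_cmult_indicator)
    also have "\<dots> = ennreal (\<Sum>k<Suc J. \<Phi> (measure \<nu> (Bl k)) * measure \<nu> (Bl k))"
      by (subst sum_ennreal[symmetric]) (auto simp: emeasure_eq_measure ennreal_mult \<Phi>0)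
    also have "\<dots> \<le> ennreal B" using sumB by (rule ennreal_leI)
    finally show ?thesis by (simp add: \<rho>_def J_def)
  qed
  define r where "r j = 2 * (2 * L / real (Suc j))" for j
  have r0: "r \<longlonglongrightarrow> 0"
  proof -
    have "(\<lambda>j. 4 * L * inverse (real (Suc j))) \<longlonglongrightarrow> 4 * L * 0"
      by (intro tendsto_intros LIMSEQ_inverse_real_of_nat)
    moreover have "r = (\<lambda>j. 4 * L * inverse (real (Suc j)))"
      by (simp add: r_def fun_eq_iff divide_inverse)
    ultimately show ?thesis by (simp only: mult_zero_right)
  qed
  have rdec: "r (Suc j) \<le> r j" for j
    unfolding r_def using L by (intro mult_left_mono divide_left_mono) auto
  have blim: "(\<lambda>j. b (r j) x) \<longlonglongrightarrow> measure \<nu> {x}" for x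
  proof -
    have "(\<lambda>j. measure \<nu> {x - r j..x + r j}) \<longlonglongrightarrow> measure \<nu> (\<Inter>j. {x - r j..x + r j})"
    proof (rule finite_Lim_measure_decseq)
      show "decseq (\<lambda>j. {x - r j..x + r j})"
      proof (rule decseq_SucI)
        show "{x - r (Suc n)..x + r (Suc n)} \<subseteq> {x - r n..x + r n}" for n using rdec[of n] by auto
      qed
    qed auto
    moreover have "(\<Inter>j. {x - r j..x + r j}) = {x}"
    proof (intro equalityI subsetI)
      fix y assume y: "y \<in> (\<Inter>j. {x - r j..x + r j})"
      have "\<bar>y - x\<bar> \<le> r j" for j
      proof -
        have "y \<in> {x - r j..x + r j}" using y by blast
        then show ?thesis by (simp add: abs_le_iff)
      qed
      then have "\<bar>y - x\<bar> \<le> 0" using LIMSEQ_le_const[OF r0] by blast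
      then show "y \<in> {x}" by simp
    next
      fix y assume "y \<in> {x}"
      moreover have "0 \<le> r j" for j using L by (simp add: r_def)
      ultimately show "y \<in> (\<Inter>j. {x - r j..x + r j})" by auto
    qed
    ultimately show ?thesis by (simp add: b_def)
  qed
  have "cohesive \<sigma>c Gc \<nu> = (\<integral>\<^sup>+x. liminf (\<lambda>j. ennreal (\<Phi> (b (r j) x))) \<partial>\<nu>)"
    unfolding cohesive_def
  proof (rule nn_integral_cong)
    fix x
    have "Gc + \<sigma>c * measure \<nu> {x} \<noteq> 0" using pos by (smt (verit) measure_nonneg mult_nonneg_nonneg)
    then have "(\<lambda>j. ennreal (\<Phi> (b (r j) x))) \<longlonglongrightarrow> ennreal (\<Phi> (measure \<nu> {x}))"
      unfolding \<Phi>_def by (intro tendsto_intros blim) auto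
    then have "liminf (\<lambda>j. ennreal (\<Phi> (b (r j) x))) = ennreal (\<Phi> (measure \<nu> {x}))"
      by (intro lim_imp_Liminf) auto
    then show "ennreal (Gc * \<sigma>c / (Gc + \<sigma>c * measure \<nu> {x})) = liminf (\<lambda>j. ennreal (\<Phi> (b (r j) x)))"
      by (simp only: \<Phi>_def)
  qed
  also have "\<dots> \<le> liminf (\<lambda>j. \<integral>\<^sup>+x. ennreal (\<Phi> (b (r j) x)) \<partial>\<nu>)"
    by (rule nn_integral_liminf) (rule \<Phi>m)
  also have "\<dots> \<le> liminf (\<lambda>j. ennreal B)"
    by (rule Liminf_mono) (use key in \<open>simp add: r_def\<close>)
  also have "\<dots> = ennreal B" by (simp add: Liminf_const)
  finally show ?thesis .
qed

section \<open>Integrals over uniform grids and dyadic slopes\<close>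

definition step_fun :: "real \<Rightarrow> real \<Rightarrow> (nat \<Rightarrow> real) \<Rightarrow> real \<Rightarrow> real" where
  "step_fun L h s x = s (nat \<lfloor>(x + L) / h\<rfloor>)"

lemma step_fun_measurable [measurable]: "step_fun L h s \<in> borel_measurable borel"
  unfolding step_fun_def[abs_def] by measurable

lemma step_fun_cell:
  assumes "0 < h" "node L h i \<le> x" "x < node L h (Suc i)"
  shows "step_fun L h s x = s i"
proof -
  have "real i \<le> (x + L) / h" "(x + L) / h < real i + 1" using assms by (auto simp: node_def field_simps)
  then have "\<lfloor>(x + L) / h\<rfloor> = int i" by linarith
  then show ?thesis by (simp add: step_fun_def)
qed

lemma step_fun_bounded:
  assumes h: "0 < h" and N: "real N * h = 2 * L"
  obtains K where "\<And>x. x \<in> {-L..L} \<Longrightarrow> \<bar>step_fun L h s x\<bar> \<le> K"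
proof
  fix x assume x: "x \<in> {-L..L}"
  have "(x + L) / h \<le> real N" using x N h by (simp add: field_simps)
  then have "nat \<lfloor>(x + L) / h\<rfloor> \<in> {..N}" by (simp, linarith)
  then show "\<bar>step_fun L h s x\<bar> \<le> (\<Sum>i\<le>N. \<bar>s i\<bar>)"
    unfolding step_fun_def by (intro member_le_sum[of _ _ "\<lambda>i. \<bar>s i\<bar>"]) auto
qed

lemma has_integral_nodes:
  fixes f :: "real \<Rightarrow> real"
  assumes h: "0 < h" and "a \<le> b" and I: "\<And>i. a \<le> i \<Longrightarrow> i < b \<Longrightarrow> (f has_integral I i) (cell L h i)"
  shows "(f has_integral (\<Sum>i=a..<b. I i)) {node L h a..node L h b}"
  using \<open>a \<le> b\<close> I
proof (induction b rule: dec_induct)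
  case base
  show ?case using has_integral_refl(2)[of f "node L h a"] by simp
next
  case (step b)
  have "(f has_integral (\<Sum>i=a..<b. I i) + I b) {node L h a..node L h (Suc b)}"
    by (rule has_integral_combine[of _ "node L h b"]) (use step h in \<open>auto simp: node_le\<close>)
  then show ?case using step by simp
qed

lemma has_integral_cell_const:
  fixes f :: "real \<Rightarrow> real"
  assumes h: "0 < h" and c: "\<And>x. x \<in> interior (cell L h i) \<Longrightarrow> f x = c"
  shows "(f has_integral c * h) (cell L h i)"
proof (rule has_integral_spike[where f="\<lambda>_. c" and S="{node L h i, node L h (Suc i)}"])
  show "((\<lambda>_. c) has_integral c * h) (cell L h i)"
    using has_integral_const_real[of c "node L h i" "node L h (Suc i)"] h by (simp add: node_Suc mult.commute)
qed (use c in auto)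

text \<open>The variance is nonnegative: the square of \<open>f - m\<close>, with \<open>m\<close>
  the mean of \<open>f\<close> on [a, b], has a nonnegative integral.\<close>

lemma cauchy_schwarz_integral:
  fixes f :: "real \<Rightarrow> real"
  assumes ab: "a \<le> b" and f: "f integrable_on {a..b}" and f2: "(\<lambda>x. (f x)\<^sup>2) integrable_on {a..b}"
  shows "(integral {a..b} f)\<^sup>2 \<le> (b - a) * integral {a..b} (\<lambda>x. (f x)\<^sup>2)"
proof (cases "a = b")
  case False
  with ab have l: "0 < b - a" by simp
  define F Q where "F = integral {a..b} f" and "Q = integral {a..b} (\<lambda>x. (f x)\<^sup>2)"
  define m where "m = F / (b - a)"
  have F: "(f has_integral F) {a..b}" and Q: "((\<lambda>x. (f x)\<^sup>2) has_integral Q) {a..b}"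
    using f f2 by (simp_all add: F_def Q_def integrable_integral)
  have c: "((\<lambda>_. m\<^sup>2) has_integral (b - a) * m\<^sup>2) {a..b}"
    using has_integral_const_real[of "m\<^sup>2" a b] ab by simp
  have "((\<lambda>x. (f x)\<^sup>2 - (2 * m) * f x + m\<^sup>2) has_integral Q - (2 * m) * F + (b - a) * m\<^sup>2) {a..b}"
    by (intro has_integral_add has_integral_diff has_integral_mult_right F Q c)
  then have "0 \<le> Q - (2 * m) * F + (b - a) * m\<^sup>2"
  proof (rule has_integral_nonneg)
    show "0 \<le> (f x)\<^sup>2 - (2 * m) * f x + m\<^sup>2" for x
      using zero_le_power2[of "f x - m"] by (simp add: power2_eq_square algebra_simps)
  qed
  then have "0 \<le> (b - a) * (Q - (2 * m) * F + (b - a) * m\<^sup>2)" using l by simp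
  also have "\<dots> = (b - a) * Q - 2 * ((b - a) * m) * F + ((b - a) * m)\<^sup>2"
    by (simp add: power2_eq_square algebra_simps)
  also have "(b - a) * m = F" using l by (simp add: m_def)
  finally show ?thesis by (simp add: F_def Q_def power2_eq_square)
qed simp

text \<open>Slopes of \<open>E\<close> on finer and finer dyadic grids form an \<open>L\<^sup>2\<close>-bounded martingale; it converges in
  \<open>L\<^sup>2\<close> to the derivative of \<open>E\<close>.\<close>

lemma derivative_from_dyadic_energy:
  fixes E :: "real \<Rightarrow> real"
  assumes L: "0 < L" and E: "continuous_on {-L..L} E"
  defines "\<tau> \<equiv> \<lambda>j. 2 * L / 2 ^ j"
  defines "S \<equiv> \<lambda>j. \<Sum>k<2^j. (E (node L (\<tau> j) (Suc k)) - E (node L (\<tau> j) k))\<^sup>2 / \<tau> j"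
  assumes bd: "\<And>j. S j \<le> C0"
  obtains e where "e absolutely_integrable_on {-L..L}"
    "\<And>x. x \<in> {-L..L} \<Longrightarrow> E x - E (-L) = (LINT y:{-L..x}|lebesgue. e y)"
    "\<And>c C. 0 \<le> c \<Longrightarrow> (\<And>j. c * S j \<le> C) \<Longrightarrow> (\<integral>\<^sup>+x\<in>{-L..L}. ennreal (c * (e x)\<^sup>2) \<partial>lebesgue) \<le> ennreal C"
proof -
  have \<tau>: "0 < \<tau> j" "real (2^j) * \<tau> j = 2 * L" for j using L by (auto simp: \<tau>_def)
  have nodeL: "node L (\<tau> j) (2^j) = L" for j using \<tau>(2)[of j] by (simp add: node_def)
  define s where "s j k = (E (node L (\<tau> j) (Suc k)) - E (node L (\<tau> j) k)) / \<tau> j" for j k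
  define e where "e j = step_fun L (\<tau> j) (s j)" for j
  have em [measurable]: "e j \<in> borel_measurable borel" for j by (simp add: e_def)
  have eb: "\<exists>K. \<forall>x\<in>{-L..L}. \<bar>e j x\<bar> \<le> K" for j
    using step_fun_bounded[OF \<tau>(1)[of j] \<tau>(2)[of j], of "s j"] unfolding e_def by metis
  have ee: "(\<lambda>x. e i x * e j x) absolutely_integrable_on {-L..L}" for i j
  proof -
    obtain K K' where "\<forall>x\<in>{-L..L}. \<bar>e i x\<bar> \<le> K" "\<forall>x\<in>{-L..L}. \<bar>e j x\<bar> \<le> K'" using eb by metis
    then have "\<bar>e i x * e j x\<bar> \<le> K * K'" if "x \<in> {-L..L}" for x
      unfolding abs_mult using that abs_ge_zero[of "e i x"] by (intro mult_mono) (auto intro: order_trans)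
    then show ?thesis by (intro bounded_borel_absint[where K="K * K'"] borel_measurable_times em)
  qed
  have ei: "e j absolutely_integrable_on {-L..L}" for j
  proof -
    obtain K where "\<forall>x\<in>{-L..L}. \<bar>e j x\<bar> \<le> K" using eb by metis
    then show ?thesis by (intro bounded_borel_absint[where K=K]) auto
  qed
  have prim: "(e j has_integral E (node L (\<tau> j) b) - E (node L (\<tau> j) a)) {node L (\<tau> j) a..node L (\<tau> j) b}" if "a \<le> b" for j a b
  proof -
    have "(e j has_integral (\<Sum>i=a..<b. s j i * \<tau> j)) {node L (\<tau> j) a..node L (\<tau> j) b}"
      using \<tau> that by (intro has_integral_nodes has_integral_cell_const) (auto simp: e_def step_fun_cell less_imp_le)
    also have "(\<Sum>i=a..<b. s j i * \<tau> j) = (\<Sum>i=a..<b. E (node L (\<tau> j) (Suc i)) - E (node L (\<tau> j) i))"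
      using \<tau>(1)[of j] by (simp add: s_def)
    also have "\<dots> = E (node L (\<tau> j) b) - E (node L (\<tau> j) a)"
      using that by (rule sum_Suc_diff')
    finally show ?thesis .
  qed
  have refine: "node L (\<tau> j) k = node L (\<tau> (j + i)) (k * 2^i)" for j i k
    by (simp add: node_def \<tau>_def power_add)
  \<comment> \<open>Martingale property: on a coarse cell \<open>e j\<close> is constant and the
    finer slope has the same integral as \<open>e j\<close>, so the mixed integral is the energy of
    the coarse level.\<close>
  have inner: "integral {-L..L} (\<lambda>x. e (j + i) x * e j x) = S j" for j i
  proof -
    have "((\<lambda>x. e (j + i) x * e j x) has_integral (\<Sum>k=0..<2^j. (E (node L (\<tau> j) (Suc k)) - E (node L (\<tau> j) k)) * s j k))
        {node L (\<tau> j) 0..node L (\<tau> j) (2^j)}"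
    proof (rule has_integral_nodes[OF \<tau>(1)])
      fix k :: nat
      have "(e (j + i) has_integral E (node L (\<tau> j) (Suc k)) - E (node L (\<tau> j) k)) (cell L (\<tau> j) k)"
        unfolding refine[of j _ i] by (rule prim) simp
      then have "((\<lambda>x. e (j + i) x * s j k) has_integral (E (node L (\<tau> j) (Suc k)) - E (node L (\<tau> j) k)) * s j k) (cell L (\<tau> j) k)"
        by (rule has_integral_mult_left)
      then show "((\<lambda>x. e (j + i) x * e j x) has_integral (E (node L (\<tau> j) (Suc k)) - E (node L (\<tau> j) k)) * s j k) (cell L (\<tau> j) k)"
        by (rule has_integral_spike[of "{node L (\<tau> j) (Suc k)}", rotated 2]) (use \<tau>(1)[of j] in \<open>auto simp: e_def step_fun_cell\<close>)
    qed simp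
    then have "integral {-L..L} (\<lambda>x. e (j + i) x * e j x) = (\<Sum>k=0..<2^j. (E (node L (\<tau> j) (Suc k)) - E (node L (\<tau> j) k)) * s j k)"
      by (simp add: node_0 nodeL integral_unique)
    also have "\<dots> = S j"
      unfolding S_def s_def by (simp add: power2_eq_square atLeast0LessThan)
    finally show ?thesis .
  qed
  have LI: "(LINT x:{-L..L}|lebesgue. f x) = integral {-L..L} f" if "f absolutely_integrable_on {-L..L}" for f :: "real \<Rightarrow> real"
    using that by (rule set_lebesgue_integral_eq_integral(2))
  have hk: "f integrable_on {-L..L}" if "f absolutely_integrable_on {-L..L}" for f :: "real \<Rightarrow> real"
    using that by (rule set_lebesgue_integral_eq_integral(1))
  \<comment> \<open>Pythagoras. It makes \<open>S\<close> nondecreasing, and since \<open>S\<close>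
    is bounded the slopes are Cauchy in the mean square.\<close>
  have dist2: "integral {-L..L} (\<lambda>x. (e m x - e j x)\<^sup>2) = S m - S j"
    "(\<lambda>x. (e m x - e j x)\<^sup>2) absolutely_integrable_on {-L..L}" if jm: "j \<le> m" for j m
  proof -
    obtain i where m: "m = j + i" using le_Suc_ex[OF jm] by auto
    have eq: "(\<lambda>x. (e m x - e j x)\<^sup>2) = (\<lambda>x. e m x * e m x - 2 * (e m x * e j x) + e j x * e j x)"
      by (auto simp: power2_eq_square algebra_simps)
    have i2: "(\<lambda>x. 2 * (e m x * e j x)) absolutely_integrable_on {-L..L}" using ee by simp
    show "(\<lambda>x. (e m x - e j x)\<^sup>2) absolutely_integrable_on {-L..L}"
      unfolding eq by (intro set_integral_add(1) set_integral_diff(1) ee i2)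
    have "integral {-L..L} (\<lambda>x. (e m x - e j x)\<^sup>2) = S m - 2 * S j + S j"
      unfolding eq using inner[of j i] inner[of m 0] inner[of j 0] m
      by (simp add: Henstock_Kurzweil_Integration.integral_add Henstock_Kurzweil_Integration.integral_diff
          integrable_diff hk ee integrable_on_cmult_left)
    then show "integral {-L..L} (\<lambda>x. (e m x - e j x)\<^sup>2) = S m - S j" by simp
  qed
  have Smono: "S j \<le> S m" if "j \<le> m" for j m
  proof -
    have "0 \<le> integral {-L..L} (\<lambda>x. (e m x - e j x)\<^sup>2)"
      by (rule integral_nonneg[OF hk[OF dist2(2)[OF that]]]) simp
    then show ?thesis using dist2(1)[OF that] by simp
  qed
  define S' where "S' = (SUP j. S j)"
  have bda: "bdd_above (range S)" by (rule bdd_aboveI2[where M=C0]) (rule bd)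
  have SS': "S j \<le> S'" for j unfolding S'_def by (rule cSUP_upper[OF _ bda]) simp
  have "\<exists>j. S' - (1/4)^i \<le> S j" for i
  proof (rule ccontr)
    assume "\<not> ?thesis"
    then have "S j \<le> S' - (1/4)^i" for j by (simp add: not_le less_imp_le)
    then have "S' \<le> S' - (1/4)^i" unfolding S'_def by (intro cSUP_least) auto
    moreover have "0 < (1/4::real)^i" by simp
    ultimately show False by linarith
  qed
  then obtain r0 where r0: "\<And>i. S' - (1/4)^i \<le> S (r0 i)" by metis
  \<comment> \<open>The maximum makes \<open>r\<close> nondecreasing and the summand
    \<open>i\<close> lets it pass every level. The energy gaps (1/4)^i become L1 gaps of order
    (1/2)^i, which are summable.\<close>
  define r where "r i = Max (r0 ` {..i}) + i" for i
  have r: "S' - (1/4)^i \<le> S (r i)" "r i \<le> r (Suc i)" "i \<le> r i" for i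
  proof -
    have "r0 i \<le> r i" by (simp add: r_def trans_le_add1)
    then show "S' - (1/4)^i \<le> S (r i)" using r0[of i] Smono order_trans by blast
    show "r i \<le> r (Suc i)" unfolding r_def by (intro add_mono Max_mono) auto
    show "i \<le> r i" by (simp add: r_def)
  qed
  define f where "f i x = e (r (Suc i)) x - e (r i) x" for i x
  have fi: "f i absolutely_integrable_on {-L..L}" for i unfolding f_def by (intro set_integral_diff(1) ei)
  have fm [measurable]: "f i \<in> borel_measurable borel" for i unfolding f_def by simp
  have f1: "integral {-L..L} (\<lambda>x. \<bar>f i x\<bar>) \<le> sqrt (2 * L) * (1/2)^i" for i
  proof -
    have ab: "(\<lambda>x. \<bar>f i x\<bar>) absolutely_integrable_on {-L..L}" using set_integrable_abs[OF fi] by simp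
    have "(integral {-L..L} (\<lambda>x. \<bar>f i x\<bar>))\<^sup>2 \<le> (L - - L) * integral {-L..L} (\<lambda>x. \<bar>f i x\<bar>\<^sup>2)"
      using L hk[OF ab] hk[OF dist2(2)[OF r(2)[of i]]] by (intro cauchy_schwarz_integral) (auto simp: f_def)
    also have "integral {-L..L} (\<lambda>x. \<bar>f i x\<bar>\<^sup>2) = S (r (Suc i)) - S (r i)"
      using dist2(1)[OF r(2)[of i]] by (simp add: f_def)
    also have "(L - - L) * (S (r (Suc i)) - S (r i)) \<le> (2 * L) * (1/4)^i"
      using SS'[of "r (Suc i)"] r(1)[of i] L by (intro mult_mono) (auto intro: Smono r(2))
    also have "\<dots> = (sqrt (2 * L) * (1/2)^i)\<^sup>2"
    proof -
      have "(1/4::real)^i = ((1/2)^i)\<^sup>2" by (simp add: power2_eq_square power_mult_distrib[symmetric])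
      then show ?thesis using L by (simp add: power_mult_distrib)
    qed
    finally show ?thesis
      by (rule power2_le_imp_le) (use L in auto)
  qed
  have nnf: "(\<integral>\<^sup>+x. ennreal (indicator {-L..L} x * \<bar>f i x\<bar>) \<partial>lebesgue) \<le> ennreal (sqrt (2 * L) * (1/2)^i)" for i
  proof -
    have ab: "(\<lambda>x. \<bar>f i x\<bar>) absolutely_integrable_on {-L..L}" using set_integrable_abs[OF fi] by simp
    have "(\<integral>\<^sup>+x. ennreal (indicator {-L..L} x * \<bar>f i x\<bar>) \<partial>lebesgue) = (\<integral>\<^sup>+x\<in>{-L..L}. ennreal \<bar>f i x\<bar> \<partial>lebesgue)"
      by (intro nn_integral_cong) (auto simp: indicator_def)
    also have "\<dots> = ennreal (integral {-L..L} (\<lambda>x. \<bar>f i x\<bar>))"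
      by (rule nn_integral_integral_on[OF ab]) simp
    finally show ?thesis using f1[of i] by (simp add: ennreal_leI)
  qed
  have lm: "g \<in> borel_measurable borel \<Longrightarrow> g \<in> borel_measurable lebesgue" for g :: "real \<Rightarrow> real"
    by (intro measurable_completion) simp
  define a where "a i x = indicator {-L..L} x * \<bar>f i x\<bar>" for i x
  have am [measurable]: "a i \<in> borel_measurable lebesgue" for i unfolding a_def[abs_def] by (rule lm) simp
  have a0: "0 \<le> a i x" for i x by (simp add: a_def)
  have suma: "(\<integral>\<^sup>+x. (\<Sum>i. ennreal (a i x)) \<partial>lebesgue) < \<infinity>"
  proof -
    have "(\<integral>\<^sup>+x. (\<Sum>i. ennreal (a i x)) \<partial>lebesgue) = (\<Sum>i. \<integral>\<^sup>+x. ennreal (a i x) \<partial>lebesgue)"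
      by (rule nn_integral_suminf) measurable
    also have "\<dots> \<le> (\<Sum>i. ennreal (sqrt (2 * L) * (1/2)^i))"
      unfolding a_def by (intro suminf_le nnf) auto
    also have "\<dots> = ennreal (\<Sum>i. sqrt (2 * L) * (1/2)^i)"
      by (rule suminf_ennreal2) (use L in \<open>auto intro!: summable_mult\<close>)
    finally show ?thesis by (simp add: le_less_trans)
  qed
  have "AE x in lebesgue. (\<Sum>i. ennreal (a i x)) \<noteq> \<infinity>"
    using suma by (intro nn_integral_PInf_AE) auto
  then have AEs: "AE x in lebesgue. summable (\<lambda>i. a i x)"
    by eventually_elim (use a0 in \<open>auto intro!: summable_suminf_not_top\<close>)
  define F where "F x = lim (\<lambda>n. e (r n) x)" for x
  \<comment> \<open>An integrable majorant of the whole subsequence, available because its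
    increments are absolutely summable in L1.\<close>
  define G where "G x = \<bar>indicator {-L..L} x * e (r 0) x\<bar> + (\<Sum>i. a i x)" for x
  have tele: "e (r n) x = e (r 0) x + (\<Sum>i<n. f i x)" for n x
    by (induction n) (auto simp: f_def)
  have Gi: "integrable lebesgue G"
    unfolding G_def[abs_def]
  proof (rule Bochner_Integration.integrable_add)
    show "integrable lebesgue (\<lambda>x. \<bar>indicator {-L..L} x * e (r 0) x\<bar>)"
      using ei[of "r 0"] by (intro integrable_abs) (simp add: set_integrable_def)
    show "integrable lebesgue (\<lambda>x. \<Sum>i. a i x)"
    proof (rule integrableI_nonneg)
      have "(\<integral>\<^sup>+x. ennreal (\<Sum>i. a i x) \<partial>lebesgue) = (\<integral>\<^sup>+x. (\<Sum>i. ennreal (a i x)) \<partial>lebesgue)"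
        by (intro nn_integral_cong_AE) (use AEs in eventually_elim, use a0 in \<open>auto simp: suminf_ennreal2\<close>)
      then show "(\<integral>\<^sup>+x. ennreal (\<Sum>i. a i x) \<partial>lebesgue) < \<infinity>" using suma by simp
      show "AE x in lebesgue. 0 \<le> (\<Sum>i. a i x)"
        using AEs by eventually_elim (use a0 in \<open>auto intro: suminf_nonneg\<close>)
    qed measurable
  qed
  have conv: "AE x in lebesgue. x \<in> {-L..L} \<longrightarrow> (\<lambda>n. e (r n) x) \<longlonglongrightarrow> F x"
    using AEs
  proof eventually_elim
    case (elim x)
    show ?case
    proof
      assume x: "x \<in> {-L..L}"
      then have "summable (\<lambda>i. \<bar>f i x\<bar>)" using elim by (simp add: a_def)
      then have sf: "summable (\<lambda>i. f i x)" by (rule summable_rabs_cancel)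
      then have "(\<lambda>n. e (r 0) x + (\<Sum>i<n. f i x)) \<longlonglongrightarrow> e (r 0) x + (\<Sum>i. f i x)"
        by (intro tendsto_intros summable_LIMSEQ)
      then have "convergent (\<lambda>n. e (r n) x)" unfolding tele[symmetric] by (auto simp: convergent_def)
      then show "(\<lambda>n. e (r n) x) \<longlonglongrightarrow> F x" unfolding F_def by (simp only: convergent_LIMSEQ_iff)
    qed
  qed
  have dom: "AE x in lebesgue. \<bar>indicator {-L..L} x * e (r n) x\<bar> \<le> G x" for n
    using AEs
  proof eventually_elim
    case (elim x)
    show ?case
    proof (cases "x \<in> {-L..L}")
      case True
      then have "\<bar>e (r n) x\<bar> \<le> \<bar>e (r 0) x\<bar> + (\<Sum>i<n. a i x)"
        unfolding tele[of n] a_def using order_trans[OF abs_triangle_ineq add_left_mono[OF sum_abs]] by auto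
      also have "(\<Sum>i<n. a i x) \<le> (\<Sum>i. a i x)" using elim a0 by (intro sum_le_suminf) auto
      finally show ?thesis using True by (simp add: G_def)
    next
      case False
      then show ?thesis using elim a0 by (auto simp: G_def intro!: suminf_nonneg)
    qed
  qed
  have Fm: "F \<in> borel_measurable borel"
    unfolding F_def[abs_def] by (rule borel_measurable_lim_metric) (rule em)
  have iFm: "(\<lambda>x. indicator {-L..L} x * F x) \<in> borel_measurable lebesgue" using Fm by (intro lm) simp
  have DC: "integrable lebesgue (\<lambda>x. indicator A x * F x)"
    "(\<lambda>n. LINT x:A|lebesgue. e (r n) x) \<longlonglongrightarrow> (LINT x:A|lebesgue. F x)" if A: "A \<in> sets borel" "A \<subseteq> {-L..L}" for A
  proof -
    have c: "AE x in lebesgue. (\<lambda>n. indicator A x * e (r n) x) \<longlonglongrightarrow> indicator A x * F x"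
      using conv by eventually_elim (use A in \<open>auto simp: indicator_def\<close>)
    have d: "AE x in lebesgue. norm (indicator A x * e (r n) x) \<le> G x" for n
      using dom[of n]
    proof eventually_elim
      case (elim x)
      have "norm (indicator A x * e (r n) x) \<le> \<bar>indicator {-L..L} x * e (r n) x\<bar>"
        using A(2) by (auto simp: indicator_def)
      then show ?case using elim by linarith
    qed
    have m: "(\<lambda>x. indicator A x * F x) \<in> borel_measurable lebesgue" "\<And>n. (\<lambda>x. indicator A x * e (r n) x) \<in> borel_measurable lebesgue"
      using A Fm by (intro lm; simp)+
    show "integrable lebesgue (\<lambda>x. indicator A x * F x)"
      by (rule integrable_dominated_convergence[OF m Gi c d])
    show "(\<lambda>n. LINT x:A|lebesgue. e (r n) x) \<longlonglongrightarrow> (LINT x:A|lebesgue. F x)"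
      unfolding set_lebesgue_integral_def real_scaleR_def
      by (rule integral_dominated_convergence[OF m Gi c d])
  qed
  have FI: "F absolutely_integrable_on {-L..L}" using DC(1)[of "{-L..L}"] by (simp add: set_integrable_def)
  \<comment> \<open>At a dyadic point the primitive of \<open>e (r n)\<close> is exact as soon as
    the level is fine enough, so only dominated convergence remains.\<close>
  have dy: "E (node L (\<tau> j) k) - E (-L) = (LINT y:{-L..node L (\<tau> j) k}|lebesgue. F y)" if k: "k \<le> 2^j" for j k
  proof -
    have nk: "node L (\<tau> j) k \<in> {-L..L}"
      using k \<tau>(1)[of j] nodeL[of j] node_le[OF \<tau>(1), of L j k "2^j"] by (auto simp: node_def)
    have "eventually (\<lambda>n. (LINT y:{-L..node L (\<tau> j) k}|lebesgue. e (r n) y) = E (node L (\<tau> j) k) - E (-L)) sequentially"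
    proof (rule eventually_sequentiallyI[of j])
      fix n assume "j \<le> n"
      then have "j \<le> r n" using r(3)[of n] by simp
      then obtain i where i: "r n = j + i" using le_Suc_ex by auto
      have "(e (j + i) has_integral E (node L (\<tau> (j + i)) (k * 2^i)) - E (node L (\<tau> (j + i)) 0))
          {node L (\<tau> (j + i)) 0..node L (\<tau> (j + i)) (k * 2^i)}" by (rule prim) simp
      then have "(e (r n) has_integral E (node L (\<tau> j) k) - E (-L)) {-L..node L (\<tau> j) k}"
        by (simp add: i node_0 refine[of j k i])
      moreover have "e (r n) absolutely_integrable_on {-L..node L (\<tau> j) k}"
        by (rule set_integrable_subset[OF ei]) (use nk in auto)
      ultimately show "(LINT y:{-L..node L (\<tau> j) k}|lebesgue. e (r n) y) = E (node L (\<tau> j) k) - E (-L)"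
        by (simp add: set_lebesgue_integral_eq_integral(2) integral_unique)
    qed
    then have "(\<lambda>n. LINT y:{-L..node L (\<tau> j) k}|lebesgue. e (r n) y) \<longlonglongrightarrow> E (node L (\<tau> j) k) - E (-L)"
      by (rule tendsto_eventually)
    moreover have "(\<lambda>n. LINT y:{-L..node L (\<tau> j) k}|lebesgue. e (r n) y) \<longlonglongrightarrow> (LINT y:{-L..node L (\<tau> j) k}|lebesgue. F y)"
      using nk by (intro DC(2)) auto
    ultimately show ?thesis by (rule LIMSEQ_unique)
  qed
  have prim': "E x - E (-L) = (LINT y:{-L..x}|lebesgue. F y)" if x: "x \<in> {-L..L}" for x
  proof -
    have LIx: "(LINT y:{-L..z}|lebesgue. F y) = integral {-L..z} F" if "z \<in> {-L..L}" for z
      by (rule set_lebesgue_integral_eq_integral(2)[OF set_integrable_subset[OF FI]]) (use that in auto)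
    \<comment> \<open>Index of the dyadic point just below \<open>x\<close>; these points converge
      to \<open>x\<close>, and both sides of the identity are continuous.\<close>
    define k where "k j = nat \<lfloor>(x + L) / \<tau> j\<rfloor>" for j
    define z where "z j = node L (\<tau> j) (k j)" for j
    have zx: "z j \<le> x" "x < z j + \<tau> j" "k j \<le> 2^j" for j
    proof -
      have q: "0 \<le> (x + L) / \<tau> j" using x \<tau>(1)[of j] by simp
      have kk: "real (k j) \<le> (x + L) / \<tau> j" "(x + L) / \<tau> j < real (k j) + 1"
        using q unfolding k_def by linarith+
      then show "z j \<le> x" "x < z j + \<tau> j" using \<tau>(1)[of j] by (auto simp: z_def node_def field_simps)
      have "(x + L) / \<tau> j \<le> real (2^j)" using x \<tau>[of j] by (simp add: field_simps)
      then have "real (k j) \<le> real (2^j)" using kk by linarith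
      then show "k j \<le> 2^j" by (simp only: of_nat_le_iff)
    qed
    have zI: "z j \<in> {-L..L}" for j using zx(1)[of j] x \<tau>(1)[of j] by (auto simp: z_def node_def)
    have "\<tau> \<longlonglongrightarrow> 0"
    proof -
      have "(\<lambda>j. 2 * L * (1/2)^j) \<longlonglongrightarrow> 2 * L * 0" by (intro tendsto_intros LIMSEQ_power_zero) simp
      moreover have "\<tau> = (\<lambda>j. 2 * L * (1/2)^j)" by (simp add: \<tau>_def fun_eq_iff power_divide)
      ultimately show ?thesis by (simp only: mult_zero_right)
    qed
    have "z \<longlonglongrightarrow> x"
    proof (rule tendsto_sandwich[of "\<lambda>j. x - \<tau> j" _ _ "\<lambda>_. x"])
      show "(\<lambda>j. x - \<tau> j) \<longlonglongrightarrow> x" using tendsto_diff[OF tendsto_const \<open>\<tau> \<longlonglongrightarrow> 0\<close>, of x] by simp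
      have "x - \<tau> j \<le> z j" for j using zx(2)[of j] by linarith
      then show "\<forall>\<^sub>F j in sequentially. x - \<tau> j \<le> z j" by simp
      show "\<forall>\<^sub>F j in sequentially. z j \<le> x" using zx(1) by simp
    qed simp
    then have lim: "(\<lambda>j. g (z j)) \<longlonglongrightarrow> g x" if "continuous_on {-L..L} g" for g :: "real \<Rightarrow> real"
      using that zI x by (auto simp: continuous_on_sequentially o_def)
    have "continuous_on {-L..L} (\<lambda>z. integral {-L..z} F)"
      by (rule indefinite_integral_continuous_1[OF hk[OF FI]])
    then have "(\<lambda>j. integral {-L..z j} F) \<longlonglongrightarrow> integral {-L..x} F" by (rule lim)
    moreover have "(\<lambda>j. E (z j) - E (-L)) \<longlonglongrightarrow> E x - E (-L)" by (intro tendsto_intros lim E)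
    moreover have "E (z j) - E (-L) = integral {-L..z j} F" for j
      using dy[OF zx(3)] LIx[OF zI] by (simp add: z_def)
    ultimately have "E x - E (-L) = integral {-L..x} F" using LIMSEQ_unique by auto
    then show ?thesis using LIx[OF x] by simp
  qed
  have en: "(\<integral>\<^sup>+x\<in>{-L..L}. ennreal (c * (F x)\<^sup>2) \<partial>lebesgue) \<le> ennreal C" if c: "0 \<le> c" and C: "\<And>j. c * S j \<le> C" for c C
  proof -
    have e2: "(\<lambda>x. c * (e j x)\<^sup>2) absolutely_integrable_on {-L..L}" for j
      using ee[of j j] by (simp add: power2_eq_square)
    have e2v: "(\<integral>\<^sup>+x\<in>{-L..L}. ennreal (c * (e j x)\<^sup>2) \<partial>lebesgue) = ennreal (c * S j)" for j
    proof -
      have S: "integral {-L..L} (\<lambda>x. (e j x)\<^sup>2) = S j" using inner[of j 0] by (simp add: power2_eq_square)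
      have "(\<integral>\<^sup>+x\<in>{-L..L}. ennreal (c * (e j x)\<^sup>2) \<partial>lebesgue) = ennreal (integral {-L..L} (\<lambda>x. c * (e j x)\<^sup>2))"
        by (rule nn_integral_integral_on[OF e2]) (use c in auto)
      also have "integral {-L..L} (\<lambda>x. c * (e j x)\<^sup>2) = c * S j"
        unfolding S[symmetric] by (rule Henstock_Kurzweil_Integration.integral_mult_right)
      finally show ?thesis .
    qed
    have "(\<integral>\<^sup>+x\<in>{-L..L}. ennreal (c * (F x)\<^sup>2) \<partial>lebesgue)
        = (\<integral>\<^sup>+x. liminf (\<lambda>n. ennreal (c * (e (r n) x)\<^sup>2) * indicator {-L..L} x) \<partial>lebesgue)"
    proof (rule nn_integral_cong_AE)
      show "AE x in lebesgue. ennreal (c * (F x)\<^sup>2) * indicator {-L..L} x =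
          liminf (\<lambda>n. ennreal (c * (e (r n) x)\<^sup>2) * indicator {-L..L} x)"
        using conv
      proof eventually_elim
        case (elim x)
        show ?case
        proof (cases "x \<in> {-L..L}")
          case True
          then have "(\<lambda>n. ennreal (c * (e (r n) x)\<^sup>2)) \<longlonglongrightarrow> ennreal (c * (F x)\<^sup>2)"
            using elim by (intro tendsto_intros) auto
          then have "liminf (\<lambda>n. ennreal (c * (e (r n) x)\<^sup>2)) = ennreal (c * (F x)\<^sup>2)"
            by (intro lim_imp_Liminf) auto
          then show ?thesis using True by simp
        next
          case False
          then show ?thesis by (simp add: Liminf_const)
        qed
      qed
    qed
    also have "\<dots> \<le> liminf (\<lambda>n. \<integral>\<^sup>+x. ennreal (c * (e (r n) x)\<^sup>2) * indicator {-L..L} x \<partial>lebesgue)"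
    proof (rule nn_integral_liminf)
      fix n
      have "e (r n) \<in> borel_measurable lebesgue" by (rule lm) simp
      then show "(\<lambda>x. ennreal (c * (e (r n) x)\<^sup>2) * indicator {-L..L} x) \<in> borel_measurable lebesgue"
        by (intro borel_measurable_times_ennreal borel_measurable_indicator) auto
    qed
    also have "\<dots> \<le> liminf (\<lambda>n::nat. ennreal C)"
      unfolding e2v using C by (intro Liminf_mono) (simp add: ennreal_leI)
    also have "\<dots> = ennreal C" by (simp add: Liminf_const)
    finally show ?thesis .
  qed
  show ?thesis using that[OF FI prim' en] .
qed

section \<open>The liminf inequality\<close>

lemma P1_has_deriv:
  assumes h: "0 < h" and N: "real N * h = 2 * L" and v: "v \<in> P1 (cell L h ` {..<N})"
    and x: "x \<in> {-L..L} - node L h ` {..N}"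
  shows "(v has_real_derivative deriv v x) (at x)"
proof -
  obtain i where i: "i < N" "x \<in> interior (cell L h i)" using cell_cover[OF h N] x by blast
  have "cell L h i \<in> cell L h ` {..<N}" using i by blast
  from P1_deriv[OF v this] obtain q where "\<forall>x\<in>interior (cell L h i). (v has_real_derivative q) (at x) \<and> deriv v x = q"
    by (elim exE conjE) (rule that)
  then show ?thesis using i(2) by metis
qed

lemma P1_FTC:
  assumes h: "0 < h" and N: "real N * h = 2 * L" and L: "0 < L" and v: "v \<in> P1 (cell L h ` {..<N})"
    and ab: "-L \<le> a" "a \<le> b" "b \<le> L"
  shows "(deriv v has_integral v b - v a) {a..b}"
    "((\<lambda>x. 2 * v x * deriv v x) has_integral (v b)\<^sup>2 - (v a)\<^sup>2) {a..b}"
proof -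
  have c: "continuous_on {a..b} v" using P1_continuous[OF h N L v] ab by (auto intro: continuous_on_subset)
  have d: "(v has_real_derivative deriv v x) (at x)" if "x \<in> {a<..<b} - node L h ` {..N}" for x
    using that ab by (intro P1_has_deriv[OF h N v]) auto
  show "(deriv v has_integral v b - v a) {a..b}"
    by (rule fundamental_theorem_of_calculus_interior_strong[of "node L h ` {..N}"])
      (use ab c d in \<open>auto simp flip: has_real_derivative_iff_has_vector_derivative\<close>)
  show "((\<lambda>x. 2 * v x * deriv v x) has_integral (v b)\<^sup>2 - (v a)\<^sup>2) {a..b}"
  proof (rule fundamental_theorem_of_calculus_interior_strong[of "node L h ` {..N}"])
    show "((\<lambda>x. (v x)\<^sup>2) has_vector_derivative 2 * v x * deriv v x) (at x)"
      if "x \<in> {a<..<b} - node L h ` {..N}" for x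
      unfolding has_real_derivative_iff_has_vector_derivative[symmetric]
      by (rule derivative_eq_intros d[OF that] refl | simp)+
    show "continuous_on {a..b} (\<lambda>x. (v x)\<^sup>2)" using c by (intro continuous_intros)
  qed (use ab in auto)
qed

lemma absint_sub:
  fixes f :: "real \<Rightarrow> real"
  assumes "f absolutely_integrable_on {-L..L}" "-L \<le> a" "b \<le> L"
  shows "f integrable_on {a..b}"
  using set_lebesgue_integral_eq_integral(1)[OF assms(1)] by (rule integrable_on_subinterval) (use assms in auto)

text \<open>By Young's inequality the integrand is at least the derivative of d^2 and at least its
  negative. The one is integrated up to \<open>z\<close> and the other from \<open>z\<close> on, so
  the height at \<open>z\<close> counts twice.\<close>

lemma phase_field_block:
  assumes h: "0 < h" and N: "real N * h = 2 * L" and L: "0 < L" and d: "d \<in> P1 (cell L h ` {..<N})"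
    and ab: "-L \<le> a" "a \<le> z" "z \<le> b" "b \<le> L" and \<epsilon>: "0 < \<epsilon>"
  shows "2 * (d z)\<^sup>2 - (d a)\<^sup>2 - (d b)\<^sup>2 \<le> integral {a..b} (\<lambda>x. 1 / \<epsilon> * (d x)\<^sup>2 + \<epsilon> * (deriv d x)\<^sup>2)"
proof -
  let ?f = "\<lambda>x. 1 / \<epsilon> * (d x)\<^sup>2 + \<epsilon> * (deriv d x)\<^sup>2"
  have fi: "?f integrable_on {s..t}" if "-L \<le> s" "t \<le> L" for s t
    using disc_energy_integrable(4)[OF h N L d d P1_deriv_P0[OF d]] that by (rule absint_sub)
  have young: "2 * d x * deriv d x \<le> ?f x" "- (2 * d x * deriv d x) \<le> ?f x" for x
  proof -
    have "0 \<le> (d x - \<epsilon> * deriv d x)\<^sup>2 / \<epsilon>" "0 \<le> (d x + \<epsilon> * deriv d x)\<^sup>2 / \<epsilon>" using \<epsilon> by auto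
    moreover have "(d x - \<epsilon> * deriv d x)\<^sup>2 / \<epsilon> = ?f x - 2 * d x * deriv d x"
      "(d x + \<epsilon> * deriv d x)\<^sup>2 / \<epsilon> = ?f x + 2 * d x * deriv d x"
      using \<epsilon> by (auto simp: power2_eq_square field_simps)
    ultimately show "2 * d x * deriv d x \<le> ?f x" "- (2 * d x * deriv d x) \<le> ?f x" by auto
  qed
  have "(d z)\<^sup>2 - (d a)\<^sup>2 \<le> integral {a..z} ?f"
  proof (rule has_integral_le)
    show "((\<lambda>x. 2 * d x * deriv d x) has_integral (d z)\<^sup>2 - (d a)\<^sup>2) {a..z}"
      using ab by (intro P1_FTC[OF h N L d]) auto
    show "(?f has_integral integral {a..z} ?f) {a..z}" using ab by (intro integrable_integral fi) auto
  qed (rule young)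
  moreover have "- ((d b)\<^sup>2 - (d z)\<^sup>2) \<le> integral {z..b} ?f"
  proof (rule has_integral_le)
    show "((\<lambda>x. - (2 * d x * deriv d x)) has_integral - ((d b)\<^sup>2 - (d z)\<^sup>2)) {z..b}"
      using ab by (intro has_integral_neg P1_FTC[OF h N L d]) auto
    show "(?f has_integral integral {z..b} ?f) {z..b}" using ab by (intro integrable_integral fi) auto
  qed (rule young)
  moreover have "integral {a..z} ?f + integral {z..b} ?f = integral {a..b} ?f"
    using ab by (intro Henstock_Kurzweil_Integration.integral_combine fi) auto
  ultimately show ?thesis by simp
qed

text \<open>By Cauchy-Schwarz the change of \<open>d\<close> over one element is at most the square
  root of h times the integral of d'^2, and \<epsilon> times that integral is at most
  \<open>K\<close>. For an affine function the mean differs from any point value by no more than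
  this change.\<close>

lemma elem_mean_close:
  assumes h: "0 < h" and N: "real N * h = 2 * L" and L: "0 < L" and d: "d \<in> P1 (cell L h ` {..<N})"
    and \<epsilon>: "0 < \<epsilon>" and K: "\<epsilon> * integral {-L..L} (\<lambda>x. (deriv d x)\<^sup>2) \<le> K"
    and x: "x \<in> {-L..L} - node L h ` {..N}"
  shows "elem_mean (cell L h ` {..<N}) d x \<le> d x + sqrt (K * (h / \<epsilon>))"
proof -
  obtain i where i: "i < N" "x \<in> interior (cell L h i)" using cell_cover[OF h N] x by blast
  let ?a = "node L h i" and ?b = "node L h (Suc i)"
  have b: "?b = ?a + h" by (rule node_Suc)
  have lo: "-L \<le> ?a" using h by (simp add: node_def)
  have "real (Suc i) * h \<le> real N * h" using i(1) h by (intro mult_right_mono) auto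
  then have hi: "?b \<le> L" using N by (simp add: node_def)
  have i2: "(\<lambda>x. (deriv d x)\<^sup>2) absolutely_integrable_on {-L..L}"
    by (rule disc_energy_integrable(6)[OF h N L d d P1_deriv_P0[OF d]])
  have F: "(deriv d has_integral d ?b - d ?a) {?a..?b}" using lo hi b h by (intro P1_FTC[OF h N L d]) auto
  have "(integral {?a..?b} (deriv d))\<^sup>2 \<le> (?b - ?a) * integral {?a..?b} (\<lambda>x. (deriv d x)\<^sup>2)"
    using F absint_sub[OF i2 lo hi] b h by (intro cauchy_schwarz_integral) auto
  then have "(d ?b - d ?a)\<^sup>2 \<le> h * integral {?a..?b} (\<lambda>x. (deriv d x)\<^sup>2)"
    using integral_unique[OF F] b by simp
  also have "\<dots> \<le> h * integral {-L..L} (\<lambda>x. (deriv d x)\<^sup>2)"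
    using h lo hi absint_sub[OF i2, of "-L" L] absint_sub[OF i2 lo hi]
    by (intro mult_left_mono integral_subset_le) auto
  also have "\<dots> \<le> K * (h / \<epsilon>)"
    using K \<epsilon> h by (simp add: field_simps mult_left_mono)
  finally have osc: "\<bar>d ?b - d ?a\<bar> \<le> sqrt (K * (h / \<epsilon>))" by (rule real_le_rsqrt[of "\<bar>_\<bar>", simplified])
  have "cell L h i \<in> cell L h ` {..<N}" using i by blast
  from P1_deriv[OF d this] obtain p q where pq: "\<forall>y\<in>cell L h i. d y = p + q * y"
    by (elim exE conjE) (rule that)
  have xi: "?a \<le> x" "x \<le> ?b" using i(2) by auto
  have v: "d ?a = p + q * ?a" "d ?b = p + q * ?b" "d x = p + q * x" using pq xi h b by auto
  have "(d ?a + d ?b) / 2 - d x = q * ((?a + ?b) / 2 - x)" unfolding v by (simp add: field_simps)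
  also have "\<dots> \<le> \<bar>q\<bar> * \<bar>(?a + ?b) / 2 - x\<bar>" by (metis abs_ge_self abs_mult)
  also have "\<dots> \<le> \<bar>q\<bar> * h" using xi b h by (intro mult_left_mono) (auto simp: abs_le_iff field_simps)
  also have "\<dots> = \<bar>d ?b - d ?a\<bar>"
  proof -
    have "d ?b - d ?a = q * h" using v b by (simp add: algebra_simps)
    then show ?thesis using h by (simp add: abs_mult)
  qed
  finally show ?thesis using osc elem_mean_P1[OF h d i] by linarith
qed

lemma elem_mean_range:
  assumes h: "0 < h" and N: "real N * h = 2 * L" and d: "d \<in> P1 (cell L h ` {..<N})"
    and d01: "\<And>x. x \<in> {-L..L} \<Longrightarrow> 0 \<le> d x \<and> d x \<le> 1" and x: "x \<in> {-L..L} - node L h ` {..N}"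
  shows "0 \<le> elem_mean (cell L h ` {..<N}) d x" "elem_mean (cell L h ` {..<N}) d x \<le> 1"
proof -
  obtain i where i: "i < N" "x \<in> interior (cell L h i)" using cell_cover[OF h N] x by blast
  have "real (Suc i) * h \<le> real N * h" using i(1) h by (intro mult_right_mono) auto
  then have "node L h i \<in> {-L..L}" "node L h (Suc i) \<in> {-L..L}" using N h by (auto simp: node_def field_simps)
  then have "0 \<le> d (node L h i) \<and> d (node L h i) \<le> 1" "0 \<le> d (node L h (Suc i)) \<and> d (node L h (Suc i)) \<le> 1"
    using d01 by blast+
  then show "0 \<le> elem_mean (cell L h ` {..<N}) d x" "elem_mean (cell L h ` {..<N}) d x \<le> 1"
    unfolding elem_mean_P1[OF h d i] by auto
qed

text \<open>Completing the square: the gap is ((Gc + t) m - t)^2 / (Gc + t), so the optimal damage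
  is t / (Gc + t). With t = \<open>\<sigma>c\<close> r the left side is phi(r).\<close>

lemma cohesive_min:
  assumes "0 < Gc" "0 \<le> t"
  shows "Gc * t / (Gc + t) \<le> Gc * m\<^sup>2 + (1 - m)\<^sup>2 * (t::real)"
proof -
  have pos: "0 < Gc + t" using assms by simp
  have "Gc * m\<^sup>2 + (1 - m)\<^sup>2 * t - Gc * t / (Gc + t) = ((Gc + t) * m - t)\<^sup>2 / (Gc + t)"
    using pos by (simp add: field_simps power2_eq_square)
  moreover have "0 \<le> ((Gc + t) * m - t)\<^sup>2 / (Gc + t)" using pos by simp
  ultimately show ?thesis by linarith
qed

text \<open>The maximum point \<open>z\<close> of the damage serves both terms: its value bounds the
  degradation factor from below on the whole block and is the height that the phase-field term has
  to climb. \<open>cohesive_min\<close> removes the unknown height.\<close>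

lemma cohesive_block:
  assumes h: "0 < h" and N: "real N * h = 2 * L" and L: "0 < L" and d: "d \<in> P1 (cell L h ` {..<N})"
    and \<epsilon>: "0 < \<epsilon>" and K: "\<epsilon> * integral {-L..L} (\<lambda>x. (deriv d x)\<^sup>2) \<le> K"
    and d01: "\<And>x. x \<in> {-L..L} \<Longrightarrow> 0 \<le> d x \<and> d x \<le> 1"
    and \<eta>: "\<eta> \<in> P0 (cell L h ` {..<N})" and \<eta>0: "\<And>x. x \<in> {-L..L} \<Longrightarrow> 0 \<le> \<eta> x"
    and pos: "0 < \<sigma>c" "0 < Gc" and ab: "-L \<le> a" "a \<le> b" "b \<le> L"
  defines "r \<equiv> integral {a..b} \<eta>"
  shows "Gc * \<sigma>c * r / (Gc + \<sigma>c * r) - 2 * sqrt (K * (h / \<epsilon>)) * \<sigma>c * r - Gc / 2 * ((d a)\<^sup>2 + (d b)\<^sup>2)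
    \<le> integral {a..b} (\<lambda>x. degr (elem_mean (cell L h ` {..<N}) d x) * \<sigma>c * \<eta> x)
      + Gc / 2 * integral {a..b} (\<lambda>x. 1 / \<epsilon> * (d x)\<^sup>2 + \<epsilon> * (deriv d x)\<^sup>2)"
proof -
  let ?m = "elem_mean (cell L h ` {..<N}) d" and ?\<omega> = "sqrt (K * (h / \<epsilon>))"
  have i2: "(\<lambda>x. (deriv d x)\<^sup>2) absolutely_integrable_on {-L..L}"
    by (rule disc_energy_integrable(6)[OF h N L d d P1_deriv_P0[OF d]])
  have "0 \<le> integral {-L..L} (\<lambda>x. (deriv d x)\<^sup>2)"
    by (rule integral_nonneg[OF absint_sub[OF i2]]) auto
  then have "0 \<le> K" using K \<epsilon> by (meson dual_order.trans less_imp_le mult_nonneg_nonneg)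
  then have \<omega>0: "0 \<le> ?\<omega>" using h \<epsilon> by simp
  have "continuous_on {a..b} d" using P1_continuous[OF h N L d] ab by (auto intro: continuous_on_subset)
  then obtain z where z: "z \<in> {a..b}" "\<And>x. x \<in> {a..b} \<Longrightarrow> d x \<le> d z"
    using continuous_attains_sup[of "{a..b}" d] ab by auto
  have dz: "0 \<le> d z" "d z \<le> 1" using d01[of z] z ab by auto
  \<comment> \<open>A lower bound for the degradation factor. Passing from the element mean to the
    maximum costs at most twice the oscillation bound, since 2 minus both values is at most
    2.\<close>
  define \<kappa> where "\<kappa> = (1 - d z)\<^sup>2 - 2 * ?\<omega>"
  have low: "\<kappa> * \<sigma>c * \<eta> x \<le> degr (?m x) * \<sigma>c * \<eta> x" if x: "x \<in> {a..b} - node L h ` {..N}" for x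
  proof -
    have xI: "x \<in> {-L..L} - node L h ` {..N}" using x ab by auto
    have m: "?m x \<le> d z + ?\<omega>" "0 \<le> ?m x" "?m x \<le> 1"
      using elem_mean_close[OF h N L d \<epsilon> K xI] z(2)[of x] x elem_mean_range[OF h N d d01 xI] by auto
    have "\<kappa> \<le> (1 - ?m x)\<^sup>2"
    proof (cases "?m x \<le> d z")
      case True
      then have "(1 - d z)\<^sup>2 \<le> (1 - ?m x)\<^sup>2" using dz by (intro power_mono) auto
      then show ?thesis using \<omega>0 unfolding \<kappa>_def by linarith
    next
      case False
      have "(1 - d z)\<^sup>2 - (1 - ?m x)\<^sup>2 = (?m x - d z) * (2 - d z - ?m x)"
        by (simp add: power2_eq_square algebra_simps)
      also have "\<dots> \<le> ?\<omega> * 2" using False m dz \<omega>0 by (intro mult_mono) auto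
      finally show ?thesis by (simp add: \<kappa>_def)
    qed
    then show ?thesis using \<eta>0[of x] xI pos by (auto simp: degr_def intro!: mult_right_mono)
  qed
  have \<eta>i: "\<eta> integrable_on {a..b}" using P0_integrable[OF h N \<eta>] ab by (intro absint_sub) auto
  have r0: "0 \<le> r" unfolding r_def using \<eta>i \<eta>0 ab by (intro integral_nonneg) auto
  have "\<kappa> * \<sigma>c * r \<le> integral {a..b} (\<lambda>x. degr (?m x) * \<sigma>c * \<eta> x)"
  proof -
    let ?f = "\<lambda>x. degr (?m x) * \<sigma>c * \<eta> x"
    \<comment> \<open>The comparison \<open>low\<close> is established off the nodes, so the
      integrand is altered on this null set before integrating.\<close>
    let ?g = "\<lambda>x. if x \<in> node L h ` {..N} then \<kappa> * \<sigma>c * \<eta> x else ?f x"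
    have neg: "negligible (node L h ` {..N})" by (intro negligible_finite) auto
    have fi: "?f integrable_on {a..b}"
      using disc_energy_integrable(3)[OF h N L d d \<eta>] ab by (intro absint_sub) auto
    have gi: "?g integrable_on {a..b}" by (rule integrable_spike[OF fi neg]) auto
    have ki: "(\<lambda>x. \<kappa> * \<sigma>c * \<eta> x) integrable_on {a..b}" using integrable_on_cmult_left[OF \<eta>i] by simp
    have "\<kappa> * \<sigma>c * r = integral {a..b} (\<lambda>x. \<kappa> * \<sigma>c * \<eta> x)"
      unfolding r_def by (rule Henstock_Kurzweil_Integration.integral_mult_right[symmetric])
    also have "\<dots> \<le> integral {a..b} ?g"
      by (rule integral_le[OF ki gi]) (use low in auto)
    also have "\<dots> = integral {a..b} ?f" by (rule integral_spike[OF neg]) auto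
    finally show ?thesis .
  qed
  moreover have "2 * (d z)\<^sup>2 - (d a)\<^sup>2 - (d b)\<^sup>2 \<le> integral {a..b} (\<lambda>x. 1 / \<epsilon> * (d x)\<^sup>2 + \<epsilon> * (deriv d x)\<^sup>2)"
    using ab z(1) by (intro phase_field_block[OF h N L d _ _ _ _ \<epsilon>]) auto
  then have "Gc / 2 * (2 * (d z)\<^sup>2 - (d a)\<^sup>2 - (d b)\<^sup>2) \<le> Gc / 2 * integral {a..b} (\<lambda>x. 1 / \<epsilon> * (d x)\<^sup>2 + \<epsilon> * (deriv d x)\<^sup>2)"
    using pos by (intro mult_left_mono) auto
  moreover have "Gc * (\<sigma>c * r) / (Gc + \<sigma>c * r) \<le> Gc * (d z)\<^sup>2 + (1 - d z)\<^sup>2 * (\<sigma>c * r)"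
    using pos r0 by (intro cohesive_min) auto
  ultimately show ?thesis by (simp add: \<kappa>_def algebra_simps)
qed

section \<open>Summation over a partition and passage to the limit\<close>

lemma integral_partition:
  fixes f :: "real \<Rightarrow> real"
  assumes "\<And>k. k < m \<Longrightarrow> t k \<le> t (Suc k)" "f integrable_on {t 0..t m}"
  shows "integral {t 0..t m} f = (\<Sum>k<m. integral {t k..t (Suc k)} f)"
  using assms
proof (induction m)
  case (Suc m)
  have mono: "t 0 \<le> t m" using Suc.prems(1) by (intro dec_induct[of 0 m "\<lambda>k. t 0 \<le> t k"])
    (auto, metis Suc.prems(1) less_Suc_eq order_trans)
  have "f integrable_on {t 0..t m}"
    by (rule integrable_on_subinterval[OF Suc.prems(2)]) (use Suc.prems(1)[of m] in auto)
  then have "integral {t 0..t m} f = (\<Sum>k<m. integral {t k..t (Suc k)} f)"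
    using Suc by auto
  moreover have "integral {t 0..t m} f + integral {t m..t (Suc m)} f = integral {t 0..t (Suc m)} f"
    by (rule Henstock_Kurzweil_Integration.integral_combine) (use mono Suc.prems in auto)
  ultimately show ?case by simp
qed simp

lemma partition_range:
  fixes t :: "nat \<Rightarrow> real"
  assumes "\<And>k. k < m \<Longrightarrow> t k \<le> t (Suc k)" "i \<le> j" "j \<le> m"
  shows "t i \<le> t j"
  using assms(2,3)
proof (induction j rule: dec_induct)
  case (step n) then show ?case using assms(1)[of n] by simp
qed simp

text \<open>Neither the grid of step \<tau> nor the partition \<open>t\<close> depends on the mesh.
  The left side involves only finitely many increments and point values, which are exactly the
  quantities that converge. The elastic part is Cauchy-Schwarz on each grid cell.\<close>

lemma disc_energy_lower:
  assumes h: "0 < h" and N: "real N * h = 2 * L" and L: "0 < L"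
    and u: "u \<in> P1 (cell L h ` {..<N})" and d: "d \<in> P1 (cell L h ` {..<N})"
    and \<epsilon>: "0 < \<epsilon>" and K: "\<epsilon> * integral {-L..L} (\<lambda>x. (deriv d x)\<^sup>2) \<le> K"
    and d01: "\<And>x. x \<in> {-L..L} \<Longrightarrow> 0 \<le> d x \<and> d x \<le> 1"
    and \<eta>: "\<eta> \<in> P0 (cell L h ` {..<N})" and \<eta>0: "\<And>x. x \<in> {-L..L} \<Longrightarrow> 0 \<le> \<eta> x"
    and pos: "0 < E0" "0 < \<sigma>c" "0 < Gc"
    and t: "t 0 = -L" "t m = L" "\<And>k. k < m \<Longrightarrow> t k \<le> t (Suc k)"
    and \<tau>: "0 < \<tau>" "real J * \<tau> = 2 * L"
  defines "E \<equiv> \<lambda>x. integral {-L..x} (\<lambda>y. deriv u y - \<eta> y)"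
    and "r \<equiv> \<lambda>k. integral {t k..t (Suc k)} \<eta>"
  shows "1/2 * E0 * (\<Sum>k<J. (E (node L \<tau> (Suc k)) - E (node L \<tau> k))\<^sup>2 / \<tau>)
    + (\<Sum>k<m. Gc * \<sigma>c * r k / (Gc + \<sigma>c * r k) - 2 * sqrt (K * (h / \<epsilon>)) * \<sigma>c * r k - Gc / 2 * ((d (t k))\<^sup>2 + (d (t (Suc k)))\<^sup>2))
    \<le> disc_energy L E0 \<sigma>c Gc \<epsilon> (cell L h ` {..<N}) u d \<eta>"
proof -
  note DI = disc_energy_integrable[OF h N L u d \<eta>]
  let ?e = "\<lambda>y. deriv u y - \<eta> y"
  have nJ: "node L \<tau> J = L" using \<tau> by (simp add: node_def)
  have ndI: "-L \<le> node L \<tau> k" "node L \<tau> k \<le> L" if "k \<le> J" for k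
  proof -
    show "-L \<le> node L \<tau> k" using \<tau>(1) by (simp add: node_def)
    have "node L \<tau> k \<le> node L \<tau> J" using node_le[OF \<tau>(1)] that by blast
    then show "node L \<tau> k \<le> L" unfolding nJ .
  qed
  have "(\<Sum>k<J. (E (node L \<tau> (Suc k)) - E (node L \<tau> k))\<^sup>2 / \<tau>) \<le> (\<Sum>k<J. integral {node L \<tau> k..node L \<tau> (Suc k)} (\<lambda>x. (?e x)\<^sup>2))"
  proof (rule sum_mono)
    fix k assume "k \<in> {..<J}"
    then have k: "-L \<le> node L \<tau> k" "node L \<tau> (Suc k) \<le> L" "node L \<tau> k \<le> node L \<tau> (Suc k)"
      using ndI[of k] ndI[of "Suc k"] node_le[OF \<tau>(1)] by auto
    have "E (node L \<tau> k) + integral {node L \<tau> k..node L \<tau> (Suc k)} ?e = E (node L \<tau> (Suc k))"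
      unfolding E_def using k by (intro Henstock_Kurzweil_Integration.integral_combine absint_sub[OF DI(1)]) auto
    moreover have "(integral {node L \<tau> k..node L \<tau> (Suc k)} ?e)\<^sup>2 \<le> (node L \<tau> (Suc k) - node L \<tau> k) * integral {node L \<tau> k..node L \<tau> (Suc k)} (\<lambda>x. (?e x)\<^sup>2)"
      using k by (intro cauchy_schwarz_integral absint_sub[OF DI(1)] absint_sub[OF DI(2)]) auto
    ultimately have "(E (node L \<tau> (Suc k)) - E (node L \<tau> k))\<^sup>2 \<le> \<tau> * integral {node L \<tau> k..node L \<tau> (Suc k)} (\<lambda>x. (?e x)\<^sup>2)"
      by (simp add: node_Suc) (metis add_diff_cancel_left')
    then show "(E (node L \<tau> (Suc k)) - E (node L \<tau> k))\<^sup>2 / \<tau> \<le> integral {node L \<tau> k..node L \<tau> (Suc k)} (\<lambda>x. (?e x)\<^sup>2)"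
      using \<tau>(1) by (simp add: divide_le_eq mult.commute)
  qed
  also have "\<dots> = integral {node L \<tau> 0..node L \<tau> J} (\<lambda>x. (?e x)\<^sup>2)"
    using absint_sub[OF DI(2), of "-L" L] node_le[OF \<tau>(1)] nJ
    by (intro integral_partition[symmetric]) (auto simp: node_0)
  also have "\<dots> = integral {-L..L} (\<lambda>x. (?e x)\<^sup>2)" by (simp add: node_0 nJ)
  finally have "1/2 * E0 * (\<Sum>k<J. (E (node L \<tau> (Suc k)) - E (node L \<tau> k))\<^sup>2 / \<tau>) \<le> 1/2 * E0 * integral {-L..L} (\<lambda>x. (?e x)\<^sup>2)"
    using pos by (intro mult_left_mono) auto
  also have "\<dots> = integral {-L..L} (\<lambda>x. 1/2 * E0 * (?e x)\<^sup>2)"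
    by (rule Henstock_Kurzweil_Integration.integral_mult_right[symmetric])
  finally have 1: "1/2 * E0 * (\<Sum>k<J. (E (node L \<tau> (Suc k)) - E (node L \<tau> k))\<^sup>2 / \<tau>) \<le> integral {-L..L} (\<lambda>x. 1/2 * E0 * (?e x)\<^sup>2)" .
  let ?A = "\<lambda>x. degr (elem_mean (cell L h ` {..<N}) d x) * \<sigma>c * \<eta> x"
  let ?B = "\<lambda>x. 1 / \<epsilon> * (d x)\<^sup>2 + \<epsilon> * (deriv d x)\<^sup>2"
  have "(\<Sum>k<m. Gc * \<sigma>c * r k / (Gc + \<sigma>c * r k) - 2 * sqrt (K * (h / \<epsilon>)) * \<sigma>c * r k - Gc / 2 * ((d (t k))\<^sup>2 + (d (t (Suc k)))\<^sup>2))
    \<le> (\<Sum>k<m. integral {t k..t (Suc k)} ?A + Gc / 2 * integral {t k..t (Suc k)} ?B)"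
  proof (rule sum_mono)
    fix k assume k: "k \<in> {..<m}"
    have "-L \<le> t k" "t (Suc k) \<le> L"
      using partition_range[of m t 0 k, OF t(3)] partition_range[of m t "Suc k" m, OF t(3)] k t(1,2) by auto
    then show "Gc * \<sigma>c * r k / (Gc + \<sigma>c * r k) - 2 * sqrt (K * (h / \<epsilon>)) * \<sigma>c * r k - Gc / 2 * ((d (t k))\<^sup>2 + (d (t (Suc k)))\<^sup>2)
      \<le> integral {t k..t (Suc k)} ?A + Gc / 2 * integral {t k..t (Suc k)} ?B"
      unfolding r_def using k t(3) pos by (intro cohesive_block[OF h N L d \<epsilon> K d01 \<eta> \<eta>0]) auto
  qed
  also have "\<dots> = integral {t 0..t m} ?A + Gc / 2 * integral {t 0..t m} ?B"
  proof -
    have A: "integral {t 0..t m} ?A = (\<Sum>k<m. integral {t k..t (Suc k)} ?A)"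
      by (rule integral_partition[where t=t and m=m, OF t(3)]) (auto simp: t(1,2) intro!: absint_sub[OF DI(3)])
    have B: "integral {t 0..t m} ?B = (\<Sum>k<m. integral {t k..t (Suc k)} ?B)"
      by (rule integral_partition[where t=t and m=m, OF t(3)]) (use absint_sub[OF DI(4), of "-L" L \<epsilon>] in \<open>auto simp: t(1,2)\<close>)
    show ?thesis unfolding A B sum.distrib sum_distrib_left ..
  qed
  finally show ?thesis unfolding disc_energy_def using 1 t by simp
qed

text \<open>The displacement is g(-L) plus the elastic primitive \<open>En\<close> plus the plastic
  primitive \<open>Nn\<close>. Arzela-Ascoli gives a uniform limit \<open>E\<close> of the former
  along a subsequence; the limit of the latter is then forced to be u - g(-L) - E almost everywhere.
  It inherits monotonicity and defines \<nu>.\<close>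

lemma liminf_core:
  fixes h \<epsilon> \<Lambda>' :: "nat \<Rightarrow> real" and N :: "nat \<Rightarrow> nat" and v d \<eta> :: "nat \<Rightarrow> real \<Rightarrow> real"
  assumes L: "0 < L" and pos: "0 < E0" "0 < \<sigma>c" "0 < Gc"
    and h: "\<And>n. 0 < h n" and N: "\<And>n. real (N n) * h n = 2 * L" and \<epsilon>: "\<And>n. 0 < \<epsilon> n"
    and \<epsilon>0: "\<epsilon> \<longlonglongrightarrow> 0" and h\<epsilon>: "(\<lambda>n. h n / \<epsilon> n) \<longlonglongrightarrow> 0"
    and adm: "\<And>n. admissible L g (cell L (h n) ` {..<N n}) (v n) (d n)"
    and \<eta>: "\<And>n. \<eta> n \<in> P0 (cell L (h n) ` {..<N n})" and \<eta>0: "\<And>n x. x \<in> {-L..L} \<Longrightarrow> 0 \<le> \<eta> n x"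
    and en: "\<And>n. disc_energy L E0 \<sigma>c Gc (\<epsilon> n) (cell L (h n) ` {..<N n}) (v n) (d n) (\<eta> n) \<le> \<Lambda>' n"
    and \<Lambda>: "\<Lambda>' \<longlonglongrightarrow> \<Lambda>"
    and conv: "AE x in lebesgue. x \<in> {-L..L} \<longrightarrow> (\<lambda>n. v n x) \<longlonglongrightarrow> u x"
  obtains e \<nu> q where "represents L g u e \<nu>" "strict_mono (q :: nat \<Rightarrow> nat)"
    "AE x in lebesgue. x \<in> {-L..L} \<longrightarrow> (\<lambda>n. d (q n) x) \<longlonglongrightarrow> 0"
    "(\<integral>\<^sup>+x\<in>{-L..L}. ennreal (1/2 * E0 * (e x)\<^sup>2) \<partial>lebesgue) + cohesive \<sigma>c Gc \<nu> \<le> ennreal \<Lambda>"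
proof -
  define TT where "TT n = cell L (h n) ` {..<N n}" for n
  have vP: "v n \<in> P1 (cell L (h n) ` {..<N n})" and dP: "d n \<in> P1 (cell L (h n) ` {..<N n})"
    and d01: "\<And>x. x \<in> {-L..L} \<Longrightarrow> 0 \<le> d n x \<and> d n x \<le> 1"
    and vb: "v n (-L) = g (-L)" "v n L = g L" and db: "d n (-L) = 0" "d n L = 0" for n
    using adm[of n] by (auto simp: admissible_def)
  have DI: "(\<lambda>x. deriv (v n) x - \<eta> n x) absolutely_integrable_on {-L..L}"
    "(\<lambda>x. (deriv (v n) x - \<eta> n x)\<^sup>2) absolutely_integrable_on {-L..L}"
    "(\<lambda>x. degr (elem_mean (cell L (h n) ` {..<N n}) (d n) x) * \<sigma>c * \<eta> n x) absolutely_integrable_on {-L..L}"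
    "(\<lambda>x. 1 / \<epsilon> n * (d n x)\<^sup>2 + \<epsilon> n * (deriv (d n) x)\<^sup>2) absolutely_integrable_on {-L..L}"
    "(\<lambda>x. (d n x)\<^sup>2) absolutely_integrable_on {-L..L}" "(\<lambda>x. (deriv (d n) x)\<^sup>2) absolutely_integrable_on {-L..L}" for n
    by (rule disc_energy_integrable[OF h N L vP dP \<eta>])+
  define en where "en n x = deriv (v n) x - \<eta> n x" for n x
  have eni: "(\<lambda>x. (en n x)\<^sup>2) absolutely_integrable_on {-L..L}" "en n absolutely_integrable_on {-L..L}" for n
    using DI(1,2)[of n] by (simp_all add: en_def[abs_def])
  obtain C where C: "\<And>n. \<Lambda>' n \<le> C" "0 \<le> C"
  proof -
    have "Bseq \<Lambda>'" using \<Lambda> by (rule convergent_imp_Bseq[OF convergentI])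
    then obtain C where "0 < C" "\<And>n. norm (\<Lambda>' n) \<le> C" by (auto simp: Bseq_def)
    then show ?thesis using that[of C] by (auto simp: abs_le_iff)
  qed
  have nn: "0 \<le> integral {-L..L} f" if "f absolutely_integrable_on {-L..L}" "\<And>x. x \<in> {-L..L} \<Longrightarrow> 0 \<le> f x" for f :: "real \<Rightarrow> real"
    by (rule nn_integral_integral_on(2)[OF that])
  have parts: "1/2 * E0 * integral {-L..L} (\<lambda>x. (en n x)\<^sup>2) \<le> C"
    "Gc / 2 * integral {-L..L} (\<lambda>x. 1 / \<epsilon> n * (d n x)\<^sup>2 + \<epsilon> n * (deriv (d n) x)\<^sup>2) \<le> C" for n
  proof -
    have 1: "0 \<le> 1/2 * E0 * integral {-L..L} (\<lambda>x. (en n x)\<^sup>2)"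
      using nn[OF eni(1)[of n]] pos by simp
    have 2: "0 \<le> integral {-L..L} (\<lambda>x. degr (elem_mean (cell L (h n) ` {..<N n}) (d n) x) * \<sigma>c * \<eta> n x)"
      using nn[OF DI(3)[of n]] \<eta>0 pos by (simp add: degr_def)
    have 3: "0 \<le> Gc / 2 * integral {-L..L} (\<lambda>x. 1 / \<epsilon> n * (d n x)\<^sup>2 + \<epsilon> n * (deriv (d n) x)\<^sup>2)"
      using nn[OF DI(4)[of n]] pos \<epsilon>[of n] by (intro mult_nonneg_nonneg) auto
    have "integral {-L..L} (\<lambda>x. 1/2 * E0 * (en n x)\<^sup>2) = 1/2 * E0 * integral {-L..L} (\<lambda>x. (en n x)\<^sup>2)"
      by (rule Henstock_Kurzweil_Integration.integral_mult_right)
    then have "1/2 * E0 * integral {-L..L} (\<lambda>x. (en n x)\<^sup>2) +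
       integral {-L..L} (\<lambda>x. degr (elem_mean (cell L (h n) ` {..<N n}) (d n) x) * \<sigma>c * \<eta> n x) +
       Gc / 2 * integral {-L..L} (\<lambda>x. 1 / \<epsilon> n * (d n x)\<^sup>2 + \<epsilon> n * (deriv (d n) x)\<^sup>2) \<le> C"
      using en[of n] C(1)[of n] unfolding disc_energy_def en_def by linarith
    then show "1/2 * E0 * integral {-L..L} (\<lambda>x. (en n x)\<^sup>2) \<le> C"
      "Gc / 2 * integral {-L..L} (\<lambda>x. 1 / \<epsilon> n * (d n x)\<^sup>2 + \<epsilon> n * (deriv (d n) x)\<^sup>2) \<le> C"
      using 1 2 3 by linarith+
  qed
  \<comment> \<open>\<open>Q\<close> bounds the squared L2 norms of the elastic strains and
    \<open>K\<close> below bounds both halves of the phase-field term; each comes from dividing the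
    energy bound \<open>C\<close> by its prefactor.\<close>
  define Q where "Q = 2 * C / E0"
  have Q: "integral {-L..L} (\<lambda>x. (en n x)\<^sup>2) \<le> Q" "0 \<le> Q" for n
    using parts(1)[of n] pos C(2) by (auto simp: Q_def field_simps)
  define K where "K = 2 * C / Gc"
  have K0: "0 \<le> K" using C(2) pos by (simp add: K_def)
  have dsplit: "integral {-L..L} (\<lambda>x. 1 / \<epsilon> n * (d n x)\<^sup>2 + \<epsilon> n * (deriv (d n) x)\<^sup>2)
      = 1 / \<epsilon> n * integral {-L..L} (\<lambda>x. (d n x)\<^sup>2) + \<epsilon> n * integral {-L..L} (\<lambda>x. (deriv (d n) x)\<^sup>2)" for n
  proof -
    have i: "(\<lambda>x. 1 / \<epsilon> n * (d n x)\<^sup>2) integrable_on {-L..L}" "(\<lambda>x. \<epsilon> n * (deriv (d n) x)\<^sup>2) integrable_on {-L..L}"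
      using DI(5,6)[of n] by (auto intro!: set_lebesgue_integral_eq_integral(1))
    show ?thesis unfolding Henstock_Kurzweil_Integration.integral_add[OF i]
      Henstock_Kurzweil_Integration.integral_mult_right ..
  qed
  have dK: "1 / \<epsilon> n * integral {-L..L} (\<lambda>x. (d n x)\<^sup>2) \<le> K" "\<epsilon> n * integral {-L..L} (\<lambda>x. (deriv (d n) x)\<^sup>2) \<le> K" for n
  proof -
    have "1 / \<epsilon> n * integral {-L..L} (\<lambda>x. (d n x)\<^sup>2) + \<epsilon> n * integral {-L..L} (\<lambda>x. (deriv (d n) x)\<^sup>2) \<le> K"
      using parts(2)[of n] pos unfolding dsplit K_def by (simp add: field_simps)
    moreover have "0 \<le> 1 / \<epsilon> n * integral {-L..L} (\<lambda>x. (d n x)\<^sup>2)"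
      using nn[OF DI(5)[of n]] \<epsilon>[of n] by simp
    moreover have "0 \<le> \<epsilon> n * integral {-L..L} (\<lambda>x. (deriv (d n) x)\<^sup>2)"
      using nn[OF DI(6)[of n]] \<epsilon>[of n] by simp
    ultimately show "1 / \<epsilon> n * integral {-L..L} (\<lambda>x. (d n x)\<^sup>2) \<le> K"
      "\<epsilon> n * integral {-L..L} (\<lambda>x. (deriv (d n) x)\<^sup>2) \<le> K" by linarith+
  qed
  define En where "En n x = integral {-L..x} (en n)" for n x
  have Ediff: "En n x + integral {x..y} (en n) = En n y" if "-L \<le> x" "x \<le> y" "y \<le> L" for n x y
    unfolding En_def using that by (intro Henstock_Kurzweil_Integration.integral_combine absint_sub[OF eni(2)]) auto
  have holder: "(En n y - En n x)\<^sup>2 \<le> (y - x) * Q" if "-L \<le> x" "x \<le> y" "y \<le> L" for n x y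
  proof -
    have "(integral {x..y} (en n))\<^sup>2 \<le> (y - x) * integral {x..y} (\<lambda>z. (en n z)\<^sup>2)"
      using that by (intro cauchy_schwarz_integral absint_sub[OF eni(1)] absint_sub[OF eni(2)]) auto
    also have "\<dots> \<le> (y - x) * integral {-L..L} (\<lambda>z. (en n z)\<^sup>2)"
      using that by (intro mult_left_mono integral_subset_le absint_sub[OF eni(1)]) auto
    also have "\<dots> \<le> (y - x) * Q" using that Q by (intro mult_left_mono) auto
    finally show ?thesis using Ediff[OF that, of n] by (metis add_diff_cancel_left')
  qed
  have holder': "\<bar>En n x - En n y\<bar> \<le> sqrt (\<bar>x - y\<bar> * Q)" if "x \<in> {-L..L}" "y \<in> {-L..L}" for n x y
  proof -
    have "(En n x - En n y)\<^sup>2 \<le> \<bar>x - y\<bar> * Q"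
    proof (cases "x \<le> y")
      case True then show ?thesis using holder[of x y n] that by (simp add: power2_commute)
    next
      case False then show ?thesis using holder[of y x n] that by simp
    qed
    then have "sqrt ((En n x - En n y)\<^sup>2) \<le> sqrt (\<bar>x - y\<bar> * Q)" by (rule real_sqrt_le_mono)
    then show ?thesis by simp
  qed
  have EnL: "En n (-L) = 0" for n by (simp add: En_def)
  obtain E k where E: "continuous_on {-L..L} E" "strict_mono (k :: nat \<Rightarrow> nat)"
    "\<And>\<delta>. 0 < \<delta> \<Longrightarrow> \<exists>N. \<forall>n x. n \<ge> N \<and> x \<in> {-L..L} \<longrightarrow> norm (En (k n) x - E x) < \<delta>"
  proof (rule Arzela_Ascoli[of "{-L..L}" En "sqrt (2 * L * Q)"])
    show "norm (En n x) \<le> sqrt (2 * L * Q)" if "x \<in> {-L..L}" for n x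
    proof -
      have "\<bar>En n x\<bar> \<le> sqrt (\<bar>x - - L\<bar> * Q)" using holder'[OF that, of "-L" n] L EnL by simp
      also have "\<dots> \<le> sqrt (2 * L * Q)" using that Q(2) by (intro real_sqrt_le_mono mult_right_mono) auto
      finally show ?thesis by simp
    qed
    fix x \<delta> :: real assume x: "x \<in> {-L..L}" and \<delta>: "0 < \<delta>"
    show "\<exists>\<rho>. 0 < \<rho> \<and> (\<forall>n y. y \<in> {-L..L} \<and> norm (x - y) < \<rho> \<longrightarrow> norm (En n x - En n y) < \<delta>)"
    proof (intro exI conjI allI impI)
      show "0 < \<delta>\<^sup>2 / (Q + 1)" using \<delta> Q(2) by simp
      fix n y assume y: "y \<in> {-L..L} \<and> norm (x - y) < \<delta>\<^sup>2 / (Q + 1)"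
      have "\<bar>x - y\<bar> * Q \<le> \<bar>x - y\<bar> * (Q + 1)" by (simp add: mult_left_mono)
      also have "\<dots> < \<delta>\<^sup>2" using y Q(2) by (simp add: field_simps)
      finally have "sqrt (\<bar>x - y\<bar> * Q) < \<delta>" using \<delta> by (simp add: real_less_lsqrt)
      then show "norm (En n x - En n y) < \<delta>" using holder'[OF x, of y n] y by simp
    qed
  qed (simp, blast)
  have Elim: "(\<lambda>n. En (k n) x) \<longlonglongrightarrow> E x" if "x \<in> {-L..L}" for x
    unfolding LIMSEQ_iff using E(3) that by blast
  have \<epsilon>k: "(\<lambda>n. \<epsilon> (k n)) \<longlonglongrightarrow> 0" using LIMSEQ_subseq_LIMSEQ[OF \<epsilon>0 E(2)] by (simp add: o_def)
  \<comment> \<open>The integral of the squared damage is at most \<open>K\<close> times \<epsilon>,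
    hence tends to 0, which gives a.e. convergence along a further subsequence.\<close>
  have "\<exists>r::nat\<Rightarrow>nat. strict_mono r \<and> (AE x in lebesgue. (\<lambda>n. indicator {-L..L} x *\<^sub>R (d (k (r n)) x)\<^sup>2) \<longlonglongrightarrow> 0)"
  proof (rule tendsto_L1_AE_subseq)
    show "integrable lebesgue (\<lambda>x. indicator {-L..L} x *\<^sub>R (d (k n) x)\<^sup>2)" for n
      using DI(5)[of "k n"] by (simp add: set_integrable_def)
    have eq: "(\<integral>x. norm (indicator {-L..L} x *\<^sub>R (d (k n) x)\<^sup>2) \<partial>lebesgue) = integral {-L..L} (\<lambda>x. (d (k n) x)\<^sup>2)" for n
    proof -
      have "(\<integral>x. norm (indicator {-L..L} x *\<^sub>R (d (k n) x)\<^sup>2) \<partial>lebesgue) = (LINT x:{-L..L}|lebesgue. (d (k n) x)\<^sup>2)"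
        unfolding set_lebesgue_integral_def by (intro Bochner_Integration.integral_cong) (auto simp: indicator_def)
      then show ?thesis using set_lebesgue_integral_eq_integral(2)[OF DI(5)[of "k n"]] by simp
    qed
    show "(\<lambda>n. \<integral>x. norm (indicator {-L..L} x *\<^sub>R (d (k n) x)\<^sup>2) \<partial>lebesgue) \<longlonglongrightarrow> 0"
      unfolding eq
    proof (rule tendsto_sandwich[of "\<lambda>_. 0" _ _ "\<lambda>n. K * \<epsilon> (k n)"])
      have "0 \<le> integral {-L..L} (\<lambda>x. (d (k n) x)\<^sup>2)" for n using nn[OF DI(5)[of "k n"]] by simp
      then show "\<forall>\<^sub>F n in sequentially. 0 \<le> integral {-L..L} (\<lambda>x. (d (k n) x)\<^sup>2)" by simp
      have "integral {-L..L} (\<lambda>x. (d (k n) x)\<^sup>2) \<le> K * \<epsilon> (k n)" for n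
        using dK(1)[of "k n"] \<epsilon>[of "k n"] by (simp add: field_simps)
      then show "\<forall>\<^sub>F n in sequentially. integral {-L..L} (\<lambda>x. (d (k n) x)\<^sup>2) \<le> K * \<epsilon> (k n)" by simp
      show "(\<lambda>n. K * \<epsilon> (k n)) \<longlonglongrightarrow> 0" using tendsto_mult_left[OF \<epsilon>k, of K] by simp
    qed simp
  qed
  then obtain r where r: "strict_mono (r :: nat \<Rightarrow> nat)"
    and rAE: "AE x in lebesgue. (\<lambda>n. indicator {-L..L} x *\<^sub>R (d (k (r n)) x)\<^sup>2) \<longlonglongrightarrow> 0" by blast
  define q where "q n = k (r n)" for n
  have q: "strict_mono q" unfolding q_def using E(2) r by (simp add: strict_mono_def)
  have qlim: "(\<lambda>n. X (q n)) \<longlonglongrightarrow> l" if "X \<longlonglongrightarrow> l" for X :: "nat \<Rightarrow> real" and l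
    using LIMSEQ_subseq_LIMSEQ[OF that q] by (simp add: o_def)
  have Eq: "(\<lambda>n. En (q n) x) \<longlonglongrightarrow> E x" if "x \<in> {-L..L}" for x
    using LIMSEQ_subseq_LIMSEQ[OF Elim[OF that] r] by (simp add: o_def q_def)
  have dq: "AE x in lebesgue. x \<in> {-L..L} \<longrightarrow> (\<lambda>n. d (q n) x) \<longlonglongrightarrow> 0"
    using rAE
  proof eventually_elim
    case (elim x)
    show ?case
    proof
      assume "x \<in> {-L..L}"
      then have "(\<lambda>n. (d (q n) x)\<^sup>2) \<longlonglongrightarrow> 0" using elim by (simp add: q_def)
      then have "(\<lambda>n. sqrt ((d (q n) x)\<^sup>2)) \<longlonglongrightarrow> sqrt 0" by (rule tendsto_real_sqrt)
      then show "(\<lambda>n. d (q n) x) \<longlonglongrightarrow> 0" by (simp add: tendsto_rabs_zero_iff)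
    qed
  qed
  define D where "D = {x \<in> {-L..L}. (\<lambda>n. v n x) \<longlonglongrightarrow> u x \<and> (\<lambda>n. d (q n) x) \<longlonglongrightarrow> 0}"
  have D: "AE x in lebesgue. x \<in> {-L..L} \<longrightarrow> x \<in> D"
    using conv dq by eventually_elim (auto simp: D_def)
  define Nn where "Nn n x = integral {-L..x} (\<eta> n)" for n x
  have \<eta>i: "\<eta> n absolutely_integrable_on {-L..L}" for n by (rule P0_integrable[OF h N \<eta>])
  have Ndiff: "Nn n x + integral {x..y} (\<eta> n) = Nn n y" if "-L \<le> x" "x \<le> y" "y \<le> L" for n x y
    unfolding Nn_def using that by (intro Henstock_Kurzweil_Integration.integral_combine absint_sub[OF \<eta>i]) auto
  have ip: "0 \<le> integral {x..y} (\<eta> n)" if "-L \<le> x" "y \<le> L" for n x y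
    using that \<eta>0 by (intro integral_nonneg absint_sub[OF \<eta>i]) auto
  have NnL: "Nn n (-L) = 0" for n by (simp add: Nn_def)
  have vdec: "v n x = g (-L) + En n x + Nn n x" if "x \<in> {-L..L}" for n x
  proof -
    have F: "(deriv (v n) has_integral v n x - v n (-L)) {-L..x}" using that by (intro P1_FTC[OF h N L vP]) auto
    have H: "(\<eta> n has_integral Nn n x) {-L..x}" unfolding Nn_def using that by (intro integrable_integral absint_sub[OF \<eta>i]) auto
    from has_integral_diff[OF F H] have "En n x = v n x - v n (-L) - Nn n x"
      unfolding En_def en_def[abs_def] by (rule integral_unique)
    then show ?thesis using vb by simp
  qed
  define NN where "NN x = (if x = L then g L else u x) - g (-L) - E x" for x
  \<comment> \<open>The total plastic opening, computed with the prescribed value at L and not with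
    a trace of \<open>u\<close>; the difference ends up in the atom at L.\<close>
  define Ktot where "Ktot = g L - g (-L) - E L"
  have Nlim: "(\<lambda>n. Nn (q n) x) \<longlonglongrightarrow> u x - g (-L) - E x" if "x \<in> D" for x
  proof -
    have xI: "x \<in> {-L..L}" using that by (auto simp: D_def)
    have "(\<lambda>n. v (q n) x - g (-L) - En (q n) x) \<longlonglongrightarrow> u x - g (-L) - E x"
      using that by (intro tendsto_diff tendsto_const Eq[OF xI] qlim) (auto simp: D_def)
    then show ?thesis using vdec[OF xI] by simp
  qed
  have NlimL: "(\<lambda>n. Nn (q n) L) \<longlonglongrightarrow> Ktot"
  proof -
    have LI: "L \<in> {-L..L}" using L by simp
    have "(\<lambda>n. v (q n) L - g (-L) - En (q n) L) \<longlonglongrightarrow> g L - g (-L) - E L"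
      unfolding vb by (intro tendsto_diff tendsto_const Eq[OF LI])
    then show ?thesis using vdec[OF LI] by (simp add: Ktot_def)
  qed
  have Nmono: "Nn n x \<le> Nn n y" if "-L \<le> x" "x \<le> y" "y \<le> L" for n x y
    using Ndiff[OF that, of n] ip[of x y n] that by simp
  obtain \<nu> where \<nu>: "finite_borel_measure \<nu>" "emeasure \<nu> (- {-L..L}) = 0" "measure \<nu> UNIV = Ktot"
    and \<nu>cdf: "\<And>x. x \<in> D \<Longrightarrow> -L < x \<Longrightarrow> x < L \<Longrightarrow> measure \<nu> {x} = 0 \<Longrightarrow> cdf \<nu> x = u x - g (-L) - E x"
  proof (rule monotone_ae_measure[OF L D, of "\<lambda>x. u x - g (-L) - E x" Ktot])
    show "u x - g (-L) - E x \<le> u y - g (-L) - E y" if "x \<in> D" "y \<in> D" "-L \<le> x" "x \<le> y" "y \<le> L" for x y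
      by (rule LIMSEQ_le[OF Nlim[OF that(1)] Nlim[OF that(2)]]) (use Nmono[OF that(3-5)] in auto)
    show "0 \<le> u x - g (-L) - E x \<and> u x - g (-L) - E x \<le> Ktot" if "x \<in> D" "-L \<le> x" "x \<le> L" for x
    proof
      have "0 \<le> Nn n x" for n using Nmono[of "-L" x n] NnL that by simp
      then show "0 \<le> u x - g (-L) - E x" using LIMSEQ_le_const[OF Nlim[OF that(1)]] by blast
      show "u x - g (-L) - E x \<le> Ktot"
        by (rule LIMSEQ_le[OF Nlim[OF that(1)] NlimL]) (use Nmono[of x L] that in auto)
    qed
  qed blast
  interpret \<nu>: finite_borel_measure \<nu> by fact
  have EL: "E (-L) = 0"
    using LIMSEQ_unique[OF Eq[of "-L"]] L by (simp add: EnL)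
  define \<tau> where "\<tau> j = 2 * L / 2 ^ j" for j :: nat
  have \<tau>: "0 < \<tau> j" "real (2^j) * \<tau> j = 2 * L" for j using L by (auto simp: \<tau>_def)
  have \<tau>I: "node L (\<tau> j) i \<in> {-L..L}" if "i \<le> 2^j" for i j
  proof -
    have "real i * \<tau> j \<le> real (2^j) * \<tau> j" using that \<tau>(1)[of j] by (intro mult_right_mono) (simp_all only: of_nat_le_iff less_imp_le)
    also have "\<dots> = 2 * L" by (rule \<tau>(2))
    finally have "real i * \<tau> j \<le> 2 * L" .
    moreover have "0 \<le> real i * \<tau> j" using \<tau>(1)[of j] by simp
    ultimately show ?thesis by (simp add: node_def)
  qed
  define S where "S j = (\<Sum>i<2^j. (E (node L (\<tau> j) (Suc i)) - E (node L (\<tau> j) i))\<^sup>2 / \<tau> j)" for j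
  define \<phi> where "\<phi> s = Gc * \<sigma>c * s / (Gc + \<sigma>c * s)" for s
  define Bl where "Bl t i = (if i = 0 then {-L..t 1} else {t i<..t (Suc i)})" for t :: "nat \<Rightarrow> real" and i :: nat
  have main: "1/2 * E0 * S j + (\<Sum>i<m. \<phi> (measure \<nu> (Bl t i))) \<le> \<Lambda>"
    if t: "t 0 = -L" "t m = L" "\<And>i. i < m \<Longrightarrow> t i < t (Suc i)" and tD: "\<And>i. 0 < i \<Longrightarrow> i < m \<Longrightarrow> t i \<in> D \<and> measure \<nu> {t i} = 0"
    for j m t
  proof -
    have m0: "0 < m" using t(1,2) L by (cases m) auto
    have tm: "t i \<le> t l" if "i \<le> l" "l \<le> m" for i l
      by (rule partition_range[OF _ that]) (use t(3) in \<open>auto intro: less_imp_le\<close>)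
    have tI: "t i \<in> {-L..L}" if "i \<le> m" for i using tm[of 0 i] tm[of i m] that t by auto
    \<comment> \<open>The value at index 0 is 0 and not the mass of {-L}, so an atom at -L is
      counted in the first block, which is closed on the left.\<close>
    define F where "F i = (if i = 0 then 0 else cdf \<nu> (t i))" for i
    have cdfL: "cdf \<nu> L = Ktot"
    proof -
      have "AE x in \<nu>. x \<in> {-L..L}"
        using \<nu>(2) by (subst AE_iff_measurable[where N="- {-L..L}"]) (auto simp: \<nu>.M_is_borel \<nu>.borel_UNIV)
      then have "measure \<nu> {..L} = measure \<nu> UNIV"
        by (intro measure_eq_AE) (auto simp: \<nu>.M_is_borel)
      then show ?thesis using \<nu>(3) by (simp add: cdf_def)
    qed
    have Flim: "(\<lambda>n. Nn (q n) (t i)) \<longlonglongrightarrow> F i" if im: "i \<le> m" for i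
    proof -
      consider "i = 0" | "i = m" "0 < i" | "0 < i" "i < m" using im by linarith
      then show ?thesis
      proof cases
        case 1 then show ?thesis by (simp add: F_def t NnL)
      next
        case 2 then show ?thesis using NlimL by (simp add: F_def t cdfL)
      next
        case 3
        have "-L < t i" "t i < L" using t(3)[of 0] tm[of 1 i] t(3)[of i] tm[of "Suc i" m] 3 t(1,2) by auto
        then show ?thesis using Nlim[of "t i"] \<nu>cdf[of "t i"] tD[OF 3] 3 by (simp add: F_def)
      qed
    qed
    have FB: "F (Suc i) - F i = measure \<nu> (Bl t i)" if "i < m" for i
    proof (cases "i = 0")
      case True
      have "AE x in \<nu>. x \<in> {-L..L}"
        using \<nu>(2) by (subst AE_iff_measurable[where N="- {-L..L}"]) (auto simp: \<nu>.M_is_borel \<nu>.borel_UNIV)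
      then have "measure \<nu> {..t 1} = measure \<nu> {-L..t 1}"
        by (intro measure_eq_AE) (auto simp: \<nu>.M_is_borel)
      then show ?thesis using True by (simp add: F_def Bl_def cdf_def)
    next
      case False
      then show ?thesis using \<nu>.cdf_diff_eq[OF t(3)[OF that]] by (simp add: F_def Bl_def)
    qed
    define rr where "rr n i = integral {t i..t (Suc i)} (\<eta> n)" for n i
    have rlim: "(\<lambda>n. rr (q n) i) \<longlonglongrightarrow> measure \<nu> (Bl t i)" if "i < m" for i
    proof -
      have "rr n i = Nn n (t (Suc i)) - Nn n (t i)" for n
        using Ndiff[of "t i" "t (Suc i)" n] tI[of i] tI[of "Suc i"] t(3)[OF that] that by (simp add: rr_def)
      moreover have "(\<lambda>n. Nn (q n) (t (Suc i)) - Nn (q n) (t i)) \<longlonglongrightarrow> F (Suc i) - F i"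
        using that by (intro tendsto_diff Flim) auto
      ultimately show ?thesis using FB[OF that] by simp
    qed
    have dlim: "(\<lambda>n. d (q n) (t i)) \<longlonglongrightarrow> 0" if "i \<le> m" for i
    proof (cases "0 < i \<and> i < m")
      case True then show ?thesis using tD[of i] by (auto simp: D_def)
    next
      case False
      then have "i = 0 \<or> i = m" using that by auto
      then show ?thesis using t db by auto
    qed
    define \<omega> where "\<omega> n = sqrt (K * (h n / \<epsilon> n))" for n
    have "(\<lambda>n. sqrt (K * (h (q n) / \<epsilon> (q n)))) \<longlonglongrightarrow> sqrt (K * 0)"
      by (intro tendsto_real_sqrt tendsto_mult_left qlim h\<epsilon>)
    then have \<omega>lim: "(\<lambda>n. \<omega> (q n)) \<longlonglongrightarrow> 0" by (simp add: \<omega>_def)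
    define low where "low n = 1/2 * E0 * (\<Sum>i<2^j. (En n (node L (\<tau> j) (Suc i)) - En n (node L (\<tau> j) i))\<^sup>2 / \<tau> j)
      + (\<Sum>i<m. Gc * \<sigma>c * rr n i / (Gc + \<sigma>c * rr n i) - 2 * \<omega> n * \<sigma>c * rr n i - Gc / 2 * ((d n (t i))\<^sup>2 + (d n (t (Suc i)))\<^sup>2))" for n
    have "low n \<le> \<Lambda>' n" for n
    proof -
      have "low n \<le> disc_energy L E0 \<sigma>c Gc (\<epsilon> n) (cell L (h n) ` {..<N n}) (v n) (d n) (\<eta> n)"
        unfolding low_def En_def en_def[abs_def] rr_def \<omega>_def
        by (rule disc_energy_lower[OF h N L vP dP \<epsilon> dK(2) d01 \<eta> \<eta>0 pos t(1,2) less_imp_le[OF t(3)] \<tau>])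
      then show ?thesis using en[of n] by linarith
    qed
    moreover have "(\<lambda>n. low (q n)) \<longlonglongrightarrow> 1/2 * E0 * S j
      + (\<Sum>i<m. Gc * \<sigma>c * measure \<nu> (Bl t i) / (Gc + \<sigma>c * measure \<nu> (Bl t i)) - 2 * 0 * \<sigma>c * measure \<nu> (Bl t i) - Gc / 2 * (0\<^sup>2 + 0\<^sup>2))"
      unfolding low_def S_def
    proof (intro tendsto_add tendsto_mult tendsto_sum tendsto_diff tendsto_divide tendsto_power tendsto_const)
      fix i assume "i \<in> {..<2^j :: nat}"
      then have i: "i \<le> 2^j" "Suc i \<le> 2^j" by auto
      show "(\<lambda>n. En (q n) (node L (\<tau> j) (Suc i))) \<longlonglongrightarrow> E (node L (\<tau> j) (Suc i))" by (rule Eq[OF \<tau>I[OF i(2)]])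
      show "(\<lambda>n. En (q n) (node L (\<tau> j) i)) \<longlonglongrightarrow> E (node L (\<tau> j) i)" by (rule Eq[OF \<tau>I[OF i(1)]])
      show "\<tau> j \<noteq> 0" using \<tau>(1)[of j] by simp
    next
      fix i assume "i \<in> {..<m}"
      then have i: "i < m" "i \<le> m" "Suc i \<le> m" by auto
      show "(\<lambda>n. rr (q n) i) \<longlonglongrightarrow> measure \<nu> (Bl t i)" by (rule rlim[OF i(1)])
      then show "(\<lambda>n. rr (q n) i) \<longlonglongrightarrow> measure \<nu> (Bl t i)" .
      then show "(\<lambda>n. rr (q n) i) \<longlonglongrightarrow> measure \<nu> (Bl t i)" .
      have "0 < Gc + \<sigma>c * measure \<nu> (Bl t i)" using pos by (intro add_pos_nonneg) auto
      then show "Gc + \<sigma>c * measure \<nu> (Bl t i) \<noteq> 0" by simp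
      show "(\<lambda>n. \<omega> (q n)) \<longlonglongrightarrow> 0" by (rule \<omega>lim)
      show "(\<lambda>n. d (q n) (t i)) \<longlonglongrightarrow> 0" by (rule dlim[OF i(2)])
      show "(\<lambda>n. d (q n) (t (Suc i))) \<longlonglongrightarrow> 0" by (rule dlim[OF i(3)])
    qed simp_all
    ultimately have "1/2 * E0 * S j
      + (\<Sum>i<m. Gc * \<sigma>c * measure \<nu> (Bl t i) / (Gc + \<sigma>c * measure \<nu> (Bl t i)) - 2 * 0 * \<sigma>c * measure \<nu> (Bl t i) - Gc / 2 * (0\<^sup>2 + 0\<^sup>2)) \<le> \<Lambda>"
      using qlim[OF \<Lambda>] by (intro LIMSEQ_le) auto
    then show ?thesis by (simp add: \<phi>_def)
  qed
  have Sb: "S j \<le> Q" for j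
  proof -
    define t where "t i = (if i = 0 then -L else L)" for i :: nat
    have "1/2 * E0 * S j + (\<Sum>i<1. \<phi> (measure \<nu> (Bl t i))) \<le> \<Lambda>"
      by (rule main) (use L in \<open>auto simp: t_def\<close>)
    moreover have "0 \<le> \<phi> (measure \<nu> (Bl t 0))" using pos by (simp add: \<phi>_def)
    moreover have "\<Lambda> \<le> C" using LIMSEQ_le_const2[OF \<Lambda>] C(1) by blast
    ultimately have "1/2 * E0 * S j \<le> C" by simp
    then show ?thesis using pos by (simp add: Q_def field_simps)
  qed
  obtain e where e: "e absolutely_integrable_on {-L..L}"
    "\<And>x. x \<in> {-L..L} \<Longrightarrow> E x - E (-L) = (LINT y:{-L..x}|lebesgue. e y)"
    "\<And>c C. 0 \<le> c \<Longrightarrow> (\<And>j. c * S j \<le> C) \<Longrightarrow> (\<integral>\<^sup>+x\<in>{-L..L}. ennreal (c * (e x)\<^sup>2) \<partial>lebesgue) \<le> ennreal C"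
    by (rule derivative_from_dyadic_energy[OF L E(1) Sb[unfolded S_def \<tau>_def], folded \<tau>_def, folded S_def])
      (rule that, assumption, blast, blast)
  have S0: "0 \<le> S j" for j unfolding S_def using \<tau>(1)[of j] by (intro sum_nonneg) (auto intro: less_imp_le)
  let ?A = "\<integral>\<^sup>+x\<in>{-L..L}. ennreal (1/2 * E0 * (e x)\<^sup>2) \<partial>lebesgue"
  \<comment> \<open>For a fixed partition all dyadic levels are used at once, so the full elastic
    energy of \<open>e\<close> is charged. Its value \<open>A'\<close> can afterwards be subtracted
    uniformly in the partition.\<close>
  have part: "?A \<le> ennreal (\<Lambda> - (\<Sum>i<m. \<phi> (measure \<nu> (Bl t i))))" "0 \<le> \<Lambda> - (\<Sum>i<m. \<phi> (measure \<nu> (Bl t i)))"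
    if t: "t 0 = -L" "t m = L" "\<And>i. i < m \<Longrightarrow> t i < t (Suc i)" "\<And>i. 0 < i \<Longrightarrow> i < m \<Longrightarrow> t i \<in> D \<and> measure \<nu> {t i} = 0" for m t
  proof -
    have *: "1/2 * E0 * S j \<le> \<Lambda> - (\<Sum>i<m. \<phi> (measure \<nu> (Bl t i)))" for j
      using main[OF t, of j] by linarith
    then show "?A \<le> ennreal (\<Lambda> - (\<Sum>i<m. \<phi> (measure \<nu> (Bl t i))))"
      using pos by (intro e(3)) auto
    have "0 \<le> 1/2 * E0 * S 0" using S0[of 0] pos by simp
    then show "0 \<le> \<Lambda> - (\<Sum>i<m. \<phi> (measure \<nu> (Bl t i)))" using *[of 0] by linarith
  qed
  \<comment> \<open>The partition into a single block already shows that the elastic energy is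
    finite.\<close>
  define t0 where "t0 i = (if i = 0 then -L else L)" for i :: nat
  have "?A \<le> ennreal (\<Lambda> - (\<Sum>i<1. \<phi> (measure \<nu> (Bl t0 i))))"
    by (rule part(1)) (use L in \<open>auto simp: t0_def\<close>)
  then have Afin: "?A < top" by (rule le_less_trans) simp
  then obtain A' where A': "?A = ennreal A'" "0 \<le> A'" by (cases ?A) auto
  have part': "(\<Sum>i<m. \<phi> (measure \<nu> (Bl t i))) \<le> \<Lambda> - A'"
    if t: "t 0 = -L" "t m = L" "\<And>i. i < m \<Longrightarrow> t i < t (Suc i)" "\<And>i. 0 < i \<Longrightarrow> i < m \<Longrightarrow> t i \<in> D \<and> measure \<nu> {t i} = 0" for m t
    using part(1)[OF t] part(2)[OF t] A' by simp
  have coh: "cohesive \<sigma>c Gc \<nu> \<le> ennreal (\<Lambda> - A')"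
  proof (rule cohesive_le_partitions[OF \<nu>(1,2) L pos(2,3) D])
    fix m t assume "t 0 = -L" "t m = L" "\<And>k. k < m \<Longrightarrow> t k < t (Suc k)" "\<And>k. 0 < k \<Longrightarrow> k < m \<Longrightarrow> t k \<in> D \<and> measure \<nu> {t k} = 0"
    from part'[OF this] show "(\<Sum>k<m. Gc * \<sigma>c * measure \<nu> (if k = 0 then {-L..t 1} else {t k<..t (Suc k)})
           / (Gc + \<sigma>c * measure \<nu> (if k = 0 then {-L..t 1} else {t k<..t (Suc k)}))) \<le> \<Lambda> - A'"
      by (simp add: \<phi>_def Bl_def)
  qed
  have "(\<Sum>i<1. \<phi> (measure \<nu> (Bl t0 i))) \<le> \<Lambda> - A'"
    by (rule part') (use L in \<open>auto simp: t0_def\<close>)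
  moreover have "0 \<le> \<phi> (measure \<nu> (Bl t0 0))" using pos by (simp add: \<phi>_def)
  ultimately have AL: "A' \<le> \<Lambda>" by simp
  have "?A + cohesive \<sigma>c Gc \<nu> \<le> ennreal A' + ennreal (\<Lambda> - A')"
    unfolding A'(1) by (intro add_left_mono coh)
  also have "\<dots> = ennreal \<Lambda>" using A'(2) AL by (subst ennreal_plus[symmetric]) auto
  finally have fin: "?A + cohesive \<sigma>c Gc \<nu> \<le> ennreal \<Lambda>" .
  have rep: "represents L g u e \<nu>"
    unfolding represents_def
  proof (intro conjI e(1) \<nu>(1,2))
    have "AE x in lborel. x \<notin> {x. measure \<nu> {x} \<noteq> 0} \<union> {-L, L}"
      by (intro AE_not_in countable_imp_null_set_lborel countable_Un \<nu>.countable_support) auto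
    then have "AE x in lebesgue. x \<notin> {x. measure \<nu> {x} \<noteq> 0} \<union> {-L, L}" by (rule AE_completion)
    with D show "AE x in lebesgue. x \<in> {-L..L} \<longrightarrow> u x = g (-L) + (LINT y:{-L..x}|lebesgue. e y) + cdf \<nu> x"
    proof eventually_elim
      case (elim x)
      show ?case
      proof
        assume x: "x \<in> {-L..L}"
        then have "x \<in> D" "-L < x" "x < L" "measure \<nu> {x} = 0" using elim by auto
        then show "u x = g (-L) + (LINT y:{-L..x}|lebesgue. e y) + cdf \<nu> x"
          using \<nu>cdf[of x] e(2)[OF x] EL by simp
      qed
    qed
    show "g L = g (-L) + (LINT y:{-L..L}|lebesgue. e y) + measure \<nu> UNIV"
      using e(2)[of L] EL L \<nu>(3) by (simp add: Ktot_def)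
  qed
  show ?thesis by (rule that[OF rep q dq fin])
qed

section \<open>Passage to subsequences\<close>

lemma L1_dist_nonneg: "0 \<le> L1_dist L u v"
  unfolding L1_dist_def set_lebesgue_integral_def by (rule Bochner_Integration.integral_nonneg) auto

lemma L1_dist_tendsto_AE_subseq:
  assumes u: "\<And>n. u n \<in> L1 L" "u0 \<in> L1 L" and lim: "(\<lambda>n. L1_dist L (u n) u0) \<longlonglongrightarrow> 0"
  obtains r :: "nat \<Rightarrow> nat" where "strict_mono r"
    "AE x in lebesgue. x \<in> {-L..L} \<longrightarrow> (\<lambda>n. u (r n) x) \<longlonglongrightarrow> u0 x"
proof -
  have i: "(\<lambda>x. u n x - u0 x) absolutely_integrable_on {-L..L}" for n
    using u by (intro set_integral_diff(1)) (auto simp: L1_def)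
  have "\<exists>r::nat\<Rightarrow>nat. strict_mono r \<and> (AE x in lebesgue. (\<lambda>n. indicator {-L..L} x *\<^sub>R (u (r n) x - u0 x)) \<longlonglongrightarrow> 0)"
  proof (rule tendsto_L1_AE_subseq)
    show "integrable lebesgue (\<lambda>x. indicator {-L..L} x *\<^sub>R (u n x - u0 x))" for n
      using i[of n] by (simp add: set_integrable_def)
    have "(\<integral>x. norm (indicator {-L..L} x *\<^sub>R (u n x - u0 x)) \<partial>lebesgue) = L1_dist L (u n) u0" for n
      unfolding L1_dist_def set_lebesgue_integral_def
      by (intro Bochner_Integration.integral_cong) (auto simp: indicator_def)
    then show "(\<lambda>n. \<integral>x. norm (indicator {-L..L} x *\<^sub>R (u n x - u0 x)) \<partial>lebesgue) \<longlonglongrightarrow> 0" using lim by simp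
  qed
  then obtain r :: "nat \<Rightarrow> nat" where r: "strict_mono r"
    and ae: "AE x in lebesgue. (\<lambda>n. indicator {-L..L} x *\<^sub>R (u (r n) x - u0 x)) \<longlonglongrightarrow> 0" by blast
  have "AE x in lebesgue. x \<in> {-L..L} \<longrightarrow> (\<lambda>n. u (r n) x) \<longlonglongrightarrow> u0 x"
    using ae by eventually_elim (auto simp: LIM_zero_iff)
  then show ?thesis using that r by blast
qed

lemma mesh_sequence:
  assumes h: "\<And>n. h n \<in> mesh_sizes L" "h \<longlonglongrightarrow> 0"
    and eps_lim: "(\<epsilon> \<longlongrightarrow> 0) (at 0 within mesh_sizes L)"
    and eps_mesh: "(\<lambda>h. h) \<in> o[at 0 within mesh_sizes L](\<epsilon>)"
  shows "(\<lambda>n. \<epsilon> (h n)) \<longlonglongrightarrow> 0" "(\<lambda>n. h n / \<epsilon> (h n)) \<longlonglongrightarrow> 0"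
proof -
  have hp: "0 < h n" for n using h(1)[of n] by (simp add: mesh_sizes_def)
  have F: "filterlim h (at 0 within mesh_sizes L) sequentially"
    unfolding filterlim_at using h hp by (auto simp: less_le)
  show "(\<lambda>n. \<epsilon> (h n)) \<longlonglongrightarrow> 0" by (rule filterlim_compose[OF eps_lim F])
  have "((\<lambda>x. x / \<epsilon> x) \<longlongrightarrow> 0) (at 0 within mesh_sizes L)" using smalloD_tendsto[OF eps_mesh] .
  then show "(\<lambda>n. h n / \<epsilon> (h n)) \<longlonglongrightarrow> 0" by (rule filterlim_compose[OF _ F])
qed

text \<open>A strict bound on the nested infima yields concrete representatives together with a
  concrete opening.\<close>

lemma F_disc_ext_less:
  assumes h: "0 < h" and N: "real N * h = 2 * L" and L: "0 < L" and pos: "0 < E0" "0 < \<sigma>c" "0 < Gc" "0 < \<epsilon>"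
    and less: "F_disc_ext L E0 \<sigma>c Gc g \<epsilon> (cell L h ` {..<N}) (u, d) < ennreal c" and c: "0 \<le> c"
  shows "\<exists>v e \<eta>. admissible L g (cell L h ` {..<N}) v e \<and> ae_eq_on L u v \<and> ae_eq_on L d e \<and>
     \<eta> \<in> P0 (cell L h ` {..<N}) \<and> (\<forall>x\<in>{-L..L}. 0 \<le> \<eta> x) \<and>
     disc_energy L E0 \<sigma>c Gc \<epsilon> (cell L h ` {..<N}) v e \<eta> \<le> c"
proof -
  let ?T = "cell L h ` {..<N}"
  obtain v e where ve: "admissible L g ?T v e" "ae_eq_on L u v" "ae_eq_on L d e" "F_disc L E0 \<sigma>c Gc \<epsilon> ?T v e < ennreal c"
    using less unfolding F_disc_ext_def prod.case Inf_less_iff by blast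
  have P: "v \<in> P1 ?T" "e \<in> P1 ?T" using ve(1) by (auto simp: admissible_def)
  obtain \<eta> where \<eta>: "\<eta> \<in> P0 ?T" "\<forall>x\<in>{-L..L}. 0 \<le> \<eta> x"
    "(\<integral>\<^sup>+x\<in>{-L..L}. ennreal (1/2 * E0 * \<bar>deriv v x - \<eta> x\<bar>\<^sup>2) \<partial>lebesgue)
      + (\<integral>\<^sup>+x\<in>{-L..L}. ennreal (degr (elem_mean ?T e x) * \<sigma>c * \<eta> x) \<partial>lebesgue)
      + ennreal (Gc / 2) * (\<integral>\<^sup>+x\<in>{-L..L}. ennreal (1 / \<epsilon> * (e x)\<^sup>2 + \<epsilon> * \<bar>deriv e x\<bar>\<^sup>2) \<partial>lebesgue) < ennreal c"
    using ve(4) unfolding F_disc_def INF_less_iff by blast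
  have "ennreal (disc_energy L E0 \<sigma>c Gc \<epsilon> ?T v e \<eta>) < ennreal c"
    by (rule ord_eq_less_trans[OF disc_energy_eq[OF h N L P \<eta>(1) _ pos, symmetric] \<eta>(3)]) (use \<eta>(2) in blast)
  then have "disc_energy L E0 \<sigma>c Gc \<epsilon> ?T v e \<eta> \<le> c"
    using c by (metis ennreal_less_iff less_imp_le linorder_le_cases order_trans)
  then show ?thesis using ve(1-3) \<eta>(1,2) by blast
qed

text \<open>A subsequence is extracted along which the energies are finite and tend to their lower
  limit and both fields converge almost everywhere; \<open>liminf_core\<close> applies to
  it.\<close>

lemma liminf_inequality:
  fixes \<epsilon> :: "real \<Rightarrow> real"
  assumes pos: "0 < L" "0 < E0" "0 < \<sigma>c" "0 < Gc"
    and mesh: "\<And>h. h \<in> mesh_sizes L \<Longrightarrow> is_mesh L h (T h)"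
    and eps_pos: "\<And>h. h \<in> mesh_sizes L \<Longrightarrow> 0 < \<epsilon> h"
    and eps_lim: "(\<epsilon> \<longlongrightarrow> 0) (at 0 within mesh_sizes L)"
    and eps_mesh: "(\<lambda>h. h) \<in> o[at 0 within mesh_sizes L](\<epsilon>)"
    and h: "\<And>n. h n \<in> mesh_sizes L" "h \<longlonglongrightarrow> 0"
    and u: "u \<in> L1 L" "d \<in> L1 L" and y: "\<And>n. y n \<in> L1 L \<times> L1 L"
    and lim: "(\<lambda>n. L1_pair_dist L (y n) (u, d)) \<longlonglongrightarrow> 0"
  shows "F_lim_ext L E0 \<sigma>c Gc g (u, d) \<le> liminf (\<lambda>n. F_disc_ext L E0 \<sigma>c Gc g (\<epsilon> (h n)) (T (h n)) (y n))"
proof -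
  define X where "X n = F_disc_ext L E0 \<sigma>c Gc g (\<epsilon> (h n)) (T (h n)) (y n)" for n
  have hp: "0 < h n" for n using h(1)[of n] by (simp add: mesh_sizes_def)
  have "\<exists>N. 0 < N \<and> real N * h n = 2 * L \<and> T (h n) = cell L (h n) ` {..<N}" for n
    by (rule mesh_structure[OF mesh[OF h(1)] hp pos(1), of n]) blast
  then obtain N where N: "\<And>n. real (N n) * h n = 2 * L" "\<And>n. T (h n) = cell L (h n) ` {..<N n}" by metis
  have \<epsilon>p: "0 < \<epsilon> (h n)" for n using eps_pos[OF h(1)] .
  note ms = mesh_sequence[OF h eps_lim eps_mesh]
  show ?thesis unfolding X_def[symmetric]
  proof (cases "liminf X = \<infinity>")
    case False
    then obtain \<Lambda> where \<Lambda>: "liminf X = ennreal \<Lambda>" "0 \<le> \<Lambda>" by (cases "liminf X") auto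
    obtain r where r: "strict_mono (r :: nat \<Rightarrow> nat)" "(X \<circ> r) \<longlonglongrightarrow> liminf X" using liminf_subseq_lim by auto
    have "eventually (\<lambda>n. (X \<circ> r) n < top) sequentially"
      using order_tendstoD(2)[OF r(2), of top] \<Lambda>(1) by simp
    then obtain n0 where n0: "\<And>n. n0 \<le> n \<Longrightarrow> X (r n) < top" by (auto simp: eventually_sequentially)
    define s1 where "s1 n = r (n + n0)" for n
    have s1: "strict_mono s1" using r(1) by (simp add: s1_def strict_mono_def)
    have X1: "(\<lambda>n. X (s1 n)) \<longlonglongrightarrow> ennreal \<Lambda>"
      using LIMSEQ_ignore_initial_segment[OF r(2), of n0] \<Lambda>(1) by (simp add: s1_def o_def)
    have Xfin: "X (s1 n) < top" for n using n0 by (simp add: s1_def)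
    have d1: "(\<lambda>n. L1_dist L (fst (y n)) u) \<longlonglongrightarrow> 0" "(\<lambda>n. L1_dist L (snd (y n)) d) \<longlonglongrightarrow> 0"
      by (rule tendsto_sandwich[OF _ _ tendsto_const lim];
        simp add: L1_pair_dist_def L1_dist_nonneg)+
    obtain s2 where s2: "strict_mono (s2 :: nat \<Rightarrow> nat)"
      "AE x in lebesgue. x \<in> {-L..L} \<longrightarrow> (\<lambda>n. fst (y (s1 (s2 n))) x) \<longlonglongrightarrow> u x"
    proof (rule L1_dist_tendsto_AE_subseq[of "\<lambda>n. fst (y (s1 n))" L u])
      show "fst (y (s1 n)) \<in> L1 L" for n using y[of "s1 n"] by auto
      show "(\<lambda>n. L1_dist L (fst (y (s1 n))) u) \<longlonglongrightarrow> 0"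
        using LIMSEQ_subseq_LIMSEQ[OF d1(1) s1] by (simp add: o_def)
    qed (use u in auto)
    have s12: "strict_mono (\<lambda>n. s1 (s2 n))" using s1 s2(1) by (simp add: strict_mono_def)
    obtain s3 where s3: "strict_mono (s3 :: nat \<Rightarrow> nat)"
      "AE x in lebesgue. x \<in> {-L..L} \<longrightarrow> (\<lambda>n. snd (y (s1 (s2 (s3 n)))) x) \<longlonglongrightarrow> d x"
    proof (rule L1_dist_tendsto_AE_subseq[of "\<lambda>n. snd (y (s1 (s2 n)))" L d])
      show "snd (y (s1 (s2 n))) \<in> L1 L" for n using y[of "s1 (s2 n)"] by auto
      show "(\<lambda>n. L1_dist L (snd (y (s1 (s2 n)))) d) \<longlonglongrightarrow> 0"
        using LIMSEQ_subseq_LIMSEQ[OF d1(2) s12] by (simp add: o_def)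
    qed (use u in auto)
    define s where "s n = s1 (s2 (s3 n))" for n
    have s: "strict_mono s" using s12 s3(1) by (simp add: s_def strict_mono_def)
    have s23: "strict_mono (\<lambda>n. s2 (s3 n))" using s2(1) s3(1) by (simp add: strict_mono_def)
    have Xs: "(\<lambda>n. X (s n)) \<longlonglongrightarrow> ennreal \<Lambda>"
      using LIMSEQ_subseq_LIMSEQ[OF X1 s23] by (simp add: o_def s_def)
    have us: "AE x in lebesgue. x \<in> {-L..L} \<longrightarrow> (\<lambda>n. fst (y (s n)) x) \<longlonglongrightarrow> u x"
      using s2(2)
    proof eventually_elim
      case (elim x)
      show ?case using LIMSEQ_subseq_LIMSEQ[OF _ s3(1), of "\<lambda>n. fst (y (s1 (s2 n))) x" "u x"] elim
        by (auto simp: o_def s_def)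
    qed
    have ds: "AE x in lebesgue. x \<in> {-L..L} \<longrightarrow> (\<lambda>n. snd (y (s n)) x) \<longlonglongrightarrow> d x"
      using s3(2) by (simp add: s_def)
    \<comment> \<open>The vanishing excess makes the bound strict, so competitors can be chosen
      without knowing that the infima are attained.\<close>
    define \<Lambda>' where "\<Lambda>' n = enn2real (X (s n)) + 1 / real (Suc n)" for n
    have \<Lambda>': "\<Lambda>' \<longlonglongrightarrow> \<Lambda>"
    proof -
      have "(\<lambda>n. enn2real (X (s n)) + 1 / real (Suc n)) \<longlonglongrightarrow> \<Lambda> + 0"
        by (rule tendsto_add[OF tendsto_enn2real[OF Xs \<Lambda>(2)] LIMSEQ_inverse_real_of_nat[unfolded inverse_eq_divide]])
      then show ?thesis by (simp only: \<Lambda>'_def[abs_def] add_0_right)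
    qed
    have "\<exists>v e \<eta>. admissible L g (cell L (h (s n)) ` {..<N (s n)}) v e \<and> ae_eq_on L (fst (y (s n))) v \<and> ae_eq_on L (snd (y (s n))) e \<and>
       \<eta> \<in> P0 (cell L (h (s n)) ` {..<N (s n)}) \<and> (\<forall>x\<in>{-L..L}. 0 \<le> \<eta> x) \<and>
       disc_energy L E0 \<sigma>c Gc (\<epsilon> (h (s n))) (cell L (h (s n)) ` {..<N (s n)}) v e \<eta> \<le> \<Lambda>' n" for n
    proof (rule F_disc_ext_less[OF hp N(1) pos \<epsilon>p])
      have "X (s n) = ennreal (enn2real (X (s n)))" using Xfin[of "s2 (s3 n)"] by (simp add: s_def)
      also have "\<dots> < ennreal (\<Lambda>' n)" unfolding \<Lambda>'_def by (subst ennreal_less_iff) auto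
      finally show "F_disc_ext L E0 \<sigma>c Gc g (\<epsilon> (h (s n))) (cell L (h (s n)) ` {..<N (s n)}) (fst (y (s n)), snd (y (s n))) < ennreal (\<Lambda>' n)"
        by (simp add: X_def N(2))
      show "0 \<le> \<Lambda>' n" by (simp add: \<Lambda>'_def)
    qed
    then have "\<forall>n. \<exists>v e \<eta>. admissible L g (cell L (h (s n)) ` {..<N (s n)}) v e \<and> ae_eq_on L (fst (y (s n))) v \<and> ae_eq_on L (snd (y (s n))) e \<and>
       \<eta> \<in> P0 (cell L (h (s n)) ` {..<N (s n)}) \<and> (\<forall>x\<in>{-L..L}. 0 \<le> \<eta> x) \<and>
       disc_energy L E0 \<sigma>c Gc (\<epsilon> (h (s n))) (cell L (h (s n)) ` {..<N (s n)}) v e \<eta> \<le> \<Lambda>' n"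
      by (rule allI)
    then obtain v e \<eta> where ve0: "\<forall>n. admissible L g (cell L (h (s n)) ` {..<N (s n)}) (v n) (e n) \<and> ae_eq_on L (fst (y (s n))) (v n) \<and> ae_eq_on L (snd (y (s n))) (e n) \<and>
       \<eta> n \<in> P0 (cell L (h (s n)) ` {..<N (s n)}) \<and> (\<forall>x\<in>{-L..L}. 0 \<le> \<eta> n x) \<and>
       disc_energy L E0 \<sigma>c Gc (\<epsilon> (h (s n))) (cell L (h (s n)) ` {..<N (s n)}) (v n) (e n) (\<eta> n) \<le> \<Lambda>' n"
      unfolding choice_iff by (elim exE) (rule that)
    have ve: "admissible L g (cell L (h (s n)) ` {..<N (s n)}) (v n) (e n)"
      "ae_eq_on L (fst (y (s n))) (v n)" "ae_eq_on L (snd (y (s n))) (e n)"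
      "\<eta> n \<in> P0 (cell L (h (s n)) ` {..<N (s n)})" "\<And>x. x \<in> {-L..L} \<Longrightarrow> 0 \<le> \<eta> n x"
      "disc_energy L E0 \<sigma>c Gc (\<epsilon> (h (s n))) (cell L (h (s n)) ` {..<N (s n)}) (v n) (e n) (\<eta> n) \<le> \<Lambda>' n" for n
      using ve0[rule_format, of n] by auto
    have vu: "AE x in lebesgue. \<forall>n. x \<in> {-L..L} \<longrightarrow> fst (y (s n)) x = v n x \<and> snd (y (s n)) x = e n x"
      unfolding AE_all_countable
    proof
      fix n
      show "AE x in lebesgue. x \<in> {-L..L} \<longrightarrow> fst (y (s n)) x = v n x \<and> snd (y (s n)) x = e n x"
        using ve(2)[of n] ve(3)[of n] unfolding ae_eq_on_def by eventually_elim auto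
    qed
    have vconv: "AE x in lebesgue. x \<in> {-L..L} \<longrightarrow> (\<lambda>n. v n x) \<longlonglongrightarrow> u x"
      using vu us by eventually_elim auto
    have econv: "AE x in lebesgue. x \<in> {-L..L} \<longrightarrow> (\<lambda>n. e n x) \<longlonglongrightarrow> d x"
      using vu ds by eventually_elim auto
    have \<epsilon>s: "(\<lambda>n. \<epsilon> (h (s n))) \<longlonglongrightarrow> 0" "(\<lambda>n. h (s n) / \<epsilon> (h (s n))) \<longlonglongrightarrow> 0"
      using LIMSEQ_subseq_LIMSEQ[OF ms(1) s] LIMSEQ_subseq_LIMSEQ[OF ms(2) s] by (simp_all add: o_def)
    obtain e' \<nu> q where core: "represents L g u e' \<nu>" "strict_mono (q :: nat \<Rightarrow> nat)"
      "AE x in lebesgue. x \<in> {-L..L} \<longrightarrow> (\<lambda>n. e (q n) x) \<longlonglongrightarrow> 0"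
      "(\<integral>\<^sup>+x\<in>{-L..L}. ennreal (1/2 * E0 * (e' x)\<^sup>2) \<partial>lebesgue) + cohesive \<sigma>c Gc \<nu> \<le> ennreal \<Lambda>"
      by (rule liminf_core[OF pos hp N(1) \<epsilon>p \<epsilon>s ve(1,4,5,6) \<Lambda>' vconv])
    have bd: "AE x in lebesgue. x \<in> {-L..L} \<longrightarrow> \<bar>u x\<bar> \<le> bdry_norm L g"
      using vconv
    proof eventually_elim
      case (elim x)
      show ?case
      proof
        assume x: "x \<in> {-L..L}"
        then have "(\<lambda>n. \<bar>v n x\<bar>) \<longlonglongrightarrow> \<bar>u x\<bar>" using elim by (intro tendsto_rabs) auto
        moreover have "\<bar>v n x\<bar> \<le> bdry_norm L g" for n using ve(1)[of n] x by (auto simp: admissible_def)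
        ultimately show "\<bar>u x\<bar> \<le> bdry_norm L g" by (intro LIMSEQ_le_const2) auto
      qed
    qed
    have d0: "AE x in lebesgue. x \<in> {-L..L} \<longrightarrow> d x = 0"
      using econv core(3)
    proof eventually_elim
      case (elim x)
      show ?case
      proof
        assume x: "x \<in> {-L..L}"
        then have "(\<lambda>n. e (q n) x) \<longlonglongrightarrow> d x"
          using LIMSEQ_subseq_LIMSEQ[OF _ core(2), of "\<lambda>n. e n x" "d x"] elim by (simp add: o_def)
        then show "d x = 0" using elim x LIMSEQ_unique by blast
      qed
    qed
    have "F_lim_ext L E0 \<sigma>c Gc g (u, d) \<le> ennreal \<Lambda>"
      using F_lim_ext_le[OF core(1) u(1) pos bd d0] core(4) by (rule order_trans)
    then show "F_lim_ext L E0 \<sigma>c Gc g (u, d) \<le> liminf X" using \<Lambda>(1) by simp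
  qed simp
qed

section \<open>Recovery sequences\<close>

definition interp :: "real \<Rightarrow> real \<Rightarrow> (nat \<Rightarrow> real) \<Rightarrow> real \<Rightarrow> real" where
  "interp L h s x = (let i = nat \<lfloor>(x + L) / h\<rfloor> in s i + (s (Suc i) - s i) * ((x - node L h i) / h))"

lemma interp_cell:
  assumes h: "0 < h" and x: "x \<in> cell L h i"
  shows "interp L h s x = s i + (s (Suc i) - s i) * ((x - node L h i) / h)"
proof (cases "x = node L h (Suc i)")
  case True
  have "(x + L) / h = real (Suc i)" using True h by (simp add: node_def field_simps)
  then have "nat \<lfloor>(x + L) / h\<rfloor> = Suc i" by (simp only: floor_of_nat nat_int)
  then show ?thesis using True h by (simp add: interp_def Let_def node_Suc)
next
  case False
  then have "real i \<le> (x + L) / h" "(x + L) / h < real i + 1" using x h by (auto simp: node_def field_simps)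
  then have "\<lfloor>(x + L) / h\<rfloor> = int i" by linarith
  then show ?thesis by (simp add: interp_def)
qed

lemma interp_node: "0 < h \<Longrightarrow> interp L h s (node L h i) = s i"
  by (subst interp_cell[of h _ _ i]) (auto simp: node_le)

lemma interp_P1:
  assumes h: "0 < h"
  shows "interp L h s \<in> P1 (cell L h ` {..<N})"
  unfolding P1_def
proof (intro CollectI conjI ballI)
  show "continuous_on (\<Union> (cell L h ` {..<N})) (interp L h s)"
  proof (rule continuous_on_closed_Union)
    fix i
    have "continuous_on (cell L h i) (\<lambda>x. s i + (s (Suc i) - s i) * ((x - node L h i) / h))"
      using h by (intro continuous_intros) auto
    then show "continuous_on (cell L h i) (interp L h s)"
      by (rule continuous_on_eq) (simp add: interp_cell[OF h])
  qed auto
  fix K assume "K \<in> cell L h ` {..<N}"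
  then obtain i where K: "K = cell L h i" by auto
  show "\<exists>p q. \<forall>x\<in>K. interp L h s x = p + q * x"
    using h by (intro exI[of _ "s i - (s (Suc i) - s i) * node L h i / h"] exI[of _ "(s (Suc i) - s i) / h"])
      (auto simp: K interp_cell[OF h] field_simps)
qed

lemma interp_deriv:
  assumes h: "0 < h" and x: "x \<in> interior (cell L h i)"
  shows "deriv (interp L h s) x = (s (Suc i) - s i) / h"
proof (rule DERIV_imp_deriv)
  show "(interp L h s has_real_derivative (s (Suc i) - s i) / h) (at x)"
  proof (rule has_field_derivative_transform_within_open[where S="interior (cell L h i)" and f="\<lambda>x. s i + (s (Suc i) - s i) * ((x - node L h i) / h)"])
    show "((\<lambda>x. s i + (s (Suc i) - s i) * ((x - node L h i) / h)) has_real_derivative (s (Suc i) - s i) / h) (at x)"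
      using h by (auto intro!: derivative_eq_intros)
    show "s i + (s (Suc i) - s i) * ((y - node L h i) / h) = interp L h s y" if "y \<in> interior (cell L h i)" for y
      using interp_cell[OF h, of y L i s] that interior_subset[of "cell L h i"] by auto
  qed (use x in auto)
qed

lemma interp_between:
  assumes h: "0 < h" and x: "x \<in> cell L h i"
  shows "min (s i) (s (Suc i)) \<le> interp L h s x" "interp L h s x \<le> max (s i) (s (Suc i))"
proof -
  define l where "l = (x - node L h i) / h"
  have l: "0 \<le> l" "l \<le> 1" using x h by (auto simp: l_def node_Suc)
  have "interp L h s x = (1 - l) * s i + l * s (Suc i)"
    unfolding interp_cell[OF h x] l_def[symmetric] by (simp add: algebra_simps)
  moreover have "(1 - l) * min (s i) (s (Suc i)) + l * min (s i) (s (Suc i)) \<le> (1 - l) * s i + l * s (Suc i)"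
    using l by (intro add_mono mult_left_mono) auto
  moreover have "(1 - l) * s i + l * s (Suc i) \<le> (1 - l) * max (s i) (s (Suc i)) + l * max (s i) (s (Suc i))"
    using l by (intro add_mono mult_left_mono) auto
  ultimately show "min (s i) (s (Suc i)) \<le> interp L h s x" "interp L h s x \<le> max (s i) (s (Suc i))"
    by (simp_all add: algebra_simps)
qed

lemma cell_exists:
  assumes h: "0 < h" and N: "real N * h = 2 * L" and L: "0 < L" and x: "x \<in> {-L..L}"
  obtains i where "i < N" "x \<in> cell L h i"
proof (cases "x = L")
  case True
  have "0 < N" using N L by (auto intro: Nat.gr0I)
  then have "N - 1 < N" "x \<in> cell L h (N - 1)" using True N h by (auto simp: node_def of_nat_diff field_simps)
  then show ?thesis using that by blast
next
  case False
  define i where "i = nat \<lfloor>(x + L) / h\<rfloor>"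
  have q: "0 \<le> (x + L) / h" using x h by simp
  have i: "real i \<le> (x + L) / h" "(x + L) / h < real i + 1"
    using q unfolding i_def by linarith+
  have "(x + L) / h < real N" using N h x False by (simp add: divide_less_eq)
  then have "i < N" using i by linarith
  moreover have "x \<in> cell L h i" using i h by (auto simp: node_def field_simps)
  ultimately show ?thesis using that by blast
qed

lemma step_fun_P0:
  assumes h: "0 < h"
  shows "step_fun L h c \<in> P0 (cell L h ` {..<N})"
  unfolding P0_def
proof (intro CollectI ballI)
  fix K assume "K \<in> cell L h ` {..<N}"
  then obtain i where "K = cell L h i" by auto
  then show "\<exists>z. \<forall>x\<in>interior K. step_fun L h c x = z"
    by (intro exI[of _ "c i"]) (auto intro!: step_fun_cell[OF h])
qed

text \<open>Only the damage term is estimated: the integral of the square of an affine function, h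
  (b^2 + b b' + b'^2) / 3, is replaced by the trapezoidal value h (b^2 + b'^2) / 2, which suits the
  geometric profile. The elastic and plastic terms are exact.\<close>

lemma disc_energy_interp_le:
  assumes h: "0 < h" and N: "real N * h = 2 * L" and \<epsilon>: "0 < \<epsilon>" and Gc: "0 < Gc"
  shows "disc_energy L E0 \<sigma>c Gc \<epsilon> (cell L h ` {..<N}) (interp L h s) (interp L h b) (step_fun L h c)
    \<le> (\<Sum>i<N. 1/2 * E0 * ((s (Suc i) - s i) / h - c i)\<^sup>2 * h)
      + (\<Sum>i<N. (1 - (b i + b (Suc i)) / 2)\<^sup>2 * \<sigma>c * c i * h)
      + Gc / 2 * (\<Sum>i<N. h / \<epsilon> * (((b i)\<^sup>2 + (b (Suc i))\<^sup>2) / 2) + (b (Suc i) - b i)\<^sup>2 / (h / \<epsilon>))"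
proof -
  have nN: "node L h 0 = -L" "node L h N = L" using N by (simp_all add: node_def)
  have all: "(f has_integral (\<Sum>i<N. I i)) {-L..L}" if "\<And>i. i < N \<Longrightarrow> (f has_integral I i) (cell L h i)" for f :: "real \<Rightarrow> real" and I
    using has_integral_nodes[OF h, of 0 N f I L] that unfolding nN by (simp add: atLeast0LessThan)
  have st: "step_fun L h c x = c i" if "x \<in> interior (cell L h i)" for x i
    using that by (intro step_fun_cell[OF h]) auto
  have 1: "integral {-L..L} (\<lambda>x. 1/2 * E0 * (deriv (interp L h s) x - step_fun L h c x)\<^sup>2)
      = (\<Sum>i<N. 1/2 * E0 * ((s (Suc i) - s i) / h - c i)\<^sup>2 * h)"
    by (intro integral_unique all has_integral_cell_const[OF h]) (simp only: interp_deriv[OF h] st)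
  have 2: "integral {-L..L} (\<lambda>x. degr (elem_mean (cell L h ` {..<N}) (interp L h b) x) * \<sigma>c * step_fun L h c x)
      = (\<Sum>i<N. (1 - (b i + b (Suc i)) / 2)\<^sup>2 * \<sigma>c * c i * h)"
    by (intro integral_unique all has_integral_cell_const[OF h])
      (simp only: elem_mean_P1[OF h interp_P1[OF h]] st interp_node[OF h] degr_def)
  have 3: "integral {-L..L} (\<lambda>x. 1 / \<epsilon> * (interp L h b x)\<^sup>2 + \<epsilon> * (deriv (interp L h b) x)\<^sup>2)
      = (\<Sum>i<N. 1 / \<epsilon> * (h * (((b i)\<^sup>2 + b i * b (Suc i) + (b (Suc i))\<^sup>2) / 3)) + \<epsilon> * (((b (Suc i) - b i) / h)\<^sup>2 * h))"
  proof (intro integral_unique all has_integral_add has_integral_mult_right)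
    fix i assume i: "i < N"
    let ?D = "b (Suc i) - b i" and ?a = "node L h i" and ?b = "node L h (Suc i)"
    define P where "P x = (b i)\<^sup>2 * (x - ?a) + b i * ?D / h * (x - ?a)\<^sup>2 + ?D\<^sup>2 / (3 * h\<^sup>2) * (x - ?a)^3" for x
    have "((\<lambda>x. (b i + ?D * ((x - ?a) / h))\<^sup>2) has_integral P ?b - P ?a) (cell L h i)"
    proof (rule fundamental_theorem_of_calculus)
      show "?a \<le> ?b" using h by (simp add: node_le)
      fix x
      have "(P has_real_derivative (b i + ?D * ((x - ?a) / h))\<^sup>2) (at x)"
        unfolding P_def using h by (auto intro!: derivative_eq_intros simp: field_simps power2_eq_square)
      then show "(P has_vector_derivative (b i + ?D * ((x - ?a) / h))\<^sup>2) (at x within cell L h i)"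
        by (simp add: has_real_derivative_iff_has_vector_derivative has_vector_derivative_at_within)
    qed
    also have "P ?b - P ?a = h * (((b i)\<^sup>2 + b i * b (Suc i) + (b (Suc i))\<^sup>2) / 3)"
      using h by (simp add: P_def node_Suc power2_eq_square power3_eq_cube field_simps)
    finally show "((\<lambda>x. (interp L h b x)\<^sup>2) has_integral h * (((b i)\<^sup>2 + b i * b (Suc i) + (b (Suc i))\<^sup>2) / 3)) (cell L h i)"
      by (rule has_integral_eq[rotated]) (simp only: interp_cell[OF h])
    show "((\<lambda>x. (deriv (interp L h b) x)\<^sup>2) has_integral ((b (Suc i) - b i) / h)\<^sup>2 * h) (cell L h i)"
      by (rule has_integral_cell_const[OF h]) (simp only: interp_deriv[OF h])
  qed
  also have "\<dots> \<le> (\<Sum>i<N. h / \<epsilon> * (((b i)\<^sup>2 + (b (Suc i))\<^sup>2) / 2) + (b (Suc i) - b i)\<^sup>2 / (h / \<epsilon>))"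
  proof (rule sum_mono)
    fix i
    have "((b i)\<^sup>2 + b i * b (Suc i) + (b (Suc i))\<^sup>2) / 3 \<le> ((b i)\<^sup>2 + (b (Suc i))\<^sup>2) / 2"
      using zero_le_power2[of "b i - b (Suc i)"] by (simp add: power2_eq_square algebra_simps)
    then have "h / \<epsilon> * (((b i)\<^sup>2 + b i * b (Suc i) + (b (Suc i))\<^sup>2) / 3) \<le> h / \<epsilon> * (((b i)\<^sup>2 + (b (Suc i))\<^sup>2) / 2)"
      using h \<epsilon> by (intro mult_left_mono) auto
    moreover have "\<epsilon> * (((b (Suc i) - b i) / h)\<^sup>2 * h) = (b (Suc i) - b i)\<^sup>2 / (h / \<epsilon>)"
      using h \<epsilon> by (simp add: power2_eq_square field_simps)
    ultimately show "1 / \<epsilon> * (h * (((b i)\<^sup>2 + b i * b (Suc i) + (b (Suc i))\<^sup>2) / 3)) + \<epsilon> * (((b (Suc i) - b i) / h)\<^sup>2 * h)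
      \<le> h / \<epsilon> * (((b i)\<^sup>2 + (b (Suc i))\<^sup>2) / 2) + (b (Suc i) - b i)\<^sup>2 / (h / \<epsilon>)"
      by simp
  qed
  finally have "Gc / 2 * integral {-L..L} (\<lambda>x. 1 / \<epsilon> * (interp L h b x)\<^sup>2 + \<epsilon> * (deriv (interp L h b) x)\<^sup>2)
     \<le> Gc / 2 * (\<Sum>i<N. h / \<epsilon> * (((b i)\<^sup>2 + (b (Suc i))\<^sup>2) / 2) + (b (Suc i) - b i)\<^sup>2 / (h / \<epsilon>))"
    using Gc by (intro mult_left_mono) auto
  then show ?thesis unfolding disc_energy_def 1 2 by linarith
qed

text \<open>The distance |i - j| within the naturals: of the two truncated differences at least one
  is zero.\<close>

definition ndist :: "nat \<Rightarrow> nat \<Rightarrow> nat" where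
  "ndist i j = (i - j) + (j - i)"

text \<open>The damage profile at an atom is the discrete analogue of \<open>m exp(-|x - a| / \<epsilon>)\<close>, truncated
  at height \<open>m \<tau>\<close> to have small support.\<close>

lemma profile_energy:
  fixes \<kappa> \<tau> m :: real and J N :: nat
  assumes \<kappa>: "0 < \<kappa>" "\<kappa> < 1" and \<tau>: "0 \<le> \<tau>" "\<tau> \<le> 1" and m: "0 \<le> m"
  defines "p \<equiv> \<lambda>i. max 0 (m * ((1 - \<kappa>) ^ ndist i J - \<tau>))"
  shows "(\<Sum>i<N. \<kappa> * (((p i)\<^sup>2 + (p (Suc i))\<^sup>2) / 2) + (p (Suc i) - p i)\<^sup>2 / \<kappa>) \<le> 4 * m\<^sup>2 / (2 - \<kappa>)"
proof -
  define q where "q = 1 - \<kappa>"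
  have q: "0 < q" "q < 1" using \<kappa> by (auto simp: q_def)
  \<comment> \<open>Half of the final bound: the energy of each flank of the profile telescopes to
    at most \<open>c\<close>.\<close>
  define c where "c = 2 * m\<^sup>2 / (2 - \<kappa>)"
  have c0: "0 \<le> c" using \<kappa> by (simp add: c_def)
  have pb: "0 \<le> p i" "p i \<le> m * q ^ ndist i J" for i
    using m q \<tau> by (auto simp: p_def q_def[symmetric] right_diff_distrib)
  have pd: "\<bar>p i - p j\<bar> \<le> \<bar>m * q ^ ndist i J - m * q ^ ndist j J\<bar>" for i j
    unfolding p_def q_def[symmetric] right_diff_distrib by (auto simp: max_def abs_if)
  \<comment> \<open>On an edge at distance k from the peak the energy is at most 2 \<kappa> m^2
    q^(2k), and 1 - q^2 = \<kappa> (2 - \<kappa>) makes this a multiple of a difference of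
    consecutive powers. The truncation increases neither values nor increments.\<close>
  have core: "\<kappa> * (((p i)\<^sup>2 + (p (Suc i))\<^sup>2) / 2) + (p (Suc i) - p i)\<^sup>2 / \<kappa> \<le> c * (q ^ (2 * k) - q ^ (2 * Suc k))"
    if or: "ndist i J = k \<and> ndist (Suc i) J = Suc k \<or> ndist (Suc i) J = k \<and> ndist i J = Suc k" for i k
  proof -
    have "(p i)\<^sup>2 \<le> (m * q ^ ndist i J)\<^sup>2" "(p (Suc i))\<^sup>2 \<le> (m * q ^ ndist (Suc i) J)\<^sup>2"
      using pb by (auto intro: power_mono)
    then have s: "(p i)\<^sup>2 + (p (Suc i))\<^sup>2 \<le> (m * q ^ k)\<^sup>2 + (m * q ^ Suc k)\<^sup>2" using or by auto
    have "(p (Suc i) - p i)\<^sup>2 \<le> (m * q ^ ndist (Suc i) J - m * q ^ ndist i J)\<^sup>2"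
      using pd[of "Suc i" i] by (rule abs_le_square_iff[THEN iffD1])
    then have dd: "(p (Suc i) - p i)\<^sup>2 \<le> (m * q ^ k - m * q ^ Suc k)\<^sup>2"
      using or by (auto simp: power2_commute)
    have e1: "m * q ^ k - m * q ^ Suc k = \<kappa> * (m * q ^ k)" by (simp add: q_def algebra_simps)
    have "\<kappa> * (((p i)\<^sup>2 + (p (Suc i))\<^sup>2) / 2) + (p (Suc i) - p i)\<^sup>2 / \<kappa>
        \<le> \<kappa> * (((m * q ^ k)\<^sup>2 + (m * q ^ Suc k)\<^sup>2) / 2) + (\<kappa> * (m * q ^ k))\<^sup>2 / \<kappa>"
    proof -
      have "\<kappa> * (((p i)\<^sup>2 + (p (Suc i))\<^sup>2) / 2) \<le> \<kappa> * (((m * q ^ k)\<^sup>2 + (m * q ^ Suc k)\<^sup>2) / 2)"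
        using s \<kappa> by (intro mult_left_mono divide_right_mono) auto
      moreover have "(p (Suc i) - p i)\<^sup>2 / \<kappa> \<le> (\<kappa> * (m * q ^ k))\<^sup>2 / \<kappa>"
        using dd \<kappa> unfolding e1 by (intro divide_right_mono) auto
      ultimately show ?thesis by linarith
    qed
    also have "\<dots> = \<kappa> * (m * q ^ k)\<^sup>2 * ((1 + q\<^sup>2) / 2 + 1)"
      using \<kappa> by (simp add: power2_eq_square field_simps)
    also have "\<dots> \<le> \<kappa> * (m * q ^ k)\<^sup>2 * 2"
      using \<kappa> q by (intro mult_left_mono) (auto simp: power_le_one)
    also have "\<dots> = c * (q ^ (2 * k) - q ^ (2 * Suc k))"
    proof -
      have "q ^ (2 * k) - q ^ (2 * Suc k) = (q ^ k)\<^sup>2 * (1 - q\<^sup>2)"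
        by (simp add: power_mult power2_eq_square algebra_simps power_mult_distrib)
      also have "1 - q\<^sup>2 = \<kappa> * (2 - \<kappa>)" by (simp add: q_def power2_eq_square algebra_simps)
      finally have "c * (q ^ (2 * k) - q ^ (2 * Suc k)) = (c * (2 - \<kappa>)) * (\<kappa> * (q ^ k)\<^sup>2)"
        by (simp only: mult_ac)
      also have "c * (2 - \<kappa>) = 2 * m\<^sup>2" using \<kappa> by (simp add: c_def)
      finally show ?thesis by (simp add: power_mult_distrib)
    qed
    finally show ?thesis .
  qed
  \<comment> \<open>A potential with values between 0 and 2 whose increments are the differences in
    \<open>core\<close> on both sides of the peak.\<close>
  define G where "G i = (if i \<le> J then q ^ (2 * (J - i)) else 2 - q ^ (2 * (i - J)))" for i
  have "(\<Sum>i<N. \<kappa> * (((p i)\<^sup>2 + (p (Suc i))\<^sup>2) / 2) + (p (Suc i) - p i)\<^sup>2 / \<kappa>) \<le> (\<Sum>i<N. c * (G (Suc i) - G i))"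
  proof (rule sum_mono)
    fix i
    consider "Suc i \<le> J" | "i = J" | "J < i" by linarith
    then show "\<kappa> * (((p i)\<^sup>2 + (p (Suc i))\<^sup>2) / 2) + (p (Suc i) - p i)\<^sup>2 / \<kappa> \<le> c * (G (Suc i) - G i)"
    proof cases
      case 1
      then have "Suc (J - Suc i) = J - i" by simp
      then show ?thesis using core[of i "J - Suc i"] 1 by (simp add: G_def ndist_def)
    next
      case 2
      then show ?thesis using core[of i 0] by (simp add: G_def ndist_def)
    next
      case 3
      then show ?thesis using core[of i "i - J"] by (simp add: G_def ndist_def Suc_diff_le)
    qed
  qed
  also have "\<dots> = c * (G N - G 0)" by (simp add: sum_distrib_left[symmetric] sum_lessThan_telescope)
  also have "\<dots> \<le> c * 2"
  proof (rule mult_left_mono[OF _ c0])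
    have "G N \<le> 2"
    proof (cases "N \<le> J")
      case True
      have "q ^ (2 * (J - N)) \<le> 1" using q by (intro power_le_one) auto
      then show ?thesis using True by (simp add: G_def)
    qed (use q in \<open>auto simp: G_def\<close>)
    moreover have "0 \<le> G 0" using q by (simp add: G_def)
    ultimately show "G N - G 0 \<le> 2" by simp
  qed
  finally show ?thesis by (simp add: c_def)
qed

text \<open>The index is clamped to \<open>{k..N - 1 - k}\<close> so that a damage profile of radius \<open>k\<close> around the cell
  vanishes at both endpoints.\<close>

definition cell_index :: "real \<Rightarrow> real \<Rightarrow> nat \<Rightarrow> nat \<Rightarrow> real \<Rightarrow> nat" where
  "cell_index L h N k x = max k (min (nat \<lfloor>(x + L) / h\<rfloor>) (N - 1 - k))"

text \<open>Truncation to [-M, M], which enforces the sup-norm constraint on admissible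
  displacements.\<close>

definition clip :: "real \<Rightarrow> real \<Rightarrow> real" where
  "clip M x = max (- M) (min M x)"

text \<open>Nodal values. Because of the strict inequality, mass assigned to cell i is added between
  nodes i and i + 1, that is inside this cell. For 2 k < N nothing has been added at node 0 and
  everything at node N.\<close>

definition rec_disp :: "real \<Rightarrow> real \<Rightarrow> nat \<Rightarrow> nat \<Rightarrow> (real \<Rightarrow> real) \<Rightarrow> (real \<Rightarrow> real) \<Rightarrow> real measure \<Rightarrow> nat \<Rightarrow> real" where
  "rec_disp L h N k g f \<nu> i = clip (bdry_norm L g)
     (g (-L) + (LINT y:{-L..node L h i}|lebesgue. f y) + measure \<nu> {x. cell_index L h N k x < i})"

definition profile :: "real \<Rightarrow> real \<Rightarrow> real \<Rightarrow> nat \<Rightarrow> nat \<Rightarrow> real" where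
  "profile \<kappa> \<tau> m J i = max 0 (m * ((1 - \<kappa>) ^ ndist i J - \<tau>))"

text \<open>The maximum, unlike the sum, keeps the damage below 1 where profiles overlap; the
  inserted 0 gives a value for empty \<open>A\<close>.\<close>

definition rec_damage :: "real \<Rightarrow> real \<Rightarrow> (real \<Rightarrow> real) \<Rightarrow> (real \<Rightarrow> nat) \<Rightarrow> real set \<Rightarrow> nat \<Rightarrow> real" where
  "rec_damage \<kappa> \<tau> m J A i = Max (insert 0 ((\<lambda>a. profile \<kappa> \<tau> (m a) (J a) i) ` A))"

section \<open>Energy of the recovery pair\<close>

lemma cell_index_measurable [measurable]: "cell_index L h N k \<in> measurable borel (count_space UNIV)"
  unfolding cell_index_def[abs_def] by measurable

lemma cell_index_bounds:
  assumes "2 * k < N"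
  shows "k \<le> cell_index L h N k x" "cell_index L h N k x \<le> N - 1 - k" "cell_index L h N k x < N"
  using assms by (auto simp: cell_index_def)

lemma clip_bound: "0 \<le> M \<Longrightarrow> \<bar>clip M x\<bar> \<le> M"
  by (auto simp: clip_def)

lemma clip_id: "\<bar>x\<bar> \<le> M \<Longrightarrow> clip M x = x"
  by (auto simp: clip_def)

text \<open>\<open>clip\<close> is nondecreasing and 1-Lipschitz. Writing this with a factor
  \<theta> allows the elastic and plastic shares of an increment to be scaled alike.\<close>

lemma clip_diff: "\<exists>\<theta>. 0 \<le> \<theta> \<and> \<theta> \<le> 1 \<and> clip M y - clip M x = \<theta> * (y - x)"
proof (cases "x = y")
  case True then show ?thesis by (intro exI[of _ 0]) simp
next
  case False
  define \<theta> where "\<theta> = (clip M y - clip M x) / (y - x)"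
  have "0 \<le> \<theta> \<and> \<theta> \<le> 1"
  proof (cases "x < y")
    case True
    then have "0 \<le> clip M y - clip M x" "clip M y - clip M x \<le> y - x" by (auto simp: clip_def)
    then show ?thesis using True by (auto simp: \<theta>_def divide_le_eq)
  next
    case False
    with \<open>x \<noteq> y\<close> have "y < x" by simp
    then have "0 \<le> clip M x - clip M y" "clip M x - clip M y \<le> x - y" by (auto simp: clip_def)
    moreover have "\<theta> = (clip M x - clip M y) / (x - y)"
      unfolding \<theta>_def using minus_divide_divide[of "clip M y - clip M x" "y - x"] by simp
    ultimately show ?thesis using \<open>y < x\<close> by (auto simp: divide_le_eq)
  qed
  moreover have "clip M y - clip M x = \<theta> * (y - x)" using False by (simp add: \<theta>_def)
  ultimately show ?thesis by blast
qed

lemma rec_damage_nonneg: "finite A \<Longrightarrow> 0 \<le> rec_damage \<kappa> \<tau> m J A i"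
  by (auto simp: rec_damage_def)

lemma profile_le_damage: "finite A \<Longrightarrow> a \<in> A \<Longrightarrow> profile \<kappa> \<tau> (m a) (J a) i \<le> rec_damage \<kappa> \<tau> m J A i"
  by (auto simp: rec_damage_def)

lemma rec_damage_cases:
  assumes "finite A"
  shows "rec_damage \<kappa> \<tau> m J A i = 0 \<or> (\<exists>a\<in>A. rec_damage \<kappa> \<tau> m J A i = profile \<kappa> \<tau> (m a) (J a) i)"
proof -
  have "rec_damage \<kappa> \<tau> m J A i \<in> insert 0 ((\<lambda>a. profile \<kappa> \<tau> (m a) (J a) i) ` A)"
    unfolding rec_damage_def using assms by (intro Max_in) auto
  then show ?thesis by auto
qed

lemma rec_damage_sq:
  assumes A: "finite A"
  shows "(rec_damage \<kappa> \<tau> m J A i)\<^sup>2 \<le> (\<Sum>a\<in>A. (profile \<kappa> \<tau> (m a) (J a) i)\<^sup>2)"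
  using rec_damage_cases[OF A, of \<kappa> \<tau> m J i]
proof
  assume "\<exists>a\<in>A. rec_damage \<kappa> \<tau> m J A i = profile \<kappa> \<tau> (m a) (J a) i"
  then obtain a where a: "a \<in> A" "rec_damage \<kappa> \<tau> m J A i = profile \<kappa> \<tau> (m a) (J a) i" by blast
  show ?thesis unfolding a(2)
    by (rule member_le_sum[of a A "\<lambda>a. (profile \<kappa> \<tau> (m a) (J a) i)\<^sup>2"]) (use A a in auto)
qed (auto intro: sum_nonneg)

text \<open>The larger of the two maxima, if positive, is attained by some profile whose value at
  the other index stays below the maximum there; this single profile accounts for the
  increment.\<close>

lemma rec_damage_diff_sq:
  assumes A: "finite A"
  shows "(rec_damage \<kappa> \<tau> m J A i - rec_damage \<kappa> \<tau> m J A j)\<^sup>2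
    \<le> (\<Sum>a\<in>A. (profile \<kappa> \<tau> (m a) (J a) i - profile \<kappa> \<tau> (m a) (J a) j)\<^sup>2)"
proof -
  let ?b = "rec_damage \<kappa> \<tau> m J A" and ?p = "\<lambda>a. profile \<kappa> \<tau> (m a) (J a)"
  have one: "(?b i - ?b j)\<^sup>2 \<le> (\<Sum>a\<in>A. (?p a i - ?p a j)\<^sup>2)" if ge: "?b j \<le> ?b i" for i j
    using rec_damage_cases[OF A, of \<kappa> \<tau> m J i]
  proof
    assume "?b i = 0"
    then have "?b j = 0" using ge rec_damage_nonneg[OF A, of \<kappa> \<tau> m J j] by simp
    then show ?thesis using \<open>?b i = 0\<close> by (simp add: sum_nonneg)
  next
    assume "\<exists>a\<in>A. ?b i = ?p a i"
    then obtain a where a: "a \<in> A" "?b i = ?p a i" by blast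
    have "?p a j \<le> ?b j" by (rule profile_le_damage[OF A a(1)])
    then have "(?b i - ?b j)\<^sup>2 \<le> (?p a i - ?p a j)\<^sup>2" using ge a by (intro power_mono) auto
    also have "\<dots> \<le> (\<Sum>a\<in>A. (?p a i - ?p a j)\<^sup>2)"
      by (rule member_le_sum[of a A "\<lambda>a. (?p a i - ?p a j)\<^sup>2"]) (use A a in auto)
    finally show ?thesis .
  qed
  show ?thesis
  proof (cases "?b j \<le> ?b i")
    case True then show ?thesis by (rule one)
  next
    case False
    then have "(?b j - ?b i)\<^sup>2 \<le> (\<Sum>a\<in>A. (?p a j - ?p a i)\<^sup>2)" by (intro one) simp
    then show ?thesis by (simp add: power2_commute)
  qed
qed

lemma profile_far:
  assumes \<kappa>: "0 < \<kappa>" "\<kappa> < 1" and m: "0 \<le> m" and k: "(1 - \<kappa>) ^ k \<le> \<tau>" "k \<le> ndist i J"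
  shows "profile \<kappa> \<tau> m J i = 0"
proof -
  have "(1 - \<kappa>) ^ ndist i J \<le> (1 - \<kappa>) ^ k" using \<kappa> k(2) by (intro power_decreasing) auto
  then have "m * ((1 - \<kappa>) ^ ndist i J - \<tau>) \<le> 0" using k(1) m by (intro mult_nonneg_nonpos) auto
  then show ?thesis by (simp add: profile_def)
qed

lemma rec_damage_range:
  assumes A: "finite A" and \<kappa>: "0 < \<kappa>" "\<kappa> < 1" and \<tau>: "0 \<le> \<tau>" and m: "\<And>a. a \<in> A \<Longrightarrow> 0 \<le> m a \<and> m a \<le> 1"
  shows "rec_damage \<kappa> \<tau> m J A i \<le> 1"
  using rec_damage_cases[OF A, of \<kappa> \<tau> m J i]
proof
  assume "\<exists>a\<in>A. rec_damage \<kappa> \<tau> m J A i = profile \<kappa> \<tau> (m a) (J a) i"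
  then obtain a where a: "a \<in> A" "rec_damage \<kappa> \<tau> m J A i = profile \<kappa> \<tau> (m a) (J a) i" by blast
  have "(1 - \<kappa>) ^ ndist i (J a) \<le> 1" using \<kappa> by (intro power_le_one) auto
  then have "(1 - \<kappa>) ^ ndist i (J a) - \<tau> \<le> 1" using \<tau> by simp
  then have "m a * ((1 - \<kappa>) ^ ndist i (J a) - \<tau>) \<le> m a * 1" using m[OF a(1)] by (intro mult_left_mono) auto
  then show ?thesis using m[OF a(1)] by (simp add: a(2) profile_def)
qed simp

lemma rec_damage_zero:
  assumes A: "finite A" and \<kappa>: "0 < \<kappa>" "\<kappa> < 1" and m: "\<And>a. a \<in> A \<Longrightarrow> 0 \<le> m a"
    and k: "(1 - \<kappa>) ^ k \<le> \<tau>" "\<And>a. a \<in> A \<Longrightarrow> k \<le> ndist i (J a)"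
  shows "rec_damage \<kappa> \<tau> m J A i = 0"
  using rec_damage_cases[OF A, of \<kappa> \<tau> m J i]
proof
  assume "\<exists>a\<in>A. rec_damage \<kappa> \<tau> m J A i = profile \<kappa> \<tau> (m a) (J a) i"
  then obtain a where a: "a \<in> A" "rec_damage \<kappa> \<tau> m J A i = profile \<kappa> \<tau> (m a) (J a) i" by blast
  then show ?thesis using profile_far[OF \<kappa> m[OF a(1)] k(1) k(2)[OF a(1)]] by simp
qed

text \<open>Each cost is kept separate: elastic energy, the opening \<open>p\<close> and the mass
  outside \<open>A\<close> at the full price \<open>\<sigma>c\<close>, and for each atom in
  \<open>A\<close> the degraded price plus its damage profile. The errors due to \<tau> and
  h/\<epsilon> stay explicit for the later limit.\<close>

lemma recovery_energy:
  assumes h: "0 < h" and N: "real N * h = 2 * L" and L: "0 < L" and \<epsilon>: "0 < \<epsilon>" and pos: "0 < E0" "0 < \<sigma>c" "0 < Gc"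
    and \<kappa>: "h / \<epsilon> < 1" and \<tau>: "0 < \<tau>" "\<tau> \<le> 1" and k: "2 * k < N" "(1 - h / \<epsilon>) ^ k \<le> \<tau>"
    and e: "e absolutely_integrable_on {-L..L}" "(\<lambda>x. (e x)\<^sup>2) absolutely_integrable_on {-L..L}"
    and p: "p absolutely_integrable_on {-L..L}" "\<And>x. 0 \<le> p x"
    and \<nu>: "finite_borel_measure \<nu>"
    and tot: "g L = g (-L) + (LINT y:{-L..L}|lebesgue. e y + p y) + measure \<nu> UNIV"
    and A: "finite A"
  defines "w \<equiv> \<lambda>a. measure \<nu> {a}"
  defines "m \<equiv> \<lambda>a. \<sigma>c * w a / (Gc + \<sigma>c * w a)"
  defines "J \<equiv> cell_index L h N k"
  defines "s \<equiv> rec_disp L h N k g (\<lambda>y. e y + p y) \<nu>"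
  defines "b \<equiv> rec_damage (h / \<epsilon>) \<tau> m J A"
  shows "admissible L g (cell L h ` {..<N}) (interp L h s) (interp L h b)"
    "F_disc L E0 \<sigma>c Gc \<epsilon> (cell L h ` {..<N}) (interp L h s) (interp L h b) \<le>
      ennreal (1/2 * E0 * integral {-L..L} (\<lambda>x. (e x)\<^sup>2) + \<sigma>c * integral {-L..L} p + \<sigma>c * measure \<nu> (- A)
        + (\<Sum>a\<in>A. \<sigma>c * w a * ((1 - m a)\<^sup>2 + 3 * (h / \<epsilon> / 2 + \<tau>)) + Gc / 2 * (4 * (m a)\<^sup>2 / (2 - h / \<epsilon>))))"
proof -
  interpret \<nu>: finite_borel_measure \<nu> by fact
  note [simp] = \<nu>.M_is_borel
  define \<kappa>' where "\<kappa>' = h / \<epsilon>"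
  have \<kappa>': "0 < \<kappa>'" "\<kappa>' < 1" using h \<epsilon> \<kappa> by (auto simp: \<kappa>'_def)
  let ?T = "cell L h ` {..<N}" and ?M = "bdry_norm L g"
  have M: "0 \<le> ?M" "\<bar>g L\<bar> \<le> ?M" "\<bar>g (-L)\<bar> \<le> ?M" by (auto simp: bdry_norm_def)
  have w0: "0 \<le> w a" for a by (simp add: w_def)
  have m01: "0 \<le> m a" "m a \<le> 1" for a
    using w0[of a] pos by (auto simp: m_def add_pos_nonneg)
  have Jb: "k \<le> J x" "J x \<le> N - 1 - k" "J x < N" for x
    unfolding J_def by (rule cell_index_bounds[OF k(1)])+
  have Nn: "node L h N = L" "node L h 0 = -L" using N by (simp_all add: node_def)
  define f where "f y = e y + p y" for y
  have fi: "f absolutely_integrable_on {-L..L}" unfolding f_def by (rule set_integral_add(1)[OF e(1) p(1)])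
  define V where "V i = g (-L) + (LINT y:{-L..node L h i}|lebesgue. f y) + measure \<nu> {x. J x < i}" for i
  have sV: "s i = clip ?M (V i)" for i by (simp add: s_def rec_disp_def V_def f_def J_def)
  have V0: "V 0 = g (-L)" using LINT_null_set[of "{-L}" f] by (simp add: V_def node_0)
  have VN: "V N = g L" using Jb(3) tot by (simp add: V_def Nn f_def)
  have s0: "s 0 = g (-L)" "s N = g L" unfolding sV V0 VN using M by (auto intro: clip_id)
  have sb: "\<bar>s i\<bar> \<le> ?M" for i unfolding sV by (rule clip_bound[OF M(1)])
  have b0: "0 \<le> b i" "b i \<le> 1" for i
    unfolding b_def using rec_damage_nonneg[OF A] rec_damage_range[OF A \<kappa>'[unfolded \<kappa>'_def]] \<tau> m01 by auto
  \<comment> \<open>Clamping keeps every peak at least k indices away from 0 and N, where the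
    truncated profile has already reached zero.\<close>
  have bz: "b 0 = 0" "b N = 0"
  proof -
    have "k \<le> ndist 0 (J a)" "k \<le> ndist N (J a)" for a
      using Jb(1)[of a] Jb(2)[of a] k(1) by (auto simp: ndist_def)
    then show "b 0 = 0" "b N = 0"
      unfolding b_def using rec_damage_zero[OF A \<kappa>'[unfolded \<kappa>'_def] m01(1) k(2)] by auto
  qed
  have icell: "node L h i \<in> {-L..L}" if "i \<le> N" for i
  proof -
    have "node L h i \<le> node L h N" using node_le[OF h] that by blast
    moreover have "-L \<le> node L h i" using h by (simp add: node_def)
    ultimately show ?thesis unfolding Nn(1) by simp
  qed
  show adm: "admissible L g ?T (interp L h s) (interp L h b)"
    unfolding admissible_def
  proof (intro conjI ballI interp_P1[OF h])
    fix x assume "x \<in> {-L..L}"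
    then obtain i where i: "x \<in> cell L h i" using cell_exists[OF h N L] by blast
    note bt = interp_between[OF h i]
    show "\<bar>interp L h s x\<bar> \<le> ?M" using bt[of s] sb[of i] sb[of "Suc i"] by linarith
    show "0 \<le> interp L h b x" using bt(1)[of b] b0(1)[of i] b0(1)[of "Suc i"] by linarith
    show "interp L h b x \<le> 1" using bt(2)[of b] b0(2)[of i] b0(2)[of "Suc i"] by linarith
  next
    show "interp L h s (-L) = g (-L)" using interp_node[OF h, of L s 0] s0 by (simp add: node_0)
    show "interp L h b (-L) = 0" using interp_node[OF h, of L b 0] bz by (simp add: node_0)
    show "interp L h s L = g L" using interp_node[OF h, of L s N] s0 by (simp add: Nn)
    show "interp L h b L = 0" using interp_node[OF h, of L b N] bz by (simp add: Nn)
  qed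
  define ei where "ei i = integral (cell L h i) e" for i
  define pi where "pi i = integral (cell L h i) p" for i
  define ni where "ni i = measure \<nu> {x. J x = i}" for i
  have Jm: "{x. P (J x)} \<in> sets borel" for P
    using measurable_sets[OF cell_index_measurable, of "{i. P i}" L h N k] by (simp add: J_def vimage_def)
  have cI: "-L \<le> node L h i" "node L h (Suc i) \<le> L" "node L h i \<le> node L h (Suc i)" if "i < N" for i
    using icell[of i] icell[of "Suc i"] that h by (auto simp: node_Suc)
  have Vd: "V (Suc i) - V i = ei i + pi i + ni i" if i: "i < N" for i
  proof -
    have LI: "(LINT y:{-L..z}|lebesgue. f y) = integral {-L..z} f" if "z \<in> {-L..L}" for z
      by (rule set_lebesgue_integral_eq_integral(2)[OF set_integrable_subset[OF fi]]) (use that in auto)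
    have "integral {-L..node L h i} f + integral (cell L h i) f = integral {-L..node L h (Suc i)} f"
      using cI[OF i] by (intro Henstock_Kurzweil_Integration.integral_combine absint_sub[OF fi]) auto
    moreover have "integral (cell L h i) f = ei i + pi i"
      unfolding f_def ei_def pi_def using cI[OF i]
      by (intro Henstock_Kurzweil_Integration.integral_add absint_sub[OF e(1)] absint_sub[OF p(1)]) auto
    moreover have "measure \<nu> {x. J x < Suc i} = measure \<nu> {x. J x < i} + ni i"
      unfolding ni_def using Jm[of "\<lambda>j. j < i"] Jm[of "\<lambda>j. j = i"]
      by (subst \<nu>.finite_measure_Union[symmetric]) (auto intro!: arg_cong[where f="measure \<nu>"])
    ultimately show ?thesis using LI[OF icell[of i]] LI[OF icell[of "Suc i"]] i by (simp add: V_def)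
  qed
  have "\<forall>i. \<exists>\<theta>. 0 \<le> \<theta> \<and> \<theta> \<le> 1 \<and> s (Suc i) - s i = \<theta> * (V (Suc i) - V i)"
    unfolding sV using clip_diff by blast
  then obtain \<theta> where \<theta>: "\<And>i. 0 \<le> \<theta> i" "\<And>i. \<theta> i \<le> 1" "\<And>i. s (Suc i) - s i = \<theta> i * (V (Suc i) - V i)"
    unfolding choice_iff by blast
  have pi0: "0 \<le> pi i" if "i < N" for i unfolding pi_def using cI[OF that] p by (intro integral_nonneg absint_sub[OF p(1)]) auto
  have ni0: "0 \<le> ni i" for i by (simp add: ni_def)
  \<comment> \<open>The opening of a cell absorbs the truncated share of \<open>p\<close> and of
    \<nu>; what is left of the slope is \<theta> times the mean of \<open>e\<close> on the
    cell.\<close>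
  define c where "c i = (if i < N then \<theta> i * (pi i + ni i) / h else 0)" for i
  have c0: "0 \<le> c i" for i using \<theta>(1) pi0 ni0 h by (simp add: c_def)
  define \<alpha> where "\<alpha> i = (1 - (b i + b (Suc i)) / 2)\<^sup>2" for i
  have \<alpha>: "0 \<le> \<alpha> i" "\<alpha> i \<le> 1" for i
    unfolding \<alpha>_def using b0[of i] b0[of "Suc i"] by (auto intro!: power_le_one)
  have "(\<Sum>i<N. 1/2 * E0 * ((s (Suc i) - s i) / h - c i)\<^sup>2 * h) \<le> (\<Sum>i<N. 1/2 * E0 * integral (cell L h i) (\<lambda>x. (e x)\<^sup>2))"
  proof (rule sum_mono)
    fix i assume "i \<in> {..<N}"
    then have i: "i < N" by simp
    have "(s (Suc i) - s i) / h - c i = \<theta> i * ei i / h"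
      using \<theta>(3)[of i] Vd[OF i] i h by (simp add: c_def field_simps)
    then have "((s (Suc i) - s i) / h - c i)\<^sup>2 * h = (\<theta> i)\<^sup>2 * ((ei i)\<^sup>2 / h)"
      using h by (simp add: power2_eq_square field_simps)
    also have "\<dots> \<le> 1 * ((ei i)\<^sup>2 / h)"
      using \<theta>(1,2)[of i] h by (intro mult_right_mono power_le_one) auto
    also have "(ei i)\<^sup>2 / h \<le> integral (cell L h i) (\<lambda>x. (e x)\<^sup>2)"
    proof -
      have "(ei i)\<^sup>2 \<le> (node L h (Suc i) - node L h i) * integral (cell L h i) (\<lambda>x. (e x)\<^sup>2)"
        unfolding ei_def using cI[OF i] by (intro cauchy_schwarz_integral absint_sub[OF e(1)] absint_sub[OF e(2)]) auto
      then show ?thesis using h by (simp add: node_Suc divide_le_eq mult.commute)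
    qed
    finally show "1/2 * E0 * ((s (Suc i) - s i) / h - c i)\<^sup>2 * h \<le> 1/2 * E0 * integral (cell L h i) (\<lambda>x. (e x)\<^sup>2)"
      using pos(1) by (simp add: mult.assoc)
  qed
  also have "\<dots> = 1/2 * E0 * (\<Sum>i<N. integral (cell L h i) (\<lambda>x. (e x)\<^sup>2))" by (simp only: sum_distrib_left)
  also have cells: "(\<Sum>i<N. integral (cell L h i) q) = integral {-L..L} q" if "q absolutely_integrable_on {-L..L}" for q :: "real \<Rightarrow> real"
    using integral_partition[of N "node L h" q] absint_sub[OF that, of "-L" L] h by (simp add: Nn node_le)
  have "(\<Sum>i<N. integral (cell L h i) (\<lambda>x. (e x)\<^sup>2)) = integral {-L..L} (\<lambda>x. (e x)\<^sup>2)" by (rule cells[OF e(2)])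
  finally have part1: "(\<Sum>i<N. 1/2 * E0 * ((s (Suc i) - s i) / h - c i)\<^sup>2 * h) \<le> 1/2 * E0 * integral {-L..L} (\<lambda>x. (e x)\<^sup>2)" .
  have part2: "(\<Sum>i<N. \<alpha> i * \<sigma>c * c i * h) \<le> \<sigma>c * integral {-L..L} p + \<sigma>c * measure \<nu> (- A)
      + (\<Sum>a\<in>A. \<sigma>c * w a * ((1 - m a)\<^sup>2 + 3 * (\<kappa>' / 2 + \<tau>)))"
  proof -
    have "(\<Sum>i<N. \<alpha> i * \<sigma>c * c i * h) \<le> (\<Sum>i<N. \<sigma>c * pi i + \<sigma>c * (\<alpha> i * ni i))"
    proof (rule sum_mono)
      fix i assume "i \<in> {..<N}"
      then have i: "i < N" by simp
      have "\<alpha> i * \<sigma>c * c i * h = \<sigma>c * (\<theta> i * (\<alpha> i * (pi i + ni i)))" using h i by (simp add: c_def)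
      also have "\<dots> \<le> \<sigma>c * (1 * (\<alpha> i * (pi i + ni i)))"
        using pos \<theta>(1,2)[of i] \<alpha>(1)[of i] pi0[OF i] ni0[of i] by (intro mult_left_mono mult_right_mono) auto
      also have "\<alpha> i * (pi i + ni i) \<le> pi i + \<alpha> i * ni i"
        using \<alpha>[of i] pi0[OF i] by (simp add: distrib_left mult_left_le_one_le)
      finally show "\<alpha> i * \<sigma>c * c i * h \<le> \<sigma>c * pi i + \<sigma>c * (\<alpha> i * ni i)"
        using pos(2) by (simp add: distrib_left)
    qed
    also have "\<dots> = \<sigma>c * integral {-L..L} p + \<sigma>c * (\<Sum>i<N. \<alpha> i * ni i)"
      unfolding cells[OF p(1), symmetric] pi_def by (simp add: sum.distrib sum_distrib_left)
    also have "(\<Sum>i<N. \<alpha> i * ni i) \<le> measure \<nu> (- A) + (\<Sum>a\<in>A. w a * ((1 - m a)\<^sup>2 + 3 * (\<kappa>' / 2 + \<tau>)))"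
    proof -
      have Ab: "A \<in> sets borel" by (rule borel_closed[OF finite_imp_closed[OF A]])
      \<comment> \<open>The mass assigned to a cell is divided into selected atoms, which profit
        from the damage of their cell, and a remainder for which only \<alpha> \<le> 1 is
        used.\<close>
      have nib: "\<alpha> i * ni i \<le> measure \<nu> ({x. J x = i} - A) + (\<Sum>a\<in>{a \<in> A. J a = i}. \<alpha> (J a) * w a)" for i
      proof -
        have fin: "finite ({x. J x = i} \<inter> A)" using A by simp
        have b1: "{x. J x = i} - A \<in> sets borel" using Jm[of "\<lambda>j. j = i"] Ab by auto
        have b2: "{x. J x = i} \<inter> A \<in> sets borel" using Jm[of "\<lambda>j. j = i"] Ab by auto
        have "ni i = measure \<nu> ({x. J x = i} - A) + measure \<nu> ({x. J x = i} \<inter> A)"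
          unfolding ni_def using b1 b2 by (subst \<nu>.finite_measure_Union[symmetric]) (auto intro!: arg_cong[where f="measure \<nu>"])
        also have "measure \<nu> ({x. J x = i} \<inter> A) = (\<Sum>a\<in>{x. J x = i} \<inter> A. w a)"
          unfolding w_def using fin by (intro \<nu>.finite_measure_eq_sum_singleton) auto
        also have "{x. J x = i} \<inter> A = {a \<in> A. J a = i}" by auto
        finally have "\<alpha> i * ni i = \<alpha> i * measure \<nu> ({x. J x = i} - A) + (\<Sum>a\<in>{a \<in> A. J a = i}. \<alpha> i * w a)"
          by (simp add: distrib_left sum_distrib_left)
        moreover have "\<alpha> i * measure \<nu> ({x. J x = i} - A) \<le> measure \<nu> ({x. J x = i} - A)"
          using \<alpha>[of i] by (simp add: mult_left_le_one_le)
        moreover have "(\<Sum>a\<in>{a \<in> A. J a = i}. \<alpha> i * w a) = (\<Sum>a\<in>{a \<in> A. J a = i}. \<alpha> (J a) * w a)"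
          by (intro sum.cong) auto
        ultimately show ?thesis by linarith
      qed
      have "(\<Sum>i<N. \<alpha> i * ni i) \<le> (\<Sum>i<N. measure \<nu> ({x. J x = i} - A)) + (\<Sum>i<N. \<Sum>a\<in>{a \<in> A. J a = i}. \<alpha> (J a) * w a)"
        unfolding sum.distrib[symmetric] by (intro sum_mono nib)
      also have "(\<Sum>i<N. measure \<nu> ({x. J x = i} - A)) = measure \<nu> (\<Union>i<N. {x. J x = i} - A)"
        using Jm Ab by (intro \<nu>.finite_measure_finite_Union[symmetric]) (auto simp: disjoint_family_on_def)
      also have "\<dots> \<le> measure \<nu> (- A)" using Ab by (intro \<nu>.finite_measure_mono) auto
      also have "(\<Sum>i<N. \<Sum>a\<in>{a \<in> A. J a = i}. \<alpha> (J a) * w a) = (\<Sum>a\<in>A. \<alpha> (J a) * w a)"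
        using A Jb(3) by (intro sum.group) auto
      also have "(\<Sum>a\<in>A. \<alpha> (J a) * w a) \<le> (\<Sum>a\<in>A. w a * ((1 - m a)\<^sup>2 + 3 * (\<kappa>' / 2 + \<tau>)))"
      proof (rule sum_mono)
        fix a assume a: "a \<in> A"
        \<comment> \<open>At the two nodes of the cell of \<open>a\<close> the profile is at least m
          (1 - \<tau>) and m (1 - \<kappa>' - \<tau>), so the element mean falls short of m by at
          most m z.\<close>
        define z where "z = \<kappa>' / 2 + \<tau>"
        have z0: "0 \<le> z" using \<kappa>' \<tau> by (simp add: z_def)
        define B where "B = (b (J a) + b (Suc (J a))) / 2"
        have B1: "B \<le> 1" using b0(2)[of "J a"] b0(2)[of "Suc (J a)"] by (simp add: B_def)
        have "m a * (1 - \<tau>) \<le> b (J a)" "m a * (1 - \<kappa>' - \<tau>) \<le> b (Suc (J a))"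
          using profile_le_damage[OF A a, of "h / \<epsilon>" \<tau> m J "J a"] profile_le_damage[OF A a, of "h / \<epsilon>" \<tau> m J "Suc (J a)"]
          by (auto simp: b_def profile_def ndist_def \<kappa>'_def)
        then have "m a - m a * z \<le> B" by (simp add: B_def z_def algebra_simps)
        moreover have "m a * z \<le> z" using m01[of a] z0 by (simp add: mult_left_le_one_le)
        ultimately have Bl: "1 - B \<le> (1 - m a) + z" by simp
        \<comment> \<open>For z \<le> 1 the square of z is at most z, which gives the factor 3 = 2 +
          1; for larger z the trivial bound \<alpha> \<le> 1 is enough.\<close>
        have "\<alpha> (J a) \<le> (1 - m a)\<^sup>2 + 3 * z"
        proof (cases "z \<le> 1")
          case True
          have "\<alpha> (J a) \<le> ((1 - m a) + z)\<^sup>2" unfolding \<alpha>_def B_def[symmetric] using Bl B1 by (intro power_mono) auto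
          also have "\<dots> = (1 - m a)\<^sup>2 + 2 * ((1 - m a) * z) + z * z" by (simp add: power2_eq_square algebra_simps)
          also have "\<dots> \<le> (1 - m a)\<^sup>2 + 2 * (1 * z) + 1 * z"
            using m01[of a] z0 True by (intro add_mono mult_left_mono mult_right_mono order_refl) auto
          finally show ?thesis by simp
        next
          case False
          then show ?thesis using \<alpha>(2)[of "J a"] zero_le_power2[of "1 - m a"] by linarith
        qed
        then show "\<alpha> (J a) * w a \<le> w a * ((1 - m a)\<^sup>2 + 3 * (\<kappa>' / 2 + \<tau>))"
          using w0[of a] by (simp add: z_def mult.commute mult_left_mono)
      qed
      finally show ?thesis by simp
    qed
    finally show ?thesis using pos(2) by (simp add: distrib_left sum_distrib_left mult.assoc)
  qed
  have part3: "(\<Sum>i<N. \<kappa>' * (((b i)\<^sup>2 + (b (Suc i))\<^sup>2) / 2) + (b (Suc i) - b i)\<^sup>2 / \<kappa>') \<le> (\<Sum>a\<in>A. 4 * (m a)\<^sup>2 / (2 - \<kappa>'))"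
  proof -
    let ?p = "\<lambda>a. profile \<kappa>' \<tau> (m a) (J a)"
    have "(\<Sum>i<N. \<kappa>' * (((b i)\<^sup>2 + (b (Suc i))\<^sup>2) / 2) + (b (Suc i) - b i)\<^sup>2 / \<kappa>')
      \<le> (\<Sum>i<N. \<Sum>a\<in>A. \<kappa>' * (((?p a i)\<^sup>2 + (?p a (Suc i))\<^sup>2) / 2) + (?p a (Suc i) - ?p a i)\<^sup>2 / \<kappa>')"
    proof (rule sum_mono)
      fix i
      have 1: "(b i)\<^sup>2 + (b (Suc i))\<^sup>2 \<le> (\<Sum>a\<in>A. (?p a i)\<^sup>2 + (?p a (Suc i))\<^sup>2)"
        unfolding sum.distrib b_def \<kappa>'_def by (intro add_mono rec_damage_sq[OF A])
      have 2: "(b (Suc i) - b i)\<^sup>2 \<le> (\<Sum>a\<in>A. (?p a (Suc i) - ?p a i)\<^sup>2)"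
        unfolding b_def \<kappa>'_def by (rule rec_damage_diff_sq[OF A])
      have "\<kappa>' * (((b i)\<^sup>2 + (b (Suc i))\<^sup>2) / 2) \<le> \<kappa>' * ((\<Sum>a\<in>A. (?p a i)\<^sup>2 + (?p a (Suc i))\<^sup>2) / 2)"
        using 1 \<kappa>' by (intro mult_left_mono divide_right_mono) auto
      moreover have "(b (Suc i) - b i)\<^sup>2 / \<kappa>' \<le> (\<Sum>a\<in>A. (?p a (Suc i) - ?p a i)\<^sup>2) / \<kappa>'"
        using 2 \<kappa>' by (intro divide_right_mono) auto
      moreover have "\<kappa>' * ((\<Sum>a\<in>A. (?p a i)\<^sup>2 + (?p a (Suc i))\<^sup>2) / 2) = (\<Sum>a\<in>A. \<kappa>' * (((?p a i)\<^sup>2 + (?p a (Suc i))\<^sup>2) / 2))"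
        by (simp only: sum_distrib_left sum_divide_distrib)
      moreover have "(\<Sum>a\<in>A. (?p a (Suc i) - ?p a i)\<^sup>2) / \<kappa>' = (\<Sum>a\<in>A. (?p a (Suc i) - ?p a i)\<^sup>2 / \<kappa>')"
        by (rule sum_divide_distrib)
      moreover have "(\<Sum>a\<in>A. \<kappa>' * (((?p a i)\<^sup>2 + (?p a (Suc i))\<^sup>2) / 2) + (?p a (Suc i) - ?p a i)\<^sup>2 / \<kappa>')
          = (\<Sum>a\<in>A. \<kappa>' * (((?p a i)\<^sup>2 + (?p a (Suc i))\<^sup>2) / 2)) + (\<Sum>a\<in>A. (?p a (Suc i) - ?p a i)\<^sup>2 / \<kappa>')"
        by (rule sum.distrib)
      ultimately show "\<kappa>' * (((b i)\<^sup>2 + (b (Suc i))\<^sup>2) / 2) + (b (Suc i) - b i)\<^sup>2 / \<kappa>'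
          \<le> (\<Sum>a\<in>A. \<kappa>' * (((?p a i)\<^sup>2 + (?p a (Suc i))\<^sup>2) / 2) + (?p a (Suc i) - ?p a i)\<^sup>2 / \<kappa>')"
        by linarith
    qed
    also have "\<dots> = (\<Sum>a\<in>A. \<Sum>i<N. \<kappa>' * (((?p a i)\<^sup>2 + (?p a (Suc i))\<^sup>2) / 2) + (?p a (Suc i) - ?p a i)\<^sup>2 / \<kappa>')"
      by (rule sum.swap)
    also have "\<dots> \<le> (\<Sum>a\<in>A. 4 * (m a)\<^sup>2 / (2 - \<kappa>'))"
      unfolding profile_def using profile_energy[OF \<kappa>'] \<tau> m01 by (intro sum_mono) auto
    finally show ?thesis .
  qed
  have \<eta>P: "step_fun L h c \<in> P0 ?T" by (rule step_fun_P0[OF h])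
  have \<eta>0: "0 \<le> step_fun L h c x" for x using c0 by (simp add: step_fun_def)
  have "F_disc L E0 \<sigma>c Gc \<epsilon> ?T (interp L h s) (interp L h b) \<le> ennreal (disc_energy L E0 \<sigma>c Gc \<epsilon> ?T (interp L h s) (interp L h b) (step_fun L h c))"
    unfolding disc_energy_eq[OF h N L interp_P1[OF h] interp_P1[OF h] \<eta>P \<eta>0 pos \<epsilon>, symmetric] F_disc_def
    by (rule INF_lower) (use \<eta>P \<eta>0 in auto)
  also have "\<dots> \<le> ennreal (1/2 * E0 * integral {-L..L} (\<lambda>x. (e x)\<^sup>2) + \<sigma>c * integral {-L..L} p + \<sigma>c * measure \<nu> (- A)
        + (\<Sum>a\<in>A. \<sigma>c * w a * ((1 - m a)\<^sup>2 + 3 * (h / \<epsilon> / 2 + \<tau>)) + Gc / 2 * (4 * (m a)\<^sup>2 / (2 - h / \<epsilon>))))"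
  proof (rule ennreal_leI)
    have "Gc / 2 * (\<Sum>i<N. \<kappa>' * (((b i)\<^sup>2 + (b (Suc i))\<^sup>2) / 2) + (b (Suc i) - b i)\<^sup>2 / \<kappa>') \<le> Gc / 2 * (\<Sum>a\<in>A. 4 * (m a)\<^sup>2 / (2 - \<kappa>'))"
      using part3 pos by (intro mult_left_mono) auto
    then show "disc_energy L E0 \<sigma>c Gc \<epsilon> ?T (interp L h s) (interp L h b) (step_fun L h c) \<le>
       1/2 * E0 * integral {-L..L} (\<lambda>x. (e x)\<^sup>2) + \<sigma>c * integral {-L..L} p + \<sigma>c * measure \<nu> (- A)
        + (\<Sum>a\<in>A. \<sigma>c * w a * ((1 - m a)\<^sup>2 + 3 * (h / \<epsilon> / 2 + \<tau>)) + Gc / 2 * (4 * (m a)\<^sup>2 / (2 - h / \<epsilon>)))"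
      using disc_energy_interp_le[OF h N \<epsilon> pos(3), of E0 \<sigma>c s b c] part1 part2
      unfolding sum.distrib sum_distrib_left[symmetric] \<alpha>_def \<kappa>'_def by linarith
  qed
  finally show "F_disc L E0 \<sigma>c Gc \<epsilon> ?T (interp L h s) (interp L h b) \<le>
      ennreal (1/2 * E0 * integral {-L..L} (\<lambda>x. (e x)\<^sup>2) + \<sigma>c * integral {-L..L} p + \<sigma>c * measure \<nu> (- A)
        + (\<Sum>a\<in>A. \<sigma>c * w a * ((1 - m a)\<^sup>2 + 3 * (h / \<epsilon> / 2 + \<tau>)) + Gc / 2 * (4 * (m a)\<^sup>2 / (2 - h / \<epsilon>))))" .
qed

section \<open>Convergence of the recovery pair\<close>

lemma cell_index_close:
  assumes h: "0 < h" and N: "real N * h = 2 * L" and k: "2 * k < N" and x: "x \<in> {-L..L}"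
  shows "\<bar>node L h (cell_index L h N k x) - x\<bar> \<le> (real k + 2) * h"
proof -
  define j where "j = nat \<lfloor>(x + L) / h\<rfloor>"
  have q: "0 \<le> (x + L) / h" "(x + L) / h \<le> real N" using x h N by (auto simp: field_simps)
  have j: "real j \<le> (x + L) / h" "(x + L) / h < real j + 1"
    using q unfolding j_def by linarith+
  have jN: "j \<le> N" using j q by linarith
  define J where "J = cell_index L h N k x"
  \<comment> \<open>At x = L the floor equals N while the largest clamped index is N - 1 - k; this
    accounts for the extra 1.\<close>
  have "J \<le> j + k" "j \<le> J + k + 1" using jN k by (auto simp: J_def cell_index_def j_def[symmetric])
  then have "real J \<le> real j + real k" "real j \<le> real J + real k + 1" by linarith+
  then have "\<bar>real J - (x + L) / h\<bar> \<le> real k + 2" using j by linarith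
  then have "\<bar>real J - (x + L) / h\<bar> * h \<le> (real k + 2) * h" using h by (intro mult_right_mono) auto
  moreover have "\<bar>real J - (x + L) / h\<bar> * h = \<bar>node L h J - x\<bar>"
  proof -
    have "(real J - (x + L) / h) * h = node L h J - x" using h by (simp add: node_def field_simps)
    then show ?thesis using h by (metis abs_mult abs_of_pos)
  qed
  ultimately show ?thesis by (simp add: J_def)
qed

lemma ndist_node: "0 < h \<Longrightarrow> \<bar>node L h i - node L h j\<bar> = real (ndist i j) * h"
proof -
  assume h: "0 < h"
  have "\<bar>real i - real j\<bar> = real (ndist i j)" by (simp add: ndist_def)
  moreover have "node L h i - node L h j = (real i - real j) * h" by (simp add: node_def algebra_simps)
  ultimately show ?thesis using h by (simp add: abs_mult)
qed

lemma tendsto_between: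
  fixes a b c :: "nat \<Rightarrow> real"
  assumes "a \<longlonglongrightarrow> l" "b \<longlonglongrightarrow> l" "\<And>n. min (a n) (b n) \<le> c n" "\<And>n. c n \<le> max (a n) (b n)"
  shows "c \<longlonglongrightarrow> l"
proof (rule tendsto_sandwich)
  show "(\<lambda>n. min (a n) (b n)) \<longlonglongrightarrow> l" using tendsto_min[OF assms(1,2)] by simp
  show "(\<lambda>n. max (a n) (b n)) \<longlonglongrightarrow> l" using tendsto_max[OF assms(1,2)] by simp
qed (use assms in auto)

lemma L1_dist_tendsto_zero:
  fixes v :: "nat \<Rightarrow> real \<Rightarrow> real"
  assumes v: "\<And>n. v n absolutely_integrable_on {-L..L}" and u: "u absolutely_integrable_on {-L..L}"
    and bd: "\<And>n. AE x in lebesgue. x \<in> {-L..L} \<longrightarrow> \<bar>v n x - u x\<bar> \<le> K"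
    and conv: "AE x in lebesgue. x \<in> {-L..L} \<longrightarrow> (\<lambda>n. v n x) \<longlonglongrightarrow> u x"
  shows "(\<lambda>n. L1_dist L (v n) u) \<longlonglongrightarrow> 0"
proof -
  have i: "integrable lebesgue (\<lambda>x. indicator {-L..L} x *\<^sub>R (v n x - u x))" for n
    using set_integral_diff(1)[OF v u] by (simp add: set_integrable_def)
  have "(\<lambda>n. \<integral>x. indicator {-L..L} x *\<^sub>R \<bar>v n x - u x\<bar> \<partial>lebesgue) \<longlonglongrightarrow> (\<integral>x. (0::real) \<partial>(lebesgue :: real measure))"
  proof (rule Bochner_Integration.integral_dominated_convergence[where f="\<lambda>x. 0::real" and s="\<lambda>n x. indicator {-L..L} x *\<^sub>R \<bar>v n x - u x\<bar>" and w="\<lambda>x. indicator {-L..L} x * \<bar>K\<bar>"])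
    show "(\<lambda>x. 0::real) \<in> borel_measurable lebesgue" by simp
    show "(\<lambda>x. indicator {-L..L} x *\<^sub>R \<bar>v n x - u x\<bar>) \<in> borel_measurable lebesgue" for n
    proof -
      have "(\<lambda>x. \<bar>indicator {-L..L} x *\<^sub>R (v n x - u x)\<bar>) \<in> borel_measurable lebesgue"
        using borel_measurable_integrable[OF i[of n]] by (rule borel_measurable_abs)
      moreover have "(\<lambda>x. \<bar>indicator {-L..L} x *\<^sub>R (v n x - u x)\<bar>) = (\<lambda>x. indicator {-L..L} x *\<^sub>R \<bar>v n x - u x\<bar>)"
        by (auto simp: indicator_def)
      ultimately show ?thesis by simp
    qed
    have "(\<lambda>_. \<bar>K\<bar>) absolutely_integrable_on {-L..L}" by (intro absolutely_integrable_on_const) simp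
    then show "integrable lebesgue (\<lambda>x. indicator {-L..L} x * \<bar>K\<bar>)" by (simp add: set_integrable_def)
    show "AE x in lebesgue. (\<lambda>n. indicator {-L..L} x *\<^sub>R \<bar>v n x - u x\<bar>) \<longlonglongrightarrow> 0"
      using conv
    proof eventually_elim
      case (elim x)
      show ?case
      proof (cases "x \<in> {-L..L}")
        case True
        then have "(\<lambda>n. \<bar>v n x - u x\<bar>) \<longlonglongrightarrow> \<bar>u x - u x\<bar>" using elim by (intro tendsto_intros) auto
        then show ?thesis using True by simp
      qed simp
    qed
    show "AE x in lebesgue. norm (indicator {-L..L} x *\<^sub>R \<bar>v n x - u x\<bar>) \<le> indicator {-L..L} x * \<bar>K\<bar>" for n
      using bd[of n] by eventually_elim (auto simp: indicator_def)
  qed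
  then show ?thesis by (simp add: L1_dist_def set_lebesgue_integral_def)
qed

text \<open>Concentration moves mass by at most (k + 2) h and the node is within h of
  \<open>x\<close>. The radius (k + 4) h leaves a margin that makes the comparison of nodes, hence
  of indices, strict.\<close>

lemma rec_disp_sandwich:
  assumes h: "0 < h" and N: "real N * h = 2 * L" and k: "2 * k < N"
    and \<nu>: "finite_borel_measure \<nu>" and supp: "emeasure \<nu> (- {-L..L}) = 0"
    and close: "\<bar>node L h i - x\<bar> \<le> h"
  shows "cdf \<nu> (x - (real k + 4) * h) \<le> measure \<nu> {y. cell_index L h N k y < i}"
    "measure \<nu> {y. cell_index L h N k y < i} \<le> cdf \<nu> (x + (real k + 4) * h)"
proof -
  interpret finite_borel_measure \<nu> by fact
  note [simp] = M_is_borel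
  let ?S = "{y. cell_index L h N k y < i}"
  have S: "?S \<in> sets borel"
    using measurable_sets[OF cell_index_measurable, of "{..<i}" L h N k] by (simp add: vimage_def)
  have AEs: "AE y in \<nu>. y \<in> {-L..L}"
    using supp by (subst AE_iff_measurable[where N="- {-L..L}"]) (auto simp: borel_UNIV)
  have R: "(real k + 4) * h = (real k + 2) * h + 2 * h" by (simp add: algebra_simps)
  have "measure \<nu> {..x - (real k + 4) * h} \<le> measure \<nu> ?S"
  proof (rule finite_measure_mono_AE)
    show "AE y in \<nu>. y \<in> {..x - (real k + 4) * h} \<longrightarrow> y \<in> ?S"
      using AEs
    proof eventually_elim
      case (elim y)
      show ?case
      proof
        assume "y \<in> {..x - (real k + 4) * h}"
        then have "node L h (cell_index L h N k y) < node L h i"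
          using cell_index_close[OF h N k elim] close h R by (auto simp: abs_le_iff)
        then show "y \<in> ?S" using node_less[OF h] by blast
      qed
    qed
  qed (use S in simp)
  then show "cdf \<nu> (x - (real k + 4) * h) \<le> measure \<nu> ?S" by (simp add: cdf_def)
  have "measure \<nu> ?S \<le> measure \<nu> {..x + (real k + 4) * h}"
  proof (rule finite_measure_mono_AE)
    show "AE y in \<nu>. y \<in> ?S \<longrightarrow> y \<in> {..x + (real k + 4) * h}"
      using AEs
    proof eventually_elim
      case (elim y)
      show ?case
      proof
        assume "y \<in> ?S"
        then have "node L h (cell_index L h N k y) < node L h i" using node_less[OF h] by blast
        then show "y \<in> {..x + (real k + 4) * h}"
          using cell_index_close[OF h N k elim] close h R by (auto simp: abs_le_iff)
      qed
    qed
  qed simp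
  then show "measure \<nu> ?S \<le> cdf \<nu> (x + (real k + 4) * h)" by (simp add: cdf_def)
qed

text \<open>Away from the countably many atoms the distribution function is continuous, so the
  concentrated masses are squeezed to \<open>cdf \<nu> x\<close>. Truncation disappears in the limit
  because |u| obeys the same bound.\<close>

lemma recovery_disp_converges:
  fixes h :: "nat \<Rightarrow> real" and N k :: "nat \<Rightarrow> nat"
  assumes L: "0 < L" and h: "\<And>n. 0 < h n" and N: "\<And>n. real (N n) * h n = 2 * L"
    and good: "eventually (\<lambda>n. 2 * k n < N n) sequentially"
    and kh: "(\<lambda>n. (real (k n) + 4) * h n) \<longlonglongrightarrow> 0"
    and rep: "represents L g u f \<nu>" and u: "u \<in> L1 L"
    and bd: "AE x in lebesgue. x \<in> {-L..L} \<longrightarrow> \<bar>u x\<bar> \<le> bdry_norm L g"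
  shows "(\<lambda>n. L1_dist L (interp L (h n) (rec_disp L (h n) (N n) (k n) g f \<nu>)) u) \<longlonglongrightarrow> 0"
proof -
  have f: "f absolutely_integrable_on {-L..L}" and \<nu>: "finite_borel_measure \<nu>" and supp: "emeasure \<nu> (- {-L..L}) = 0"
    and ae: "AE x in lebesgue. x \<in> {-L..L} \<longrightarrow> u x = g (-L) + (LINT y:{-L..x}|lebesgue. f y) + cdf \<nu> x"
    using rep by (auto simp: represents_def)
  interpret finite_borel_measure \<nu> by fact
  let ?M = "bdry_norm L g"
  have M: "0 \<le> ?M" by (simp add: bdry_norm_def)
  define s where "s n = rec_disp L (h n) (N n) (k n) g f \<nu>" for n
  have sb: "\<bar>s n i\<bar> \<le> ?M" for n i unfolding s_def rec_disp_def by (rule clip_bound[OF M])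
  have vb: "\<bar>interp L (h n) (s n) x\<bar> \<le> ?M" if x: "x \<in> {-L..L}" for n x
  proof -
    obtain i where "x \<in> cell L (h n) i" using cell_exists[OF h N L x] by blast
    from interp_between[OF h this, of "s n"] sb[of n i] sb[of n "Suc i"] show ?thesis by linarith
  qed
  have h0: "h \<longlonglongrightarrow> 0"
  proof (rule tendsto_sandwich[OF _ _ tendsto_const kh])
    show "\<forall>\<^sub>F n in sequentially. 0 \<le> h n" using h by (simp add: less_imp_le)
    have "1 * h n \<le> (real (k n) + 4) * h n" for n using h[of n] by (intro mult_right_mono) auto
    then show "\<forall>\<^sub>F n in sequentially. h n \<le> (real (k n) + 4) * h n" by simp
  qed
  have "AE x in lborel. x \<notin> {x. measure \<nu> {x} \<noteq> 0}"
    by (intro AE_not_in countable_imp_null_set_lborel countable_support)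
  then have atoms: "AE x in lebesgue. x \<notin> {x. measure \<nu> {x} \<noteq> 0}" by (rule AE_completion)
  have conv: "AE x in lebesgue. x \<in> {-L..L} \<longrightarrow> (\<lambda>n. interp L (h n) (s n) x) \<longlonglongrightarrow> u x"
    using ae bd atoms
  proof eventually_elim
    case (elim x)
    show ?case
    proof
      assume x: "x \<in> {-L..L}"
      have ux: "u x = g (-L) + (LINT y:{-L..x}|lebesgue. f y) + cdf \<nu> x" "\<bar>u x\<bar> \<le> ?M" "isCont (cdf \<nu>) x"
        using elim x by (auto simp: isCont_cdf)
      have "\<forall>n. \<exists>i. i < N n \<and> x \<in> cell L (h n) i" using cell_exists[OF h N L x] by metis
      then obtain i where i: "\<And>n. i n < N n" "\<And>n. x \<in> cell L (h n) (i n)" by metis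
      define F where "F z = (LINT y:{-L..z}|lebesgue. f y)" for z
      have Fi: "F z = integral {-L..z} f" if "z \<in> {-L..L}" for z
        unfolding F_def by (rule set_lebesgue_integral_eq_integral(2)[OF set_integrable_subset[OF f]]) (use that in auto)
      have Fc: "continuous_on {-L..L} F"
      proof (rule continuous_on_eq)
        show "continuous_on {-L..L} (\<lambda>z. integral {-L..z} f)"
          by (rule indefinite_integral_continuous_1[OF set_lebesgue_integral_eq_integral(1)[OF f]])
      qed (simp add: Fi)
      \<comment> \<open>Stated for any nodes within h of \<open>x\<close>, to be applied to both
        endpoints of the cell containing \<open>x\<close>.\<close>
      have sl: "(\<lambda>n. s n (j n)) \<longlonglongrightarrow> u x" if jN: "\<And>n. j n \<le> N n" and jx: "\<And>n. \<bar>node L (h n) (j n) - x\<bar> \<le> h n" for j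
      proof -
        have jI: "node L (h n) (j n) \<in> {-L..L}" for n
        proof -
          have "node L (h n) (j n) \<le> node L (h n) (N n)" using node_le[OF h] jN by blast
          moreover have "node L (h n) (N n) = L" using N[of n] by (simp add: node_def)
          moreover have "-L \<le> node L (h n) (j n)" using h[of n] by (simp add: node_def)
          ultimately show ?thesis by simp
        qed
        have "(\<lambda>n. node L (h n) (j n) - x) \<longlonglongrightarrow> 0"
          by (rule Lim_null_comparison[OF _ h0]) (use jx in simp)
        then have nx: "(\<lambda>n. node L (h n) (j n)) \<longlonglongrightarrow> x" by (rule LIM_zero_cancel)
        then have Fl: "(\<lambda>n. F (node L (h n) (j n))) \<longlonglongrightarrow> F x"
          using Fc jI x by (auto simp: continuous_on_sequentially o_def)
        define W where "W n = measure \<nu> {y. cell_index L (h n) (N n) (k n) y < j n}" for n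
        have cl: "(\<lambda>n. cdf \<nu> (x - (real (k n) + 4) * h n)) \<longlonglongrightarrow> cdf \<nu> x" "(\<lambda>n. cdf \<nu> (x + (real (k n) + 4) * h n)) \<longlonglongrightarrow> cdf \<nu> x"
          using isCont_tendsto_compose[OF ux(3), of "\<lambda>n. x - (real (k n) + 4) * h n"]
            isCont_tendsto_compose[OF ux(3), of "\<lambda>n. x + (real (k n) + 4) * h n"]
            tendsto_diff[OF tendsto_const kh, of x] tendsto_add[OF tendsto_const kh, of x] by simp_all
        have Wl: "W \<longlonglongrightarrow> cdf \<nu> x"
        proof (rule tendsto_sandwich[OF _ _ cl])
          show "\<forall>\<^sub>F n in sequentially. cdf \<nu> (x - (real (k n) + 4) * h n) \<le> W n"
            using good by eventually_elim (use rec_disp_sandwich(1)[OF h N _ \<nu> supp jx] in \<open>simp add: W_def\<close>)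
          show "\<forall>\<^sub>F n in sequentially. W n \<le> cdf \<nu> (x + (real (k n) + 4) * h n)"
            using good by eventually_elim (use rec_disp_sandwich(2)[OF h N _ \<nu> supp jx] in \<open>simp add: W_def\<close>)
        qed
        have "(\<lambda>n. clip ?M (g (-L) + F (node L (h n) (j n)) + W n)) \<longlonglongrightarrow> clip ?M (g (-L) + F x + cdf \<nu> x)"
          unfolding clip_def by (intro tendsto_intros Fl Wl)
        moreover have "clip ?M (g (-L) + F x + cdf \<nu> x) = u x"
          using ux by (simp add: F_def clip_id)
        ultimately show ?thesis by (simp add: s_def rec_disp_def F_def W_def)
      qed
      have close: "\<bar>node L (h n) (i n) - x\<bar> \<le> h n" "\<bar>node L (h n) (Suc (i n)) - x\<bar> \<le> h n" for n
        using i(2)[of n] by (auto simp: node_Suc abs_le_iff)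
      show "(\<lambda>n. interp L (h n) (s n) x) \<longlonglongrightarrow> u x"
      proof (rule tendsto_between)
        show "(\<lambda>n. s n (i n)) \<longlonglongrightarrow> u x" using i(1) close(1) by (intro sl) (auto intro: less_imp_le)
        show "(\<lambda>n. s n (Suc (i n))) \<longlonglongrightarrow> u x" using i(1) close(2) by (intro sl) (auto intro: Suc_leI)
      qed (rule interp_between[OF h i(2)])+
    qed
  qed
  show ?thesis unfolding s_def[symmetric]
  proof (rule L1_dist_tendsto_zero[where K="2 * ?M"])
    show "interp L (h n) (s n) absolutely_integrable_on {-L..L}" for n
      by (intro absolutely_integrable_continuous_real P1_continuous[OF h N L interp_P1[OF h]])
    show "u absolutely_integrable_on {-L..L}" using u by (simp add: L1_def)
    show "AE x in lebesgue. x \<in> {-L..L} \<longrightarrow> \<bar>interp L (h n) (s n) x - u x\<bar> \<le> 2 * ?M" for n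
      using bd
    proof eventually_elim
      case (elim x)
      show ?case using vb[of x n] elim by (auto simp: abs_le_iff)
    qed
  qed (rule conv)
qed

text \<open>Each profile vanishes from index distance k on, and the corresponding length tends to 0;
  at any point outside the finite set \<open>A\<close> the damage is therefore eventually
  zero.\<close>

lemma recovery_damage_converges:
  fixes h \<kappa> :: "nat \<Rightarrow> real" and N k :: "nat \<Rightarrow> nat"
  assumes L: "0 < L" and h: "\<And>n. 0 < h n" and N: "\<And>n. real (N n) * h n = 2 * L"
    and good: "eventually (\<lambda>n. 2 * k n < N n \<and> \<kappa> n < 1) sequentially"
    and \<kappa>: "\<And>n. 0 < \<kappa> n" and \<tau>: "0 < \<tau>" and k: "\<And>n. \<kappa> n < 1 \<Longrightarrow> (1 - \<kappa> n) ^ k n \<le> \<tau>"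
    and kh: "(\<lambda>n. (real (k n) + 4) * h n) \<longlonglongrightarrow> 0"
    and A: "finite A" "A \<subseteq> {-L..L}" and m: "\<And>a. a \<in> A \<Longrightarrow> 0 \<le> m a \<and> m a \<le> 1"
  shows "(\<lambda>n. L1_dist L (interp L (h n) (rec_damage (\<kappa> n) \<tau> m (cell_index L (h n) (N n) (k n)) A)) (\<lambda>_. 0)) \<longlonglongrightarrow> 0"
proof -
  define b where "b n = rec_damage (\<kappa> n) \<tau> m (cell_index L (h n) (N n) (k n)) A" for n
  \<comment> \<open>For the finitely many n with unsuitable parameters the function is replaced by
    0, so that the bound 1 holds for every n.\<close>
  define v where "v n = (if 2 * k n < N n \<and> \<kappa> n < 1 then interp L (h n) (b n) else (\<lambda>_. 0))" for n
  have b0: "0 \<le> b n i" for n i unfolding b_def by (rule rec_damage_nonneg[OF A(1)])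
  have b1: "b n i \<le> 1" if "\<kappa> n < 1" for n i
    unfolding b_def using \<tau> m by (intro rec_damage_range[OF A(1) \<kappa> that]) auto
  have "(\<lambda>n. L1_dist L (v n) (\<lambda>_. 0)) \<longlonglongrightarrow> 0"
  proof (rule L1_dist_tendsto_zero[where K=1])
    show "v n absolutely_integrable_on {-L..L}" for n
    proof -
      have "interp L (h n) (b n) \<in> P1 (cell L (h n) ` {..<N n})" by (rule interp_P1[OF h])
      from absolutely_integrable_continuous_real[OF P1_continuous[OF h N L this]]
      show ?thesis by (simp add: v_def)
    qed
    show "(\<lambda>_. 0::real) absolutely_integrable_on {-L..L}" by simp
    show "AE x in lebesgue. x \<in> {-L..L} \<longrightarrow> \<bar>v n x - 0\<bar> \<le> 1" for n
    proof (intro AE_I2 impI)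
      fix x assume x: "x \<in> {-L..L}"
      obtain i where i: "x \<in> cell L (h n) i" using cell_exists[OF h N L x] by blast
      have "\<bar>interp L (h n) (b n) x\<bar> \<le> 1" if "\<kappa> n < 1"
        using interp_between[OF h i, of "b n"] b0[of n i] b0[of n "Suc i"] b1[OF that, of i] b1[OF that, of "Suc i"] by linarith
      then show "\<bar>v n x - 0\<bar> \<le> 1" by (simp add: v_def)
    qed
    have "AE x in lborel. x \<notin> A" by (intro AE_not_in finite_imp_null_set_lborel A)
    then have "AE x in lebesgue. x \<notin> A" by (rule AE_completion)
    then show "AE x in lebesgue. x \<in> {-L..L} \<longrightarrow> (\<lambda>n. v n x) \<longlonglongrightarrow> 0"
    proof eventually_elim
      case (elim x)
      show ?case
      proof
        assume x: "x \<in> {-L..L}"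
        have "\<forall>\<^sub>F n in sequentially. \<forall>a\<in>A. 2 * ((real (k n) + 4) * h n) < \<bar>x - a\<bar>"
        proof (rule eventually_ball_finite[OF A(1)], rule ballI)
          fix a assume "a \<in> A"
          then have "0 < \<bar>x - a\<bar>" using elim by auto
          moreover have "(\<lambda>n. 2 * ((real (k n) + 4) * h n)) \<longlonglongrightarrow> 0"
            using tendsto_mult_left[OF kh, of 2] by simp
          ultimately show "\<forall>\<^sub>F n in sequentially. 2 * ((real (k n) + 4) * h n) < \<bar>x - a\<bar>"
            by (rule order_tendstoD(2)[rotated])
        qed
        then have "\<forall>\<^sub>F n in sequentially. v n x = 0"
          using good
        proof eventually_elim
          case (elim n)
          obtain i where i: "x \<in> cell L (h n) i" using cell_exists[OF h N L x] by blast
          have z: "b n j = 0" if j: "\<bar>node L (h n) j - x\<bar> \<le> h n" for j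
            unfolding b_def
          proof (rule rec_damage_zero[OF A(1) \<kappa>])
            show "\<kappa> n < 1" using elim by simp
            then show "(1 - \<kappa> n) ^ k n \<le> \<tau>" by (rule k)
            show "0 \<le> m a" if "a \<in> A" for a using m[OF that] by simp
            fix a assume a: "a \<in> A"
            let ?J = "cell_index L (h n) (N n) (k n) a"
            have "\<bar>node L (h n) ?J - a\<bar> \<le> (real (k n) + 2) * h n"
              using elim a A(2) by (intro cell_index_close[OF h N]) auto
            moreover have "2 * ((real (k n) + 4) * h n) < \<bar>x - a\<bar>" using elim a by blast
            moreover have "(real (k n) + 2) * h n = real (k n) * h n + 2 * h n" "(real (k n) + 4) * h n = real (k n) * h n + 4 * h n"
              by (simp_all add: algebra_simps)
            ultimately have "real (k n) * h n \<le> \<bar>node L (h n) j - node L (h n) ?J\<bar>"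
              using j h[of n] by linarith
            then have "real (k n) * h n \<le> real (ndist j ?J) * h n" using ndist_node[OF h[of n], of L j ?J] by simp
            then show "k n \<le> ndist j ?J" using h[of n] by simp
          qed
          have "b n i = 0" "b n (Suc i) = 0"
            using i by (intro z; auto simp: node_Suc abs_le_iff)+
          then show ?case using interp_between[OF h i, of "b n"] by (simp add: v_def)
        qed
        then show "(\<lambda>n. v n x) \<longlonglongrightarrow> 0" by (rule tendsto_eventually)
      qed
    qed
  qed
  moreover have "\<forall>\<^sub>F n in sequentially. L1_dist L (v n) (\<lambda>_. 0) = L1_dist L (interp L (h n) (b n)) (\<lambda>_. 0)"
    using good by eventually_elim (simp add: v_def)
  ultimately show ?thesis unfolding b_def[symmetric] by (rule Lim_transform_eventually)
qed

text \<open>Atoms left out of \<open>A\<close> are charged \<open>\<sigma>c\<close> per unit of mass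
  in place of their cheaper \<open>phi\<close>. Since the masses of all atoms are summable, finitely
  many can be kept so that the others weigh at most \<delta>.\<close>

lemma cohesive_finite_approx:
  assumes \<nu>: "finite_borel_measure \<nu>" and supp: "emeasure \<nu> (- {-L..L}) = 0" and pos: "0 < \<sigma>c" "0 < Gc"
    and C: "cohesive \<sigma>c Gc \<nu> = ennreal C" "0 \<le> C" and \<delta>: "0 < \<delta>"
  obtains A where "finite A" "A \<subseteq> {-L..L}"
    "\<sigma>c * measure \<nu> (- A) + (\<Sum>a\<in>A. Gc * \<sigma>c * measure \<nu> {a} / (Gc + \<sigma>c * measure \<nu> {a})) \<le> C + \<sigma>c * \<delta>"
proof -
  interpret finite_borel_measure \<nu> by fact
  note [simp] = M_is_borel
  define At where "At = {x. measure \<nu> {x} \<noteq> 0}"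
  have At: "countable At" unfolding At_def by (rule countable_support)
  have Atb: "At \<in> sets borel" by (rule sets.countable[OF _ At]) simp
  obtain A where A: "finite A" "A \<subseteq> At" "dist (\<Sum>a\<in>A. measure \<nu> {a}) (measure \<nu> At) \<le> \<delta>"
    using has_sum_finite_approximation[OF has_sum_atoms[OF \<nu> At] \<delta>] by blast
  have Ab: "A \<in> sets borel" by (rule borel_closed[OF finite_imp_closed[OF A(1)]])
  have AI: "A \<subseteq> {-L..L}"
  proof
    fix a assume "a \<in> A"
    then have "emeasure \<nu> {a} \<noteq> 0" using A(2) by (auto simp: At_def measure_def)
    moreover have "emeasure \<nu> {a} \<le> emeasure \<nu> (- {-L..L})" if "a \<notin> {-L..L}"
      using that by (intro emeasure_mono) auto
    ultimately show "a \<in> {-L..L}" using supp by auto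
  qed
  let ?f = "\<lambda>x. ennreal (Gc * \<sigma>c / (Gc + \<sigma>c * measure \<nu> {x}))"
  have mA: "(\<lambda>x. ?f x * indicator A x) \<in> borel_measurable \<nu>"
  proof -
    have "(\<lambda>x. ?f x * indicator A x) = (\<lambda>x. if x \<in> A then ?f x else 0)" by (auto simp: indicator_def)
    moreover have "(\<lambda>x. if x \<in> A then ?f x else 0) \<in> borel_measurable borel"
      by (rule measurable_discrete_difference[of "\<lambda>_. 0" _ _ A]) (use A in \<open>auto intro: countable_finite\<close>)
    ultimately show ?thesis by (simp cong: measurable_cong_sets)
  qed
  have mB: "(\<lambda>x. ennreal \<sigma>c * indicator (- At) x) \<in> borel_measurable \<nu>"
    by (intro borel_measurable_times_ennreal borel_measurable_indicator)
      (simp_all only: borel_measurable_const M_is_borel borel_comp[OF Atb])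
  have "ennreal (\<sigma>c * measure \<nu> (- At)) + ennreal (\<Sum>a\<in>A. Gc * \<sigma>c * measure \<nu> {a} / (Gc + \<sigma>c * measure \<nu> {a}))
      = (\<integral>\<^sup>+x. ennreal \<sigma>c * indicator (- At) x \<partial>\<nu>) + (\<integral>\<^sup>+x. ?f x * indicator A x \<partial>\<nu>)"
  proof -
    have "(\<integral>\<^sup>+x. ?f x * indicator A x \<partial>\<nu>) = (\<Sum>a\<in>A. phi \<sigma>c Gc (measure \<nu> {a}))"
      using nn_integral_countable_atoms[OF \<nu>, of A ?f] A(1) by (simp add: countable_finite phi_point[OF \<nu> pos])
    also have "\<dots> = (\<Sum>a\<in>A. ennreal (Gc * \<sigma>c * measure \<nu> {a} / (Gc + \<sigma>c * measure \<nu> {a})))"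
      by (simp add: phi_def)
    also have "\<dots> = ennreal (\<Sum>a\<in>A. Gc * \<sigma>c * measure \<nu> {a} / (Gc + \<sigma>c * measure \<nu> {a}))"
      using pos by (intro sum_ennreal) simp
    finally have 1: "(\<integral>\<^sup>+x. ?f x * indicator A x \<partial>\<nu>) = ennreal (\<Sum>a\<in>A. Gc * \<sigma>c * measure \<nu> {a} / (Gc + \<sigma>c * measure \<nu> {a}))" .
    have "(\<integral>\<^sup>+x. ennreal \<sigma>c * indicator (- At) x \<partial>\<nu>) = ennreal \<sigma>c * emeasure \<nu> (- At)"
      by (rule nn_integral_cmult_indicator) (simp only: M_is_borel borel_comp[OF Atb])
    also have "\<dots> = ennreal (\<sigma>c * measure \<nu> (- At))" using pos by (simp add: emeasure_eq_measure ennreal_mult)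
    finally show ?thesis using 1 by simp
  qed
  also have "\<dots> = (\<integral>\<^sup>+x. ennreal \<sigma>c * indicator (- At) x + ?f x * indicator A x \<partial>\<nu>)"
    by (rule nn_integral_add[symmetric, OF mB mA])
  also have "\<dots> \<le> cohesive \<sigma>c Gc \<nu>"
    unfolding cohesive_def
  proof (rule nn_integral_mono)
    fix x
    show "ennreal \<sigma>c * indicator (- At) x + ?f x * indicator A x \<le> ?f x"
      using A(2) pos by (cases "x \<in> At") (auto simp: indicator_def At_def)
  qed
  finally have "ennreal (\<sigma>c * measure \<nu> (- At)) + ennreal (\<Sum>a\<in>A. Gc * \<sigma>c * measure \<nu> {a} / (Gc + \<sigma>c * measure \<nu> {a})) \<le> ennreal C"
    unfolding C(1) .
  moreover have "0 \<le> (\<Sum>a\<in>A. Gc * \<sigma>c * measure \<nu> {a} / (Gc + \<sigma>c * measure \<nu> {a}))" using pos by (intro sum_nonneg) simp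
  ultimately have le: "\<sigma>c * measure \<nu> (- At) + (\<Sum>a\<in>A. Gc * \<sigma>c * measure \<nu> {a} / (Gc + \<sigma>c * measure \<nu> {a})) \<le> C"
    using C(2) pos by (simp add: ennreal_plus[symmetric] del: ennreal_plus)
  have "measure \<nu> (- A) = measure \<nu> (- At) + measure \<nu> (At - A)"
    using Atb Ab A(2) by (subst finite_measure_Union[symmetric]) (auto intro!: arg_cong[where f="measure \<nu>"])
  moreover have "measure \<nu> (At - A) = measure \<nu> At - measure \<nu> A"
    using Atb Ab A(2) by (intro finite_measure_Diff) auto
  moreover have "measure \<nu> A = (\<Sum>a\<in>A. measure \<nu> {a})" using A(1) by (intro finite_measure_eq_sum_singleton) auto
  ultimately have "measure \<nu> (- A) \<le> measure \<nu> (- At) + \<delta>" using A(3) by (simp add: dist_real_def abs_le_iff)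
  then have "\<sigma>c * measure \<nu> (- A) \<le> \<sigma>c * (measure \<nu> (- At) + \<delta>)" using pos by (intro mult_left_mono) auto
  then show ?thesis using that[OF A(1) AI] le by (simp add: distrib_left)
qed

lemma recovery_approx:
  fixes h \<epsilon> :: "nat \<Rightarrow> real" and N :: "nat \<Rightarrow> nat"
  assumes L: "0 < L" and pos: "0 < E0" "0 < \<sigma>c" "0 < Gc"
    and h: "\<And>n. 0 < h n" and N: "\<And>n. real (N n) * h n = 2 * L" and \<epsilon>: "\<And>n. 0 < \<epsilon> n"
    and h0: "h \<longlonglongrightarrow> 0" and \<epsilon>0: "\<epsilon> \<longlonglongrightarrow> 0" and h\<epsilon>: "(\<lambda>n. h n / \<epsilon> n) \<longlonglongrightarrow> 0"
    and e: "e absolutely_integrable_on {-L..L}" "(\<lambda>x. (e x)\<^sup>2) absolutely_integrable_on {-L..L}"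
    and p: "p absolutely_integrable_on {-L..L}" "\<And>x. 0 \<le> p x"
    and rep: "represents L g u (\<lambda>x. e x + p x) \<nu>" and u: "u \<in> L1 L"
    and bd: "AE x in lebesgue. x \<in> {-L..L} \<longrightarrow> \<bar>u x\<bar> \<le> bdry_norm L g"
    and C: "cohesive \<sigma>c Gc \<nu> = ennreal C" "0 \<le> C" and \<delta>: "0 < \<delta>"
  shows "eventually (\<lambda>n. \<exists>v b. admissible L g (cell L (h n) ` {..<N n}) v b \<and> L1_dist L v u < \<delta> \<and> L1_dist L b (\<lambda>_. 0) < \<delta> \<and>
     F_disc L E0 \<sigma>c Gc (\<epsilon> n) (cell L (h n) ` {..<N n}) v b
      \<le> ennreal (1/2 * E0 * integral {-L..L} (\<lambda>x. (e x)\<^sup>2) + \<sigma>c * integral {-L..L} p + C + \<delta>)) sequentially"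
proof -
  have \<nu>: "finite_borel_measure \<nu>" and supp: "emeasure \<nu> (- {-L..L}) = 0"
    and tot: "g L = g (-L) + (LINT y:{-L..L}|lebesgue. e y + p y) + measure \<nu> UNIV"
    using rep by (auto simp: represents_def)
  interpret finite_borel_measure \<nu> by fact
  \<comment> \<open>A quarter of \<delta> pays for the atoms left out, a quarter for the truncation
    height \<tau>, and the rest absorbs the terms that vanish with h/\<epsilon>.\<close>
  define \<delta>' where "\<delta>' = \<delta> / (4 * \<sigma>c)"
  have \<delta>': "0 < \<delta>'" using \<delta> pos by (simp add: \<delta>'_def)
  obtain A where A: "finite A" "A \<subseteq> {-L..L}"
    "\<sigma>c * measure \<nu> (- A) + (\<Sum>a\<in>A. Gc * \<sigma>c * measure \<nu> {a} / (Gc + \<sigma>c * measure \<nu> {a})) \<le> C + \<sigma>c * \<delta>'"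
    using cohesive_finite_approx[OF \<nu> supp pos(2,3) C \<delta>'] .
  define w where "w a = measure \<nu> {a}" for a
  \<comment> \<open>the minimiser of \<open>\<sigma>c * w a * (1 - m)\<^sup>2 + Gc * m\<^sup>2\<close>, whose minimum is \<open>\<phi> (w a)\<close>\<close>
  define m where "m a = \<sigma>c * w a / (Gc + \<sigma>c * w a)" for a
  have w0: "0 \<le> w a" for a by (simp add: w_def)
  have m01: "0 \<le> m a \<and> m a \<le> 1" for a
    using w0[of a] pos by (auto simp: m_def add_pos_nonneg)
  define W where "W = (\<Sum>a\<in>A. w a)"
  have W0: "0 \<le> W" unfolding W_def by (intro sum_nonneg w0)
  \<comment> \<open>The truncation errors of all selected atoms add up to 3 \<open>\<sigma>c\<close>
    \<tau> W, which this choice keeps at most \<delta>/4; \<open>W + 1\<close> guards against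
    division by zero.\<close>
  define \<tau> where "\<tau> = min 1 (\<delta> / (12 * \<sigma>c * (W + 1)))"
  have \<tau>: "0 < \<tau>" "\<tau> \<le> 1" using \<delta> pos W0 by (auto simp: \<tau>_def)
  have \<tau>W: "3 * \<sigma>c * \<tau> * W \<le> \<delta> / 4"
  proof -
    have "\<tau> * W \<le> \<delta> / (12 * \<sigma>c * (W + 1)) * (W + 1)"
      using W0 \<delta> pos by (intro mult_mono) (auto simp: \<tau>_def)
    also have "\<dots> = \<delta> / (12 * \<sigma>c)"
    proof -
      have "W + 1 \<noteq> 0" using W0 by simp
      then show ?thesis by simp
    qed
    finally have "3 * \<sigma>c * (\<tau> * W) \<le> 3 * \<sigma>c * (\<delta> / (12 * \<sigma>c))" using pos by (intro mult_left_mono) auto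
    also have "\<dots> = \<delta> / 4" using pos by simp
    finally show ?thesis by (simp add: mult.assoc)
  qed
  define \<kappa> where "\<kappa> n = h n / \<epsilon> n" for n
  have \<kappa>0: "0 < \<kappa> n" for n using h \<epsilon> by (simp add: \<kappa>_def)
  have \<kappa>lim: "\<kappa> \<longlonglongrightarrow> 0" using h\<epsilon> by (simp add: \<kappa>_def[abs_def])
  \<comment> \<open>Since (1 - \<kappa>)^k \<le> exp(-k \<kappa>), this radius brings the profile
    down to \<tau>. The length k h is about -ln \<tau> times \<epsilon>, hence tends to 0.\<close>
  define k where "k n = nat \<lceil>- ln \<tau> / \<kappa> n\<rceil>" for n
  have lnt: "0 \<le> - ln \<tau>" using \<tau> by simp
  have kq: "(1 - \<kappa> n) ^ k n \<le> \<tau>" if "\<kappa> n < 1" for n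
  proof -
    have "- ln \<tau> / \<kappa> n \<le> real (k n)" unfolding k_def by (rule real_nat_ceiling_ge)
    then have "- ln \<tau> \<le> real (k n) * \<kappa> n" by (rule pos_divide_le_eq[OF \<kappa>0, THEN iffD1])
    then have le: "exp (- (real (k n) * \<kappa> n)) \<le> exp (ln \<tau>)" by simp
    have "(1 - \<kappa> n) ^ k n \<le> exp (- \<kappa> n) ^ k n"
      using that exp_ge_add_one_self[of "- \<kappa> n"] by (intro power_mono) auto
    also have "\<dots> = exp (- (real (k n) * \<kappa> n))" by (simp add: exp_of_nat_mult[symmetric])
    also have "\<dots> \<le> \<tau>" using le \<tau> by simp
    finally show ?thesis .
  qed
  have kh: "(\<lambda>n. (real (k n) + 4) * h n) \<longlonglongrightarrow> 0"
  proof (rule tendsto_sandwich[OF _ _ tendsto_const])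
    show "\<forall>\<^sub>F n in sequentially. 0 \<le> (real (k n) + 4) * h n" using h by (simp add: less_imp_le)
    have "(real (k n) + 4) * h n \<le> - ln \<tau> * \<epsilon> n + 5 * h n" for n
    proof -
      have "0 \<le> - ln \<tau> / \<kappa> n" by (rule divide_nonneg_pos[OF lnt \<kappa>0])
      then have "real (k n) \<le> - ln \<tau> / \<kappa> n + 1" unfolding k_def by linarith
      then have "(real (k n) + 4) * h n \<le> (- ln \<tau> / \<kappa> n + 5) * h n" using h[of n] by (intro mult_right_mono) auto
      also have "\<dots> = - ln \<tau> * \<epsilon> n + 5 * h n" using h[of n] \<epsilon>[of n] by (simp add: \<kappa>_def field_simps)
      finally show ?thesis .
    qed
    then show "\<forall>\<^sub>F n in sequentially. (real (k n) + 4) * h n \<le> - ln \<tau> * \<epsilon> n + 5 * h n" by simp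
    have "(\<lambda>n. - ln \<tau> * \<epsilon> n + 5 * h n) \<longlonglongrightarrow> - ln \<tau> * 0 + 5 * 0" by (intro tendsto_intros \<epsilon>0 h0)
    then show "(\<lambda>n. - ln \<tau> * \<epsilon> n + 5 * h n) \<longlonglongrightarrow> 0" by simp
  qed
  have good: "eventually (\<lambda>n. 2 * k n < N n \<and> \<kappa> n < 1) sequentially"
    using order_tendstoD(2)[OF kh L] order_tendstoD(2)[OF \<kappa>lim zero_less_one]
  proof eventually_elim
    case (elim n)
    have "real (2 * k n) * h n < real (N n) * h n" using elim(1) N[of n] h[of n] by (simp add: algebra_simps)
    then have "real (2 * k n) < real (N n)" using h[of n] by simp
    then show ?case using elim(2) by (simp only: of_nat_less_iff)
  qed
  define s where "s n = rec_disp L (h n) (N n) (k n) g (\<lambda>y. e y + p y) \<nu>" for n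
  define b where "b n = rec_damage (\<kappa> n) \<tau> m (cell_index L (h n) (N n) (k n)) A" for n
  have sconv: "(\<lambda>n. L1_dist L (interp L (h n) (s n)) u) \<longlonglongrightarrow> 0"
    unfolding s_def
    by (rule recovery_disp_converges[OF L h N _ kh rep u bd]) (use good in \<open>auto elim: eventually_mono\<close>)
  have bconv: "(\<lambda>n. L1_dist L (interp L (h n) (b n)) (\<lambda>_. 0)) \<longlonglongrightarrow> 0"
    unfolding b_def by (rule recovery_damage_converges[OF L h N good \<kappa>0 \<tau>(1) kq kh A(1,2) m01])
  define X where "X = 1/2 * E0 * integral {-L..L} (\<lambda>x. (e x)\<^sup>2) + \<sigma>c * integral {-L..L} p"
  define Bd where "Bd n = X + \<sigma>c * measure \<nu> (- A)
        + (\<Sum>a\<in>A. \<sigma>c * w a * ((1 - m a)\<^sup>2 + 3 * (\<kappa> n / 2 + \<tau>)) + Gc / 2 * (4 * (m a)\<^sup>2 / (2 - \<kappa> n)))" for n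
  have "Bd \<longlonglongrightarrow> X + \<sigma>c * measure \<nu> (- A)
        + (\<Sum>a\<in>A. \<sigma>c * w a * ((1 - m a)\<^sup>2 + 3 * (0 / 2 + \<tau>)) + Gc / 2 * (4 * (m a)\<^sup>2 / (2 - 0)))"
    unfolding Bd_def[abs_def] by (intro tendsto_intros \<kappa>lim) auto
  moreover have "X + \<sigma>c * measure \<nu> (- A)
        + (\<Sum>a\<in>A. \<sigma>c * w a * ((1 - m a)\<^sup>2 + 3 * (0 / 2 + \<tau>)) + Gc / 2 * (4 * (m a)\<^sup>2 / (2 - 0))) < X + C + \<delta>"
  proof -
    have "\<sigma>c * w a * ((1 - m a)\<^sup>2 + 3 * (0 / 2 + \<tau>)) + Gc / 2 * (4 * (m a)\<^sup>2 / (2 - 0))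
        = Gc * \<sigma>c * w a / (Gc + \<sigma>c * w a) + 3 * \<sigma>c * \<tau> * w a" for a
    proof -
      define t where "t = \<sigma>c * w a"
      have t: "0 < Gc + t" using w0[of a] pos by (simp add: t_def add_pos_nonneg)
      have "t * (1 - t / (Gc + t))\<^sup>2 + Gc * (t / (Gc + t))\<^sup>2 = Gc * t / (Gc + t)"
      proof -
        define q where "q = Gc + t"
        have q: "0 < q" "Gc = q - t" using t by (auto simp: q_def)
        have "1 - t / q = Gc / q" using q by (simp add: field_simps)
        then have "t * (1 - t / q)\<^sup>2 + Gc * (t / q)\<^sup>2 = (t * Gc\<^sup>2 + Gc * t\<^sup>2) / q\<^sup>2"
          by (simp only: power_divide times_divide_eq_right add_divide_distrib[symmetric])
        also have "t * Gc\<^sup>2 + Gc * t\<^sup>2 = Gc * t * q" unfolding q_def by (simp add: power2_eq_square algebra_simps)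
        finally show ?thesis using q(1) by (simp add: power2_eq_square q_def[symmetric])
      qed
      then have "t * (1 - m a)\<^sup>2 + Gc * (m a)\<^sup>2 = Gc * t / (Gc + t)" by (simp add: m_def t_def)
      then show ?thesis by (simp add: t_def algebra_simps)
    qed
    then have "(\<Sum>a\<in>A. \<sigma>c * w a * ((1 - m a)\<^sup>2 + 3 * (0 / 2 + \<tau>)) + Gc / 2 * (4 * (m a)\<^sup>2 / (2 - 0)))
        = (\<Sum>a\<in>A. Gc * \<sigma>c * w a / (Gc + \<sigma>c * w a)) + 3 * \<sigma>c * \<tau> * W"
      by (simp add: sum.distrib W_def sum_distrib_left)
    moreover have "\<sigma>c * \<delta>' = \<delta> / 4" using pos by (simp add: \<delta>'_def)
    ultimately show ?thesis using A(3) \<tau>W \<delta> unfolding w_def[symmetric] by linarith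
  qed
  ultimately have "eventually (\<lambda>n. Bd n < X + C + \<delta>) sequentially" by (rule order_tendstoD(2))
  then show ?thesis
    using good order_tendstoD(2)[OF sconv \<delta>] order_tendstoD(2)[OF bconv \<delta>]
  proof eventually_elim
    case (elim n)
    have k1: "2 * k n < N n" and k2: "\<kappa> n < 1" using elim by auto
    note R = recovery_energy[OF h N L \<epsilon> pos k2[unfolded \<kappa>_def] \<tau> k1 kq[OF k2, unfolded \<kappa>_def] e p \<nu> tot A(1), folded w_def, folded m_def, folded \<kappa>_def]
    have "F_disc L E0 \<sigma>c Gc (\<epsilon> n) (cell L (h n) ` {..<N n}) (interp L (h n) (s n)) (interp L (h n) (b n)) \<le> ennreal (Bd n)"
      using R(2) by (simp only: s_def b_def Bd_def X_def)
    also have "\<dots> \<le> ennreal (X + C + \<delta>)" using elim by (intro ennreal_leI) simp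
    finally show ?case
      using R(1) elim by (intro exI[of _ "interp L (h n) (s n)"] exI[of _ "interp L (h n) (b n)"]) (simp add: s_def b_def X_def)
  qed
qed

text \<open>At stage n the largest j \<le> n satisfying the requirement is taken. Every fixed j is
  eventually a candidate, so the choice tends to infinity even if \<open>R\<close> is not monotone
  in j.\<close>

lemma diagonal_index:
  assumes "\<And>j. eventually (\<lambda>n. R j n) sequentially"
  obtains J :: "nat \<Rightarrow> nat" where "filterlim J at_top sequentially" "eventually (\<lambda>n. R (J n) n) sequentially"
proof -
  define J where "J n = Max {j. j \<le> n \<and> R j n}" for n
  have fin: "finite {j. j \<le> n \<and> R j n}" for n by simp
  have "eventually (\<lambda>n. j \<le> J n) sequentially" for j
    using assms[of j] eventually_ge_at_top[of j]
    by eventually_elim (auto simp: J_def intro!: Max_ge)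
  then have 1: "filterlim J at_top sequentially" by (simp add: filterlim_at_top)
  have "eventually (\<lambda>n. R (J n) n) sequentially"
    using assms[of 0]
  proof eventually_elim
    case (elim n)
    then have "{j. j \<le> n \<and> R j n} \<noteq> {}" by auto
    from Max_in[OF fin this] show ?case by (simp add: J_def)
  qed
  with 1 show ?thesis using that by blast
qed

lemma recovery_sequence:
  fixes \<epsilon> :: "real \<Rightarrow> real"
  assumes pos: "0 < L" "0 < E0" "0 < \<sigma>c" "0 < Gc"
    and mesh: "\<And>h. h \<in> mesh_sizes L \<Longrightarrow> is_mesh L h (T h)"
    and eps_pos: "\<And>h. h \<in> mesh_sizes L \<Longrightarrow> 0 < \<epsilon> h"
    and eps_lim: "(\<epsilon> \<longlongrightarrow> 0) (at 0 within mesh_sizes L)"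
    and eps_mesh: "(\<lambda>h. h) \<in> o[at 0 within mesh_sizes L](\<epsilon>)"
    and h: "\<And>n. h n \<in> mesh_sizes L" "h \<longlonglongrightarrow> 0"
    and u: "u \<in> L1 L" "d \<in> L1 L"
  shows "\<exists>y. (\<forall>n. y n \<in> L1 L \<times> L1 L) \<and> (\<lambda>n. L1_pair_dist L (y n) (u, d)) \<longlonglongrightarrow> 0 \<and>
     limsup (\<lambda>n. F_disc_ext L E0 \<sigma>c Gc g (\<epsilon> (h n)) (T (h n)) (y n)) \<le> F_lim_ext L E0 \<sigma>c Gc g (u, d)"
proof (cases "F_lim_ext L E0 \<sigma>c Gc g (u, d) = \<infinity>")
  case True
  have "L1_dist L w w = 0" for w by (simp add: L1_dist_def)
  then show ?thesis using True u by (intro exI[of _ "\<lambda>_. (u, d)"]) (simp add: L1_pair_dist_def)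
next
  case False
  obtain e p \<nu> where e: "e absolutely_integrable_on {-L..L}" and p: "p absolutely_integrable_on {-L..L}" "\<And>x. 0 \<le> p x"
    and rep: "represents L g u (\<lambda>x. e x + p x) \<nu>"
    and bd: "AE x in lebesgue. x \<in> {-L..L} \<longrightarrow> \<bar>u x\<bar> \<le> bdry_norm L g"
    and d0: "AE x in lebesgue. x \<in> {-L..L} \<longrightarrow> d x = 0"
    and en: "(\<integral>\<^sup>+x\<in>{-L..L}. ennreal (1/2 * E0 * (e x)\<^sup>2) \<partial>lebesgue) + ennreal \<sigma>c * (\<integral>\<^sup>+x\<in>{-L..L}. ennreal (p x) \<partial>lebesgue)
      + cohesive \<sigma>c Gc \<nu> \<le> F_lim_ext L E0 \<sigma>c Gc g (u, d)"
    by (rule F_lim_ext_finite_repr[OF u(1) pos False]) (erule that, assumption, blast, assumption+)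
  have fin: "(\<integral>\<^sup>+x\<in>{-L..L}. ennreal (1/2 * E0 * (e x)\<^sup>2) \<partial>lebesgue) \<noteq> top" "cohesive \<sigma>c Gc \<nu> \<noteq> top"
    using en False by (auto simp: top_unique)
  have e2: "(\<lambda>x. (e x)\<^sup>2) absolutely_integrable_on {-L..L}"
  proof -
    have em: "(\<lambda>x. indicator {-L..L} x * e x) \<in> borel_measurable lebesgue" by (rule absint_borel_measurable[OF e])
    have eq: "(\<lambda>x. 1/2 * E0 * (indicator {-L..L} x * e x)\<^sup>2) = (\<lambda>x. indicator {-L..L} x * (1/2 * E0 * (e x)\<^sup>2))"
      by (auto simp: indicator_def)
    have "integrable lebesgue (\<lambda>x. 1/2 * E0 * (indicator {-L..L} x * e x)\<^sup>2)"
    proof (rule integrableI_nonneg)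
      show "(\<lambda>x. 1/2 * E0 * (indicator {-L..L} x * e x)\<^sup>2) \<in> borel_measurable lebesgue" using em by measurable
      have "(\<integral>\<^sup>+x. ennreal (1/2 * E0 * (indicator {-L..L} x * e x)\<^sup>2) \<partial>lebesgue) = (\<integral>\<^sup>+x\<in>{-L..L}. ennreal (1/2 * E0 * (e x)\<^sup>2) \<partial>lebesgue)"
        by (intro nn_integral_cong) (auto simp: indicator_def)
      then show "(\<integral>\<^sup>+x. ennreal (1/2 * E0 * (indicator {-L..L} x * e x)\<^sup>2) \<partial>lebesgue) < \<infinity>"
        using fin(1) by (simp add: less_top)
    qed (use pos in auto)
    then have "(\<lambda>x. 1/2 * E0 * (e x)\<^sup>2) absolutely_integrable_on {-L..L}"
      unfolding eq set_integrable_def by simp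
    then have "(\<lambda>x. 2 / E0 * (1/2 * E0 * (e x)\<^sup>2)) absolutely_integrable_on {-L..L}" by (rule set_integrable_mult_right)
    then show ?thesis using pos by simp
  qed
  obtain C where C: "cohesive \<sigma>c Gc \<nu> = ennreal C" "0 \<le> C" using fin(2) by (cases "cohesive \<sigma>c Gc \<nu>") auto
  define X where "X = 1/2 * E0 * integral {-L..L} (\<lambda>x. (e x)\<^sup>2) + \<sigma>c * integral {-L..L} p + C"
  have X: "ennreal X \<le> F_lim_ext L E0 \<sigma>c Gc g (u, d)" "0 \<le> X"
  proof -
    have 1: "(\<integral>\<^sup>+x\<in>{-L..L}. ennreal (1/2 * E0 * (e x)\<^sup>2) \<partial>lebesgue) = ennreal (1/2 * E0 * integral {-L..L} (\<lambda>x. (e x)\<^sup>2))"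
    proof -
      have "(\<lambda>x. 1/2 * E0 * (e x)\<^sup>2) absolutely_integrable_on {-L..L}" using e2 by simp
      then have "(\<integral>\<^sup>+x\<in>{-L..L}. ennreal (1/2 * E0 * (e x)\<^sup>2) \<partial>lebesgue) = ennreal (integral {-L..L} (\<lambda>x. 1/2 * E0 * (e x)\<^sup>2))"
        by (rule nn_integral_integral_on) (use pos in auto)
      also have "integral {-L..L} (\<lambda>x. 1/2 * E0 * (e x)\<^sup>2) = 1/2 * E0 * integral {-L..L} (\<lambda>x. (e x)\<^sup>2)"
        by (rule Henstock_Kurzweil_Integration.integral_mult_right)
      finally show ?thesis .
    qed
    have 2: "(\<integral>\<^sup>+x\<in>{-L..L}. ennreal (p x) \<partial>lebesgue) = ennreal (integral {-L..L} p)" "0 \<le> integral {-L..L} p"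
      using p by (auto intro: nn_integral_integral_on)
    have 3: "0 \<le> 1/2 * E0 * integral {-L..L} (\<lambda>x. (e x)\<^sup>2)"
      using nn_integral_integral_on(2)[OF e2] pos by simp
    have "ennreal X = ennreal (1/2 * E0 * integral {-L..L} (\<lambda>x. (e x)\<^sup>2)) + ennreal \<sigma>c * ennreal (integral {-L..L} p) + ennreal C"
      unfolding X_def using 2(2) 3 C(2) pos by (simp add: ennreal_mult ennreal_plus)
    then show "ennreal X \<le> F_lim_ext L E0 \<sigma>c Gc g (u, d)" using en unfolding 1 2(1) C(1) by simp
    show "0 \<le> X" unfolding X_def using 2(2) 3 C(2) pos by simp
  qed
  have hp: "0 < h n" for n using h(1)[of n] by (simp add: mesh_sizes_def)
  have "\<exists>N. 0 < N \<and> real N * h n = 2 * L \<and> T (h n) = cell L (h n) ` {..<N}" for n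
    by (rule mesh_structure[OF mesh[OF h(1)] hp pos(1), of n]) blast
  then obtain N where N: "\<And>n. real (N n) * h n = 2 * L" "\<And>n. T (h n) = cell L (h n) ` {..<N n}" by metis
  have \<epsilon>p: "0 < \<epsilon> (h n)" for n using eps_pos[OF h(1)] .
  note ms = mesh_sequence[OF h eps_lim eps_mesh]
  define R where "R j n z \<longleftrightarrow> admissible L g (T (h n)) (fst z) (snd z) \<and> L1_dist L (fst z) u < 1 / real (Suc j) \<and>
      L1_dist L (snd z) (\<lambda>_. 0) < 1 / real (Suc j) \<and>
      F_disc L E0 \<sigma>c Gc (\<epsilon> (h n)) (T (h n)) (fst z) (snd z) \<le> ennreal (X + 1 / real (Suc j))" for j n z
  have ev: "eventually (\<lambda>n. \<exists>z. R j n z) sequentially" for j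
  proof -
    have "0 < 1 / real (Suc j)" by simp
    from recovery_approx[OF pos hp N(1) \<epsilon>p h(2) ms e e2 p rep u(1) bd C this]
    show ?thesis unfolding R_def N(2) X_def
    proof (rule eventually_mono)
      fix n
      assume "\<exists>v b. admissible L g (cell L (h n) ` {..<N n}) v b \<and> L1_dist L v u < 1 / real (Suc j) \<and> L1_dist L b (\<lambda>_. 0) < 1 / real (Suc j) \<and>
        F_disc L E0 \<sigma>c Gc (\<epsilon> (h n)) (cell L (h n) ` {..<N n}) v b
        \<le> ennreal (1/2 * E0 * integral {-L..L} (\<lambda>x. (e x)\<^sup>2) + \<sigma>c * integral {-L..L} p + C + 1 / real (Suc j))"
      then obtain v b where "admissible L g (cell L (h n) ` {..<N n}) v b \<and> L1_dist L v u < 1 / real (Suc j) \<and> L1_dist L b (\<lambda>_. 0) < 1 / real (Suc j) \<and>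
        F_disc L E0 \<sigma>c Gc (\<epsilon> (h n)) (cell L (h n) ` {..<N n}) v b
        \<le> ennreal (1/2 * E0 * integral {-L..L} (\<lambda>x. (e x)\<^sup>2) + \<sigma>c * integral {-L..L} p + C + 1 / real (Suc j))" by (elim exE)
      then show "\<exists>z. admissible L g (cell L (h n) ` {..<N n}) (fst z) (snd z) \<and> L1_dist L (fst z) u < 1 / real (Suc j) \<and>
        L1_dist L (snd z) (\<lambda>_. 0) < 1 / real (Suc j) \<and>
        F_disc L E0 \<sigma>c Gc (\<epsilon> (h n)) (cell L (h n) ` {..<N n}) (fst z) (snd z)
        \<le> ennreal (1/2 * E0 * integral {-L..L} (\<lambda>x. (e x)\<^sup>2) + \<sigma>c * integral {-L..L} p + C + 1 / real (Suc j))"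
        by (intro exI[of _ "(v, b)"]) (simp only: fst_conv snd_conv)
    qed
  qed
  obtain J where J: "filterlim J at_top sequentially" "eventually (\<lambda>n. \<exists>z. R (J n) n z) sequentially"
    using diagonal_index[of "\<lambda>j n. \<exists>z. R j n z", OF ev] .
  \<comment> \<open>The default \<open>(u, d)\<close> keeps the sequence inside the space at the
    finitely many stages without a competitor.\<close>
  define y where "y n = (if \<exists>z. R (J n) n z then SOME z. R (J n) n z else (u, d))" for n
  have yR: "eventually (\<lambda>n. R (J n) n (y n)) sequentially"
    using J(2) by eventually_elim (simp add: y_def someI_ex)
  have J0: "(\<lambda>n. 1 / real (Suc (J n))) \<longlonglongrightarrow> 0"
    using filterlim_compose[OF LIMSEQ_inverse_real_of_nat J(1)] by (simp add: inverse_eq_divide)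
  have dist0: "L1_dist L w d = L1_dist L w (\<lambda>_. 0)" if "w \<in> L1 L" for w
    unfolding L1_dist_def set_lebesgue_integral_def
  proof (rule integral_cong_AE)
    have i: "(\<lambda>x. \<bar>w x - z x\<bar>) absolutely_integrable_on {-L..L}" if "z \<in> L1 L" for z
      using set_integrable_abs[OF set_integral_diff(1)[of lebesgue "{-L..L}" w z]] that \<open>w \<in> L1 L\<close> by (simp add: L1_def)
    show "(\<lambda>x. indicator {-L..L} x *\<^sub>R \<bar>w x - d x\<bar>) \<in> borel_measurable lebesgue"
      using i[OF u(2)] unfolding set_integrable_def by (rule borel_measurable_integrable)
    have "(\<lambda>_. 0) \<in> L1 L" by (simp add: L1_def)
    from i[OF this] show "(\<lambda>x. indicator {-L..L} x *\<^sub>R \<bar>w x - 0\<bar>) \<in> borel_measurable lebesgue"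
      unfolding set_integrable_def by (rule borel_measurable_integrable)
    show "AE x in lebesgue. indicator {-L..L} x *\<^sub>R \<bar>w x - d x\<bar> = indicator {-L..L} x *\<^sub>R \<bar>w x - 0\<bar>"
      using d0 by eventually_elim (auto simp: indicator_def)
  qed
  have yL1: "fst (y n) \<in> L1 L \<and> snd (y n) \<in> L1 L" for n
  proof (cases "\<exists>z. R (J n) n z")
    case True
    then have "R (J n) n (y n)" by (simp add: y_def someI_ex)
    then have "fst (y n) \<in> P1 (cell L (h n) ` {..<N n})" "snd (y n) \<in> P1 (cell L (h n) ` {..<N n})"
      by (auto simp: R_def admissible_def N(2))
    then show ?thesis unfolding L1_def
      by (auto intro!: absolutely_integrable_continuous_real P1_continuous[OF hp N(1) pos(1)])
  next
    case False
    then show ?thesis using u by (simp add: y_def)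
  qed
  show ?thesis
  proof (intro exI[of _ y] conjI allI)
    show "y n \<in> L1 L \<times> L1 L" for n using yL1[of n] by (simp add: mem_Times_iff)
    show "(\<lambda>n. L1_pair_dist L (y n) (u, d)) \<longlonglongrightarrow> 0"
    proof (rule tendsto_sandwich[OF _ _ tendsto_const])
      show "\<forall>\<^sub>F n in sequentially. 0 \<le> L1_pair_dist L (y n) (u, d)"
        by (simp add: L1_pair_dist_def L1_dist_nonneg)
      show "\<forall>\<^sub>F n in sequentially. L1_pair_dist L (y n) (u, d) \<le> 1 / real (Suc (J n)) + 1 / real (Suc (J n))"
        using yR
      proof eventually_elim
        case (elim n)
        then have "L1_dist L (fst (y n)) u < 1 / real (Suc (J n))" "L1_dist L (snd (y n)) (\<lambda>_. 0) < 1 / real (Suc (J n))"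
          by (simp_all only: R_def)
        then show ?case using dist0[of "snd (y n)"] yL1[of n] by (simp add: L1_pair_dist_def)
      qed
      show "(\<lambda>n. 1 / real (Suc (J n)) + 1 / real (Suc (J n))) \<longlonglongrightarrow> 0"
        using tendsto_add[OF J0 J0] by simp
    qed
    have "limsup (\<lambda>n. F_disc_ext L E0 \<sigma>c Gc g (\<epsilon> (h n)) (T (h n)) (y n)) \<le> limsup (\<lambda>n. ennreal (X + 1 / real (Suc (J n))))"
    proof (rule Limsup_mono)
      show "\<forall>\<^sub>F n in sequentially. F_disc_ext L E0 \<sigma>c Gc g (\<epsilon> (h n)) (T (h n)) (y n) \<le> ennreal (X + 1 / real (Suc (J n)))"
        using yR
      proof eventually_elim
        case (elim n)
        obtain v b where vb: "y n = (v, b)" by (cases "y n")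
        have "F_disc_ext L E0 \<sigma>c Gc g (\<epsilon> (h n)) (T (h n)) (v, b) \<le> F_disc L E0 \<sigma>c Gc (\<epsilon> (h n)) (T (h n)) v b"
          unfolding F_disc_ext_def prod.case
          by (rule Inf_lower) (use elim in \<open>auto simp: R_def vb ae_eq_on_def\<close>)
        then show ?case using elim vb by (simp add: R_def) (metis order_trans)
      qed
    qed
    also have "\<dots> = ennreal X"
    proof (rule lim_imp_Limsup)
      have "(\<lambda>n. X + 1 / real (Suc (J n))) \<longlonglongrightarrow> X + 0" by (intro tendsto_add tendsto_const J0)
      then show "(\<lambda>n. ennreal (X + 1 / real (Suc (J n)))) \<longlonglongrightarrow> ennreal X" by (intro tendsto_ennrealI) simp
    qed simp
    finally show "limsup (\<lambda>n. F_disc_ext L E0 \<sigma>c Gc g (\<epsilon> (h n)) (T (h n)) (y n)) \<le> F_lim_ext L E0 \<sigma>c Gc g (u, d)"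
      using X(1) by (rule order_trans)
  qed
qed

theorem theorem2p1:
  fixes L E0 \<sigma>c Gc :: real
    and g :: "real \<Rightarrow> real"
    and \<epsilon> :: "real \<Rightarrow> real"
    and T :: "real \<Rightarrow> real set set"
  assumes "0 < L" "0 < E0" "0 < \<sigma>c" "0 < Gc"
    and mesh: "\<And>h. h \<in> mesh_sizes L \<Longrightarrow> is_mesh L h (T h)"
    and eps_pos: "\<And>h. h \<in> mesh_sizes L \<Longrightarrow> 0 < \<epsilon> h"
    and eps_lim: "(\<epsilon> \<longlongrightarrow> 0) (at 0 within mesh_sizes L)"
    and eps_mesh: "(\<lambda>h. h) \<in> o[at 0 within mesh_sizes L](\<epsilon>)"
  shows "gamma_converges (L1 L \<times> L1 L) (L1_pair_dist L) (mesh_sizes L)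
           (\<lambda>h. F_disc_ext L E0 \<sigma>c Gc g (\<epsilon> h) (T h))
           (F_lim_ext L E0 \<sigma>c Gc g)"
  unfolding gamma_converges_def
proof (intro allI impI ballI conjI; elim conjE)
  fix h :: "nat \<Rightarrow> real" and x :: "(real \<Rightarrow> real) \<times> (real \<Rightarrow> real)"
  assume h: "\<forall>n. h n \<in> mesh_sizes L" "h \<longlonglongrightarrow> 0" and x: "x \<in> L1 L \<times> L1 L"
  obtain u d where ud: "x = (u, d)" "u \<in> L1 L" "d \<in> L1 L" using x by auto
  note prem = assms(1-4) mesh eps_pos eps_lim eps_mesh h(1)[rule_format] h(2) ud(2,3)
  show "\<exists>y. (\<forall>n. y n \<in> L1 L \<times> L1 L) \<and> (\<lambda>n. L1_pair_dist L (y n) x) \<longlonglongrightarrow> 0 \<and>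
      limsup (\<lambda>n. F_disc_ext L E0 \<sigma>c Gc g (\<epsilon> (h n)) (T (h n)) (y n)) \<le> F_lim_ext L E0 \<sigma>c Gc g x"
    unfolding ud(1) by (rule recovery_sequence[OF prem])
  fix y :: "nat \<Rightarrow> (real \<Rightarrow> real) \<times> (real \<Rightarrow> real)"
  assume y: "\<forall>n. y n \<in> L1 L \<times> L1 L" "(\<lambda>n. L1_pair_dist L (y n) x) \<longlonglongrightarrow> 0"
  show "F_lim_ext L E0 \<sigma>c Gc g x \<le> liminf (\<lambda>n. F_disc_ext L E0 \<sigma>c Gc g (\<epsilon> (h n)) (T (h n)) (y n))"
    unfolding ud(1) by (rule liminf_inequality[OF prem y(1)[rule_format] y(2)[unfolded ud(1)]])
qed

end
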